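(* Let $R$ be a commutative Noetherian ring with identity, of finite Krull dimension $d$, which is singular (i.e. not regular) and irreducible (i.e. $\mathrm{Spec}\,R$ is irreducible). Let $(\mathscr{U},\mathscr{V})$ be a t-structure on the triangulated category $\mathrm{Perf}(R)$ of perfect complexes over $R$. Then either $\mathscr{U}=0$ or $\mathscr{U}=\mathrm{Perf}(R)$.
   Context: $\mathrm{Perf}(R)$ is the full triangulated subcategory of the unbounded derived category $\mathrm{D}(R)$ of $R$-modules consisting of the complexes quasi-isomorphic to a bounded complex of finitely generated projective $R$-modules; $[1]$ is the suspension functor. A t-structure on a triangulated category $\mathscr{C}$ is a pair of full subcategories $(\mathscr{U},\mathscr{V})$ (closed under isomorphism) such that: (1) $\mathscr{U}[1]\subseteq\mathscr{U}$ and $\mathscr{V}\subseteq\mathscr{V}[1]$; (2) $\mathrm{Hom}_{\mathscr{C}}(X[1],Y)=0$ for all $X\in\mathscr{U}$, $Y\in\mathscr{V}$; (3) for every $X\in\mathscr{C}$ there is a distinguished triangle $A\to X\to B\to A[1]$ with $A\in\mathscr{U}$ and $B\in\mathscr{V}[-1]$. Here $\mathscr{U}=0$ means that $\mathscr{U}$ consists of zero objects only. *)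

theory Defs
  imports "HOL-Algebra.Ring_Divisibility" "HOL-Algebra.Module" "HOL-Analysis.Abstract_Topology" "HOL-Library.Extended_Nat"
begin

section \<open>Commutative algebra\<close>

text \<open>The supremum of the empty set of chains is \<^term>\<open>0::enat\<close>, so the zero ring gets dimension 0
  (there is no negative value in \<^typ>\<open>enat\<close>).\<close>

definition krull_dim :: "('a, 'r) ring_scheme \<Rightarrow> enat" where
  "krull_dim R = Sup {enat n | n. \<exists>p :: nat \<Rightarrow> 'a set.
     (\<forall>i\<le>n. primeideal (p i) R) \<and> (\<forall>i<n. p i \<subset> p (Suc i))}"

definition prime_spectrum :: "('a, 'r) ring_scheme \<Rightarrow> 'a set set" where
  "prime_spectrum R = {P. primeideal P R}"

text \<open>The Zariski topology: the open sets are the complements of the sets of primes containing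
  some \<open>E\<close>.\<close>

definition zariski_open :: "('a, 'r) ring_scheme \<Rightarrow> 'a set set \<Rightarrow> bool" where
  "zariski_open R W \<longleftrightarrow> (\<exists>E \<subseteq> carrier R. W = {P \<in> prime_spectrum R. \<not> E \<subseteq> P})"

lemma istopology_zariski_open:
  assumes "cring R"
  shows "istopology (zariski_open R)"
proof -
  interpret cring R by fact
  have "zariski_open R (S \<inter> T)" if S: "zariski_open R S" and T: "zariski_open R T" for S T
  proof -
    from S T obtain E F where E: "E \<subseteq> carrier R" "S = {P \<in> prime_spectrum R. \<not> E \<subseteq> P}"
      and F: "F \<subseteq> carrier R" "T = {P \<in> prime_spectrum R. \<not> F \<subseteq> P}"
      unfolding zariski_open_def by blast
    let ?G = "{e \<otimes>\<^bsub>R\<^esub> f | e f. e \<in> E \<and> f \<in> F}"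
    have "(\<not> E \<subseteq> P \<and> \<not> F \<subseteq> P) \<longleftrightarrow> \<not> ?G \<subseteq> P" if "P \<in> prime_spectrum R" for P
    proof -
      interpret P: primeideal P R using that by (simp add: prime_spectrum_def)
      show ?thesis
      proof
        assume "\<not> E \<subseteq> P \<and> \<not> F \<subseteq> P"
        then obtain e f where ef: "e \<in> E" "e \<notin> P" "f \<in> F" "f \<notin> P" by blast
        then have "e \<otimes>\<^bsub>R\<^esub> f \<notin> P" using P.I_prime[of e f] E(1) F(1) by blast
        then show "\<not> ?G \<subseteq> P" using ef by blast
      next
        assume "\<not> ?G \<subseteq> P"
        then obtain e f where "e \<in> E" "f \<in> F" "e \<otimes>\<^bsub>R\<^esub> f \<notin> P" by blast
        then show "\<not> E \<subseteq> P \<and> \<not> F \<subseteq> P"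
          using P.I_l_closed[of f e] P.I_r_closed[of e f] E(1) F(1) by blast
      qed
    qed
    then have "S \<inter> T = {P \<in> prime_spectrum R. \<not> ?G \<subseteq> P}"
      using E F by auto
    moreover have "?G \<subseteq> carrier R" using E F by auto
    ultimately show ?thesis unfolding zariski_open_def by blast
  qed
  moreover have "zariski_open R (\<Union>K)" if K: "\<forall>S\<in>K. zariski_open R S" for K
  proof -
    from K obtain E where E: "\<And>S. S \<in> K \<Longrightarrow> E S \<subseteq> carrier R"
      "\<And>S. S \<in> K \<Longrightarrow> S = {P \<in> prime_spectrum R. \<not> E S \<subseteq> P}"
      unfolding zariski_open_def by metis
    have "\<Union>K = {P \<in> prime_spectrum R. \<not> (\<Union>S\<in>K. E S) \<subseteq> P}"
    proof (intro equalityI subsetI)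
      fix P assume "P \<in> \<Union>K"
      then obtain S where "S \<in> K" "P \<in> S" by blast
      then show "P \<in> {P \<in> prime_spectrum R. \<not> (\<Union>S\<in>K. E S) \<subseteq> P}"
        using E(2)[of S] by blast
    next
      fix P assume "P \<in> {P \<in> prime_spectrum R. \<not> (\<Union>S\<in>K. E S) \<subseteq> P}"
      then obtain S where "S \<in> K" "P \<in> prime_spectrum R" "\<not> E S \<subseteq> P" by blast
      then have "P \<in> S" using E(2)[of S] by blast
      then show "P \<in> \<Union>K" using \<open>S \<in> K\<close> by blast
    qed
    moreover have "(\<Union>S\<in>K. E S) \<subseteq> carrier R" using E(1) by blast
    ultimately show ?thesis unfolding zariski_open_def by blast
  qed
  ultimately show ?thesis unfolding istopology_def by blast
qed

definition Spec :: "('a, 'r) ring_scheme \<Rightarrow> 'a set topology" where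
  "Spec R = topology (zariski_open R)"

definition irreducible_space :: "'b topology \<Rightarrow> bool" where
  "irreducible_space X \<longleftrightarrow> topspace X \<noteq> {} \<and>
     (\<forall>C D. closedin X C \<and> closedin X D \<and> C \<union> D = topspace X
        \<longrightarrow> C = topspace X \<or> D = topspace X)"

text \<open>Localisation of a commutative ring at a multiplicative subset \<open>S\<close>, as a quotient of
  \<open>carrier R \<times> S\<close>.\<close>

definition frac_rel :: "('a, 'r) ring_scheme \<Rightarrow> 'a set \<Rightarrow> (('a \<times> 'a) \<times> ('a \<times> 'a)) set" where
  "frac_rel R S = {((a, s), (b, t)). a \<in> carrier R \<and> s \<in> S \<and> b \<in> carrier R \<and> t \<in> S \<and>
     (\<exists>u\<in>S. u \<otimes>\<^bsub>R\<^esub> (a \<otimes>\<^bsub>R\<^esub> t) = u \<otimes>\<^bsub>R\<^esub> (b \<otimes>\<^bsub>R\<^esub> s))}"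

definition frac :: "('a, 'r) ring_scheme \<Rightarrow> 'a set \<Rightarrow> 'a \<Rightarrow> 'a \<Rightarrow> ('a \<times> 'a) set" where
  "frac R S a s = frac_rel R S `` {(a, s)}"

definition localization :: "('a, 'r) ring_scheme \<Rightarrow> 'a set \<Rightarrow> ('a \<times> 'a) set ring" where
  "localization R S =
     \<lparr> carrier = (carrier R \<times> S) // frac_rel R S,
       mult = (\<lambda>A B. \<Union>(a, s)\<in>A. \<Union>(b, t)\<in>B. frac R S (a \<otimes>\<^bsub>R\<^esub> b) (s \<otimes>\<^bsub>R\<^esub> t)),
       one = frac R S \<one>\<^bsub>R\<^esub> \<one>\<^bsub>R\<^esub>,
       zero = frac R S \<zero>\<^bsub>R\<^esub> \<one>\<^bsub>R\<^esub>,
       add = (\<lambda>A B. \<Union>(a, s)\<in>A. \<Union>(b, t)\<in>B.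
               frac R S ((a \<otimes>\<^bsub>R\<^esub> t) \<oplus>\<^bsub>R\<^esub> (b \<otimes>\<^bsub>R\<^esub> s)) (s \<otimes>\<^bsub>R\<^esub> t)) \<rparr>"

definition regular_local_ring :: "('a, 'r) ring_scheme \<Rightarrow> bool" where
  "regular_local_ring A \<longleftrightarrow> cring A \<and> noetherian_ring A \<and>
     (\<exists>\<mm>. {M. maximalideal M A} = {\<mm>} \<and>
        (\<exists>G \<subseteq> carrier A. finite G \<and> \<mm> = genideal A G \<and> enat (card G) = krull_dim A))"

definition regular_ring :: "('a, 'r) ring_scheme \<Rightarrow> bool" where
  "regular_ring R \<longleftrightarrow> cring R \<and> noetherian_ring R \<and>
     (\<forall>P. primeideal P R \<longrightarrow> regular_local_ring (localization R (carrier R - P)))"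


section \<open>Modules\<close>

definition lin_maps ::
  "('a, 'r) ring_scheme \<Rightarrow> ('a, 'm) module \<Rightarrow> ('a, 'n) module \<Rightarrow> ('m \<Rightarrow> 'n) set" where
  "lin_maps R M N = {f \<in> carrier M \<rightarrow> carrier N.
     (\<forall>x\<in>carrier M. \<forall>y\<in>carrier M. f (x \<oplus>\<^bsub>M\<^esub> y) = f x \<oplus>\<^bsub>N\<^esub> f y) \<and>
     (\<forall>r\<in>carrier R. \<forall>x\<in>carrier M. f (r \<odot>\<^bsub>M\<^esub> x) = r \<odot>\<^bsub>N\<^esub> f x)}"

definition fin_gen_module :: "('a, 'r) ring_scheme \<Rightarrow> ('a, 'm) module \<Rightarrow> bool" where
  "fin_gen_module R M \<longleftrightarrow> (\<exists>G \<subseteq> carrier M. finite G \<and>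
     (\<forall>N. submodule N R M \<and> G \<subseteq> N \<longrightarrow> N = carrier M))"

text \<open>The lifting property is tested on the modules whose carriers lie in the same type \<open>'m\<close>. When
  \<open>'m\<close> is infinite and at least as large as \<open>R\<close>, the test modules include a copy of a free module
  covering \<open>M\<close>, so nothing is lost.\<close>

definition projective_module :: "('a, 'r) ring_scheme \<Rightarrow> ('a, 'm) module \<Rightarrow> bool" where
  "projective_module R M \<longleftrightarrow> module R M \<and>
     (\<forall>(A :: ('a, 'm) module) (B :: ('a, 'm) module) g h.
        module R A \<and> module R B \<and> g \<in> lin_maps R A B \<and> g ` carrier A = carrier B \<and>
        h \<in> lin_maps R M B \<longrightarrow>
        (\<exists>l \<in> lin_maps R M A. \<forall>x\<in>carrier M. g (l x) = h x))"


section \<open>Cochain complexes\<close>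

record ('a, 'm) cpx =
  cmod :: "int \<Rightarrow> ('a, 'm) module"
  cdiff :: "int \<Rightarrow> 'm \<Rightarrow> 'm"

text \<open>The unbounded complexes of \<open>R\<close>-modules with carriers in \<open>'m\<close>. Module maps are only
  relevant on carriers, and equations between them are only required there.\<close>

definition complexes :: "('a, 'r) ring_scheme \<Rightarrow> ('a, 'm) cpx set" where
  "complexes R = {X. (\<forall>n. module R (cmod X n)) \<and>
     (\<forall>n. cdiff X n \<in> lin_maps R (cmod X n) (cmod X (n + 1))) \<and>
     (\<forall>n. \<forall>x\<in>carrier (cmod X n). cdiff X (n + 1) (cdiff X n x) = \<zero>\<^bsub>cmod X (n + 2)\<^esub>)}"

type_synonym 'm cmap = "int \<Rightarrow> 'm \<Rightarrow> 'm"

definition chain_maps ::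
  "('a, 'r) ring_scheme \<Rightarrow> ('a, 'm) cpx \<Rightarrow> ('a, 'm) cpx \<Rightarrow> 'm cmap set" where
  "chain_maps R X Y = {f. (\<forall>n. f n \<in> lin_maps R (cmod X n) (cmod Y n)) \<and>
     (\<forall>n. \<forall>x\<in>carrier (cmod X n). f (n + 1) (cdiff X n x) = cdiff Y n (f n x))}"

definition cmap_id :: "'m cmap" where
  "cmap_id = (\<lambda>n x. x)"

definition cmap_comp :: "'m cmap \<Rightarrow> 'm cmap \<Rightarrow> 'm cmap" (infixr "\<circ>\<^sub>c" 55) where
  "g \<circ>\<^sub>c f = (\<lambda>n x. g n (f n x))"

definition homotopic_maps ::
  "('a, 'r) ring_scheme \<Rightarrow> ('a, 'm) cpx \<Rightarrow> ('a, 'm) cpx \<Rightarrow> 'm cmap \<Rightarrow> 'm cmap \<Rightarrow> bool" where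
  "homotopic_maps R X Y f g \<longleftrightarrow> f \<in> chain_maps R X Y \<and> g \<in> chain_maps R X Y \<and>
     (\<exists>h. (\<forall>n. h n \<in> lin_maps R (cmod X n) (cmod Y (n - 1))) \<and>
        (\<forall>n. \<forall>x\<in>carrier (cmod X n).
           f n x \<ominus>\<^bsub>cmod Y n\<^esub> g n x =
             cdiff Y (n - 1) (h n x) \<oplus>\<^bsub>cmod Y n\<^esub> h (n + 1) (cdiff X n x)))"

definition cocycles :: "('a, 'm) cpx \<Rightarrow> int \<Rightarrow> 'm set" where
  "cocycles X n = a_kernel (cmod X n) (cmod X (n + 1)) (cdiff X n)"

definition coboundaries :: "('a, 'm) cpx \<Rightarrow> int \<Rightarrow> 'm set" where
  "coboundaries X n = cdiff X (n - 1) ` carrier (cmod X (n - 1))"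

definition cohomology :: "('a, 'm) cpx \<Rightarrow> int \<Rightarrow> 'm set set" where
  "cohomology X n = (\<lambda>z. coboundaries X n +>\<^bsub>cmod X n\<^esub> z) ` cocycles X n"

text \<open>The induced map sends the class of a cocycle \<open>z\<close> to the class of \<open>f n z\<close>, that is, a coset
  \<open>c\<close> to the coset of the coboundaries of \<open>Y\<close> which contains the image of \<open>c\<close>.\<close>

definition cohomology_map :: "('a, 'm) cpx \<Rightarrow> 'm cmap \<Rightarrow> int \<Rightarrow> 'm set \<Rightarrow> 'm set" where
  "cohomology_map Y f n c = coboundaries Y n <+>\<^bsub>cmod Y n\<^esub> (f n ` c)"

definition quasi_isos ::
  "('a, 'r) ring_scheme \<Rightarrow> ('a, 'm) cpx \<Rightarrow> ('a, 'm) cpx \<Rightarrow> 'm cmap set" where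
  "quasi_isos R X Y = {f \<in> chain_maps R X Y.
     \<forall>n. bij_betw (cohomology_map Y f n) (cohomology X n) (cohomology Y n)}"

text \<open>\<open>X[k]\<close> has \<open>X[k]\<^sup>n = X\<^sup>n\<^sup>+\<^sup>k\<close> and differential \<open>(-1)\<^sup>k d\<close>.\<close>

definition shift_cpx :: "int \<Rightarrow> ('a, 'm) cpx \<Rightarrow> ('a, 'm) cpx" where
  "shift_cpx k X =
     \<lparr> cmod = (\<lambda>n. cmod X (n + k)),
       cdiff = (\<lambda>n x. if even k then cdiff X (n + k) x
                      else \<ominus>\<^bsub>cmod X (n + 1 + k)\<^esub> cdiff X (n + k) x) \<rparr>"

definition shift_map :: "int \<Rightarrow> 'm cmap \<Rightarrow> 'm cmap" where
  "shift_map k f = (\<lambda>n. f (n + k))"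

text \<open>\<open>C\<close> is a mapping cone of \<open>f : X \<rightarrow> Y\<close>: the maps \<open>\<phi> n\<close> identify
  \<open>X\<^sup>n\<^sup>+\<^sup>1 \<oplus> Y\<^sup>n\<close> with \<open>C\<^sup>n\<close>, the differential becoming \<open>(x, y) \<mapsto> (-dx, fx + dy)\<close>. Moreover
  \<open>i : Y \<rightarrow> C\<close> and \<open>p : C \<rightarrow> X[1]\<close> are the canonical maps. Stating this up to isomorphism
  keeps the carriers of \<open>C\<close> inside \<open>'m\<close>.\<close>

definition mapping_cone ::
  "('a, 'r) ring_scheme \<Rightarrow> ('a, 'm) cpx \<Rightarrow> ('a, 'm) cpx \<Rightarrow> 'm cmap \<Rightarrow>
   ('a, 'm) cpx \<Rightarrow> 'm cmap \<Rightarrow> 'm cmap \<Rightarrow> bool" where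
  "mapping_cone R X Y f C i p \<longleftrightarrow>
     C \<in> complexes R \<and> i \<in> chain_maps R Y C \<and> p \<in> chain_maps R C (shift_cpx 1 X) \<and>
     (\<exists>\<phi> :: int \<Rightarrow> 'm \<Rightarrow> 'm \<Rightarrow> 'm. \<forall>n.
        bij_betw (\<lambda>(x, y). \<phi> n x y)
          (carrier (cmod X (n + 1)) \<times> carrier (cmod Y n)) (carrier (cmod C n)) \<and>
        (\<forall>x\<in>carrier (cmod X (n + 1)). \<forall>y\<in>carrier (cmod Y n).
           (\<forall>x'\<in>carrier (cmod X (n + 1)). \<forall>y'\<in>carrier (cmod Y n).
              \<phi> n (x \<oplus>\<^bsub>cmod X (n + 1)\<^esub> x') (y \<oplus>\<^bsub>cmod Y n\<^esub> y') =
                \<phi> n x y \<oplus>\<^bsub>cmod C n\<^esub> \<phi> n x' y') \<and>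
           (\<forall>r\<in>carrier R.
              \<phi> n (r \<odot>\<^bsub>cmod X (n + 1)\<^esub> x) (r \<odot>\<^bsub>cmod Y n\<^esub> y) = r \<odot>\<^bsub>cmod C n\<^esub> \<phi> n x y) \<and>
           cdiff C n (\<phi> n x y) =
             \<phi> (n + 1) (\<ominus>\<^bsub>cmod X (n + 2)\<^esub> cdiff X (n + 1) x)
               (f (n + 1) x \<oplus>\<^bsub>cmod Y (n + 1)\<^esub> cdiff Y n y) \<and>
           p n (\<phi> n x y) = x \<and>
           i n y = \<phi> n \<zero>\<^bsub>cmod X (n + 1)\<^esub> y))"


section \<open>Categories with shifts and distinguished triangles; t-structures\<close>

text \<open>The data of a triangulated category entering the definition of a t-structure.
  \<open>Cmp C X Y Z g f\<close> is the composite of \<open>f : X \<rightarrow> Y\<close> and \<open>g : Y \<rightarrow> Z\<close>; \<open>Zer C X Y\<close> is the zero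
  morphism; \<open>Dist C X Y Z u v w\<close> says that \<open>X \<rightarrow> Y \<rightarrow> Z \<rightarrow> X[1]\<close>, with maps \<open>u, v, w\<close>, is a
  distinguished triangle.\<close>

record ('o, 'h) cat =
  Ob :: "'o set"
  Hom :: "'o \<Rightarrow> 'o \<Rightarrow> 'h set"
  Cmp :: "'o \<Rightarrow> 'o \<Rightarrow> 'o \<Rightarrow> 'h \<Rightarrow> 'h \<Rightarrow> 'h"
  Idn :: "'o \<Rightarrow> 'h"

record ('o, 'h) tricat = "('o, 'h) cat" +
  Zer :: "'o \<Rightarrow> 'o \<Rightarrow> 'h"
  Shf :: "int \<Rightarrow> 'o \<Rightarrow> 'o"
  Dist :: "'o \<Rightarrow> 'o \<Rightarrow> 'o \<Rightarrow> 'h \<Rightarrow> 'h \<Rightarrow> 'h \<Rightarrow> bool"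

definition isos :: "('o, 'h, 'z) cat_scheme \<Rightarrow> 'o \<Rightarrow> 'o \<Rightarrow> 'h set" where
  "isos C X Y = {f \<in> Hom C X Y. \<exists>g \<in> Hom C Y X.
     Cmp C X Y X g f = Idn C X \<and> Cmp C Y X Y f g = Idn C Y}"

definition isomorphic :: "('o, 'h, 'z) cat_scheme \<Rightarrow> 'o \<Rightarrow> 'o \<Rightarrow> bool" where
  "isomorphic C X Y \<longleftrightarrow> isos C X Y \<noteq> {}"

definition zero_object :: "('o, 'h, 'z) cat_scheme \<Rightarrow> 'o \<Rightarrow> bool" where
  "zero_object C X \<longleftrightarrow> X \<in> Ob C \<and>
     (\<forall>Y\<in>Ob C. (\<exists>!f. f \<in> Hom C X Y) \<and> (\<exists>!f. f \<in> Hom C Y X))"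

definition full_subcat :: "('o, 'h, 'z) cat_scheme \<Rightarrow> 'o set \<Rightarrow> ('o, 'h, 'z) cat_scheme" where
  "full_subcat C S = C\<lparr>Ob := Ob C \<inter> S\<rparr>"

text \<open>Full subcategories closed under isomorphism are identified with their classes of objects.\<close>

definition strict_subcat :: "('o, 'h, 'z) cat_scheme \<Rightarrow> 'o set \<Rightarrow> bool" where
  "strict_subcat C S \<longleftrightarrow> S \<subseteq> Ob C \<and> (\<forall>X\<in>S. \<forall>Y\<in>Ob C. isomorphic C X Y \<longrightarrow> Y \<in> S)"

definition shift_subcat :: "('o, 'h, 'z) tricat_scheme \<Rightarrow> int \<Rightarrow> 'o set \<Rightarrow> 'o set" where
  "shift_subcat C k S = {X \<in> Ob C. \<exists>Y\<in>S. isomorphic C X (Shf C k Y)}"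

definition t_structure :: "('o, 'h, 'z) tricat_scheme \<Rightarrow> 'o set \<Rightarrow> 'o set \<Rightarrow> bool" where
  "t_structure C U V \<longleftrightarrow>
     strict_subcat C U \<and> strict_subcat C V \<and>
     shift_subcat C 1 U \<subseteq> U \<and> V \<subseteq> shift_subcat C 1 V \<and>
     (\<forall>X\<in>U. \<forall>Y\<in>V. Hom C (Shf C 1 X) Y = {Zer C (Shf C 1 X) Y}) \<and>
     (\<forall>X\<in>Ob C. \<exists>A B u v w.
        A \<in> U \<and> B \<in> shift_subcat C (-1) V \<and> Dist C A X B u v w)"


section \<open>The derived category and perfect complexes\<close>

text \<open>The derived category is the localisation of the homotopy category at the quasi-isomorphisms.
  A morphism \<open>X \<rightarrow> Y\<close> is an equivalence class of roofs \<open>X \<leftarrow> Z \<rightarrow> Y\<close>, encoded as triples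
  \<open>(Z, s, f)\<close>, with \<open>s : Z \<rightarrow> X\<close> a quasi-isomorphism and \<open>f : Z \<rightarrow> Y\<close> a chain map. Two roofs are
  equivalent if a third one dominates both up to homotopy.\<close>

type_synonym ('a, 'm) roof = "('a, 'm) cpx \<times> 'm cmap \<times> 'm cmap"

definition roofs ::
  "('a, 'r) ring_scheme \<Rightarrow> ('a, 'm) cpx \<Rightarrow> ('a, 'm) cpx \<Rightarrow> ('a, 'm) roof set" where
  "roofs R X Y = {(Z, s, f). Z \<in> complexes R \<and> s \<in> quasi_isos R Z X \<and> f \<in> chain_maps R Z Y}"

definition roof_rel ::
  "('a, 'r) ring_scheme \<Rightarrow> ('a, 'm) cpx \<Rightarrow> ('a, 'm) cpx \<Rightarrow>
   (('a, 'm) roof \<times> ('a, 'm) roof) set" where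
  "roof_rel R X Y = {((Z, s, f), (Z', s', f')).
     (Z, s, f) \<in> roofs R X Y \<and> (Z', s', f') \<in> roofs R X Y \<and>
     (\<exists>W \<in> complexes R. \<exists>u \<in> chain_maps R W Z. \<exists>v \<in> chain_maps R W Z'.
        s \<circ>\<^sub>c u \<in> quasi_isos R W X \<and>
        homotopic_maps R W X (s \<circ>\<^sub>c u) (s' \<circ>\<^sub>c v) \<and>
        homotopic_maps R W Y (f \<circ>\<^sub>c u) (f' \<circ>\<^sub>c v))}"

definition roof_class ::
  "('a, 'r) ring_scheme \<Rightarrow> ('a, 'm) cpx \<Rightarrow> ('a, 'm) cpx \<Rightarrow> ('a, 'm) roof \<Rightarrow>
   ('a, 'm) roof set" where
  "roof_class R X Y \<rho> = roof_rel R X Y `` {\<rho>}"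

definition derived_hom ::
  "('a, 'r) ring_scheme \<Rightarrow> ('a, 'm) cpx \<Rightarrow> ('a, 'm) cpx \<Rightarrow> ('a, 'm) roof set set" where
  "derived_hom R X Y = roofs R X Y // roof_rel R X Y"

text \<open>Roofs \<open>X \<leftarrow> Z \<rightarrow> Y\<close> and \<open>Y \<leftarrow> Z' \<rightarrow> W\<close> are composed by completing \<open>Z \<rightarrow> Y \<leftarrow> Z'\<close> to a
  square, commutative up to homotopy, with a quasi-isomorphism \<open>T \<rightarrow> Z\<close>.\<close>

definition derived_comp ::
  "('a, 'r) ring_scheme \<Rightarrow> ('a, 'm) cpx \<Rightarrow> ('a, 'm) cpx \<Rightarrow> ('a, 'm) cpx \<Rightarrow>
   ('a, 'm) roof set \<Rightarrow> ('a, 'm) roof set \<Rightarrow> ('a, 'm) roof set" where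
  "derived_comp R X Y W \<Psi> \<Phi> =
     \<Union>{roof_class R X W (T, s \<circ>\<^sub>c q, g \<circ>\<^sub>c e) | Z s f Z' t g T q e.
        (Z, s, f) \<in> \<Phi> \<and> (Z', t, g) \<in> \<Psi> \<and>
        T \<in> complexes R \<and> q \<in> quasi_isos R T Z \<and> e \<in> chain_maps R T Z' \<and>
        homotopic_maps R T Y (f \<circ>\<^sub>c q) (t \<circ>\<^sub>c e)}"

text \<open>The morphism of the derived category given by a chain map.\<close>

definition derived_map ::
  "('a, 'r) ring_scheme \<Rightarrow> ('a, 'm) cpx \<Rightarrow> ('a, 'm) cpx \<Rightarrow> 'm cmap \<Rightarrow> ('a, 'm) roof set" where
  "derived_map R X Y f = roof_class R X Y (X, cmap_id, f)"

definition derived_shift ::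
  "('a, 'r) ring_scheme \<Rightarrow> int \<Rightarrow> ('a, 'm) cpx \<Rightarrow> ('a, 'm) cpx \<Rightarrow>
   ('a, 'm) roof set \<Rightarrow> ('a, 'm) roof set" where
  "derived_shift R k X Y \<Phi> =
     (\<Union>(Z, s, f)\<in>\<Phi>. roof_class R (shift_cpx k X) (shift_cpx k Y)
        (shift_cpx k Z, shift_map k s, shift_map k f))"

definition derived_cat ::
  "('a, 'r) ring_scheme \<Rightarrow> (('a, 'm) cpx, ('a, 'm) roof set) cat" where
  "derived_cat R =
     \<lparr> Ob = complexes R,
       Hom = derived_hom R,
       Cmp = derived_comp R,
       Idn = (\<lambda>X. derived_map R X X cmap_id) \<rparr>"

text \<open>The distinguished triangles are those isomorphic, in the derived category, to the triangle
  of a mapping cone.\<close>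

definition derived_triangle ::
  "('a, 'r) ring_scheme \<Rightarrow> ('a, 'm) cpx \<Rightarrow> ('a, 'm) cpx \<Rightarrow> ('a, 'm) cpx \<Rightarrow>
   ('a, 'm) roof set \<Rightarrow> ('a, 'm) roof set \<Rightarrow> ('a, 'm) roof set \<Rightarrow> bool" where
  "derived_triangle R X Y Z u v w \<longleftrightarrow>
     X \<in> complexes R \<and> Y \<in> complexes R \<and> Z \<in> complexes R \<and>
     u \<in> derived_hom R X Y \<and> v \<in> derived_hom R Y Z \<and> w \<in> derived_hom R Z (shift_cpx 1 X) \<and>
     (\<exists>X' \<in> complexes R. \<exists>Y' \<in> complexes R. \<exists>f \<in> chain_maps R X' Y'. \<exists>C i p.
        mapping_cone R X' Y' f C i p \<and>
        (\<exists>a \<in> isos (derived_cat R) X X'. \<exists>b \<in> isos (derived_cat R) Y Y'.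
         \<exists>c \<in> isos (derived_cat R) Z C.
           derived_comp R X Y Y' b u = derived_comp R X X' Y' (derived_map R X' Y' f) a \<and>
           derived_comp R Y Z C c v = derived_comp R Y Y' C (derived_map R Y' C i) b \<and>
           derived_comp R Z (shift_cpx 1 X) (shift_cpx 1 X') (derived_shift R 1 X X' a) w =
             derived_comp R Z C (shift_cpx 1 X') (derived_map R C (shift_cpx 1 X') p) c))"

definition derived_tricat ::
  "('a, 'r) ring_scheme \<Rightarrow> (('a, 'm) cpx, ('a, 'm) roof set) tricat" where
  "derived_tricat R = cat.extend (derived_cat R)
     \<lparr> Zer = (\<lambda>X Y. derived_map R X Y (\<lambda>n x. \<zero>\<^bsub>cmod Y n\<^esub>)),
       Shf = shift_cpx,
       Dist = derived_triangle R \<rparr>"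

definition bounded_cpx :: "('a, 'm) cpx \<Rightarrow> bool" where
  "bounded_cpx X \<longleftrightarrow> (\<exists>a b. \<forall>n. n < a \<or> b < n \<longrightarrow> carrier (cmod X n) = {\<zero>\<^bsub>cmod X n\<^esub>})"

text \<open>Quasi-isomorphic means isomorphic in the derived category, i.e. connected by a zigzag of
  quasi-isomorphisms.\<close>

definition perfect_cpx :: "('a, 'r) ring_scheme \<Rightarrow> ('a, 'm) cpx \<Rightarrow> bool" where
  "perfect_cpx R X \<longleftrightarrow> X \<in> complexes R \<and>
     (\<exists>P \<in> complexes R. bounded_cpx P \<and>
        (\<forall>n. fin_gen_module R (cmod P n) \<and> projective_module R (cmod P n)) \<and>
        isomorphic (derived_cat R) X P)"

definition Perf :: "('a, 'r) ring_scheme \<Rightarrow> (('a, 'm) cpx, ('a, 'm) roof set) tricat" where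
  "Perf R = full_subcat (derived_tricat R) {X. perfect_cpx R X}"

end

theory Submission
  imports Defs
begin

text \<open>Let \<open>\<eta>\<close> be the smallest prime of \<open>R\<close> and consider the bounded complexes of finitely generated projectives in
  the aisle \<open>U\<close>. If all of them are exact at \<open>\<eta>\<close>, they are acyclic: truncating \<open>F = R[-k]\<close> gives a triangle
  \<open>A \<rightarrow> F \<rightarrow> C\<close> with \<open>C\<close> orthogonal to \<open>U\<close>; at \<open>\<eta>\<close> the complex \<open>C\<close> looks like \<open>F\<close>, whereas at a prime where \<open>U\<close>
  is nonzero its depth would be large, as Koszul cones on maps out of \<open>U\<close> show. If their degrees of cohomology at
  \<open>\<eta>\<close> are unbounded above, everything orthogonal to \<open>U\<close> is acyclic, so \<open>U\<close> is everything. Otherwise the same depth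
  estimate bounds \<open>U\<close> above at every prime \<open>p\<close>, and truncating a piece of the minimal resolution of the residue
  field of \<open>p\<close> by the t-structure shows that this resolution is finite. By Serre's theorem \<open>R\<close> is then regular.
  Localisation at \<open>p\<close> never leaves \<open>R\<close>: statements are required only up to factors outside \<open>p\<close>.\<close>

text \<open>Two obstacles shape the proof. Morphisms of the derived category are classes of roofs,
  but out of a bounded complex of finitely generated projectives they are homotopy classes of chain
  maps; so what the t-structure says is restated through \<open>null_maps\<close> and
  \<open>hqi\<close>, and triangles become cones with explicit coordinates. All modules have
  carriers in one type \<open>'m\<close>; being infinite and containing a copy of \<open>R\<close>,
  it also contains copies of finite direct sums and of free modules of finite rank. The depth
  estimate costs one degree per generator of \<open>p\<close>: a Koszul cone shifts orthogonality by
  one and makes its element act nilpotently on each class, until among the primes inside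
  \<open>p\<close> only \<open>p\<close> can be associated to the lowest cohomology. Serre's theorem
  is proved by comparing two numbers. The Koszul complex inside a minimal resolution makes its
  length at least the number of generators of \<open>p\<close> after localisation; a resolution of
  finite length \<open>n\<close> yields \<open>n\<close> successive nonzerodivisors, and from them a
  chain of \<open>n\<close> inclusions of primes ending at \<open>p\<close>. Finite Krull dimension
  keeps the dimensions of the local rings finite.\<close>

abbreviation madd (\<open>(_ +[_]/ _)\<close> [65, 0, 66] 65) where "x +[M] y \<equiv> x \<oplus>\<^bsub>M\<^esub> y"
abbreviation mdiff (\<open>(_ -[_]/ _)\<close> [65, 0, 66] 65) where "x -[M] y \<equiv> x \<ominus>\<^bsub>M\<^esub> y"
abbreviation mneg (\<open>(-[_] _)\<close> [0, 81] 80) where "-[M] x \<equiv> \<ominus>\<^bsub>M\<^esub> x"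
abbreviation msmult (\<open>(_ *[_]/ _)\<close> [70, 0, 71] 70) where "a *[M] x \<equiv> a \<odot>\<^bsub>M\<^esub> x"
abbreviation mzero (\<open>0[_]\<close>) where "0[M] \<equiv> \<zero>\<^bsub>M\<^esub>"
abbreviation term_at (infixl \<open>$\<close> 999) where "X$n \<equiv> cmod X n"
abbreviation el where "el X n \<equiv> carrier (X$n)"
abbreviation bd where "bd \<equiv> coboundaries"
abbreviation cyc where "cyc \<equiv> cocycles"

section \<open>Modules\<close>

lemma (in abelian_group) a_inv_zero [simp]: "\<ominus> \<zero> = \<zero>"
  by (metis l_zero r_neg zero_closed a_inv_closed)

text \<open>Registers the module operations with the \<open>algebra\<close> normaliser, so that it
  proves identities mixing ring elements and module elements. Most element computations below rely
  on it.\<close>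

lemmas (in module) module_simprules
  [algebra add: mod "zero M" "add M" "a_inv M" "a_minus M" "smult M"] =
  M.a_closed M.zero_closed M.a_inv_closed M.minus_closed smult_closed
  M.a_assoc M.l_zero M.l_neg M.a_comm M.minus_eq
  M.r_zero M.r_neg M.r_neg2 M.r_neg1 M.minus_add M.minus_minus M.a_inv_zero
  M.a_lcomm smult_r_distr smult_l_distr smult_assoc1 [symmetric] smult_r_minus smult_l_minus
  smult_l_null smult_r_null smult_one
  R.a_closed R.zero_closed R.a_inv_closed R.minus_closed R.m_closed R.one_closed
  R.m_comm R.m_lcomm R.m_assoc R.minus_eq

lemma (in module) submoduleI':
  assumes "H \<subseteq> carrier M" "0[M] \<in> H"
    and "\<And>a b. a \<in> H ==> b \<in> H ==> a +[M] b \<in> H"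
    and s: "\<And>a x. a \<in> carrier R ==> x \<in> H ==> a *[M] x \<in> H"
  shows "submodule H R M"
proof (rule submoduleI)
  fix a assume a: "a \<in> H"
  then have "-[M] a = (\<ominus> \<one>) *[M] a"
    using assms(1) by (subst smult_l_minus) auto
  then show "-[M] a \<in> H" using s[OF _ a, of "\<ominus> \<one>"] by simp
qed (use assms in auto)

lemma (in module) submoduleD:
  assumes "submodule H R M"
  shows "x \<in> H ==> x \<in> carrier M" "0[M] \<in> H" "x \<in> H ==> y \<in> H ==> x +[M] y \<in> H"
    "x \<in> H ==> -[M] x \<in> H" "r \<in> carrier R ==> x \<in> H ==> r *[M] x \<in> H"
    "x \<in> H ==> y \<in> H ==> x -[M] y \<in> H"
proof -
  note E = submoduleE[OF assms]
  show "x \<in> H ==> x \<in> carrier M" using E(1) by blast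
  show z: "x \<in> H ==> y \<in> H ==> x +[M] y \<in> H" for x y by (rule E(5))
  show n: "x \<in> H ==> -[M] x \<in> H" for x by (rule E(3))
  show "r \<in> carrier R ==> x \<in> H ==> r *[M] x \<in> H" by (rule E(4))
  show "x \<in> H ==> y \<in> H ==> x -[M] y \<in> H" by (simp add: a_minus_def z n)
  obtain x where x: "x \<in> H" using E(2) by blast
  then have "x +[M] -[M] x \<in> H" by (simp add: z n)
  then show "0[M] \<in> H" using x E(1) by (simp add: M.r_neg subset_iff)
qed

lemma (in module) submodule_Int:
  assumes "submodule H R M" "submodule K R M" shows "submodule (H \<inter> K) R M"
proof (rule submoduleI')
  show "H \<inter> K \<subseteq> carrier M" using submoduleD(1)[OF assms(1)] by blast
qed (use submoduleD(2,3,5)[OF assms(1)] submoduleD(2,3,5)[OF assms(2)] in simp_all)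

text \<open>The set is the sum of \<open>K\<close> and the cyclic submodule of \<open>g\<close>;
  inductions over a finite generating set enlarge a submodule in this way, one generator at a
  time.\<close>

lemma (in module) add_line_submodule:
  assumes K: "submodule K R M" and g: "g \<in> carrier M"
  shows "submodule {k +[M] r *[M] g | k r. k \<in> K \<and> r \<in> carrier R} R M" (is "submodule ?H R M")
    and "K \<subseteq> {k +[M] r *[M] g | k r. k \<in> K \<and> r \<in> carrier R}"
    and "g \<in> {k +[M] r *[M] g | k r. k \<in> K \<and> r \<in> carrier R}"
proof -
  note KD = submoduleD[OF K]
  show "submodule ?H R M"
  proof (rule submoduleI')
    show "?H \<subseteq> carrier M" using KD(1) g by auto
    show "0[M] \<in> ?H" using KD(2) g by (intro CollectI exI[of _ "0[M]"] exI[of _ \<zero>]) simp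
  next
    fix a b assume "a \<in> ?H" "b \<in> ?H"
    then obtain k r k' r' where *: "a = k +[M] r *[M] g" "b = k' +[M] r' *[M] g" "k \<in> K" "k' \<in> K" "r \<in> carrier R" "r' \<in> carrier R"
      by auto
    moreover have "a +[M] b = (k +[M] k') +[M] (r \<oplus> r') *[M] g"
      unfolding * using *(3-) g KD(1)[OF *(3)] KD(1)[OF *(4)] by algebra
    ultimately show "a +[M] b \<in> ?H" using KD(3) by blast
  next
    fix a x assume a: "a \<in> carrier R" "x \<in> ?H"
    then obtain k r where *: "x = k +[M] r *[M] g" "k \<in> K" "r \<in> carrier R" by auto
    moreover have "a *[M] x = a *[M] k +[M] (a \<otimes> r) *[M] g"
      unfolding * using *(3-) a(1) g KD(1)[OF *(2)] by algebra
    ultimately show "a *[M] x \<in> ?H" using KD(5) a by blast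
  qed
  show "K \<subseteq> ?H"
  proof
    fix k assume "k \<in> K" then show "k \<in> ?H" using KD(1) g
      by (intro CollectI exI[of _ k] exI[of _ \<zero>]) simp
  qed
  show "g \<in> ?H" using KD(2) g by (intro CollectI exI[of _ "0[M]"] exI[of _ \<one>]) simp
qed

text \<open>Finite generation of \<open>N\<close> is tested against the submodules of the ambient
  module \<open>M\<close>, so that no module structure on \<open>N\<close> itself has to be
  formed.\<close>

definition fgs :: "('a, 'r) ring_scheme \<Rightarrow> ('a, 'm, 'e) module_scheme \<Rightarrow> 'm set \<Rightarrow> bool" where
  "fgs R M N \<longleftrightarrow> (\<exists>G. finite G \<and> G \<subseteq> N \<and> (\<forall>K. submodule K R M \<and> G \<subseteq> K \<longrightarrow> N \<subseteq> K))"

lemma fgsE: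
  assumes "fgs R M N"
  obtains G where "finite G" "G \<subseteq> N" "\<forall>K. submodule K R M \<longrightarrow> G \<subseteq> K \<longrightarrow> N \<subseteq> K"
  using assms unfolding fgs_def by (auto simp: imp_conjL)

definition noeth_module :: "('a, 'r) ring_scheme \<Rightarrow> ('a, 'm) module \<Rightarrow> bool" where
  "noeth_module R M \<longleftrightarrow> module R M \<and> (\<forall>N. submodule N R M \<longrightarrow> fgs R M N)"

lemma (in cring) idealI':
  assumes "I \<subseteq> carrier R" "\<zero> \<in> I" "\<And>a b. a \<in> I ==> b \<in> I ==> a \<oplus> b \<in> I"
    "\<And>a x. a \<in> I ==> x \<in> carrier R ==> x \<otimes> a \<in> I"
  shows "ideal I R"
proof (rule idealI)
  have "a \<in> I ==> \<ominus> a \<in> I" for a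
    using assms(1) assms(4)[of a "\<ominus> \<one>"] by (auto simp: l_minus)
  then show "subgroup I (add_monoid R)"
    using assms by (intro add.subgroupI) auto
  show "ring R" by (rule ring_axioms)
qed (use assms m_comm in \<open>auto simp: subset_iff\<close>)

locale noeth_cring = cring R + noetherian_ring R for R (structure)

text \<open>The coefficients of \<open>g\<close> in elements of \<open>N\<close> modulo
  \<open>L\<close> form an ideal, which is finitely generated. Lifts of its generators to
  \<open>N\<close>, together with generators of \<open>N \<inter> L\<close>, generate
  \<open>N\<close>.\<close>

lemma (in noeth_cring) submodules_add_line_fgs:
  assumes M: "module R M" and L: "submodule L R M" and g: "g \<in> carrier M"
    and Lfg: "\<And>N. submodule N R M ==> N \<subseteq> L ==> fgs R M N"
    and N: "submodule N R M" and NL: "N \<subseteq> {l +[M] r *[M] g | l r. l \<in> L \<and> r \<in> carrier R}"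
  shows "fgs R M N"
proof -
  interpret M: module R M by fact
  note LD = M.submoduleD[OF L] and ND = M.submoduleD[OF N]
  \<comment> \<open>Formed for an arbitrary submodule \<open>K\<close>, because the ideals of
    \<open>N\<close> and of \<open>K \<inter> N\<close> are compared below.\<close>
  have id: "ideal {r \<in> carrier R. \<exists>l\<in>L. l +[M] r *[M] g \<in> K} R" (is "ideal (?I K) R") if K: "submodule K R M" for K
  proof (rule idealI')
    note KD = M.submoduleD[OF K]
    show "?I K \<subseteq> carrier R" by auto
    show "\<zero> \<in> ?I K" using LD(2) KD(2) g by (auto intro!: bexI[of _ "0[M]"])
  next
    note KD = M.submoduleD[OF K]
    fix a b assume "a \<in> ?I K" "b \<in> ?I K"
    then obtain l l' where *: "a \<in> carrier R" "b \<in> carrier R" "l \<in> L" "l' \<in> L"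
        "l +[M] a *[M] g \<in> K" "l' +[M] b *[M] g \<in> K" by auto
    have "(l +[M] l') +[M] (a \<oplus> b) *[M] g = (l +[M] a *[M] g) +[M] (l' +[M] b *[M] g)"
      using *(1,2) g LD(1)[OF *(3)] LD(1)[OF *(4)] by algebra
    then show "a \<oplus> b \<in> ?I K" using * KD(3)[OF *(5,6)] LD(3)[OF *(3,4)] by (intro CollectI conjI bexI[of _ "l +[M] l'"]) auto
  next
    note KD = M.submoduleD[OF K]
    fix a x assume "a \<in> ?I K" and x: "x \<in> carrier R"
    then obtain l where *: "a \<in> carrier R" "l \<in> L" "l +[M] a *[M] g \<in> K" by auto
    have "x *[M] l +[M] (x \<otimes> a) *[M] g = x *[M] (l +[M] a *[M] g)"
      using *(1) x g LD(1)[OF *(2)] by algebra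
    then show "x \<otimes> a \<in> ?I K" using * x KD(5)[OF x *(3)] LD(5)[OF x *(2)] by (intro CollectI conjI bexI[of _ "x *[M] l"]) simp_all
  qed
  obtain A where A: "A \<subseteq> carrier R" "finite A" "?I N = Idl A" using finetely_gen[OF id[OF N]] by blast
  have "A \<subseteq> ?I N" using A genideal_self by auto
  then have "\<forall>a\<in>A. \<exists>m. m \<in> L \<and> m +[M] a *[M] g \<in> N" by blast
  from bchoice[OF this] obtain l where "\<forall>a\<in>A. l a \<in> L \<and> l a +[M] a *[M] g \<in> N" ..
  then have l: "\<And>a. a \<in> A ==> l a \<in> L \<and> l a +[M] a *[M] g \<in> N" by blast
  have NLs: "submodule (N \<inter> L) R M" by (rule M.submodule_Int[OF N L])
  obtain G where G: "finite G" "G \<subseteq> N \<inter> L" "\<forall>K. submodule K R M \<longrightarrow> G \<subseteq> K \<longrightarrow> N \<inter> L \<subseteq> K"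
    by (rule fgsE[OF Lfg[OF NLs Int_lower2]]) (rule that)
  show ?thesis unfolding fgs_def
  proof (intro exI conjI allI impI subsetI)
    let ?G = "G \<union> (\<lambda>a. l a +[M] a *[M] g) ` A"
    show "finite ?G" using G A by auto
    show "x \<in> N" if "x \<in> ?G" for x using that G l by auto
    fix K x assume K: "submodule K R M \<and> ?G \<subseteq> K" and x: "x \<in> N"
    note KD = M.submoduleD[OF conjunct1[OF K]]
    have KN: "submodule (K \<inter> N) R M" by (rule M.submodule_Int[OF conjunct1[OF K] N])
    have "A \<subseteq> ?I (K \<inter> N)"
    proof
      fix a assume "a \<in> A"
      then show "a \<in> ?I (K \<inter> N)" using l[of a] K A(1) by (intro CollectI conjI bexI[of _ "l a"]) auto
    qed
    then have "?I N \<subseteq> ?I (K \<inter> N)" unfolding A(3) by (rule genideal_minimal[OF id[OF KN]])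
    moreover obtain m r where mr: "x = m +[M] r *[M] g" "m \<in> L" "r \<in> carrier R" using x NL by blast
    ultimately have "r \<in> ?I (K \<inter> N)" using x by blast
    then obtain m' where m': "m' \<in> L" "m' +[M] r *[M] g \<in> K \<inter> N" by blast
    \<comment> \<open>Both elements have the coefficient \<open>r\<close> at \<open>g\<close>, so
      their difference falls into \<open>L\<close>.\<close>
    have e: "x -[M] (m' +[M] r *[M] g) = m -[M] m'"
      unfolding mr using mr(3) g LD(1)[OF mr(2)] LD(1)[OF m'(1)] by algebra
    have "x -[M] (m' +[M] r *[M] g) \<in> N" using ND(6)[OF x] m' by blast
    moreover have "x -[M] (m' +[M] r *[M] g) \<in> L" unfolding e using LD(6) mr m' by blast
    ultimately have "x -[M] (m' +[M] r *[M] g) \<in> K" using G(3) K by auto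
    then have "(x -[M] (m' +[M] r *[M] g)) +[M] (m' +[M] r *[M] g) \<in> K" using KD(3) m' by blast
    moreover have "(x -[M] (m' +[M] r *[M] g)) +[M] (m' +[M] r *[M] g) = x"
      using ND(1)[OF x] LD(1)[OF m'(1)] mr(3) g by algebra
    ultimately show "x \<in> K" by simp
  qed
qed

text \<open>Starts from the zero submodule and adds the generators of \<open>M\<close> one line at a
  time.\<close>

lemma (in noeth_cring) noeth_moduleI:
  assumes M: "module R M" and fg: "fin_gen_module R M"
  shows "noeth_module R M"
proof -
  interpret M: module R M by fact
  obtain G where G: "G \<subseteq> carrier M" "finite G" "\<And>N. submodule N R M ==> G \<subseteq> N ==> N = carrier M"
    using fg unfolding fin_gen_module_def by blast
  have "\<exists>L. submodule L R M \<and> G' \<subseteq> L \<and> (\<forall>N. submodule N R M \<longrightarrow> N \<subseteq> L \<longrightarrow> fgs R M N)"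
    if "finite G'" "G' \<subseteq> carrier M" for G'
    using that
  proof (induction G')
    case empty
    have "submodule {0[M]} R M" by (intro M.submoduleI') auto
    moreover have "fgs R M N" if "submodule N R M" "N \<subseteq> {0[M]}" for N
      unfolding fgs_def using that M.submoduleD(2) by (intro exI[of _ "{}"]) blast
    ultimately show ?case by blast
  next
    case (insert g G')
    then obtain L where L: "submodule L R M" "G' \<subseteq> L" "\<And>N. submodule N R M ==> N \<subseteq> L ==> fgs R M N" by auto
    have g: "g \<in> carrier M" using insert by auto
    note a = M.add_line_submodule[OF L(1) g]
    show ?case
      using a L(2) submodules_add_line_fgs[OF M L(1) g L(3)] by (intro exI conjI) blast+
  qed
  from this[OF G(2,1)] obtain L where L: "submodule L R M" "G \<subseteq> L" "\<And>N. submodule N R M ==> N \<subseteq> L ==> fgs R M N" by auto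
  have "L = carrier M" using G L by blast
  then show ?thesis unfolding noeth_module_def using L(3) M M.submoduleD(1) by blast
qed

section \<open>Multiplicative systems and saturation\<close>

definition msys :: "('a, 'r) ring_scheme \<Rightarrow> 'a set \<Rightarrow> bool" where
  "msys R S \<longleftrightarrow> S \<subseteq> carrier R \<and> \<one>\<^bsub>R\<^esub> \<in> S \<and> (\<forall>s\<in>S. \<forall>t\<in>S. s \<otimes>\<^bsub>R\<^esub> t \<in> S)"

lemma msysD:
  assumes "msys R S"
  shows "s \<in> S ==> s \<in> carrier R" "\<one>\<^bsub>R\<^esub> \<in> S" "s \<in> S ==> t \<in> S ==> s \<otimes>\<^bsub>R\<^esub> t \<in> S"
  using assms unfolding msys_def by auto

lemma (in cring) msys_one: "msys R {\<one>}"
  unfolding msys_def by auto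

lemma (in cring) msys_compl_prime:
  assumes "primeideal p R" shows "msys R (carrier R - p)"
proof -
  interpret p: primeideal p R by fact
  show ?thesis unfolding msys_def using p.I_prime p.I_notcarr p.one_imp_carrier by auto
qed

text \<open>The elements of \<open>M\<close> whose image in the localisation of \<open>M\<close> at
  \<open>S\<close> lies in the localisation of \<open>K\<close>. An inclusion
  \<open>N \<subseteq> sat R S M K\<close> is thus an inclusion of localised submodules, stated
  without denominators.\<close>

definition sat :: "('a, 'r) ring_scheme \<Rightarrow> 'a set \<Rightarrow> ('a, 'm, 'e) module_scheme \<Rightarrow> 'm set \<Rightarrow> 'm set" where
  "sat R S M K = {x \<in> carrier M. \<exists>t\<in>S. t *[M] x \<in> K}"

lemma sat_mono: "K \<subseteq> L ==> sat R S M K \<subseteq> sat R S M L"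
  unfolding sat_def by blast

lemma sat_mono_S: "S \<subseteq> T ==> sat R S M K \<subseteq> sat R T M K"
  unfolding sat_def by blast

context module begin

lemma subset_sat: "msys R S ==> K \<subseteq> carrier M ==> K \<subseteq> sat R S M K"
  unfolding sat_def msys_def by (auto intro!: bexI[of _ \<one>] simp: subset_iff)

lemma sat_sat:
  assumes "msys R S" shows "sat R S M (sat R S M K) = sat R S M K"
proof
  show "sat R S M (sat R S M K) \<subseteq> sat R S M K"
  proof
    fix x assume "x \<in> sat R S M (sat R S M K)"
    then obtain t u where "x \<in> carrier M" "t \<in> S" "u \<in> S" "u *[M] (t *[M] x) \<in> K" unfolding sat_def by auto
    then show "x \<in> sat R S M K" unfolding sat_def using assms msysD[OF assms]
      by (auto intro!: bexI[of _ "u \<otimes> t"] simp: smult_assoc1)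
  qed
  show "sat R S M K \<subseteq> sat R S M (sat R S M K)"
    by (rule subset_sat[OF assms]) (auto simp: sat_def)
qed

lemma sat_submodule:
  assumes S: "msys R S" and K: "submodule K R M" shows "submodule (sat R S M K) R M"
proof (rule submoduleI')
  note KD = submoduleD[OF K] and SD = msysD[OF S]
  show "sat R S M K \<subseteq> carrier M" by (auto simp: sat_def)
  show "0[M] \<in> sat R S M K" using KD(2) SD(2) by (auto simp: sat_def intro!: bexI[of _ \<one>])
  fix a b assume "a \<in> sat R S M K" "b \<in> sat R S M K"
  then obtain t u where *: "a \<in> carrier M" "b \<in> carrier M" "t \<in> S" "u \<in> S" "t *[M] a \<in> K" "u *[M] b \<in> K"
    unfolding sat_def by auto
  have "(t \<otimes> u) *[M] (a +[M] b) = u *[M] (t *[M] a) +[M] t *[M] (u *[M] b)"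
    using *(1,2) SD(1)[OF *(3)] SD(1)[OF *(4)] by algebra
  also have "\<dots> \<in> K" using KD(3,5) * SD(1) by blast
  finally show "a +[M] b \<in> sat R S M K" unfolding sat_def using * SD(3)[OF *(3,4)] by (auto intro!: bexI[of _ "t \<otimes> u"])
next
  note KD = submoduleD[OF K] and SD = msysD[OF S]
  fix a x assume a: "a \<in> carrier R" "x \<in> sat R S M K"
  then obtain t where *: "x \<in> carrier M" "t \<in> S" "t *[M] x \<in> K" unfolding sat_def by auto
  have "t *[M] (a *[M] x) = a *[M] (t *[M] x)"
    using *(1) SD(1)[OF *(2)] a(1) by algebra
  then show "a *[M] x \<in> sat R S M K" unfolding sat_def using * a KD(5)[OF a(1) *(3)] by (auto intro!: bexI[of _ t])
qed

text \<open>Generators of \<open>N\<close> are added to \<open>K\<close> until the sum becomes all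
  of \<open>N\<close> after localisation; the last one added is \<open>z\<close>. At
  \<open>S\<close> the quotient of \<open>N\<close> by \<open>W\<close> is then nonzero and cyclic,
  generated by \<open>z\<close>.\<close>

lemma simple_quotient:
  assumes S: "msys R S" and fg: "fgs R M N" and N: "submodule N R M" and K: "submodule K R M" "K \<subseteq> N"
    and nz: "\<not> N \<subseteq> sat R S M K"
  obtains W z where "submodule W R M" "K \<subseteq> W" "z \<in> N" "z \<notin> sat R S M W"
    "N \<subseteq> sat R S M {k +[M] r *[M] z | k r. k \<in> W \<and> r \<in> carrier R}"
proof -
  obtain G where G: "finite G" "G \<subseteq> N" "\<forall>K. submodule K R M \<longrightarrow> G \<subseteq> K \<longrightarrow> N \<subseteq> K"
    by (rule fgsE[OF fg]) (rule that)
  have NM: "N \<subseteq> carrier M" using submoduleD(1)[OF N] by blast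
  have "\<exists>W z. submodule W R M \<and> K \<subseteq> W \<and> z \<in> N \<and> z \<notin> sat R S M W \<and>
    N \<subseteq> sat R S M {k +[M] r *[M] z | k r. k \<in> W \<and> r \<in> carrier R}"
    if "finite G" "G \<subseteq> N" "submodule K R M" "\<not> N \<subseteq> sat R S M K"
       "\<And>L. submodule L R M ==> G \<subseteq> L ==> K \<subseteq> L ==> N \<subseteq> L" for G K
    using that
  proof (induction G arbitrary: K)
    case empty
    then have "N \<subseteq> K" by blast
    also have "K \<subseteq> sat R S M K" using subset_sat[OF S] submoduleD(1)[OF empty(2)] by blast
    finally show ?case using empty by blast
  next
    case (insert g G)
    let ?L = "{k +[M] r *[M] g | k r. k \<in> K \<and> r \<in> carrier R}"
    have g: "g \<in> carrier M" "g \<in> N" using insert NM by auto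
    note a = add_line_submodule[OF insert(5) g(1)]
    show ?case
    proof (cases "N \<subseteq> sat R S M ?L")
      case True
      \<comment> \<open>Otherwise adjoining \<open>g\<close> would change nothing after
        localisation, although it reaches all of \<open>N\<close>.\<close>
      have "g \<notin> sat R S M K"
      proof
        assume gs: "g \<in> sat R S M K"
        note sD = submoduleD[OF sat_submodule[OF S insert(5)]]
        have "K \<subseteq> sat R S M K" using subset_sat[OF S] submoduleD(1)[OF insert(5)] by blast
        then have "?L \<subseteq> sat R S M K" using gs sD(3,5) by blast
        then have "N \<subseteq> sat R S M K" using True sat_mono[of ?L "sat R S M K" R S M] sat_sat[OF S] by blast
        then show False using insert by blast
      qed
      then show ?thesis using True g insert(5) by blast
    next
      case False
      have "\<exists>W z. submodule W R M \<and> ?L \<subseteq> W \<and> z \<in> N \<and> z \<notin> sat R S M W \<and>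
        N \<subseteq> sat R S M {k +[M] r *[M] z | k r. k \<in> W \<and> r \<in> carrier R}"
        using insert(4) a insert(7) by (intro insert(3) False) blast+
      then show ?thesis using a(2) by blast
    qed
  qed
  from this[OF G(1,2) K(1) nz G(3)[rule_format]] show ?thesis using that by blast
qed

end

text \<open>The hypothesis \<open>xN\<close> says that \<open>N\<close> equals
  \<open>K + x N\<close> at \<open>p\<close>. In a nonzero cyclic quotient of \<open>N\<close>,
  generated by \<open>z\<close>, it makes \<open>z\<close> a multiple of \<open>x\<close> times
  itself. The resulting factor \<open>u \<otimes> t \<ominus> x \<otimes> r\<close> kills
  \<open>z\<close> and lies outside \<open>p\<close>, as \<open>x\<close> is in
  \<open>p\<close>.\<close>

lemma (in module) nakayama:
  assumes p: "primeideal p R" and fg: "fgs R M N" and N: "submodule N R M" and K: "submodule K R M" "K \<subseteq> N"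
    and x: "x \<in> p"
    and xN: "\<And>y. y \<in> N ==> \<exists>t\<in>carrier R - p. \<exists>k\<in>K. \<exists>w\<in>N. t *[M] y = k +[M] x *[M] w"
  shows "N \<subseteq> sat R (carrier R - p) M K"
proof (rule ccontr)
  let ?S = "carrier R - p"
  interpret p: primeideal p R by fact
  have S: "msys R ?S" using msys_compl_prime[OF p] .
  assume nz: "\<not> ?thesis"
  obtain W z where W: "submodule W R M" "K \<subseteq> W" "z \<in> N" "z \<notin> sat R ?S M W"
    "N \<subseteq> sat R ?S M {k +[M] r *[M] z | k r. k \<in> W \<and> r \<in> carrier R}"
    by (rule simple_quotient[OF S fg N K nz])
  note WD = submoduleD[OF W(1)] and ND = submoduleD[OF N]
  obtain t k w where t: "t \<in> ?S" "k \<in> K" "w \<in> N" "t *[M] z = k +[M] x *[M] w" using xN[OF W(3)] by blast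
  obtain u k' r where u: "u \<in> ?S" "u *[M] w = k' +[M] r *[M] z" "k' \<in> W" "r \<in> carrier R"
    using W(5) t(3) unfolding sat_def by blast
  have xc: "x \<in> carrier R" using x p.a_subset by blast
  have c: "z \<in> carrier M" "w \<in> carrier M" "k \<in> carrier M" "k' \<in> carrier M" "t \<in> carrier R" "u \<in> carrier R"
    using W t u ND(1) WD(1) by blast+
  have "(u \<otimes> t \<ominus> x \<otimes> r) *[M] z = u *[M] (t *[M] z) -[M] (x \<otimes> r) *[M] z" using c xc u(4) by algebra
  also have "\<dots> = u *[M] k +[M] x *[M] (u *[M] w) -[M] (x \<otimes> r) *[M] z"
    unfolding t(4) using c xc u(4) by algebra
  also have "\<dots> = u *[M] k +[M] x *[M] k'" unfolding u(2) using c xc u(4) by algebra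
  also have "\<dots> \<in> W" by (rule WD(3)[OF WD(5)[OF c(6) subsetD[OF W(2) t(2)]] WD(5)[OF xc u(3)]])
  finally have m: "(u \<otimes> t \<ominus> x \<otimes> r) *[M] z \<in> W" .
  have "u \<otimes> t \<ominus> x \<otimes> r \<notin> p"
  proof
    assume a: "u \<otimes> t \<ominus> x \<otimes> r \<in> p"
    have "x \<otimes> r \<in> p" using p.I_r_closed x u by blast
    then have "(u \<otimes> t \<ominus> x \<otimes> r) \<oplus> x \<otimes> r \<in> p" using a by blast
    moreover have "(u \<otimes> t \<ominus> x \<otimes> r) \<oplus> x \<otimes> r = u \<otimes> t" using c xc u(4) by algebra
    ultimately show False using msysD(3)[OF S u(1) t(1)] by simp
  qed
  then show False using m W(4) c xc u(4) unfolding sat_def by auto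
qed

section \<open>Linear maps\<close>

lemma lin_simps:
  assumes "module R M" "module R N" "f \<in> lin_maps R M N"
  shows "x \<in> carrier M ==> f x \<in> carrier N"
    "x \<in> carrier M ==> y \<in> carrier M ==> f (x +[M] y) = f x +[N] f y"
    "r \<in> carrier R ==> x \<in> carrier M ==> f (r *[M] x) = r *[N] f x"
    "f 0[M] = 0[N]"
    "x \<in> carrier M ==> f (-[M] x) = -[N] f x"
    "x \<in> carrier M ==> y \<in> carrier M ==> f (x -[M] y) = f x -[N] f y"
proof -
  interpret M: module R M by fact
  interpret N: module R N by fact
  show c: "x \<in> carrier M ==> f x \<in> carrier N" for x using assms(3) by (auto simp: lin_maps_def)
  show a: "x \<in> carrier M ==> y \<in> carrier M ==> f (x +[M] y) = f x +[N] f y" for x y using assms(3) by (auto simp: lin_maps_def)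
  show s: "r \<in> carrier R ==> x \<in> carrier M ==> f (r *[M] x) = r *[N] f x" for r x using assms(3) by (auto simp: lin_maps_def)
  show "f 0[M] = 0[N]" using s[of "0[R]" "0[M]"] c[of "0[M]"] by simp
  show n: "x \<in> carrier M ==> f (-[M] x) = -[N] f x" for x
  proof -
    assume x: "x \<in> carrier M"
    have "-[M] x = (-[R] \<one>\<^bsub>R\<^esub>) *[M] x" using x M.smult_l_minus[of "\<one>\<^bsub>R\<^esub>" x] by simp
    then have "f (-[M] x) = (-[R] \<one>\<^bsub>R\<^esub>) *[N] f x" using s[of "-[R] \<one>\<^bsub>R\<^esub>" x] x by simp
    then show ?thesis using c[OF x] N.smult_l_minus[of "\<one>\<^bsub>R\<^esub>" "f x"] by simp
  qed
  show "x \<in> carrier M ==> y \<in> carrier M ==> f (x -[M] y) = f x -[N] f y"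
    by (simp add: a_minus_def a n)
qed

lemma lin_mapsI:
  assumes "\<And>x. x \<in> carrier M ==> f x \<in> carrier N"
    "\<And>x y. x \<in> carrier M ==> y \<in> carrier M ==> f (x +[M] y) = f x +[N] f y"
    "\<And>r x. r \<in> carrier R ==> x \<in> carrier M ==> f (r *[M] x) = r *[N] f x"
  shows "f \<in> lin_maps R M N"
  using assms unfolding lin_maps_def by auto

lemma lin_maps_comp:
  "f \<in> lin_maps R M N ==> g \<in> lin_maps R N L ==> (\<lambda>x. g (f x)) \<in> lin_maps R M L"
  unfolding lin_maps_def by (auto simp: Pi_iff)

lemma lin_maps_id: "(\<lambda>x. x) \<in> lin_maps R M M"
  unfolding lin_maps_def by auto

lemma lin_maps_zero: "module R M ==> module R N ==> (\<lambda>x. 0[N]) \<in> lin_maps R M N"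
proof (rule lin_mapsI)
  assume "module R N" then interpret N: module R N .
  show "0[N] \<in> carrier N" by simp
  show "0[N] = 0[N] +[N] 0[N]" by simp
  show "\<And>r. r \<in> carrier R ==> 0[N] = r *[N] 0[N]" by simp
qed

lemma lin_maps_add:
  assumes M: "module R M" and N: "module R N" and f: "f \<in> lin_maps R M N" and g: "g \<in> lin_maps R M N"
  shows "(\<lambda>x. f x +[N] g x) \<in> lin_maps R M N"
proof -
  interpret N: module R N by fact
  note fs = lin_simps[OF M N f] lin_simps[OF M N g]
  show ?thesis
  proof (rule lin_mapsI)
    fix x y assume "x \<in> carrier M" "y \<in> carrier M"
    then show "f (x +[M] y) +[N] g (x +[M] y) = f x +[N] g x +[N] (f y +[N] g y)"
      by (simp add: fs N.a_ac)
  qed (auto simp: fs N.smult_r_distr)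
qed

lemma lin_maps_smult:
  assumes M: "module R M" and N: "module R N" and f: "f \<in> lin_maps R M N" and t: "t \<in> carrier R"
  shows "(\<lambda>x. t *[N] f x) \<in> lin_maps R M N"
proof -
  interpret N: module R N by fact
  note fs = lin_simps[OF M N f]
  show ?thesis
  proof (rule lin_mapsI)
    fix r x assume "r \<in> carrier R" "x \<in> carrier M"
    then show "t *[N] f (r *[M] x) = r *[N] (t *[N] f x)"
      using t by (simp add: fs N.smult_assoc1[symmetric] N.R.m_comm)
  qed (auto simp: fs N.smult_r_distr t)
qed

lemma lin_maps_neg:
  assumes M: "module R M" and N: "module R N" and f: "f \<in> lin_maps R M N"
  shows "(\<lambda>x. -[N] f x) \<in> lin_maps R M N"
proof -
  interpret N: module R N by fact
  note fs = lin_simps[OF M N f]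
  show ?thesis
    by (rule lin_mapsI) (auto simp: fs N.minus_add N.smult_r_minus N.a_comm)
qed

lemma lin_maps_diff:
  assumes M: "module R M" and N: "module R N" and f: "f \<in> lin_maps R M N" and g: "g \<in> lin_maps R M N"
  shows "(\<lambda>x. f x -[N] g x) \<in> lin_maps R M N"
  unfolding a_minus_def by (rule lin_maps_add[OF M N f lin_maps_neg[OF M N g]])

text \<open>\<open>R\<close> as a module over itself. The ring \<open>R\<close> has an arbitrary
  record type, whereas linear maps go between records of type \<open>module\<close>; hence the
  copy.\<close>

definition selfmod :: "('a, 'r) ring_scheme \<Rightarrow> ('a, 'a) module" where
  "selfmod R = \<lparr>carrier = carrier R, mult = mult R, one = one R, zero = zero R, add = add R, smult = mult R\<rparr>"

lemma selfmod_simps [simp]: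
  "carrier (selfmod R) = carrier R" "zero (selfmod R) = zero R" "add (selfmod R) = add R" "smult (selfmod R) = mult R"
  by (auto simp: selfmod_def)

lemma selfmod_a_inv [simp]: "a_inv (selfmod R) = a_inv R" "a_minus (selfmod R) = a_minus R"
  by (auto simp: a_inv_def m_inv_def a_minus_def fun_eq_iff)

lemma (in cring) selfmod_module: "module R (selfmod R)"
proof (rule moduleI)
  show "abelian_group (selfmod R)"
    by (rule abelian_groupI) (auto intro!: bexI[of _ "\<ominus> _"] a_assoc a_comm exI[of _ "\<ominus> _"] simp: l_neg)
qed (auto simp: l_distr r_distr m_assoc cring_axioms)

lemma (in cring) submodule_selfmod_iff: "submodule I R (selfmod R) \<longleftrightarrow> ideal I R"
proof
  interpret s: module R "selfmod R" by (rule selfmod_module)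
  assume I: "submodule I R (selfmod R)"
  note D = s.submoduleD[OF I]
  show "ideal I R" by (rule idealI') (use D in auto)
next
  interpret s: module R "selfmod R" by (rule selfmod_module)
  assume I: "ideal I R"
  interpret I: ideal I R by fact
  show "submodule I R (selfmod R)" by (rule s.submoduleI') (use I.a_subset I.I_l_closed in auto)
qed

text \<open>The combination of the first \<open>n\<close> members of a family is defined by
  recursion, so that its unfolding equations carry no closure conditions.\<close>

primrec lc :: "('a, 'm, 'e) module_scheme \<Rightarrow> (nat \<Rightarrow> 'a) \<Rightarrow> (nat \<Rightarrow> 'm) \<Rightarrow> nat \<Rightarrow> 'm" where
  "lc M c b 0 = 0[M]"
| "lc M c b (Suc n) = lc M c b n +[M] c n *[M] b n"

lemma lc_cong: "(\<And>i. i < n ==> c i = c' i \<and> b i = b' i) ==> lc M c b n = lc M c' b' n"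
  by (induction n) auto

lemma (in module) lc_closed [simp]:
  "(\<And>i. i < n ==> c i \<in> carrier R) ==> (\<And>i. i < n ==> b i \<in> carrier M) ==> lc M c b n \<in> carrier M"
  by (induction n) auto

lemma (in module) lc_mem:
  "submodule N R M ==> (\<And>i. i < n ==> c i \<in> carrier R) ==> (\<And>i. i < n ==> b i \<in> N) ==> lc M c b n \<in> N"
  by (induction n) (auto simp: submoduleD)

lemma (in module) lc_add:
  assumes "\<And>i. i < n ==> c i \<in> carrier R" "\<And>i. i < n ==> c' i \<in> carrier R" "\<And>i. i < n ==> b i \<in> carrier M"
  shows "lc M (\<lambda>i. c i \<oplus> c' i) b n = lc M c b n +[M] lc M c' b n"
  using assms
proof (induction n)
  case (Suc n)
  have "lc M c b n \<in> carrier M" "lc M c' b n \<in> carrier M" "c n \<in> carrier R" "c' n \<in> carrier R" "b n \<in> carrier M"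
    using Suc by auto
  then show ?case using Suc by (simp add: smult_l_distr M.a_ac)
qed simp

lemma (in module) lc_smult:
  assumes "\<And>i. i < n ==> c i \<in> carrier R" "r \<in> carrier R" "\<And>i. i < n ==> b i \<in> carrier M"
  shows "lc M (\<lambda>i. r \<otimes> c i) b n = r *[M] lc M c b n"
  using assms
  by (induction n) (auto simp: smult_r_distr smult_assoc1)

lemma lin_maps_lc:
  assumes M: "module R M" and N: "module R N" and f: "f \<in> lin_maps R M N"
    and "\<And>i. i < n ==> c i \<in> carrier R" "\<And>i. i < n ==> b i \<in> carrier M"
  shows "f (lc M c b n) = lc N c (\<lambda>i. f (b i)) n"
  using assms(4,5)
proof (induction n)
  case 0 then show ?case using lin_simps[OF M N f] by simp
next
  case (Suc n)
  interpret M: module R M by fact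
  have "lc M c b n \<in> carrier M" using Suc by auto
  then show ?case using Suc lin_simps[OF M N f] by simp
qed

lemma lc_lin_maps:
  assumes M: "module R M" and N: "module R N" and f: "\<And>i. i < n ==> f i \<in> lin_maps R M (selfmod R)"
    and b: "\<And>i. i < n ==> b i \<in> carrier N"
  shows "(\<lambda>x. lc N (\<lambda>i. f i x) b n) \<in> lin_maps R M N"
proof -
  interpret N: module R N by fact
  note fs = lin_simps[OF M N.R.selfmod_module f, simplified]
  show ?thesis
  proof (rule lin_mapsI)
    fix x y assume x: "x \<in> carrier M" "y \<in> carrier M"
    have "lc N (\<lambda>i. f i (x +[M] y)) b n = lc N (\<lambda>i. f i x +[R] f i y) b n"
      by (rule lc_cong) (simp add: fs x)
    then show "lc N (\<lambda>i. f i (x +[M] y)) b n = lc N (\<lambda>i. f i x) b n +[N] lc N (\<lambda>i. f i y) b n"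
      by (simp add: N.lc_add fs b x)
  next
    fix r x assume x: "r \<in> carrier R" "x \<in> carrier M"
    have "lc N (\<lambda>i. f i (r *[M] x)) b n = lc N (\<lambda>i. r \<otimes>\<^bsub>R\<^esub> f i x) b n"
      by (rule lc_cong) (simp add: fs x)
    then show "lc N (\<lambda>i. f i (r *[M] x)) b n = r *[N] lc N (\<lambda>i. f i x) b n"
      by (simp add: N.lc_smult fs b x)
  qed (auto intro!: N.lc_closed simp: fs b)
qed

text \<open>By the dual basis lemma, \<open>fgp\<close> means finitely generated projective; no test modules are involved.\<close>

definition fgp :: "('a, 'r) ring_scheme \<Rightarrow> ('a, 'm) module \<Rightarrow> bool" where
  "fgp R M \<longleftrightarrow> module R M \<and> (\<exists>n b \<phi>. (\<forall>i<n. b i \<in> carrier M \<and> \<phi> i \<in> lin_maps R M (selfmod R)) \<and>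
     (\<forall>x\<in>carrier M. x = lc M (\<lambda>i. \<phi> i x) b n))"

lemma (in module) lc_diff:
  assumes "\<And>i. i < n ==> c i \<in> carrier R" "\<And>i. i < n ==> u i \<in> carrier M" "\<And>i. i < n ==> v i \<in> carrier M"
  shows "lc M c u n -[M] lc M c v n = lc M c (\<lambda>i. u i -[M] v i) n"
  using assms
proof (induction n)
  case (Suc n)
  have "lc M c u n \<in> carrier M" "lc M c v n \<in> carrier M" "c n \<in> carrier R" "u n \<in> carrier M" "v n \<in> carrier M"
    using Suc by auto
  then have "lc M c u n +[M] c n *[M] u n -[M] (lc M c v n +[M] c n *[M] v n) =
     (lc M c u n -[M] lc M c v n) +[M] c n *[M] (u n -[M] v n)" by algebra
  then show ?case using Suc by simp
qed (simp add: a_minus_def)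

text \<open>Lift the dual basis elements \<open>b i\<close> through \<open>d\<close>, bring their
  denominators to a common \<open>t\<close>, and recombine with the coordinate forms
  \<open>\<phi> i\<close>. There are finitely many denominators, so one factor in \<open>S\<close>
  serves for all of \<open>P\<close>.\<close>

lemma fgp_lift_mod:
  assumes S: "msys R S" and P: "fgp R P" and N: "module R N" and N': "module R N'"
    and W: "submodule W R N" and g: "g \<in> lin_maps R P N" and d: "d \<in> lin_maps R N' N"
    and ex: "\<And>x. x \<in> carrier P ==> \<exists>t\<in>S. \<exists>y\<in>carrier N'. t *[N] g x -[N] d y \<in> W"
  obtains t \<sigma> where "t \<in> S" "\<sigma> \<in> lin_maps R P N'"
    "\<And>x. x \<in> carrier P ==> t *[N] g x -[N] d (\<sigma> x) \<in> W"
proof -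
  interpret N: module R N by fact
  interpret N': module R N' by fact
  note SD = msysD[OF S] and WD = N.submoduleD[OF W]
  obtain n b \<phi> where b: "\<And>i. i < n ==> b i \<in> carrier P" "\<And>i. i < n ==> \<phi> i \<in> lin_maps R P (selfmod R)"
      "\<And>x. x \<in> carrier P ==> x = lc P (\<lambda>i. \<phi> i x) b n" and P': "module R P"
    using P unfolding fgp_def by blast
  interpret P: module R P by fact
  note gs = lin_simps[OF P' N g] and ds = lin_simps[OF N' N d]
  have "\<exists>t\<in>S. \<exists>y. \<forall>i<m. y i \<in> carrier N' \<and> t *[N] g (b i) -[N] d (y i) \<in> W" if "m \<le> n" for m
    using that
  proof (induction m)
    case 0 then show ?case using SD by blast
  next
    case (Suc m)
    then obtain t y where ty: "t \<in> S" "\<And>i. i < m ==> y i \<in> carrier N' \<and> t *[N] g (b i) -[N] d (y i) \<in> W" by auto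
    have bm: "b m \<in> carrier P" using b Suc by auto
    from ex[OF this] obtain u w where u: "u \<in> S" "w \<in> carrier N'" "u *[N] g (b m) -[N] d w \<in> W" by auto
    \<comment> \<open>Cross-multiplication: the old lifts take the new denominator \<open>u\<close>
      and the new lift the old denominator \<open>t\<close>, so that all share
      \<open>t \<otimes> u\<close>.\<close>
    define y' where "y' i = (if i = m then t *[N'] w else u *[N'] y i)" for i
    have tc: "t \<in> carrier R" "u \<in> carrier R" using ty u SD by auto
    have "y' i \<in> carrier N' \<and> (t \<otimes>\<^bsub>R\<^esub> u) *[N] g (b i) -[N] d (y' i) \<in> W" if i: "i < Suc m" for i
    proof (cases "i = m")
      case True
      have c: "g (b m) \<in> carrier N" "d w \<in> carrier N" using bm u gs ds by auto
      have "(t \<otimes>\<^bsub>R\<^esub> u) *[N] g (b m) -[N] t *[N] d w = t *[N] (u *[N] g (b m) -[N] d w)"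
        using c tc by algebra
      then show ?thesis using True u tc ds WD(5)[OF tc(1) u(3)] by (simp add: y'_def)
    next
      case False
      then have i': "i < m" "i < n" using i Suc by auto
      have c: "g (b i) \<in> carrier N" "d (y i) \<in> carrier N" using b(1)[OF i'(2)] ty(2)[OF i'(1)] gs ds by auto
      have "(t \<otimes>\<^bsub>R\<^esub> u) *[N] g (b i) -[N] u *[N] d (y i) = u *[N] (t *[N] g (b i) -[N] d (y i))"
        using c tc by algebra
      then show ?thesis using False tc ds ty(2)[OF i'(1)] WD(5)[OF tc(2)] by (simp add: y'_def)
    qed
    then show ?case using SD(3)[OF ty(1) u(1)] by blast
  qed
  from this[of n] obtain t y where ty: "t \<in> S" "\<And>i. i < n ==> y i \<in> carrier N'"
    "\<And>i. i < n ==> t *[N] g (b i) -[N] d (y i) \<in> W" by auto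
  define \<sigma> where "\<sigma> x = lc N' (\<lambda>i. \<phi> i x) y n" for x
  have \<phi>c: "i < n ==> x \<in> carrier P ==> \<phi> i x \<in> carrier R" for i x
    using lin_simps(1)[OF P' N.R.selfmod_module b(2)] by simp
  have tc: "t \<in> carrier R" using ty SD by auto
  have "\<sigma> \<in> lin_maps R P N'" unfolding \<sigma>_def using b ty by (intro lc_lin_maps P' N') auto
  moreover have "t *[N] g x -[N] d (\<sigma> x) \<in> W" if x: "x \<in> carrier P" for x
  proof -
    have "d (\<sigma> x) = lc N (\<lambda>i. \<phi> i x) (\<lambda>i. d (y i)) n"
      unfolding \<sigma>_def using ty \<phi>c x by (subst lin_maps_lc[OF N' N d]) auto
    moreover have "t *[N] g (lc P (\<lambda>i. \<phi> i x) b n) = lc N (\<lambda>i. \<phi> i x) (\<lambda>i. t *[N] g (b i)) n"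
      using lin_maps_lc[OF P' N lin_maps_smult[OF P' N g tc], of n "\<lambda>i. \<phi> i x" b] \<phi>c x b by simp
    ultimately have "t *[N] g x -[N] d (\<sigma> x) = lc N (\<lambda>i. \<phi> i x) (\<lambda>i. t *[N] g (b i) -[N] d (y i)) n"
      using b(3)[OF x] N.lc_diff[of n "\<lambda>i. \<phi> i x" "\<lambda>i. t *[N] g (b i)" "\<lambda>i. d (y i)"] \<phi>c x b ty tc gs ds by simp
    also have "\<dots> \<in> W" by (rule N.lc_mem[OF W]) (use \<phi>c x ty in auto)
    finally show ?thesis .
  qed
  ultimately show ?thesis using that ty by blast
qed

lemma fgp_lift:
  assumes S: "msys R S" and P: "fgp R P" and N: "module R N" and N': "module R N'"
    and g: "g \<in> lin_maps R P N" and d: "d \<in> lin_maps R N' N"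
    and ex: "\<And>x. x \<in> carrier P ==> g x \<in> sat R S N (d ` carrier N')"
  obtains t \<sigma> where "t \<in> S" "\<sigma> \<in> lin_maps R P N'" "\<And>x. x \<in> carrier P ==> d (\<sigma> x) = t *[N] g x"
proof -
  interpret N: module R N by fact
  have P': "module R P" using P by (simp add: fgp_def)
  have W: "submodule {0[N]} R N" by (intro N.submoduleI') auto
  have ex': "\<exists>t\<in>S. \<exists>y\<in>carrier N'. t *[N] g x -[N] d y \<in> {0[N]}" if x: "x \<in> carrier P" for x
  proof -
    obtain t y where *: "t \<in> S" "y \<in> carrier N'" "t *[N] g x = d y" using ex[OF x] unfolding sat_def by auto
    then have "t *[N] g x -[N] d y = 0[N]"
      using lin_simps(1)[OF N' N d *(2)] by (simp add: a_minus_def N.r_neg)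
    then show ?thesis using * by blast
  qed
  obtain t \<sigma> where t: "t \<in> S" "\<sigma> \<in> lin_maps R P N'" "\<And>x. x \<in> carrier P ==> t *[N] g x -[N] d (\<sigma> x) \<in> {0[N]}"
    using ex' by (rule fgp_lift_mod[OF S P N N' W g d]) (assumption, rule that, assumption, assumption, blast)
  show ?thesis
  proof (rule that[OF t(1,2)])
    fix x assume x: "x \<in> carrier P"
    have c: "g x \<in> carrier N" "d (\<sigma> x) \<in> carrier N" "t \<in> carrier R"
      using lin_simps(1)[OF P' N g x] lin_simps(1)[OF N' N d lin_simps(1)[OF P' N' t(2) x]] msysD[OF S] t by auto
    have "d (\<sigma> x) = t *[N] g x -[N] (t *[N] g x -[N] d (\<sigma> x))" using c by algebra
    then show "d (\<sigma> x) = t *[N] g x" using t(3)[OF x] c by (simp add: a_minus_def)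
  qed
qed

lemma fgp_fin_gen: "fgp R M ==> fin_gen_module R M"
proof -
  assume P: "fgp R M"
  obtain n b \<phi> where b: "\<And>i. i < n ==> b i \<in> carrier M" "\<And>i. i < n ==> \<phi> i \<in> lin_maps R M (selfmod R)"
      "\<And>x. x \<in> carrier M ==> x = lc M (\<lambda>i. \<phi> i x) b n" and P': "module R M"
    using P unfolding fgp_def by blast
  interpret P: module R M by fact
  have \<phi>c: "i < n ==> x \<in> carrier M ==> \<phi> i x \<in> carrier R" for i x
    using lin_simps(1)[OF P' P.R.selfmod_module b(2)] by simp
  show ?thesis unfolding fin_gen_module_def
  proof (intro exI[of _ "b ` {..<n}"] conjI allI impI)
    fix N assume N: "submodule N R M \<and> b ` {..<n} \<subseteq> N"
    have "x \<in> N" if "x \<in> carrier M" for x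
      using b(3)[OF that] P.lc_mem[of N n "\<lambda>i. \<phi> i x" b] N \<phi>c that by auto
    then show "N = carrier M" using P.submoduleD(1) N by blast
  qed (use b in auto)
qed

section \<open>Complexes\<close>

lemma cpxD:
  assumes "X \<in> complexes R"
  shows "module R (X$n)" "cdiff X n \<in> lin_maps R (X$n) (X$(n + 1))"
    "cdiff X (n - 1) \<in> lin_maps R (X$(n - 1)) (X$n)"
    "x \<in> el X n ==> cdiff X (n + 1) (cdiff X n x) = 0[X$(n + 2)]"
    "x \<in> el X (n - 1) ==> cdiff X n (cdiff X (n - 1) x) = 0[X$(n + 1)]"
    "x \<in> el X (n - 2) ==> cdiff X (n - 1) (cdiff X (n - 2) x) = 0[X$n]"
proof -
  show "module R (X$n)" for n using assms by (auto simp: complexes_def)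
  show l: "cdiff X n \<in> lin_maps R (X$n) (X$(n + 1))" for n using assms by (auto simp: complexes_def)
  show "cdiff X (n - 1) \<in> lin_maps R (X$(n - 1)) (X$n)" using l[of "n - 1"] by simp
  show d: "x \<in> el X n ==> cdiff X (n + 1) (cdiff X n x) = 0[X$(n + 2)]" for n x
    using assms by (auto simp: complexes_def)
  show "x \<in> el X (n - 1) ==> cdiff X n (cdiff X (n - 1) x) = 0[X$(n + 1)]"
    using d[of x "n - 1"] by (simp add: add.commute)
  show "x \<in> el X (n - 2) ==> cdiff X (n - 1) (cdiff X (n - 2) x) = 0[X$n]"
    using d[of x "n - 2"] by (simp add: add.commute)
qed

text \<open>Every rule appears for \<open>n\<close> and for \<open>n - 1\<close>, because the module
  in degree \<open>n - 1 + 1\<close> is not syntactically the one in degree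
  \<open>n\<close>.\<close>

lemma cpx_simps:
  assumes "X \<in> complexes R"
  shows "x \<in> el X n ==> cdiff X n x \<in> el X (n + 1)"
    "x \<in> el X n ==> y \<in> el X n ==>
       cdiff X n (x +[X$n] y) = cdiff X n x +[X$(n + 1)] cdiff X n y"
    "r \<in> carrier R ==> x \<in> el X n ==>
       cdiff X n (r *[X$n] x) = r *[X$(n + 1)] cdiff X n x"
    "cdiff X n 0[X$n] = 0[X$(n + 1)]"
    "x \<in> el X n ==> cdiff X n (-[X$n] x) = -[X$(n + 1)] cdiff X n x"
    "x \<in> el X n ==> y \<in> el X n ==>
       cdiff X n (x -[X$n] y) = cdiff X n x -[X$(n + 1)] cdiff X n y"
    "x \<in> el X (n - 1) ==> cdiff X (n - 1) x \<in> el X n"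
    "x \<in> el X (n - 1) ==> y \<in> el X (n - 1) ==>
       cdiff X (n - 1) (x +[X$(n - 1)] y) = cdiff X (n - 1) x +[X$n] cdiff X (n - 1) y"
    "r \<in> carrier R ==> x \<in> el X (n - 1) ==>
       cdiff X (n - 1) (r *[X$(n - 1)] x) = r *[X$n] cdiff X (n - 1) x"
    "cdiff X (n - 1) 0[X$(n - 1)] = 0[X$n]"
    "x \<in> el X (n - 1) ==> cdiff X (n - 1) (-[X$(n - 1)] x) = -[X$n] cdiff X (n - 1) x"
    "x \<in> el X (n - 1) ==> y \<in> el X (n - 1) ==>
       cdiff X (n - 1) (x -[X$(n - 1)] y) = cdiff X (n - 1) x -[X$n] cdiff X (n - 1) y"
  by (rule lin_simps[OF cpxD(1)[OF assms] cpxD(1)[OF assms] cpxD(2)[OF assms]]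
        lin_simps[OF cpxD(1)[OF assms] cpxD(1)[OF assms] cpxD(3)[OF assms]]; assumption)+

lemma chain_mapsD:
  assumes "f \<in> chain_maps R X Y"
  shows "f n \<in> lin_maps R (X$n) (Y$n)"
    "x \<in> el X n ==> f (n + 1) (cdiff X n x) = cdiff Y n (f n x)"
    "x \<in> el X (n - 1) ==> f n (cdiff X (n - 1) x) = cdiff Y (n - 1) (f (n - 1) x)"
proof -
  show "f n \<in> lin_maps R (X$n) (Y$n)" using assms by (auto simp: chain_maps_def)
  show c: "x \<in> el X n ==> f (n + 1) (cdiff X n x) = cdiff Y n (f n x)" for n x
    using assms by (auto simp: chain_maps_def)
  show "x \<in> el X (n - 1) ==> f n (cdiff X (n - 1) x) = cdiff Y (n - 1) (f (n - 1) x)"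
    using c[of x "n - 1"] by simp
qed

lemma chain_mapsI:
  assumes "\<And>n. f n \<in> lin_maps R (X$n) (Y$n)"
    "\<And>n x. x \<in> el X n ==> f (n + 1) (cdiff X n x) = cdiff Y n (f n x)"
  shows "f \<in> chain_maps R X Y"
  using assms by (auto simp: chain_maps_def)

lemma cmap_simps:
  assumes "X \<in> complexes R" "Y \<in> complexes R" "f \<in> chain_maps R X Y"
  shows "x \<in> el X n ==> f n x \<in> el Y n"
    "x \<in> el X n ==> y \<in> el X n ==> f n (x +[X$n] y) = f n x +[Y$n] f n y"
    "r \<in> carrier R ==> x \<in> el X n ==> f n (r *[X$n] x) = r *[Y$n] f n x"
    "f n 0[X$n] = 0[Y$n]"
    "x \<in> el X n ==> f n (-[X$n] x) = -[Y$n] f n x"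
    "x \<in> el X n ==> y \<in> el X n ==> f n (x -[X$n] y) = f n x -[Y$n] f n y"
  by (rule lin_simps[OF cpxD(1)[OF assms(1)] cpxD(1)[OF assms(2)] chain_mapsD(1)[OF assms(3)]]; assumption)+

lemma chain_maps_id: "X \<in> complexes R ==> cmap_id \<in> chain_maps R X X"
  by (auto simp: chain_maps_def cmap_id_def lin_maps_id)

lemma chain_maps_comp:
  assumes "f \<in> chain_maps R X Y" "g \<in> chain_maps R Y Z"
  shows "g \<circ>\<^sub>c f \<in> chain_maps R X Z"
proof (rule chain_mapsI)
  fix n show "(g \<circ>\<^sub>c f) n \<in> lin_maps R (X$n) (Z$n)"
    unfolding cmap_comp_def by (rule lin_maps_comp[OF chain_mapsD(1)[OF assms(1)] chain_mapsD(1)[OF assms(2)]])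
  fix x assume x: "x \<in> el X n"
  then have "f n x \<in> el Y n" using chain_mapsD(1)[OF assms(1), of n] by (auto simp: lin_maps_def)
  then show "(g \<circ>\<^sub>c f) (n + 1) (cdiff X n x) = cdiff Z n ((g \<circ>\<^sub>c f) n x)"
    using x chain_mapsD(2)[OF assms(1)] chain_mapsD(2)[OF assms(2)] by (simp add: cmap_comp_def)
qed

lemma cmap_comp_assoc: "(h \<circ>\<^sub>c g) \<circ>\<^sub>c f = h \<circ>\<^sub>c (g \<circ>\<^sub>c f)"
  by (simp add: cmap_comp_def)

lemma cmap_comp_id [simp]: "f \<circ>\<^sub>c cmap_id = f" "cmap_id \<circ>\<^sub>c f = f"
  by (simp_all add: cmap_comp_def cmap_id_def)

definition zmap :: "('a, 'm) cpx \<Rightarrow> 'm cmap" where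
  "zmap Y = (\<lambda>n x. 0[Y$n])"

lemma chain_maps_zero: "X \<in> complexes R ==> Y \<in> complexes R ==> zmap Y \<in> chain_maps R X Y"
  unfolding zmap_def
  by (rule chain_mapsI) (auto intro!: lin_maps_zero simp: cpxD(1) cpx_simps(4))

lemma chain_maps_diff:
  assumes X: "X \<in> complexes R" and Y: "Y \<in> complexes R"
    and f: "f \<in> chain_maps R X Y" and g: "g \<in> chain_maps R X Y"
  shows "(\<lambda>n x. f n x -[Y$n] g n x) \<in> chain_maps R X Y"
proof (rule chain_mapsI)
  fix n show "(\<lambda>x. f n x -[Y$n] g n x) \<in> lin_maps R (X$n) (Y$n)"
    by (intro lin_maps_diff cpxD(1) X Y chain_mapsD(1)[OF f] chain_mapsD(1)[OF g])
  fix x assume "x \<in> el X n"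
  then show "f (n + 1) (cdiff X n x) -[Y$(n + 1)] g (n + 1) (cdiff X n x) = cdiff Y n (f n x -[Y$n] g n x)"
    by (simp add: chain_mapsD(2)[OF f] chain_mapsD(2)[OF g] cpx_simps[OF Y] cmap_simps[OF X Y f] cmap_simps[OF X Y g])
qed

subsection \<open>Homotopies\<close>

lemma htD:
  assumes "homotopic_maps R X Y f g"
  shows "f \<in> chain_maps R X Y" "g \<in> chain_maps R X Y"
  using assms by (auto simp: homotopic_maps_def)

lemma htE:
  assumes Y: "Y \<in> complexes R" and X: "X \<in> complexes R" and H: "homotopic_maps R X Y f g"
  obtains h where "\<And>n. h n \<in> lin_maps R (X$n) (Y$(n - 1))"
    "\<And>n x. x \<in> el X n ==>
       f n x = g n x +[Y$n] (cdiff Y (n - 1) (h n x) +[Y$n] h (n + 1) (cdiff X n x))"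
proof -
  obtain h where h: "\<And>n. h n \<in> lin_maps R (X$n) (Y$(n - 1))"
    "\<And>n x. x \<in> el X n ==>
       f n x -[Y$n] g n x = cdiff Y (n - 1) (h n x) +[Y$n] h (n + 1) (cdiff X n x)"
    using H unfolding homotopic_maps_def by blast
  show ?thesis
  proof (rule that[OF h(1)])
    fix n x assume x: "x \<in> el X n"
    interpret Yn: module R "Y$n" by (rule cpxD(1)[OF Y])
    have "f n x \<in> el Y n" "g n x \<in> el Y n"
      using cmap_simps(1)[OF X Y _ x] htD[OF H] by auto
    then have "f n x = g n x +[Y$n] (f n x -[Y$n] g n x)" by algebra
    then show "f n x = g n x +[Y$n] (cdiff Y (n - 1) (h n x) +[Y$n] h (n + 1) (cdiff X n x))"
      using h(2)[OF x] by simp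
  qed
qed

lemma htI:
  assumes Y: "Y \<in> complexes R" and X: "X \<in> complexes R" and fg: "f \<in> chain_maps R X Y" "g \<in> chain_maps R X Y"
    and h: "\<And>n. h n \<in> lin_maps R (X$n) (Y$(n - 1))"
    "\<And>n x. x \<in> el X n ==>
       f n x = g n x +[Y$n] (cdiff Y (n - 1) (h n x) +[Y$n] h (n + 1) (cdiff X n x))"
  shows "homotopic_maps R X Y f g"
proof -
  have "f n x -[Y$n] g n x = cdiff Y (n - 1) (h n x) +[Y$n] h (n + 1) (cdiff X n x)"
    if x: "x \<in> el X n" for n x
  proof -
    interpret Yn: module R "Y$n" by (rule cpxD(1)[OF Y])
    have "cdiff Y (n - 1) (h n x) \<in> el Y n"
      using x cpx_simps(7)[OF Y] lin_simps(1)[OF cpxD(1)[OF X] cpxD(1)[OF Y] h(1)] by auto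
    moreover have "h (n + 1) (cdiff X n x) \<in> el Y n"
      using lin_simps(1)[OF cpxD(1)[OF X] cpxD(1)[OF Y] h(1) cpx_simps(1)[OF X x]] by simp
    moreover have "g n x \<in> el Y n" using cmap_simps(1)[OF X Y fg(2) x] .
    ultimately show ?thesis unfolding h(2)[OF x] by algebra
  qed
  then show ?thesis using assms unfolding homotopic_maps_def by blast
qed

text \<open>Chain maps are total functions of which only the values on carriers matter; agreement
  there is absorbed by the zero homotopy.\<close>

lemma ht_eqI:
  assumes Y: "Y \<in> complexes R" and X: "X \<in> complexes R" and f: "f \<in> chain_maps R X Y"
    and e: "\<And>n x. x \<in> el X n ==> g n x = f n x"
  shows "homotopic_maps R X Y f g"
proof (rule htI[OF Y X f])
  show "g \<in> chain_maps R X Y"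
  proof (rule chain_mapsI)
    fix n show "g n \<in> lin_maps R (X$n) (Y$n)"
    proof (rule lin_mapsI)
      interpret Xn: module R "X$n" by (rule cpxD(1)[OF X])
      fix x y r assume "x \<in> el X n"
      then show "g n x \<in> el Y n" "y \<in> el X n ==> g n (x +[X$n] y) = g n x +[Y$n] g n y"
        "r \<in> carrier R ==> g n (r *[X$n] x) = r *[Y$n] g n x"
        by (simp_all add: e cmap_simps[OF X Y f])
    qed
    fix x assume "x \<in> el X n"
    then show "g (n + 1) (cdiff X n x) = cdiff Y n (g n x)"
      by (simp add: e cpx_simps[OF X] chain_mapsD(2)[OF f])
  qed
  show "(\<lambda>x. 0[Y$(n - 1)]) \<in> lin_maps R (X$n) (Y$(n - 1))" for n
    by (rule lin_maps_zero[OF cpxD(1)[OF X] cpxD(1)[OF Y]])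
  fix n x assume x: "x \<in> el X n"
  interpret Yn: module R "Y$n" by (rule cpxD(1)[OF Y])
  show "f n x = g n x +[Y$n] (cdiff Y (n - 1) 0[Y$(n - 1)] +[Y$n] 0[Y$(n + 1 - 1)])"
    using x by (simp add: e cpx_simps[OF Y] cmap_simps[OF X Y f])
qed

lemma ht_refl:
  assumes "Y \<in> complexes R" "X \<in> complexes R" "f \<in> chain_maps R X Y"
  shows "homotopic_maps R X Y f f"
  by (rule ht_eqI[OF assms]) simp

lemma ht_sym:
  assumes Y: "Y \<in> complexes R" and X: "X \<in> complexes R" and H: "homotopic_maps R X Y f g"
  shows "homotopic_maps R X Y g f"
proof -
  obtain h where h: "\<And>n. h n \<in> lin_maps R (X$n) (Y$(n - 1))"
    "\<And>n x. x \<in> el X n ==>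
       f n x = g n x +[Y$n] (cdiff Y (n - 1) (h n x) +[Y$n] h (n + 1) (cdiff X n x))"
    by (rule htE[OF Y X H]) (rule that, blast, blast)
  note hc = lin_simps(1)[OF cpxD(1)[OF X] cpxD(1)[OF Y] h(1)]
  show ?thesis
  proof (rule htI[OF Y X htD(2,1)[OF H]])
    fix n show "(\<lambda>x. -[Y$(n - 1)] h n x) \<in> lin_maps R (X$n) (Y$(n - 1))"
      by (rule lin_maps_neg[OF cpxD(1)[OF X] cpxD(1)[OF Y] h(1)])
    fix x assume x: "x \<in> el X n"
    interpret Yn: module R "Y$n" by (rule cpxD(1)[OF Y])
    have c: "cdiff Y (n - 1) (h n x) \<in> el Y n" "h (n + 1) (cdiff X n x) \<in> el Y n"
       "g n x \<in> el Y n"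
      using x hc[of x n] hc[of "cdiff X n x" "n + 1"] cmap_simps(1)[OF X Y htD(2)[OF H] x]
      by (simp_all add: cpx_simps[OF X] cpx_simps[OF Y])
    show "g n x = f n x +[Y$n] (cdiff Y (n - 1) (-[Y$(n - 1)] h n x) +[Y$n]
        -[Y$(n + 1 - 1)] h (n + 1) (cdiff X n x))"
      unfolding h(2)[OF x] cpx_simps(11)[OF Y hc[OF x]] add_diff_cancel using c by algebra
  qed
qed

lemma ht_trans:
  assumes Y: "Y \<in> complexes R" and X: "X \<in> complexes R"
    and H: "homotopic_maps R X Y f g" and H': "homotopic_maps R X Y g k"
  shows "homotopic_maps R X Y f k"
proof -
  obtain h where h: "\<And>n. h n \<in> lin_maps R (X$n) (Y$(n - 1))"
    "\<And>n x. x \<in> el X n ==>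
       f n x = g n x +[Y$n] (cdiff Y (n - 1) (h n x) +[Y$n] h (n + 1) (cdiff X n x))"
    by (rule htE[OF Y X H]) (rule that, blast, blast)
  obtain h' where h': "\<And>n. h' n \<in> lin_maps R (X$n) (Y$(n - 1))"
    "\<And>n x. x \<in> el X n ==>
       g n x = k n x +[Y$n] (cdiff Y (n - 1) (h' n x) +[Y$n] h' (n + 1) (cdiff X n x))"
    by (rule htE[OF Y X H']) (rule that, blast, blast)
  note hc = lin_simps(1)[OF cpxD(1)[OF X] cpxD(1)[OF Y] h(1)]
    and hc' = lin_simps(1)[OF cpxD(1)[OF X] cpxD(1)[OF Y] h'(1)]
  show ?thesis
  proof (rule htI[OF Y X htD(1)[OF H] htD(2)[OF H']])
    fix n show "(\<lambda>x. h n x +[Y$(n - 1)] h' n x) \<in> lin_maps R (X$n) (Y$(n - 1))"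
      by (rule lin_maps_add[OF cpxD(1)[OF X] cpxD(1)[OF Y] h(1) h'(1)])
    fix x assume x: "x \<in> el X n"
    interpret Yn: module R "Y$n" by (rule cpxD(1)[OF Y])
    have c: "cdiff Y (n - 1) (h n x) \<in> el Y n" "h (n + 1) (cdiff X n x) \<in> el Y n"
        "cdiff Y (n - 1) (h' n x) \<in> el Y n" "h' (n + 1) (cdiff X n x) \<in> el Y n"
        "k n x \<in> el Y n"
      using x hc[of x n] hc[of "cdiff X n x" "n + 1"] hc'[of x n] hc'[of "cdiff X n x" "n + 1"]
        cmap_simps(1)[OF X Y htD(2)[OF H'] x]
      by (simp_all add: cpx_simps[OF X] cpx_simps[OF Y])
    show "f n x = k n x +[Y$n] (cdiff Y (n - 1) (h n x +[Y$(n - 1)] h' n x) +[Y$n]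
        (h (n + 1) (cdiff X n x) +[Y$(n + 1 - 1)] h' (n + 1) (cdiff X n x)))"
      unfolding h(2)[OF x] h'(2)[OF x] cpx_simps(8)[OF Y hc[OF x] hc'[OF x]] add_diff_cancel
      using c by algebra
  qed
qed

lemma ht_comp_left:
  assumes X: "X \<in> complexes R" and Y: "Y \<in> complexes R" and Z: "Z \<in> complexes R"
    and H: "homotopic_maps R X Y f g" and k: "k \<in> chain_maps R Y Z"
  shows "homotopic_maps R X Z (k \<circ>\<^sub>c f) (k \<circ>\<^sub>c g)"
proof -
  obtain h where h: "\<And>n. h n \<in> lin_maps R (X$n) (Y$(n - 1))"
    "\<And>n x. x \<in> el X n ==>
       f n x = g n x +[Y$n] (cdiff Y (n - 1) (h n x) +[Y$n] h (n + 1) (cdiff X n x))"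
    by (rule htE[OF Y X H]) (rule that, blast, blast)
  note hc = lin_simps(1)[OF cpxD(1)[OF X] cpxD(1)[OF Y] h(1)]
  show ?thesis
  proof (rule htI[OF Z X chain_maps_comp[OF htD(1)[OF H] k] chain_maps_comp[OF htD(2)[OF H] k]])
    fix n show "(\<lambda>x. k (n - 1) (h n x)) \<in> lin_maps R (X$n) (Z$(n - 1))"
      by (rule lin_maps_comp[OF h(1) chain_mapsD(1)[OF k]])
    fix x assume x: "x \<in> el X n"
    interpret Yn: module R "Y$n" by (rule cpxD(1)[OF Y])
    have c: "cdiff Y (n - 1) (h n x) \<in> el Y n" "h (n + 1) (cdiff X n x) \<in> el Y n"
       "g n x \<in> el Y n"
      using x hc[of x n] hc[of "cdiff X n x" "n + 1"] cmap_simps(1)[OF X Y htD(2)[OF H] x]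
      by (simp_all add: cpx_simps[OF X] cpx_simps[OF Y])
    show "(k \<circ>\<^sub>c f) n x = (k \<circ>\<^sub>c g) n x +[Z$n] (cdiff Z (n - 1) (k (n - 1) (h n x)) +[Z$n]
       k (n + 1 - 1) (h (n + 1) (cdiff X n x)))"
      using c chain_mapsD(3)[OF k hc[OF x]] by (simp add: cmap_comp_def h(2)[OF x] cmap_simps[OF Y Z k])
  qed
qed

lemma ht_comp_right:
  assumes X: "X \<in> complexes R" and Y: "Y \<in> complexes R" and Z: "Z \<in> complexes R"
    and H: "homotopic_maps R Y Z f g" and k: "k \<in> chain_maps R X Y"
  shows "homotopic_maps R X Z (f \<circ>\<^sub>c k) (g \<circ>\<^sub>c k)"
proof -
  obtain h where h: "\<And>n. h n \<in> lin_maps R (Y$n) (Z$(n - 1))"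
    "\<And>n x. x \<in> el Y n ==>
       f n x = g n x +[Z$n] (cdiff Z (n - 1) (h n x) +[Z$n] h (n + 1) (cdiff Y n x))"
    by (rule htE[OF Z Y H]) (rule that, blast, blast)
  show ?thesis
  proof (rule htI[OF Z X chain_maps_comp[OF k htD(1)[OF H]] chain_maps_comp[OF k htD(2)[OF H]]])
    fix n show "(\<lambda>x. h n (k n x)) \<in> lin_maps R (X$n) (Z$(n - 1))"
      by (rule lin_maps_comp[OF chain_mapsD(1)[OF k] h(1)])
    fix x assume x: "x \<in> el X n"
    show "(f \<circ>\<^sub>c k) n x = (g \<circ>\<^sub>c k) n x +[Z$n] (cdiff Z (n - 1) (h n (k n x)) +[Z$n]
       h (n + 1) (k (n + 1) (cdiff X n x)))"
      using h(2)[OF cmap_simps(1)[OF X Y k x]] x by (simp add: cmap_comp_def chain_mapsD(2)[OF k])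
  qed
qed

text \<open>Vanishing of the morphisms from \<open>X\<close> to \<open>Y\<close> in the homotopy
  category. For a bounded complex \<open>X\<close> of finitely generated projectives this amounts to
  vanishing in the derived category.\<close>

definition null_maps :: "('a, 'r) ring_scheme \<Rightarrow> ('a, 'm) cpx \<Rightarrow> ('a, 'm) cpx \<Rightarrow> bool" where
  "null_maps R X Y \<longleftrightarrow> (\<forall>f\<in>chain_maps R X Y. homotopic_maps R X Y f (zmap Y))"

lemma nullE:
  assumes Y: "Y \<in> complexes R" and X: "X \<in> complexes R" and H: "homotopic_maps R X Y f (zmap Y)"
  obtains h where "\<And>n. h n \<in> lin_maps R (X$n) (Y$(n - 1))"
    "\<And>n x. x \<in> el X n ==>
       f n x = cdiff Y (n - 1) (h n x) +[Y$n] h (n + 1) (cdiff X n x)"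
proof -
  obtain h where h: "\<And>n. h n \<in> lin_maps R (X$n) (Y$(n - 1))"
    "\<And>n x. x \<in> el X n ==>
       f n x = zmap Y n x +[Y$n] (cdiff Y (n - 1) (h n x) +[Y$n] h (n + 1) (cdiff X n x))"
    by (rule htE[OF Y X H]) (rule that, blast, blast)
  note hc = lin_simps(1)[OF cpxD(1)[OF X] cpxD(1)[OF Y] h(1)]
  show ?thesis
  proof (rule that[OF h(1)])
    fix n x assume x: "x \<in> el X n"
    interpret Yn: module R "Y$n" by (rule cpxD(1)[OF Y])
    show "f n x = cdiff Y (n - 1) (h n x) +[Y$n] h (n + 1) (cdiff X n x)"
      using h(2)[OF x] x hc[of x n] hc[of "cdiff X n x" "n + 1"]
      by (simp add: zmap_def cpx_simps[OF X] cpx_simps[OF Y])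
  qed
qed

lemma nullI:
  assumes Y: "Y \<in> complexes R" and X: "X \<in> complexes R" and f: "f \<in> chain_maps R X Y"
    and h: "\<And>n. h n \<in> lin_maps R (X$n) (Y$(n - 1))"
    "\<And>n x. x \<in> el X n ==>
       f n x = cdiff Y (n - 1) (h n x) +[Y$n] h (n + 1) (cdiff X n x)"
  shows "homotopic_maps R X Y f (zmap Y)"
proof (rule htI[OF Y X f chain_maps_zero[OF X Y] h(1)])
  note hc = lin_simps(1)[OF cpxD(1)[OF X] cpxD(1)[OF Y] h(1)]
  fix n x assume x: "x \<in> el X n"
  interpret Yn: module R "Y$n" by (rule cpxD(1)[OF Y])
  show "f n x = zmap Y n x +[Y$n] (cdiff Y (n - 1) (h n x) +[Y$n] h (n + 1) (cdiff X n x))"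
    using x hc[of x n] hc[of "cdiff X n x" "n + 1"]
    by (simp add: h(2)[OF x] zmap_def cpx_simps[OF X] cpx_simps[OF Y])
qed

subsection \<open>Cocycles, coboundaries and exactness after localisation\<close>

lemma mem_cocycles: "z \<in> cyc X n \<longleftrightarrow> z \<in> el X n \<and> cdiff X n z = 0[X$(n + 1)]"
  by (simp add: cocycles_def a_kernel_def')

lemma mem_coboundaries: "z \<in> bd X n \<longleftrightarrow> (\<exists>y\<in>el X (n - 1). z = cdiff X (n - 1) y)"
  by (auto simp: coboundaries_def)

lemma coboundaries_submodule:
  assumes X: "X \<in> complexes R" shows "submodule (bd X n) R (X$n)"
proof -
  interpret A: module R "X$(n - 1)" by (rule cpxD(1)[OF X])
  interpret M: module R "X$n" by (rule cpxD(1)[OF X])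
  show ?thesis
  proof (rule M.submoduleI')
    show "bd X n \<subseteq> el X n" by (auto simp: coboundaries_def cpx_simps[OF X])
    show "0[X$n] \<in> bd X n"
      unfolding mem_coboundaries by (intro bexI[of _ "0[X$(n - 1)]"]) (simp_all add: cpx_simps[OF X])
  next
    fix a b assume "a \<in> bd X n" "b \<in> bd X n"
    then obtain x y where "x \<in> el X (n - 1)" "y \<in> el X (n - 1)" "a = cdiff X (n - 1) x" "b = cdiff X (n - 1) y"
      unfolding mem_coboundaries by auto
    then show "a +[X$n] b \<in> bd X n" unfolding mem_coboundaries
      by (intro bexI[of _ "x +[X$(n - 1)] y"]) (simp_all add: cpx_simps[OF X])
  next
    fix r a assume r: "r \<in> carrier R" and "a \<in> bd X n"
    then obtain x where "x \<in> el X (n - 1)" "a = cdiff X (n - 1) x"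
      unfolding mem_coboundaries by auto
    then show "r *[X$n] a \<in> bd X n" unfolding mem_coboundaries using r
      by (intro bexI[of _ "r *[X$(n - 1)] x"]) (simp_all add: cpx_simps[OF X])
  qed
qed

lemma cocycles_submodule:
  assumes X: "X \<in> complexes R" shows "submodule (cyc X n) R (X$n)"
proof -
  interpret A: module R "X$(n + 1)" by (rule cpxD(1)[OF X])
  interpret M: module R "X$n" by (rule cpxD(1)[OF X])
  show ?thesis
    by (rule M.submoduleI') (auto simp: mem_cocycles cpx_simps[OF X])
qed

lemma coboundaries_subset_cocycles:
  assumes X: "X \<in> complexes R" shows "bd X n \<subseteq> cyc X n"
  by (auto simp: mem_cocycles mem_coboundaries cpx_simps[OF X] cpxD[OF X])

text \<open>Exactness in degree \<open>n\<close> after localisation at \<open>S\<close>: over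
  \<open>R\<close> itself for \<open>S = {\<one>}\<close>, and at a prime when \<open>S\<close> is
  its complement.\<close>

definition exact_at :: "('a, 'r) ring_scheme \<Rightarrow> 'a set \<Rightarrow> ('a, 'm) cpx \<Rightarrow> int \<Rightarrow> bool" where
  "exact_at R S X n \<longleftrightarrow> cyc X n \<subseteq> sat R S (X$n) (bd X n)"

lemma exact_atD:
  assumes "exact_at R S X n" "z \<in> el X n" "cdiff X n z = 0[X$(n + 1)]"
  obtains t y where "t \<in> S" "y \<in> el X (n - 1)" "cdiff X (n - 1) y = t *[X$n] z"
proof -
  have "z \<in> sat R S (X$n) (bd X n)" using assms by (auto simp: exact_at_def mem_cocycles)
  then show ?thesis using that by (auto simp: sat_def mem_coboundaries)
qed

lemma exact_at_mono: "exact_at R S X n ==> S \<subseteq> T ==> exact_at R T X n"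
  unfolding exact_at_def by (rule subset_trans[OF _ sat_mono_S])

lemma exact_at_zero:
  assumes X: "X \<in> complexes R" and S: "msys R S" and z: "el X n = {0[X$n]}"
  shows "exact_at R S X n"
proof -
  interpret M: module R "X$n" by (rule cpxD(1)[OF X])
  have "bd X n \<subseteq> el X n"
    using M.submoduleD(1)[OF coboundaries_submodule[OF X]] by auto
  then have "bd X n \<subseteq> sat R S (X$n) (bd X n)"
    by (rule M.subset_sat[OF S])
  moreover have "cyc X n \<subseteq> bd X n"
    using z M.submoduleD(2)[OF coboundaries_submodule[OF X, of n]] by (auto simp: mem_cocycles)
  ultimately show ?thesis unfolding exact_at_def by blast
qed

text \<open>Downward induction from \<open>b\<close>, as in the comparison theorem: the defect of
  the homotopy found so far is a cocycle of \<open>E\<close>, bounds at \<open>S\<close> by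
  exactness, and is lifted through the differential since \<open>P\<close> is projective. Each
  degree contributes a denominator; there are finitely many, so \<open>t\<close> is one element of
  \<open>S\<close>. With the identity as \<open>f\<close> this contracts an exact tail.\<close>

lemma descend_homotopy:
  assumes S: "msys R S" and P: "P \<in> complexes R" "\<And>n. fgp R (P$n)" and E: "E \<in> complexes R"
    and f: "f \<in> chain_maps R P E"
    and top: "\<And>n. n > b ==> el P n = {0[P$n]}"
    and ex: "\<And>k. m \<le> k ==> k < b ==> exact_at R S E k"
    and exb: "\<And>x. m \<le> b ==> x \<in> el P b ==> f b x \<in> sat R S (E$b) (bd E b)"
  shows "\<exists>t\<in>S. \<exists>h. (\<forall>n. h n \<in> lin_maps R (P$n) (E$(n - 1))) \<and>
    (\<forall>n\<ge>m. \<forall>x\<in>el P n. t *[E$n] f n x =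
       cdiff E (n - 1) (h n x) +[E$n] h (n + 1) (cdiff P n x))"
    (is "?Q m")
proof -
  note SD = msysD[OF S] and fs = cmap_simps[OF P(1) E f] and dE = cpx_simps[OF E] and dP = cpx_simps[OF P(1)]
  have triv: "?Q i" if "i > b" for i
  proof (intro bexI[of _ "\<one>\<^bsub>R\<^esub>"] exI[of _ "\<lambda>n. \<lambda>x. 0[E$(n - 1)]"] conjI allI impI ballI)
    show "(\<lambda>x. 0[E$(n - 1)]) \<in> lin_maps R (P$n) (E$(n - 1))" for n
      by (rule lin_maps_zero[OF cpxD(1)[OF P(1)] cpxD(1)[OF E]])
    fix n x assume "i \<le> n" and x: "x \<in> el P n"
    then have "x = 0[P$n]" using top[of n] that by auto
    interpret M: module R "E$n" by (rule cpxD(1)[OF E])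
    show "\<one>\<^bsub>R\<^esub> *[E$n] f n x = cdiff E (n - 1) 0[E$(n - 1)] +[E$n] 0[E$(n + 1 - 1)]"
      using \<open>x = _\<close> by (simp add: fs dE)
  qed (rule SD)
  have "m \<le> i \<longrightarrow> ?Q i" if "i \<le> b + 1" for i
    using that
  proof (induction i rule: int_le_induct)
    case base then show ?case using triv[of "b + 1"] by simp
  next
    case (step i)
    show ?case
    proof
      assume mi: "m \<le> i - 1"
      define n where "n = i - 1"
      have n: "m \<le> n" "n \<le> b" "i = n + 1" using mi step by (auto simp: n_def)
      have Qn: "?Q (n + 1)" using step.IH mi n(3) by simp
      obtain t h where t: "t \<in> S" and h: "\<And>n. h n \<in> lin_maps R (P$n) (E$(n - 1))"
        and th: "\<And>k x. n + 1 \<le> k ==> x \<in> el P k ==> t *[E$k] f k x =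
           cdiff E (k - 1) (h k x) +[E$k] h (k + 1) (cdiff P k x)"
        using Qn by blast
      note hs = lin_simps[OF cpxD(1)[OF P(1)] cpxD(1)[OF E] h]
      have h1: "h (n + 1) \<in> lin_maps R (P$(n + 1)) (E$n)" using h[of "n + 1"] by simp
      note h1s = lin_simps[OF cpxD(1)[OF P(1)] cpxD(1)[OF E] h1]
      interpret E0: module R "E$n" by (rule cpxD(1)[OF E])
      interpret E1: module R "E$(n + 1)" by (rule cpxD(1)[OF E])
      interpret P1: module R "P$(n + 1)" by (rule cpxD(1)[OF P(1)])
      have tc: "t \<in> carrier R" using t SD by auto
      \<comment> \<open>The defect that the homotopy in degree \<open>n\<close> has to
        bound.\<close>
      define g where "g x = t *[E$n] f n x -[E$n] h (n + 1) (cdiff P n x)" for x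
      have g: "g \<in> lin_maps R (P$n) (E$n)" unfolding g_def
        by (intro lin_maps_diff lin_maps_smult tc cpxD(1)[OF P(1)] cpxD(1)[OF E] chain_mapsD(1)[OF f]
             lin_maps_comp[OF cpxD(2)[OF P(1)] h1])
      have gsat: "g x \<in> sat R S (E$n) (bd E n)" if x: "x \<in> el P n" for x
      proof (cases "n = b")
        case True
        have "cdiff P n x = 0[P$(n + 1)]" using top[of "n + 1"] True dP(1)[OF x] by auto
        then have "g x = t *[E$n] f n x" unfolding g_def using x tc by (simp add: h1s fs a_minus_def)
        moreover have "f n x \<in> sat R S (E$n) (bd E n)" using exb x n True by auto
        ultimately show ?thesis using E0.submoduleD(5)[OF E0.sat_submodule[OF S coboundaries_submodule[OF E]] tc] by simp
      next
        case False
        have dx: "cdiff P n x \<in> el P (n + 1)" using dP(1)[OF x] .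
        have c: "h (n + 1) (cdiff P n x) \<in> el E n" "f n x \<in> el E n" "g x \<in> el E n"
          using dx h1s x fs lin_simps(1)[OF cpxD(1)[OF P(1)] cpxD(1)[OF E] g] by auto
        have "t *[E$(n + 1)] f (n + 1) (cdiff P n x) =
           cdiff E n (h (n + 1) (cdiff P n x)) +[E$(n + 1)] h (n + 2) 0[P$(n + 2)]"
          using th[OF order_refl dx] cpxD(4)[OF P(1) x] by (simp add: add.assoc)
        then have "t *[E$(n + 1)] cdiff E n (f n x) = cdiff E n (h (n + 1) (cdiff P n x))"
          using hs(4)[of "n + 2", simplified, unfolded add.commute[of 1 n]] chain_mapsD(2)[OF f x] c dE(1)[OF c(1)] by (simp add: add.assoc)
        then have "cdiff E n (g x) = 0[E$(n + 1)]"
          unfolding g_def using c dE(1)[OF c(1)] tc by (simp add: dE E1.r_neg a_minus_def)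
        then have "g x \<in> cyc E n" using c by (simp add: mem_cocycles)
        then show ?thesis using ex[of n] n False unfolding exact_at_def by auto
      qed
      obtain u \<sigma> where u: "u \<in> S" and \<sigma>: "\<sigma> \<in> lin_maps R (P$n) (E$(n - 1))"
        and us: "\<And>x. x \<in> el P n ==> cdiff E (n - 1) (\<sigma> x) = u *[E$n] g x"
        using gsat unfolding coboundaries_def
        by (rule fgp_lift[OF S P(2) cpxD(1)[OF E] cpxD(1)[OF E] g cpxD(3)[OF E]]) (assumption, rule that, assumption, assumption, blast)
      have uc: "u \<in> carrier R" using u SD by auto
      define h' where "h' k = (if k = n then \<sigma> else (\<lambda>x. u *[E$(k - 1)] h k x))" for k
      have "?Q n"
      proof (intro bexI[of _ "u \<otimes>\<^bsub>R\<^esub> t"] exI[of _ h'] conjI allI impI ballI)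
        show "h' k \<in> lin_maps R (P$k) (E$(k - 1))" for k
          unfolding h'_def using \<sigma> by (auto intro!: lin_maps_smult cpxD(1)[OF P(1)] cpxD(1)[OF E] h uc)
        show "u \<otimes>\<^bsub>R\<^esub> t \<in> S" using SD u t by auto
        fix k x assume k: "n \<le> k" and x: "x \<in> el P k"
        interpret Ek: module R "E$k" by (rule cpxD(1)[OF E])
        have dx: "cdiff P k x \<in> el P (k + 1)" using dP(1)[OF x] .
        have c: "h (k + 1) (cdiff P k x) \<in> el E k" "f k x \<in> el E k" "cdiff E (k - 1) (h k x) \<in> el E k"
          using hs(1)[OF dx] fs(1)[OF x] dE(7)[OF hs(1)[OF x]] by auto
        have e: "(u \<otimes>\<^bsub>R\<^esub> t) *[E$k] f k x = u *[E$k] (t *[E$k] f k x)"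
          using c uc tc by (simp add: Ek.smult_assoc1)
        show "(u \<otimes>\<^bsub>R\<^esub> t) *[E$k] f k x = cdiff E (k - 1) (h' k x) +[E$k] h' (k + 1) (cdiff P k x)"
        proof (cases "k = n")
          case True
          have "u *[E$k] (t *[E$k] f k x) = u *[E$k] g x +[E$k] u *[E$k] h (k + 1) (cdiff P k x)"
            unfolding g_def True using c[unfolded True] uc tc by algebra
          then show ?thesis using e x us[of x] True by (simp add: h'_def)
        next
          case False
          then show ?thesis unfolding e using th[of k x] k x c uc hs(1)[OF x]
            by (simp add: h'_def Ek.smult_r_distr dE)
        qed
      qed
      then show "?Q (i - 1)" by (simp add: n_def)
    qed
  qed
  then show ?thesis using triv[of m] by (cases "m \<le> b") auto
qed

text \<open>The same descent for a chain map given in degrees at least \<open>s\<close>: composition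
  with the differential of \<open>P\<close> produces cocycles, which bound at \<open>S\<close> and
  can be lifted. It ends at the lower bound \<open>a\<close> of \<open>P\<close>.\<close>

lemma extend_chain_map:
  assumes S: "msys R S" and P: "P \<in> complexes R" "\<And>n. fgp R (P$n)" and M: "M \<in> complexes R"
    and bot: "\<And>n. n < a ==> el P n = {0[P$n]}"
    and f: "\<And>k. k \<ge> s ==> f k \<in> lin_maps R (P$k) (M$k)"
      "\<And>k x. k \<ge> s ==> x \<in> el P k ==> f (k + 1) (cdiff P k x) = cdiff M k (f k x)"
    and fs: "\<And>x. x \<in> el P (s - 1) ==> f s (cdiff P (s - 1) x) \<in> sat R S (M$s) (bd M s)"
    and ex: "\<And>k. k < s ==> exact_at R S M k"
  shows "\<exists>t\<in>S. \<exists>f'\<in>chain_maps R P M. \<forall>k\<ge>s. \<forall>x\<in>el P k. f' k x = t *[M$k] f k x"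
proof -
  note SD = msysD[OF S] and dM = cpx_simps[OF M] and dP = cpx_simps[OF P(1)]
  note Pm = cpxD(1)[OF P(1)] and Mm = cpxD(1)[OF M]
  define Q where "Q i = (\<exists>t\<in>S. \<exists>f'. (\<forall>k\<ge>i. f' k \<in> lin_maps R (P$k) (M$k)) \<and>
    (\<forall>k\<ge>i. \<forall>x\<in>el P k. f' (k + 1) (cdiff P k x) = cdiff M k (f' k x)) \<and>
    (\<forall>k\<ge>s. \<forall>x\<in>el P k. f' k x = t *[M$k] f k x) \<and>
    (\<forall>x\<in>el P (i - 1). f' i (cdiff P (i - 1) x) \<in> sat R S (M$i) (bd M i)))" for i
  have "Q i" if "i \<le> s" for i
    using that
  proof (induction i rule: int_le_induct)
    case base
    show ?case unfolding Q_def
    proof (intro bexI[of _ "\<one>\<^bsub>R\<^esub>"] exI[of _ f] conjI allI impI ballI)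
      fix k x assume "s \<le> k" "x \<in> el P k"
      interpret K: module R "M$k" by (rule Mm)
      show "f k x = \<one>\<^bsub>R\<^esub> *[M$k] f k x"
        using lin_simps(1)[OF Pm Mm f(1)[OF \<open>s \<le> k\<close>] \<open>x \<in> _\<close>] by simp
    qed (use f fs SD in auto)
  next
    case (step i)
    obtain t f' where t: "t \<in> S" and f': "\<And>k. k \<ge> i ==> f' k \<in> lin_maps R (P$k) (M$k)"
      "\<And>k x. k \<ge> i ==> x \<in> el P k ==> f' (k + 1) (cdiff P k x) = cdiff M k (f' k x)"
      "\<And>k x. k \<ge> s ==> x \<in> el P k ==> f' k x = t *[M$k] f k x"
      "\<And>x. x \<in> el P (i - 1) ==> f' i (cdiff P (i - 1) x) \<in> sat R S (M$i) (bd M i)"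
      using step.IH unfolding Q_def by blast
    define n where "n = i - 1"
    have i: "i = n + 1" "n < s" using step by (auto simp: n_def)
    have tc: "t \<in> carrier R" using t SD by auto
    have fn: "f' (n + 1) \<in> lin_maps R (P$(n + 1)) (M$(n + 1))" using f'(1)[of "n + 1"] i by simp
    have gsat: "f' (n + 1) (cdiff P n x) \<in> sat R S (M$(n + 1)) (cdiff M n ` el M n)"
      if x: "x \<in> el P n" for x using f'(4) x unfolding i coboundaries_def by simp
    obtain u \<sigma> where u: "u \<in> S" and \<sigma>: "\<sigma> \<in> lin_maps R (P$n) (M$n)"
      and us: "\<And>x. x \<in> el P n ==> cdiff M n (\<sigma> x) = u *[M$(n + 1)] f' (n + 1) (cdiff P n x)"
      using gsat
      by (rule fgp_lift[OF S P(2) Mm Mm lin_maps_comp[OF cpxD(2)[OF P(1)] fn] cpxD(2)[OF M]]) (assumption, rule that, assumption, assumption, blast)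
    have uc: "u \<in> carrier R" using u SD by auto
    define f'' where "f'' k = (if k = n then \<sigma> else (\<lambda>x. u *[M$k] f' k x))" for k
    have "Q n" unfolding Q_def
    proof (intro bexI[of _ "u \<otimes>\<^bsub>R\<^esub> t"] exI[of _ f''] conjI allI impI ballI)
      show "u \<otimes>\<^bsub>R\<^esub> t \<in> S" using SD u t by auto
      fix k assume k: "n \<le> k"
      show "f'' k \<in> lin_maps R (P$k) (M$k)"
        unfolding f''_def using \<sigma> k by (auto intro!: lin_maps_smult Pm Mm f' uc simp: i)
      fix x assume x: "x \<in> el P k"
      show "f'' (k + 1) (cdiff P k x) = cdiff M k (f'' k x)"
      proof (cases "k = n")
        case True then show ?thesis using x by (simp add: f''_def us)
      next
        case False
        then have k: "k \<ge> i" using k by (simp add: i)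
        then show ?thesis using False k x dP(1)[OF x] uc lin_simps(1)[OF Pm Mm f'(1)[OF k] x]
          by (simp add: f''_def f'(2) dM i)
      qed
    next
      fix k x assume k: "s \<le> k" and x: "x \<in> el P k"
      interpret K: module R "M$k" by (rule Mm)
      show "f'' k x = (u \<otimes>\<^bsub>R\<^esub> t) *[M$k] f k x"
        using i k x uc tc lin_simps(1)[OF Pm Mm f(1)[OF k] x] by (simp add: f''_def f'(3) K.smult_assoc1)
    next
      fix x assume x: "x \<in> el P (n - 1)"
      have dx: "cdiff P (n - 1) x \<in> el P n" using dP(7)[OF x] .
      interpret K: module R "M$(n + 1)" by (rule Mm)
      have "cdiff M n (\<sigma> (cdiff P (n - 1) x)) = u *[M$(n + 1)] f' (n + 1) 0[P$(n + 1)]"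
        using us[OF dx] cpxD(5)[OF P(1) x] by simp
      also have "\<dots> = 0[M$(n + 1)]" using lin_simps(4)[OF Pm Mm fn] uc by simp
      finally have "\<sigma> (cdiff P (n - 1) x) \<in> cyc M n"
        using lin_simps(1)[OF Pm Mm \<sigma> dx] by (simp add: mem_cocycles)
      then show "f'' n (cdiff P (n - 1) x) \<in> sat R S (M$n) (bd M n)"
        using ex[OF i(2)] by (auto simp: f''_def exact_at_def)
    qed
    then show ?case by (simp add: n_def)
  qed
  \<comment> \<open>Below \<open>min a s\<close> the complex \<open>P\<close> vanishes and the map
    is continued by zero; the minimum covers the case \<open>s < a\<close>.\<close>
  then have "Q (min a s)" by simp
  then obtain t f' where t: "t \<in> S" and f': "\<And>k. k \<ge> min a s ==> f' k \<in> lin_maps R (P$k) (M$k)"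
      "\<And>k x. k \<ge> min a s ==> x \<in> el P k ==> f' (k + 1) (cdiff P k x) = cdiff M k (f' k x)"
      "\<And>k x. k \<ge> s ==> x \<in> el P k ==> f' k x = t *[M$k] f k x"
    unfolding Q_def by blast
  define F where "F k = (if k \<ge> min a s then f' k else (\<lambda>x. 0[M$k]))" for k
  have Fl: "F k \<in> lin_maps R (P$k) (M$k)" for k
    unfolding F_def using f'(1) by (auto intro!: lin_maps_zero Pm Mm)
  have "F \<in> chain_maps R P M"
  proof (rule chain_mapsI[OF Fl])
    fix k x assume x: "x \<in> el P k"
    show "F (k + 1) (cdiff P k x) = cdiff M k (F k x)"
    proof (cases "k \<ge> min a s")
      case True then show ?thesis using f'(2)[OF True x] by (simp add: F_def)
    next
      case False
      then have "x = 0[P$k]" using bot[of k] x by auto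
      then show ?thesis using False by (simp add: dP dM lin_simps(4)[OF Pm Mm Fl])
    qed
  qed
  moreover have "\<forall>k\<ge>s. \<forall>x\<in>el P k. F k x = t *[M$k] f k x"
    using f'(3) by (auto simp: F_def)
  ultimately show ?thesis using t by blast
qed

text \<open>Strictly perfect complexes, as opposed to the complexes isomorphic to one of them in the
  derived category.\<close>

definition perf_cpx :: "('a, 'r) ring_scheme \<Rightarrow> ('a, 'm) cpx \<Rightarrow> bool" where
  "perf_cpx R P \<longleftrightarrow> P \<in> complexes R \<and> bounded_cpx P \<and> (\<forall>n. fgp R (P$n))"

lemma perfD:
  assumes "perf_cpx R P"
  shows "P \<in> complexes R" "bounded_cpx P" "fgp R (P$n)"
  using assms by (auto simp: perf_cpx_def)

text \<open>Descent with \<open>S = {\<one>}\<close> from above the top of \<open>P\<close> down to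
  its bottom; below the bottom both sides of the homotopy equation vanish.\<close>

lemma null_maps_acyclic:
  assumes P: "perf_cpx R P" and R: "cring R" and E: "E \<in> complexes R" and ex: "\<And>n. exact_at R {\<one>\<^bsub>R\<^esub>} E n"
  shows "null_maps R P E"
  unfolding null_maps_def
proof
  fix f assume f: "f \<in> chain_maps R P E"
  interpret cring R by fact
  note PD = perfD[OF P]
  obtain a b where ab: "\<And>n. n < a \<or> b < n ==> el P n = {0[P$n]}"
    using PD(2) unfolding bounded_cpx_def by blast
  have "\<exists>t\<in>{\<one>\<^bsub>R\<^esub>}. \<exists>h. (\<forall>n. h n \<in> lin_maps R (P$n) (E$(n - 1))) \<and>
    (\<forall>n\<ge>a. \<forall>x\<in>el P n. t *[E$n] f n x =
       cdiff E (n - 1) (h n x) +[E$n] h (n + 1) (cdiff P n x))"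
  \<comment> \<open>In degree \<open>b + 1\<close> the complex \<open>P\<close> is already zero, so
    the condition on the top degree is trivially satisfied.\<close>
  proof (rule descend_homotopy[OF msys_one PD(1) PD(3) E f, where b = "b + 1"])
    fix x assume "x \<in> el P (b + 1)"
    then have "x = 0[P$(b + 1)]" using ab[of "b + 1"] by auto
    interpret M: module R "E$(b + 1)" by (rule cpxD(1)[OF E])
    show "f (b + 1) x \<in> sat R {\<one>\<^bsub>R\<^esub>} (E$(b + 1)) (bd E (b + 1))"
      using M.submoduleD(2)[OF M.sat_submodule[OF msys_one coboundaries_submodule[OF E]]]
      unfolding \<open>x = _\<close> cmap_simps(4)[OF PD(1) E f] .
  qed (use ab ex in auto)
  then obtain h where h: "\<And>n. h n \<in> lin_maps R (P$n) (E$(n - 1))"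
    "\<And>n x. n \<ge> a ==> x \<in> el P n ==> \<one>\<^bsub>R\<^esub> *[E$n] f n x =
       cdiff E (n - 1) (h n x) +[E$n] h (n + 1) (cdiff P n x)" by auto
  note hs = lin_simps[OF cpxD(1)[OF PD(1)] cpxD(1)[OF E] h(1)]
  show "homotopic_maps R P E f (zmap E)"
  proof (rule nullI[OF E PD(1) f h(1)])
    fix n x assume x: "x \<in> el P n"
    interpret M: module R "E$n" by (rule cpxD(1)[OF E])
    show "f n x = cdiff E (n - 1) (h n x) +[E$n] h (n + 1) (cdiff P n x)"
    proof (cases "n \<ge> a")
      case True
      then show ?thesis using h(2)[OF True x] cmap_simps(1)[OF PD(1) E f x] by simp
    next
      case False
      then have "x = 0[P$n]" using ab[of n] x by auto
      then show ?thesis using hs(4)[of "n + 1"]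
        by (simp add: cmap_simps[OF PD(1) E f] hs cpx_simps[OF PD(1)] cpx_simps[OF E])
    qed
  qed
qed

section \<open>Maps from perfect complexes detected by associated primes\<close>

lemma (in noetherian_ring) maximal_ideal_in_family:
  assumes "F \<noteq> {}" "\<And>I. I \<in> F ==> ideal I R"
  obtains I where "I \<in> F" "\<And>J. J \<in> F ==> I \<subseteq> J ==> J = I"
proof -
  have "\<exists>M\<in>F. \<forall>X\<in>F. M \<subseteq> X \<longrightarrow> X = M"
  proof (rule subset_Zorn)
    fix C assume C: "subset.chain F C"
    show "\<exists>U\<in>F. \<forall>X\<in>C. X \<subseteq> U"
    proof (cases "C = {}")
      case True then show ?thesis using assms(1) by auto
    next
      case False
      have "subset.chain {I. ideal I R} C" using C assms(2) unfolding pred_on.chain_def by auto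
      from ideal_chain_is_trivial[OF False this] have "\<Union>C \<in> F" using C unfolding pred_on.chain_def by auto
      then show ?thesis by (intro bexI[of _ "\<Union>C"]) auto
    qed
  qed
  then show ?thesis using that by blast
qed

lemma (in module) annihilator_ideal:
  assumes K: "submodule K R M" and w: "w \<in> carrier M"
  shows "ideal {a \<in> carrier R. a *[M] w \<in> K} R"
  by (rule R.idealI') (use submoduleD(2,3,5)[OF K] w in \<open>simp_all add: smult_l_distr smult_assoc1 subset_iff\<close>)

text \<open>Among the annihilators modulo \<open>K\<close> of multiples of \<open>z\<close>, those
  inside \<open>p\<close> have a maximal member, and it is prime. Staying inside \<open>p\<close>
  ensures that the multiple survives at \<open>p\<close>.\<close>

lemma (in noeth_cring) associated_prime:
  assumes M: "module R M" and K: "submodule K R M" and p: "primeideal p R"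
    and z: "z \<in> carrier M" "z \<notin> sat R (carrier R - p) M K"
  obtains q r where "primeideal q R" "q \<subseteq> p" "r \<in> carrier R" "\<And>a. a \<in> carrier R ==> a *[M] (r *[M] z) \<in> K \<longleftrightarrow> a \<in> q"
proof -
  interpret M: module R M by fact
  interpret p: primeideal p R by fact
  note KD = M.submoduleD[OF K]
  define ann where "ann w = {a \<in> carrier R. a *[M] w \<in> K}" for w
  define F where "F = {ann (r *[M] z) | r. r \<in> carrier R \<and> ann (r *[M] z) \<subseteq> p}"
  have "ann (\<one> *[M] z) \<subseteq> p" using z unfolding ann_def sat_def by auto
  then have "F \<noteq> {}" unfolding F_def by blast
  moreover have "ideal I R" if "I \<in> F" for I
    using that M.annihilator_ideal[OF K] z unfolding F_def ann_def by auto
  ultimately obtain q where q: "q \<in> F" "\<And>J. J \<in> F ==> q \<subseteq> J ==> J = q" and qi: "ideal q R"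
    using maximal_ideal_in_family[of F] by metis
  obtain r where r: "r \<in> carrier R" "q = ann (r *[M] z)" "q \<subseteq> p" using q(1) unfolding F_def by auto
  have max: "s \<in> carrier R ==> ann (s *[M] (r *[M] z)) \<subseteq> p ==> ann (s *[M] (r *[M] z)) = q" for s
  proof -
    assume s: "s \<in> carrier R" and sp: "ann (s *[M] (r *[M] z)) \<subseteq> p"
    have e: "s *[M] (r *[M] z) = (s \<otimes> r) *[M] z" using s r z by (simp add: M.smult_assoc1)
    have "ann (s *[M] (r *[M] z)) \<in> F" using s r sp unfolding F_def e by blast
    moreover have "q \<subseteq> ann (s *[M] (r *[M] z))"
    proof
      fix a assume "a \<in> q"
      then have a: "a \<in> carrier R" "a *[M] (r *[M] z) \<in> K" unfolding r(2) ann_def by auto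
      have "a *[M] (s *[M] (r *[M] z)) = s *[M] (a *[M] (r *[M] z))"
        using a(1) s r(1) z(1) by algebra
      then show "a \<in> ann (s *[M] (r *[M] z))" using a KD(5)[OF s a(2)] unfolding ann_def by simp
    qed
    ultimately show ?thesis using q(2) by blast
  qed
  have "primeideal q R"
  proof (rule primeidealI[OF qi])
    show "cring R" by (rule cring_axioms)
    show "carrier R \<noteq> q" using r(3) p.I_notcarr p.a_subset by blast
    fix a b assume a: "a \<in> carrier R" "b \<in> carrier R" and ab: "a \<otimes> b \<in> q"
    let ?w = "r *[M] z"
    have w: "?w \<in> carrier M" using r z by simp
    show "a \<in> q \<or> b \<in> q"
    \<comment> \<open>If the annihilator of \<open>b\<close> times \<open>?w\<close> stays inside
      \<open>p\<close>, maximality gives \<open>a \<in> q\<close>. Otherwise some \<open>t\<close>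
      outside \<open>p\<close> kills this element; then the annihilator of \<open>t\<close> times
      \<open>?w\<close> is inside \<open>p\<close> and contains \<open>b\<close>, and maximality
      gives \<open>b \<in> q\<close>.\<close>
    proof (cases "ann (b *[M] ?w) \<subseteq> p")
      case True
      have "a \<in> ann (b *[M] ?w)" using ab a w unfolding r(2) ann_def by (simp add: M.smult_assoc1)
      then show ?thesis using max[OF a(2) True] by simp
    next
      case False
      then obtain t where t: "t \<in> carrier R" "t \<notin> p" "t *[M] (b *[M] ?w) \<in> K" unfolding ann_def by auto
      have "b *[M] (t *[M] ?w) = t *[M] (b *[M] ?w)" using t(1) a(2) w by algebra
      then have b: "b \<in> ann (t *[M] ?w)" using t a unfolding ann_def by simp
      have "ann (t *[M] ?w) \<subseteq> p"
      proof
        fix s assume s: "s \<in> ann (t *[M] ?w)"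
        then have "s \<otimes> t \<in> q" using t(1) w unfolding r(2) ann_def by (auto simp: M.smult_assoc1)
        then have "s \<otimes> t \<in> p" using r(3) by blast
        then show "s \<in> p" using p.I_prime[of s t] s t unfolding ann_def by auto
      qed
      then show ?thesis using max[OF t(1)] b by simp
    qed
  qed
  then show ?thesis using that[of q r] r unfolding ann_def by blast
qed

text \<open>A surjection of the top cohomology of \<open>P\<close> at \<open>p\<close> onto the residue field, followed by the embedding
  of the latter into the bottom cohomology of \<open>M\<close>, extends to a chain map.\<close>

lemma (in noeth_cring) not_null_maps:
  assumes p: "primeideal p R" and P: "perf_cpx R P" and M: "M \<in> complexes R"
    and topP: "\<And>k. k > s ==> exact_at R (carrier R - p) P k" and nzP: "\<not> exact_at R (carrier R - p) P s"
    and botM: "\<And>k. k < s ==> exact_at R (carrier R - p) M k"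
    and w: "w \<in> cyc M s" "\<And>r. r \<in> carrier R ==> r *[M$s] w \<in> bd M s \<longleftrightarrow> r \<in> p"
  shows "\<not> null_maps R P M"
proof
  assume null: "null_maps R P M"
  let ?S = "carrier R - p"
  interpret p: primeideal p R by fact
  have S: "msys R ?S" using msys_compl_prime[OF p] .
  note SD = msysD[OF S] and PD = perfD[OF P]
  note Pm = cpxD(1)[OF PD(1)] and Mm = cpxD(1)[OF M]
  note dP = cpx_simps[OF PD(1)] and dM = cpx_simps[OF M]
  interpret Ps: module R "P$s" by (rule Pm)
  interpret Ps1: module R "P$(s + 1)" by (rule Pm)
  interpret Ms: module R "M$s" by (rule Mm)
  obtain a b where ab: "\<And>n. n < a \<or> b < n ==> el P n = {0[P$n]}"
    using PD(2) unfolding bounded_cpx_def by blast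
  \<comment> \<open>At \<open>p\<close> the complex \<open>P\<close> is exact above
    \<open>s\<close>, so up to a factor its identity is null-homotopic there.\<close>
  have "\<exists>t\<in>?S. \<exists>h. (\<forall>n. h n \<in> lin_maps R (P$n) (P$(n - 1))) \<and>
    (\<forall>n\<ge>s + 1. \<forall>x\<in>el P n. t *[P$n] cmap_id n x =
       cdiff P (n - 1) (h n x) +[P$n] h (n + 1) (cdiff P n x))"
  proof (rule descend_homotopy[OF S PD(1) PD(3) PD(1) chain_maps_id[OF PD(1)], where b = "b + 1"])
    fix x assume "x \<in> el P (b + 1)"
    then have "x = 0[P$(b + 1)]" using ab[of "b + 1"] by auto
    interpret N: module R "P$(b + 1)" by (rule Pm)
    show "cmap_id (b + 1) x \<in> sat R ?S (P$(b + 1)) (bd P (b + 1))"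
      using N.submoduleD(2)[OF N.sat_submodule[OF S coboundaries_submodule[OF PD(1)]]]
      unfolding \<open>x = _\<close> cmap_id_def .
  qed (use ab topP in auto)
  then obtain t h where t: "t \<in> ?S" and h: "\<And>n. h n \<in> lin_maps R (P$n) (P$(n - 1))"
    and th: "\<And>n x. n \<ge> s + 1 ==> x \<in> el P n ==> t *[P$n] x =
       cdiff P (n - 1) (h n x) +[P$n] h (n + 1) (cdiff P n x)" unfolding cmap_id_def by blast
  have tc: "t \<in> carrier R" using t by auto
  have h1: "h (s + 1) \<in> lin_maps R (P$(s + 1)) (P$s)" using h[of "s + 1"] by simp
  note h1s = lin_simps[OF Pm Pm h1]
  \<comment> \<open>An approximate projection of \<open>P$s\<close> onto its cocycles: on a cocycle
    it is multiplication by \<open>t\<close>.\<close>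
  define \<pi> where "\<pi> x = t *[P$s] x -[P$s] h (s + 1) (cdiff P s x)" for x
  have \<pi>: "\<pi> \<in> lin_maps R (P$s) (P$s)" unfolding \<pi>_def
    by (intro lin_maps_diff lin_maps_smult Pm tc lin_maps_id lin_maps_comp[OF cpxD(2)[OF PD(1)] h1])
  note \<pi>c = lin_simps(1)[OF Pm Pm \<pi>]
  have \<pi>_cocycle: "\<pi> x \<in> cyc P s" if x: "x \<in> el P s" for x
  proof -
    have dx: "cdiff P s x \<in> el P (s + 1)" using dP x by auto
    have c: "h (s + 1) (cdiff P s x) \<in> el P s" using h1s dx by auto
    have "h (s + 2) 0[P$(s + 2)] = 0[P$(s + 1)]"
      using lin_simps(4)[OF Pm Pm h, of "s + 2"] by (simp add: add.commute)
    then have "t *[P$(s + 1)] cdiff P s x = cdiff P s (h (s + 1) (cdiff P s x))"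
      using th[OF order_refl dx] cpxD(4)[OF PD(1) x] dP(1)[OF c] by (simp add: add.assoc)
    then have "cdiff P s (\<pi> x) = 0[P$(s + 1)]"
      unfolding \<pi>_def using x c tc dP(1)[OF c] by (simp add: dP a_minus_def Ps1.r_neg)
    then show ?thesis using \<pi>c[OF x] by (simp add: mem_cocycles)
  qed
  have "noeth_module R (P$s)" by (rule noeth_moduleI[OF Pm fgp_fin_gen[OF PD(3)]])
  then have fg: "fgs R (P$s) (cyc P s)"
    unfolding noeth_module_def using cocycles_submodule[OF PD(1)] by blast
  have nz: "\<not> cyc P s \<subseteq> sat R ?S (P$s) (bd P s)" using nzP unfolding exact_at_def .
  obtain W z where W: "submodule W R (P$s)" "bd P s \<subseteq> W" "z \<in> cyc P s"
    "z \<notin> sat R ?S (P$s) W"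
    "cyc P s \<subseteq> sat R ?S (P$s) {k +[P$s] r *[P$s] z | k r. k \<in> W \<and> r \<in> carrier R}"
    by (rule Ps.simple_quotient[OF S fg cocycles_submodule[OF PD(1)] coboundaries_submodule[OF PD(1)]
          coboundaries_subset_cocycles[OF PD(1)] nz])
  note WD = Ps.submoduleD[OF W(1)]
  have zc: "z \<in> el P s" "cdiff P s z = 0[P$(s + 1)]" using W(3) by (auto simp: mem_cocycles)
  have zp: "r \<in> p" if "r \<in> carrier R" "r *[P$s] z \<in> W" for r
    using W(4) zc that unfolding sat_def by auto
  have zlin: "(\<lambda>r. r *[P$s] z) \<in> lin_maps R (selfmod R) (P$s)"
    by (rule lin_mapsI) (use zc in \<open>auto simp: Ps.smult_l_distr Ps.smult_assoc1\<close>)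
  have ex: "\<exists>u\<in>?S. \<exists>r\<in>carrier (selfmod R). u *[P$s] \<pi> x -[P$s] r *[P$s] z \<in> W"
    if x: "x \<in> el P s" for x
  proof -
    obtain u k r where u: "u \<in> ?S" "u *[P$s] \<pi> x = k +[P$s] r *[P$s] z" "k \<in> W" "r \<in> carrier R"
      using \<pi>_cocycle[OF x] W(5) unfolding sat_def by blast
    have "k +[P$s] r *[P$s] z -[P$s] r *[P$s] z = k" using zc u(4) WD(1)[OF u(3)] by algebra
    then have "u *[P$s] \<pi> x -[P$s] r *[P$s] z \<in> W" using u by simp
    then show ?thesis using u(1,4) by auto
  qed
  \<comment> \<open>Modulo \<open>W\<close> and up to the factor \<open>u\<close>, the projection is
    \<open>z\<close> times a form \<open>\<rho>\<close>; projectivity of \<open>P$s\<close> provides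
    \<open>\<rho>\<close> as a linear map over \<open>R\<close>.\<close>
  obtain u \<rho> where u: "u \<in> ?S" and \<rho>: "\<rho> \<in> lin_maps R (P$s) (selfmod R)"
    and u\<rho>: "\<And>x. x \<in> el P s ==> u *[P$s] \<pi> x -[P$s] \<rho> x *[P$s] z \<in> W"
    using ex by (rule fgp_lift_mod[OF S PD(3) Pm selfmod_module W(1) \<pi> zlin]) (assumption, rule that, assumption, assumption, blast)
  have uc: "u \<in> carrier R" using u by auto
  note \<rho>s = lin_simps[OF Pm selfmod_module \<rho>, simplified]
  have wc: "w \<in> el M s" "cdiff M s w = 0[M$(s + 1)]" using w(1) by (auto simp: mem_cocycles)
  have \<rho>d: "\<rho> (cdiff P (s - 1) y) \<in> p" if y: "y \<in> el P (s - 1)" for y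
  proof -
    let ?x = "cdiff P (s - 1) y"
    have x: "?x \<in> el P s" using dP(7)[OF y] .
    have "\<pi> ?x = t *[P$s] ?x" unfolding \<pi>_def using x tc cpxD(5)[OF PD(1) y] by (simp add: h1s a_minus_def)
    moreover have "?x \<in> W" by (rule subsetD[OF W(2)]) (use y in \<open>auto simp: mem_coboundaries\<close>)
    ultimately have m: "u *[P$s] \<pi> ?x \<in> W" using WD(5) uc tc by simp
    have "\<rho> ?x *[P$s] z = u *[P$s] \<pi> ?x -[P$s] (u *[P$s] \<pi> ?x -[P$s] \<rho> ?x *[P$s] z)"
      using uc \<pi>c[OF x] \<rho>s(1)[OF x] zc(1) by algebra
    also have "\<dots> \<in> W" by (rule WD(6)[OF m u\<rho>[OF x]])
    finally show ?thesis using zp \<rho>s(1)[OF x] by blast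
  qed
  \<comment> \<open>Compatible with the differentials because \<open>w\<close> is a cocycle and
    \<open>\<rho>\<close> maps coboundaries into \<open>p\<close>, the annihilator of the class of
    \<open>w\<close>.\<close>
  define f where "f k = (if k = s then (\<lambda>x. \<rho> x *[M$s] w) else (\<lambda>x. 0[M$k]))" for k
  have wlin: "(\<lambda>r. r *[M$s] w) \<in> lin_maps R (selfmod R) (M$s)"
    by (rule lin_mapsI) (use wc in \<open>auto simp: Ms.smult_l_distr Ms.smult_assoc1\<close>)
  have flin: "f k \<in> lin_maps R (P$k) (M$k)" for k
    unfolding f_def using lin_maps_comp[OF \<rho> wlin] lin_maps_zero[OF Pm Mm] by auto
  have "\<exists>v\<in>?S. \<exists>F\<in>chain_maps R P M. \<forall>k\<ge>s. \<forall>x\<in>el P k. F k x = v *[M$k] f k x"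
  proof (rule extend_chain_map[OF S PD(1) PD(3) M, where a = a])
    show "n < a ==> el P n = {0[P$n]}" for n using ab by auto
    show "f k \<in> lin_maps R (P$k) (M$k)" for k by (rule flin)
    show "exact_at R ?S M k" if "k < s" for k by (rule botM[OF that])
    fix k x assume k: "s \<le> k" and x: "x \<in> el P k"
    interpret Ms1: module R "M$(s + 1)" by (rule Mm)
    show "f (k + 1) (cdiff P k x) = cdiff M k (f k x)"
      using k x wc by (auto simp: f_def dM \<rho>s)
  next
    fix x assume x: "x \<in> el P (s - 1)"
    have "f s (cdiff P (s - 1) x) \<in> bd M s"
      using \<rho>d[OF x] w(2) p.Icarr by (simp add: f_def)
    moreover have "bd M s \<subseteq> el M s" using Ms.submoduleD(1)[OF coboundaries_submodule[OF M]] by auto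
    ultimately show "f s (cdiff P (s - 1) x) \<in> sat R ?S (M$s) (bd M s)"
      using Ms.subset_sat[OF S] by blast
  qed
  then obtain v F where v: "v \<in> ?S" and F: "F \<in> chain_maps R P M"
    and vF: "\<And>x. x \<in> el P s ==> F s x = v *[M$s] (\<rho> x *[M$s] w)" unfolding f_def by auto
  have vc: "v \<in> carrier R" using v by auto
  have "homotopic_maps R P M F (zmap M)" using null F unfolding null_maps_def by blast
  \<comment> \<open>Evaluated at \<open>z\<close>, a null homotopy would put \<open>\<rho> z\<close>
    into \<open>p\<close>. But \<open>\<rho> z\<close> agrees modulo \<open>p\<close> with
    \<open>u \<otimes> t\<close>, a product of elements outside \<open>p\<close>.\<close>
  from nullE[OF M PD(1) this] obtain g where g: "\<And>n. g n \<in> lin_maps R (P$n) (M$(n - 1))"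
    "\<And>x. x \<in> el P s ==> F s x = cdiff M (s - 1) (g s x) +[M$s] g (s + 1) (cdiff P s x)" by metis
  have gz: "g s z \<in> el M (s - 1)" using lin_simps(1)[OF Pm Mm g(1)] zc by auto
  have "g (s + 1) 0[P$(s + 1)] = 0[M$s]" using lin_simps(4)[OF Pm Mm g(1), of "s + 1"] by simp
  then have "F s z = cdiff M (s - 1) (g s z)" using g(2)[OF zc(1)] zc(2) dM(7)[OF gz] by simp
  then have "(v \<otimes> \<rho> z) *[M$s] w \<in> bd M s"
    using vF[OF zc(1)] gz \<rho>s(1)[OF zc(1)] vc wc by (auto simp: mem_coboundaries Ms.smult_assoc1)
  then have "v \<otimes> \<rho> z \<in> p" using w(2) vc \<rho>s(1)[OF zc(1)] by simp
  then have \<rho>z: "\<rho> z \<in> p" using p.I_prime[OF vc \<rho>s(1)[OF zc(1)]] v by auto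
  have "\<pi> z = t *[P$s] z" unfolding \<pi>_def using zc tc by (simp add: h1s a_minus_def)
  then have "(u \<otimes> t \<ominus> \<rho> z) *[P$s] z = u *[P$s] \<pi> z -[P$s] \<rho> z *[P$s] z"
    using uc tc \<rho>s(1)[OF zc(1)] zc(1) by algebra
  then have "(u \<otimes> t \<ominus> \<rho> z) *[P$s] z \<in> W" using u\<rho>[OF zc(1)] by simp
  then have "u \<otimes> t \<ominus> \<rho> z \<in> p" using zp uc tc \<rho>s(1)[OF zc(1)] by simp
  then have "(u \<otimes> t \<ominus> \<rho> z) \<oplus> \<rho> z \<in> p" using \<rho>z by blast
  moreover have "(u \<otimes> t \<ominus> \<rho> z) \<oplus> \<rho> z = u \<otimes> t" using uc tc \<rho>s(1)[OF zc(1)] by algebra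
  ultimately show False using SD(3)[OF u t] by simp
qed

section \<open>Shifts and mapping cones\<close>

lemma shift_cpx_simps [simp]:
  "(shift_cpx k X)$n = X$(n + k)"
  "cdiff (shift_cpx k X) n x = (if even k then cdiff X (n + k) x else -[X$(n + 1 + k)] cdiff X (n + k) x)"
  by (simp_all add: shift_cpx_def)

lemma shift_complexes:
  assumes X: "X \<in> complexes R" shows "shift_cpx k X \<in> complexes R"
proof -
  note Xm = cpxD(1)[OF X]
  have d: "cdiff X (n + k) \<in> lin_maps R (X$(n + k)) (X$(n + 1 + k))" for n
    using cpxD(2)[OF X, of "n + k"] by (simp add: ac_simps)
  note ds = lin_simps[OF Xm Xm d]
  have dd: "cdiff X (n + 1 + k) (cdiff X (n + k) x) = 0[X$(n + 2 + k)]"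
    if "x \<in> el X (n + k)" for n x
    using cpxD(4)[OF X that] by (simp add: ac_simps)
  show ?thesis unfolding complexes_def
  proof (intro CollectI conjI allI ballI)
    fix n
    show "module R ((shift_cpx k X)$n)" by (simp add: Xm)
    show "cdiff (shift_cpx k X) n \<in> lin_maps R ((shift_cpx k X)$n) ((shift_cpx k X)$(n + 1))"
      using d[of n] lin_maps_neg[OF Xm Xm d[of n]] by (auto simp: lin_maps_def Pi_iff)
    fix x assume "x \<in> el (shift_cpx k X) n"
    then have x: "x \<in> el X (n + k)" by simp
    interpret M: module R "X$(n + 2 + k)" by (rule Xm)
    have e: "n + 1 + 1 + k = n + 2 + k" by simp
    show "cdiff (shift_cpx k X) (n + 1) (cdiff (shift_cpx k X) n x) = 0[(shift_cpx k X)$(n + 2)]"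
      unfolding shift_cpx_simps e using x ds(1)[OF x] ds(5)[of "cdiff X (n + k) x" "n + 1", unfolded e] dd[OF x] by simp
  qed
qed

text \<open>The sign of a shifted differential does not change its kernel.\<close>

lemma shift_cocycles:
  assumes X: "X \<in> complexes R" shows "cyc (shift_cpx k X) n = cyc X (n + k)"
proof -
  interpret M: module R "X$(n + 1 + k)" by (rule cpxD(1)[OF X])
  have e: "n + k + 1 = n + 1 + k" by simp
  have "-[X$(n + 1 + k)] y = 0[X$(n + 1 + k)] \<longleftrightarrow> y = 0[X$(n + 1 + k)]"
    if "y \<in> el X (n + 1 + k)" for y
    using that by (metis M.minus_minus M.a_inv_zero)
  moreover have "x \<in> el X (n + k) ==> cdiff X (n + k) x \<in> el X (n + 1 + k)" for x
    using cpx_simps(1)[OF X, of x "n + k"] by (simp add: e)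
  ultimately show ?thesis by (cases "even k") (auto simp: mem_cocycles e)
qed

lemma shift_coboundaries:
  assumes X: "X \<in> complexes R" shows "bd (shift_cpx k X) n = bd X (n + k)"
proof -
  have e: "n - 1 + k = n + k - 1" "n - 1 + 1 + k = n + k" by simp_all
  interpret M: module R "X$(n + k)" by (rule cpxD(1)[OF X])
  interpret N: module R "X$(n + k - 1)" by (rule cpxD(1)[OF X])
  note d = cpx_simps[OF X, where n = "n + k"]
  have "\<exists>y\<in>el X (n + k - 1). cdiff X (n + k - 1) x = -[X$(n + k)] cdiff X (n + k - 1) y"
    if "x \<in> el X (n + k - 1)" for x
    using that d by (intro bexI[of _ "-[X$(n + k - 1)] x"]) auto
  moreover have "\<exists>y\<in>el X (n + k - 1). -[X$(n + k)] cdiff X (n + k - 1) x = cdiff X (n + k - 1) y"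
    if "x \<in> el X (n + k - 1)" for x
    using that d by (intro bexI[of _ "-[X$(n + k - 1)] x"]) auto
  ultimately show ?thesis by (cases "even k") (auto simp: mem_coboundaries e)
qed

lemma shift_exact_at:
  assumes X: "X \<in> complexes R" shows "exact_at R S (shift_cpx k X) n \<longleftrightarrow> exact_at R S X (n + k)"
  unfolding exact_at_def by (simp add: shift_cocycles[OF X] shift_coboundaries[OF X])

lemma shift_perf_cpx:
  assumes P: "perf_cpx R P" shows "perf_cpx R (shift_cpx k P)"
proof -
  note PD = perfD[OF P]
  obtain a b where ab: "\<And>n. n < a \<or> b < n ==> el P n = {0[P$n]}"
    using PD(2) unfolding bounded_cpx_def by blast
  have "bounded_cpx (shift_cpx k P)" unfolding bounded_cpx_def
    by (intro exI[of _ "a - k"] exI[of _ "b - k"] allI impI) (simp, rule ab, arith)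
  then show ?thesis using PD(3) by (simp add: perf_cpx_def shift_complexes[OF PD(1)])
qed

text \<open>The coordinates in \<open>mapping_cone\<close> made available as a locale:
  \<open>\<phi> n x y\<close> is the element of the cone with components \<open>x\<close> and
  \<open>y\<close>. The canonical maps are the inclusion in the second coordinate and the first
  projection \<open>\<pi>1\<close>.\<close>

locale mcone =
  fixes R :: "('a, 'r) ring_scheme" and X Y :: "('a, 'm) cpx" and f :: "'m cmap" and C :: "('a, 'm) cpx"
    and \<phi> :: "int \<Rightarrow> 'm \<Rightarrow> 'm \<Rightarrow> 'm"
  assumes X: "X \<in> complexes R" and Y: "Y \<in> complexes R" and f: "f \<in> chain_maps R X Y" and C: "C \<in> complexes R"
    and bij: "bij_betw (\<lambda>(x, y). \<phi> n x y) (el X (n + 1) \<times> el Y n) (el C n)"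
    and \<phi>_add: "[|x \<in> el X (n + 1); y \<in> el Y n; x' \<in> el X (n + 1); y' \<in> el Y n|]
       ==> \<phi> n (x +[X$(n + 1)] x') (y +[Y$n] y') = \<phi> n x y +[C$n] \<phi> n x' y'"
    and \<phi>_smult: "[|x \<in> el X (n + 1); y \<in> el Y n; r \<in> carrier R|]
       ==> \<phi> n (r *[X$(n + 1)] x) (r *[Y$n] y) = r *[C$n] \<phi> n x y"
    and \<phi>_diff: "[|x \<in> el X (n + 1); y \<in> el Y n|]
       ==> cdiff C n (\<phi> n x y) = \<phi> (n + 1) (-[X$(n + 2)] cdiff X (n + 1) x)
               (f (n + 1) x +[Y$(n + 1)] cdiff Y n y)"
begin

lemmas Xm = cpxD(1)[OF X] and Ym = cpxD(1)[OF Y] and Cm = cpxD(1)[OF C]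

sublocale X: module R "X$n" for n by (rule Xm)
sublocale Y: module R "Y$n" for n by (rule Ym)
sublocale C: module R "C$n" for n by (rule Cm)

lemmas dX = cpx_simps[OF X] and dY = cpx_simps[OF Y] and dC = cpx_simps[OF C]
lemmas fs = cmap_simps[OF X Y f]

lemma \<phi>_closed: "x \<in> el X (n + 1) ==> y \<in> el Y n ==> \<phi> n x y \<in> el C n"
  using bij[of n] by (auto simp: bij_betw_def)

lemma \<phi>_inj:
  assumes "x \<in> el X (n + 1)" "y \<in> el Y n" "x' \<in> el X (n + 1)" "y' \<in> el Y n"
  shows "\<phi> n x y = \<phi> n x' y' \<longleftrightarrow> x = x' \<and> y = y'"
proof
  assume "\<phi> n x y = \<phi> n x' y'"
  then have "(x, y) = (x', y')"
    using bij[of n] assms by (intro inj_onD[of "\<lambda>(x, y). \<phi> n x y" _ "(x, y)" "(x', y')"]) (auto simp: bij_betw_def)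
  then show "x = x' \<and> y = y'" by simp
qed simp

lemma \<phi>_surj:
  assumes "c \<in> el C n"
  obtains x y where "x \<in> el X (n + 1)" "y \<in> el Y n" "c = \<phi> n x y"
proof -
  have "c \<in> (\<lambda>(x, y). \<phi> n x y) ` (el X (n + 1) \<times> el Y n)" using assms bij[of n] unfolding bij_betw_def by simp
  then show ?thesis using that by (elim imageE SigmaE) simp
qed

lemma \<phi>_zero: "\<phi> n 0[X$(n + 1)] 0[Y$n] = 0[C$n]"
proof -
  show ?thesis using \<phi>_smult[of "0[X$(n + 1)]" n "0[Y$n]" "0[R]"]
      \<phi>_closed[of "0[X$(n + 1)]" n "0[Y$n]"] by simp
qed

lemma \<phi>_diff':
  assumes "x \<in> el X n" "y \<in> el Y (n - 1)"
  shows "cdiff C (n - 1) (\<phi> (n - 1) x y) = \<phi> n (-[X$(n + 1)] cdiff X n x) (f n x +[Y$n] cdiff Y (n - 1) y)"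
  using \<phi>_diff[of x "n - 1" y] assms by (simp add: add.commute)

definition \<pi>1 :: "int \<Rightarrow> 'm \<Rightarrow> 'm" where
  "\<pi>1 n c = fst (inv_into (el X (n + 1) \<times> el Y n) (\<lambda>(x, y). \<phi> n x y) c)"

definition \<pi>2 :: "int \<Rightarrow> 'm \<Rightarrow> 'm" where
  "\<pi>2 n c = snd (inv_into (el X (n + 1) \<times> el Y n) (\<lambda>(x, y). \<phi> n x y) c)"

lemma \<pi>_\<phi>:
  assumes "x \<in> el X (n + 1)" "y \<in> el Y n"
  shows "\<pi>1 n (\<phi> n x y) = x" "\<pi>2 n (\<phi> n x y) = y"
proof -
  have "inv_into (el X (n + 1) \<times> el Y n) (\<lambda>(x, y). \<phi> n x y) (\<phi> n x y) = (x, y)"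
    using inv_into_f_f[of "\<lambda>(x, y). \<phi> n x y" "el X (n + 1) \<times> el Y n" "(x, y)"] bij[of n] assms
    by (auto simp: bij_betw_def)
  then show "\<pi>1 n (\<phi> n x y) = x" "\<pi>2 n (\<phi> n x y) = y" by (simp_all add: \<pi>1_def \<pi>2_def)
qed

lemma \<pi>1_lin: "\<pi>1 n \<in> lin_maps R (C$n) (X$(n + 1))"
proof (rule lin_mapsI)
  fix c assume "c \<in> el C n"
  from \<phi>_surj[OF this] obtain x y where c: "x \<in> el X (n + 1)" "y \<in> el Y n" "c = \<phi> n x y" .
  show "\<pi>1 n c \<in> el X (n + 1)" using c by (simp add: \<pi>_\<phi>)
  show "\<pi>1 n (r *[C$n] c) = r *[X$(n + 1)] \<pi>1 n c" if "r \<in> carrier R" for r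
    using c that by (simp add: \<pi>_\<phi> \<phi>_smult[symmetric])
  fix c' assume "c' \<in> el C n"
  from \<phi>_surj[OF this] obtain x' y' where c': "x' \<in> el X (n + 1)" "y' \<in> el Y n" "c' = \<phi> n x' y'" .
  show "\<pi>1 n (c +[C$n] c') = \<pi>1 n c +[X$(n + 1)] \<pi>1 n c'"
    using c c' by (simp add: \<pi>_\<phi> \<phi>_add[symmetric])
qed

lemma \<pi>2_lin: "\<pi>2 n \<in> lin_maps R (C$n) (Y$n)"
proof (rule lin_mapsI)
  fix c assume "c \<in> el C n"
  from \<phi>_surj[OF this] obtain x y where c: "x \<in> el X (n + 1)" "y \<in> el Y n" "c = \<phi> n x y" .
  show "\<pi>2 n c \<in> el Y n" using c by (simp add: \<pi>_\<phi>)
  show "\<pi>2 n (r *[C$n] c) = r *[Y$n] \<pi>2 n c" if "r \<in> carrier R" for r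
    using c that by (simp add: \<pi>_\<phi> \<phi>_smult[symmetric])
  fix c' assume "c' \<in> el C n"
  from \<phi>_surj[OF this] obtain x' y' where c': "x' \<in> el X (n + 1)" "y' \<in> el Y n" "c' = \<phi> n x' y'" .
  show "\<pi>2 n (c +[C$n] c') = \<pi>2 n c +[Y$n] \<pi>2 n c'"
    using c c' by (simp add: \<pi>_\<phi> \<phi>_add[symmetric])
qed

lemma \<phi>_\<pi>: "c \<in> el C n ==> \<phi> n (\<pi>1 n c) (\<pi>2 n c) = c"
  by (erule \<phi>_surj) (simp add: \<pi>_\<phi>)

lemma \<phi>_lin:
  assumes g: "g \<in> lin_maps R M (X$(n + 1))" and k: "k \<in> lin_maps R M (Y$n)"
  shows "(\<lambda>q. \<phi> n (g q) (k q)) \<in> lin_maps R M (C$n)"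
  using g k unfolding lin_maps_def by (auto simp: Pi_iff \<phi>_closed \<phi>_add \<phi>_smult)

lemma mem_cocycles_iff:
  assumes "x \<in> el X (n + 1)" "y \<in> el Y n"
  shows "\<phi> n x y \<in> cyc C n \<longleftrightarrow> cdiff X (n + 1) x = 0[X$(n + 2)] \<and>
    f (n + 1) x +[Y$(n + 1)] cdiff Y n y = 0[Y$(n + 1)]"
proof -
  have e: "n + 1 + 1 = n + 2" by simp
  have dx: "cdiff X (n + 1) x \<in> el X (n + 2)" using dX(1)[OF assms(1)] by (simp add: add.assoc)
  have "\<phi> n x y \<in> cyc C n \<longleftrightarrow> \<phi> (n + 1) (-[X$(n + 2)] cdiff X (n + 1) x)
               (f (n + 1) x +[Y$(n + 1)] cdiff Y n y) = \<phi> (n + 1) 0[X$(n + 1 + 1)] 0[Y$(n + 1)]"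
    using assms by (simp only: mem_cocycles \<phi>_closed \<phi>_diff \<phi>_zero simp_thms)
  also have "\<dots> \<longleftrightarrow> -[X$(n + 2)] cdiff X (n + 1) x = 0[X$(n + 2)] \<and>
     f (n + 1) x +[Y$(n + 1)] cdiff Y n y = 0[Y$(n + 1)]"
    using assms dx X.a_inv_closed[unfolded e] X.zero_closed[unfolded e] by (subst \<phi>_inj) (simp_all add: e fs dY)
  also have "-[X$(n + 2)] cdiff X (n + 1) x = 0[X$(n + 2)] \<longleftrightarrow> cdiff X (n + 1) x = 0[X$(n + 2)]"
    using dx by (metis X.minus_minus[unfolded e] X.a_inv_zero[unfolded e])
  finally show ?thesis .
qed

lemma mem_coboundaries_iff:
  assumes "x \<in> el X (n + 1)" "y \<in> el Y n"
  shows "\<phi> n x y \<in> bd C n \<longleftrightarrow> (\<exists>x'\<in>el X n. \<exists>y'\<in>el Y (n - 1).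
     x = -[X$(n + 1)] cdiff X n x' \<and> y = f n x' +[Y$n] cdiff Y (n - 1) y')"
    (is "_ \<longleftrightarrow> ?R")
proof
  assume "\<phi> n x y \<in> bd C n"
  then obtain c where c: "c \<in> el C (n - 1)" "\<phi> n x y = cdiff C (n - 1) c" by (auto simp: mem_coboundaries)
  obtain x' y' where *: "x' \<in> el X (n - 1 + 1)" "y' \<in> el Y (n - 1)" "c = \<phi> (n - 1) x' y'"
    using \<phi>_surj[OF c(1)] .
  then have x': "x' \<in> el X n" by simp
  have "\<phi> n x y = \<phi> n (-[X$(n + 1)] cdiff X n x') (f n x' +[Y$n] cdiff Y (n - 1) y')"
    using c(2) *(3) \<phi>_diff'[OF x' *(2)] by simp
  then show ?R using assms x' * by (subst (asm) \<phi>_inj) (auto simp: dX fs dY)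
next
  assume ?R
  then obtain x' y' where *: "x' \<in> el X n" "y' \<in> el Y (n - 1)"
    "x = -[X$(n + 1)] cdiff X n x'" "y = f n x' +[Y$n] cdiff Y (n - 1) y'" by auto
  then have "\<phi> n x y = cdiff C (n - 1) (\<phi> (n - 1) x' y')" by (simp add: \<phi>_diff')
  moreover have "\<phi> (n - 1) x' y' \<in> el C (n - 1)" using * by (intro \<phi>_closed) auto
  ultimately show "\<phi> n x y \<in> bd C n" by (auto simp: mem_coboundaries)
qed

text \<open>The long exact sequence around degree \<open>n\<close> of the cone. A cocycle
  \<open>(x, y)\<close> has \<open>x\<close> a cocycle and \<open>f x = - d y\<close>; injectivity
  makes a multiple of \<open>x\<close> a coboundary, and the corrected second component is a cocycle
  of \<open>Y\<close>, to which surjectivity applies.\<close>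

lemma exact_coneI:
  assumes S: "msys R S"
    and inj: "\<And>x. x \<in> cyc X (n + 1) ==> f (n + 1) x \<in> sat R S (Y$(n + 1)) (bd Y (n + 1)) ==> x \<in> sat R S (X$(n + 1)) (bd X (n + 1))"
    and surj: "\<And>y. y \<in> cyc Y n ==> \<exists>t\<in>S. \<exists>x\<in>cyc X n. t *[Y$n] y -[Y$n] f n x \<in> bd Y n"
  shows "exact_at R S C n"
  unfolding exact_at_def
proof
  note SD = msysD[OF S]
  fix c assume c: "c \<in> cyc C n"
  then have cc: "c \<in> el C n" by (simp add: mem_cocycles)
  then obtain x y where x: "x \<in> el X (n + 1)" and y: "y \<in> el Y n" and xy: "c = \<phi> n x y" by (rule \<phi>_surj)
  have z: "x \<in> cyc X (n + 1)" "f (n + 1) x +[Y$(n + 1)] cdiff Y n y = 0[Y$(n + 1)]"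
    using c mem_cocycles_iff[OF x y] x unfolding xy by (auto simp: mem_cocycles add.assoc)
  have dy: "cdiff Y n y \<in> el Y (n + 1)" "f (n + 1) x \<in> el Y (n + 1)" using dY(1)[OF y] fs(1)[OF x] by auto
  have "f (n + 1) x = cdiff Y n (-[Y$n] y)" using z(2) dy y by (simp add: dY Y.minus_equality[symmetric])
  then have "f (n + 1) x \<in> bd Y (n + 1)" using y unfolding mem_coboundaries by auto
  then have "f (n + 1) x \<in> sat R S (Y$(n + 1)) (bd Y (n + 1))"
    using Y.subset_sat[OF S Y.submoduleE(1)[OF coboundaries_submodule[OF Y]]] by blast
  from inj[OF z(1) this] obtain t x' where t: "t \<in> S" "x' \<in> el X n" "cdiff X n x' = t *[X$(n + 1)] x"
    unfolding sat_def mem_coboundaries by auto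
  have tc: "t \<in> carrier R" using t SD by auto
  \<comment> \<open>Adding the coboundary of \<open>(x', 0)\<close> to \<open>t\<close> times the
    cocycle removes the first component and leaves \<open>?y\<close> in the second.\<close>
  let ?y = "t *[Y$n] y +[Y$n] f n x'"
  have yc: "?y \<in> el Y n" using t tc y fs by auto
  have "cdiff Y n ?y = t *[Y$(n + 1)] cdiff Y n y +[Y$(n + 1)] f (n + 1) (cdiff X n x')"
    using t(1,2) tc y by (simp add: dY fs chain_mapsD(2)[OF f])
  also have "\<dots> = t *[Y$(n + 1)] (f (n + 1) x +[Y$(n + 1)] cdiff Y n y)"
    unfolding t(3) using tc x y by (simp add: fs dY Y.smult_r_distr Y.a_comm)
  also have "\<dots> = 0[Y$(n + 1)]" unfolding z(2) using tc by simp
  finally have "?y \<in> cyc Y n" using yc by (simp add: mem_cocycles)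
  from surj[OF this] obtain u w y' where u: "u \<in> S" "w \<in> cyc X n" "y' \<in> el Y (n - 1)" "u *[Y$n] ?y -[Y$n] f n w = cdiff Y (n - 1) y'"
    unfolding mem_coboundaries by blast
  have uc: "u \<in> carrier R" and w: "w \<in> el X n" "cdiff X n w = 0[X$(n + 1)]" using u SD by (auto simp: mem_cocycles)
  have fx: "f n x' \<in> el Y n" "f n w \<in> el Y n" using fs t w by auto
  let ?x = "w -[X$n] u *[X$n] x'"
  have "(u \<otimes>\<^bsub>R\<^esub> t) *[C$n] c = \<phi> n ((u \<otimes>\<^bsub>R\<^esub> t) *[X$(n + 1)] x) ((u \<otimes>\<^bsub>R\<^esub> t) *[Y$n] y)"
    unfolding xy using x y uc tc by (simp add: \<phi>_smult)
  also have "\<dots> \<in> bd C n"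
  proof (subst mem_coboundaries_iff)
    have "(u \<otimes>\<^bsub>R\<^esub> t) *[X$(n + 1)] x = -[X$(n + 1)] cdiff X n ?x"
      using uc tc t x w by (simp add: dX X.smult_assoc1 a_minus_def)
    moreover have "(u \<otimes>\<^bsub>R\<^esub> t) *[Y$n] y = f n ?x +[Y$n] (u *[Y$n] ?y -[Y$n] f n w)"
      using uc t(2) w(1) by (simp add: fs, insert uc tc y fx) algebra
    ultimately show "\<exists>x''\<in>el X n. \<exists>y'\<in>el Y (n - 1). (u \<otimes>\<^bsub>R\<^esub> t) *[X$(n + 1)] x = -[X$(n + 1)] cdiff X n x'' \<and>
        (u \<otimes>\<^bsub>R\<^esub> t) *[Y$n] y = f n x'' +[Y$n] cdiff Y (n - 1) y'"
      unfolding u(4) using uc t(2) w(1) u(3) by (intro bexI[of _ ?x] bexI[of _ y']) auto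
  qed (use x y uc tc in auto)
  finally show "c \<in> sat R S (C$n) (bd C n)"
    using cc SD(3)[OF u(1) t(1)] unfolding sat_def by auto
qed

lemma exact_cone:
  assumes S: "msys R S" and eX: "exact_at R S X (n + 1)" and eY: "exact_at R S Y n"
  shows "exact_at R S C n"
proof (rule exact_coneI[OF S])
  show "x \<in> sat R S (X$(n + 1)) (bd X (n + 1))" if "x \<in> cyc X (n + 1)" for x using eX that unfolding exact_at_def by blast
  fix y assume "y \<in> cyc Y n"
  then obtain t where t: "t \<in> S" "t *[Y$n] y \<in> bd Y n" using eY unfolding exact_at_def sat_def by blast
  have "t *[Y$n] y -[Y$n] f n 0[X$n] \<in> bd Y n"
    using t(2) Y.submoduleD(1)[OF coboundaries_submodule[OF Y] t(2)] by (simp add: fs a_minus_def)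
  then show "\<exists>t\<in>S. \<exists>x\<in>cyc X n. t *[Y$n] y -[Y$n] f n x \<in> bd Y n"
    using t(1) X.submoduleD(2)[OF cocycles_submodule[OF X]] by blast
qed

text \<open>If \<open>t\<close> times \<open>f z\<close> equals \<open>d y\<close>, then
  \<open>(t z, - y)\<close> is a cocycle of the cone; writing a multiple of it as a coboundary shows
  that \<open>z\<close> bounds at \<open>S\<close>.\<close>

lemma source_sat:
  assumes S: "msys R S" and eC: "exact_at R S C n" and z: "z \<in> cyc X (n + 1)" "f (n + 1) z \<in> sat R S (Y$(n + 1)) (bd Y (n + 1))"
  shows "z \<in> sat R S (X$(n + 1)) (bd X (n + 1))"
proof -
  note SD = msysD[OF S]
  have zc: "z \<in> el X (n + 1)" and dz: "cdiff X (n + 1) z = 0[X$(n + 2)]" using z(1) by (auto simp: mem_cocycles add.assoc)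
  obtain t y where t: "t \<in> S" "y \<in> el Y n" "t *[Y$(n + 1)] f (n + 1) z = cdiff Y n y"
    using z(2) unfolding sat_def mem_coboundaries by auto
  have tc: "t \<in> carrier R" using t SD by auto
  have c: "t *[X$(n + 1)] z \<in> el X (n + 1)" "-[Y$n] y \<in> el Y n" using zc tc t(2) by simp_all
  have "cdiff X (n + 1) (t *[X$(n + 1)] z) = 0[X$(n + 2)]" using dX(3)[OF tc zc] dz tc by (simp add: add.assoc)
  then have "\<phi> n (t *[X$(n + 1)] z) (-[Y$n] y) \<in> cyc C n"
    using t(2,3) tc zc dY(1)[OF t(2)] by (subst mem_cocycles_iff[OF c]) (simp add: fs dY Y.r_neg)
  then obtain u where u: "u \<in> S" "u *[C$n] \<phi> n (t *[X$(n + 1)] z) (-[Y$n] y) \<in> bd C n"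
    using eC unfolding exact_at_def sat_def by blast
  have uc: "u \<in> carrier R" using u SD by auto
  have c': "u *[X$(n + 1)] (t *[X$(n + 1)] z) \<in> el X (n + 1)" "u *[Y$n] (-[Y$n] y) \<in> el Y n" using c uc by simp_all
  have "\<phi> n (u *[X$(n + 1)] (t *[X$(n + 1)] z)) (u *[Y$n] (-[Y$n] y)) \<in> bd C n"
    using u(2) \<phi>_smult[OF c uc] by simp
  then obtain x where x: "x \<in> el X n" "u *[X$(n + 1)] (t *[X$(n + 1)] z) = -[X$(n + 1)] cdiff X n x"
    using mem_coboundaries_iff[OF c'] by auto
  then have "(u \<otimes>\<^bsub>R\<^esub> t) *[X$(n + 1)] z = cdiff X n (-[X$n] x)" using uc tc zc by (simp add: dX X.smult_assoc1)
  then have "(u \<otimes>\<^bsub>R\<^esub> t) *[X$(n + 1)] z \<in> bd X (n + 1)" using x(1) by (auto simp: mem_coboundaries)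
  then show ?thesis using zc SD(3)[OF u(1) t(1)] unfolding sat_def by auto
qed

text \<open>The pair \<open>(0, y)\<close> is a cocycle of the cone; \<open>x\<close> and
  \<open>y'\<close> are read off from an element whose coboundary is a multiple of it.\<close>

lemma target_sat:
  assumes S: "msys R S" and eC: "exact_at R S C n" and y: "y \<in> cyc Y n"
  obtains t x y' where "t \<in> S" "x \<in> cyc X n" "y' \<in> el Y (n - 1)" "t *[Y$n] y = f n x +[Y$n] cdiff Y (n - 1) y'"
proof -
  have yc: "y \<in> el Y n" "cdiff Y n y = 0[Y$(n + 1)]" using y by (auto simp: mem_cocycles)
  have dz: "cdiff X (n + 1) 0[X$(n + 1)] = 0[X$(n + 2)]" using dX(4)[of "n + 1"] by (simp add: add.assoc)
  have "\<phi> n 0[X$(n + 1)] y \<in> cyc C n"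
    using yc dz by (subst mem_cocycles_iff) (simp_all add: fs)
  then obtain t where t: "t \<in> S" "t *[C$n] \<phi> n 0[X$(n + 1)] y \<in> bd C n"
    using eC unfolding exact_at_def sat_def by blast
  have tc: "t \<in> carrier R" using t msysD[OF S] by auto
  have "\<phi> n 0[X$(n + 1)] (t *[Y$n] y) \<in> bd C n"
    using t \<phi>_smult[of "0[X$(n + 1)]" n y t] yc tc by simp
  then obtain x y' where *: "x \<in> el X n" "y' \<in> el Y (n - 1)"
     "0[X$(n + 1)] = -[X$(n + 1)] cdiff X n x" "t *[Y$n] y = f n x +[Y$n] cdiff Y (n - 1) y'"
    using mem_coboundaries_iff[of "0[X$(n + 1)]" n "t *[Y$n] y"] yc tc by auto
  have "cdiff X n x = 0[X$(n + 1)]" using *(3) dX(1)[OF *(1)] by (metis X.minus_minus X.a_inv_zero)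
  then show ?thesis using that[OF t(1) _ *(2,4)] *(1) by (simp add: mem_cocycles)
qed

lemma exact_target:
  assumes S: "msys R S" and eX: "exact_at R S X n" and eC: "exact_at R S C n"
  shows "exact_at R S Y n"
  unfolding exact_at_def
proof
  fix y assume y: "y \<in> cyc Y n"
  note SD = msysD[OF S]
  obtain t x y' where t: "t \<in> S" "x \<in> cyc X n" "y' \<in> el Y (n - 1)" "t *[Y$n] y = f n x +[Y$n] cdiff Y (n - 1) y'"
    by (rule target_sat[OF S eC y])
  have xc: "x \<in> el X n" "cdiff X n x = 0[X$(n + 1)]" using t(2) by (auto simp: mem_cocycles)
  obtain u x' where u: "u \<in> S" "x' \<in> el X (n - 1)" "cdiff X (n - 1) x' = u *[X$n] x" by (rule exact_atD[OF eX xc])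
  have c: "u \<in> carrier R" "t \<in> carrier R" "y \<in> el Y n" using u t SD y by (auto simp: mem_cocycles)
  have "(u \<otimes>\<^bsub>R\<^esub> t) *[Y$n] y = cdiff Y (n - 1) (f (n - 1) x' +[Y$(n - 1)] u *[Y$(n - 1)] y')"
    using c xc t(3,4) u(2,3) chain_mapsD(3)[OF f u(2)] by (simp add: Y.smult_assoc1 Y.smult_r_distr dY fs)
  then have "(u \<otimes>\<^bsub>R\<^esub> t) *[Y$n] y \<in> bd Y n"
    using u(2) t(3) c fs unfolding mem_coboundaries by auto
  then show "y \<in> sat R S (Y$n) (bd Y n)"
    using c(3) SD(3)[OF u(1) t(1)] unfolding sat_def by auto
qed

text \<open>A null homotopy of the composite of \<open>\<psi>\<close> with the inclusion of
  \<open>Y\<close> in the cone has two components: the one in \<open>X\<close> is the lift, the one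
  in \<open>Y\<close> the homotopy between \<open>\<psi>\<close> and its image under
  \<open>f\<close>.\<close>

lemma lift_through:
  assumes Q: "Q \<in> complexes R" and null: "null_maps R Q C" and \<psi>: "\<psi> \<in> chain_maps R Q Y"
  obtains \<psi>' where "\<psi>' \<in> chain_maps R Q X" "homotopic_maps R Q Y \<psi> (f \<circ>\<^sub>c \<psi>')"
proof -
  note Qm = cpxD(1)[OF Q] and dQ = cpx_simps[OF Q] and \<psi>s = cmap_simps[OF Q Y \<psi>]
  have "(\<lambda>n q. \<phi> n 0[X$(n + 1)] (\<psi> n q)) \<in> chain_maps R Q C"
  proof (rule chain_mapsI)
    fix n show "(\<lambda>q. \<phi> n 0[X$(n + 1)] (\<psi> n q)) \<in> lin_maps R (Q$n) (C$n)"
      by (intro \<phi>_lin lin_maps_zero Qm Xm chain_mapsD(1)[OF \<psi>])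
    fix q assume q: "q \<in> el Q n"
    have e: "n + 1 + 1 = n + 2" by simp
    show "\<phi> (n + 1) 0[X$(n + 1 + 1)] (\<psi> (n + 1) (cdiff Q n q)) = cdiff C n (\<phi> n 0[X$(n + 1)] (\<psi> n q))"
      using q dX(4)[of "n + 1"] by (simp add: \<phi>_diff \<psi>s fs chain_mapsD(2)[OF \<psi>] dY e)
  qed
  then have "homotopic_maps R Q C (\<lambda>n q. \<phi> n 0[X$(n + 1)] (\<psi> n q)) (zmap C)" using null unfolding null_maps_def by blast
  from nullE[OF C Q this] obtain h where h: "\<And>n. h n \<in> lin_maps R (Q$n) (C$(n - 1))"
    "\<And>n q. q \<in> el Q n ==> \<phi> n 0[X$(n + 1)] (\<psi> n q) =
       cdiff C (n - 1) (h n q) +[C$n] h (n + 1) (cdiff Q n q)" by metis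
  define \<psi>' where "\<psi>' n q = \<pi>1 (n - 1) (h n q)" for n q
  define k where "k n q = \<pi>2 (n - 1) (h n q)" for n q
  have \<psi>'l: "\<psi>' n \<in> lin_maps R (Q$n) (X$n)" for n
    using lin_maps_comp[OF h(1) \<pi>1_lin, of n] unfolding \<psi>'_def by simp
  have kl: "k n \<in> lin_maps R (Q$n) (Y$(n - 1))" for n
    using lin_maps_comp[OF h(1) \<pi>2_lin, of n] unfolding k_def by simp
  note \<psi>'s = lin_simps[OF Qm Xm \<psi>'l] and ks = lin_simps[OF Qm Ym kl]
  have hk: "h n q = \<phi> (n - 1) (\<psi>' n q) (k n q)" if "q \<in> el Q n" for n q
    using \<phi>_\<pi>[OF lin_simps(1)[OF Qm Cm h(1) that]] by (simp add: \<psi>'_def k_def)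
  have eq: "cdiff X n (\<psi>' n q) = \<psi>' (n + 1) (cdiff Q n q) \<and>
     \<psi> n q = f n (\<psi>' n q) +[Y$n] (cdiff Y (n - 1) (k n q) +[Y$n] k (n + 1) (cdiff Q n q))"
    if q: "q \<in> el Q n" for n q
  proof -
    have dq: "cdiff Q n q \<in> el Q (n + 1)" using dQ(1)[OF q] .
    have c: "\<psi>' n q \<in> el X n" "k n q \<in> el Y (n - 1)" "\<psi>' (n + 1) (cdiff Q n q) \<in> el X (n + 1)"
      "k (n + 1) (cdiff Q n q) \<in> el Y n" "\<psi> n q \<in> el Y n"
      using \<psi>'s(1)[OF q] ks(1)[OF q] \<psi>'s(1)[OF dq] ks(1)[OF dq] \<psi>s q by simp_all
    have c': "cdiff X n (\<psi>' n q) \<in> el X (n + 1)" "f n (\<psi>' n q) \<in> el Y n" "cdiff Y (n - 1) (k n q) \<in> el Y n"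
      using c dX fs dY by auto
    have "\<phi> n 0[X$(n + 1)] (\<psi> n q) = cdiff C (n - 1) (\<phi> (n - 1) (\<psi>' n q) (k n q)) +[C$n]
       \<phi> n (\<psi>' (n + 1) (cdiff Q n q)) (k (n + 1) (cdiff Q n q))"
      using h(2)[OF q] hk[OF q] hk[OF dq] by simp
    also have "\<dots> = \<phi> n (-[X$(n + 1)] cdiff X n (\<psi>' n q) +[X$(n + 1)] \<psi>' (n + 1) (cdiff Q n q))
       (f n (\<psi>' n q) +[Y$n] cdiff Y (n - 1) (k n q) +[Y$n] k (n + 1) (cdiff Q n q))"
      using c c' by (simp add: \<phi>_diff' \<phi>_add)
    finally have 1: "0[X$(n + 1)] = -[X$(n + 1)] cdiff X n (\<psi>' n q) +[X$(n + 1)] \<psi>' (n + 1) (cdiff Q n q)"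
      and 2: "\<psi> n q = f n (\<psi>' n q) +[Y$n] cdiff Y (n - 1) (k n q) +[Y$n] k (n + 1) (cdiff Q n q)"
      using c c' by (subst (asm) \<phi>_inj; simp)+
    have "cdiff X n (\<psi>' n q) = cdiff X n (\<psi>' n q) +[X$(n + 1)] 0[X$(n + 1)]" using c' by simp
    also have "\<dots> = \<psi>' (n + 1) (cdiff Q n q)" unfolding 1 using c c' by algebra
    finally show ?thesis using 2 c c' by (simp add: Y.a_assoc)
  qed
  have "\<psi>' \<in> chain_maps R Q X" by (rule chain_mapsI[OF \<psi>'l]) (simp add: eq)
  moreover from this have "homotopic_maps R Q Y \<psi> (f \<circ>\<^sub>c \<psi>')"
    by (intro htI[OF Y Q \<psi> _ kl] chain_maps_comp[OF _ f]) (simp_all add: eq cmap_comp_def)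
  ultimately show ?thesis by (rule that)
qed

text \<open>A null homotopy \<open>h\<close> of \<open>f\<close> after \<open>\<psi>\<close> makes
  \<open>(\<psi>, - h)\<close> a chain map from the shift of \<open>Q\<close> to the cone. The
  \<open>X\<close> component of its own null homotopy contracts \<open>\<psi>\<close>, up to
  sign.\<close>

lemma lift_unique:
  assumes Q: "Q \<in> complexes R" and null: "null_maps R (shift_cpx 1 Q) C" and \<psi>: "\<psi> \<in> chain_maps R Q X"
    and H: "homotopic_maps R Q Y (f \<circ>\<^sub>c \<psi>) (zmap Y)"
  shows "homotopic_maps R Q X \<psi> (zmap X)"
proof -
  note Qm = cpxD(1)[OF Q] and dQ = cpx_simps[OF Q] and \<psi>s = cmap_simps[OF Q X \<psi>]
  from nullE[OF Y Q H] obtain h where h: "\<And>n. h n \<in> lin_maps R (Q$n) (Y$(n - 1))"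
    "\<And>n q. q \<in> el Q n ==> f n (\<psi> n q) = cdiff Y (n - 1) (h n q) +[Y$n] h (n + 1) (cdiff Q n q)"
    unfolding cmap_comp_def by metis
  note hs = lin_simps[OF Qm Ym h(1)]
  have h1: "h (n + 1) \<in> lin_maps R (Q$(n + 1)) (Y$n)" for n using h(1)[of "n + 1"] by simp
  note h1s = lin_simps[OF Qm Ym h1]
  define \<theta> where "\<theta> n q = \<phi> n (\<psi> (n + 1) q) (-[Y$n] h (n + 1) q)" for n q
  have Q1: "shift_cpx 1 Q \<in> complexes R" by (rule shift_complexes[OF Q])
  have "\<theta> \<in> chain_maps R (shift_cpx 1 Q) C"
  proof (rule chain_mapsI)
    fix n show "\<theta> n \<in> lin_maps R ((shift_cpx 1 Q)$n) (C$n)"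
      unfolding \<theta>_def by (simp, intro \<phi>_lin lin_maps_neg Qm Ym chain_mapsD(1)[OF \<psi>] h1)
    fix q assume "q \<in> el (shift_cpx 1 Q) n"
    then have q: "q \<in> el Q (n + 1)" by simp
    interpret Q2: module R "Q$(n + 2)" by (rule Qm)
    have e: "n + 1 + 1 = n + 2" by simp
    have dq: "cdiff Q (n + 1) q \<in> el Q (n + 2)" using dQ(1)[OF q] by (simp add: add.assoc)
    have hq: "h (n + 1) q \<in> el Y n" using h1s(1)[OF q] .
    have hdq: "h (n + 2) (cdiff Q (n + 1) q) \<in> el Y (n + 1)" using h1s(1)[of "cdiff Q (n + 1) q" "n + 1"] dq by (simp add: add.assoc)
    have c: "\<psi> (n + 1) q \<in> el X (n + 1)" using \<psi>s q by auto
    have "cdiff C n (\<theta> n q) = \<phi> (n + 1) (-[X$(n + 2)] cdiff X (n + 1) (\<psi> (n + 1) q))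
         (f (n + 1) (\<psi> (n + 1) q) +[Y$(n + 1)] cdiff Y n (-[Y$n] h (n + 1) q))"
      unfolding \<theta>_def using c hq by (simp add: \<phi>_diff)
    also have "f (n + 1) (\<psi> (n + 1) q) +[Y$(n + 1)] cdiff Y n (-[Y$n] h (n + 1) q) = h (n + 2) (cdiff Q (n + 1) q)"
    proof -
      have "f (n + 1) (\<psi> (n + 1) q) = cdiff Y n (h (n + 1) q) +[Y$(n + 1)] h (n + 2) (cdiff Q (n + 1) q)"
        using h(2)[OF q] by (simp add: add.assoc)
      moreover have "cdiff Y n (h (n + 1) q) +[Y$(n + 1)] h (n + 2) (cdiff Q (n + 1) q) +[Y$(n + 1)]
          -[Y$(n + 1)] cdiff Y n (h (n + 1) q) = h (n + 2) (cdiff Q (n + 1) q)"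
        using hdq dY(1)[OF hq] by algebra
      ultimately show ?thesis using hq by (simp add: dY)
    qed
    also have "-[X$(n + 2)] cdiff X (n + 1) (\<psi> (n + 1) q) = \<psi> (n + 2) (-[Q$(n + 2)] cdiff Q (n + 1) q)"
      using chain_mapsD(2)[OF \<psi> q] dq \<psi>s(5)[of "cdiff Q (n + 1) q" "n + 2"] by (simp add: add.assoc)
    also have "h (n + 2) (cdiff Q (n + 1) q) = -[Y$(n + 1)] h (n + 2) (-[Q$(n + 2)] cdiff Q (n + 1) q)"
      using h1s(5)[of "cdiff Q (n + 1) q" "n + 1"] dq hdq by (simp add: add.assoc)
    finally show "\<theta> (n + 1) (cdiff (shift_cpx 1 Q) n q) = cdiff C n (\<theta> n q)"
      by (simp add: \<theta>_def e)
  qed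
  then have "homotopic_maps R (shift_cpx 1 Q) C \<theta> (zmap C)" using null unfolding null_maps_def by blast
  from nullE[OF C Q1 this] obtain g where g: "\<And>n. g n \<in> lin_maps R ((shift_cpx 1 Q)$n) (C$(n - 1))"
    "\<And>n q. q \<in> el (shift_cpx 1 Q) n ==> \<theta> n q =
       cdiff C (n - 1) (g n q) +[C$n] g (n + 1) (cdiff (shift_cpx 1 Q) n q)" by metis
  define k where "k n q = -[X$(n - 1)] \<pi>1 (n - 2) (g (n - 1) q)" for n q
  have \<pi>gl: "(\<lambda>q. \<pi>1 (n - 2) (g (n - 1) q)) \<in> lin_maps R (Q$n) (X$(n - 1))" for n
    using lin_maps_comp[OF g(1) \<pi>1_lin, of "n - 1"] by (simp add: add.commute)
  have kl: "k n \<in> lin_maps R (Q$n) (X$(n - 1))" for n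
    unfolding k_def by (rule lin_maps_neg[OF Qm Xm \<pi>gl])
  note ks = lin_simps[OF Qm Xm kl]
  show ?thesis
  proof (rule nullI[OF X Q \<psi> kl])
    fix n q assume q: "q \<in> el Q n"
    interpret Q1: module R "Q$(n + 1)" by (rule Qm)
    have dq: "cdiff Q n q \<in> el Q (n + 1)" "-[Q$(n + 1)] cdiff Q n q \<in> el Q (n + 1)" using dQ(1)[OF q] by simp_all
    have gl: "g (n - 1) q \<in> el C (n - 2)" using lin_simps(1)[OF cpxD(1)[OF Q1] Cm g(1), of q "n - 1"] q by simp
    have gn: "g n (-[Q$(n + 1)] cdiff Q n q) \<in> el C (n - 1)"
      using lin_simps(1)[OF cpxD(1)[OF Q1] Cm g(1), of "-[Q$(n + 1)] cdiff Q n q" n] dq by simp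
    let ?x = "\<pi>1 (n - 2) (g (n - 1) q)" and ?y = "\<pi>2 (n - 2) (g (n - 1) q)"
    have x: "?x \<in> el X (n - 1)" using lin_simps(1)[OF Cm Xm \<pi>1_lin gl] by (simp add: add.commute)
    have y: "?y \<in> el Y (n - 2)" using lin_simps(1)[OF Cm Ym \<pi>2_lin gl] .
    have "cdiff C (n - 2) (g (n - 1) q) = cdiff C (n - 1 - 1) (\<phi> (n - 1 - 1) ?x ?y)" using \<phi>_\<pi>[OF gl] by simp
    also have "\<dots> = \<phi> (n - 1) (-[X$n] cdiff X (n - 1) ?x) (f (n - 1) ?x +[Y$(n - 1)] cdiff Y (n - 2) ?y)"
      using \<phi>_diff'[of ?x "n - 1" ?y] x y by simp
    finally have e1: "cdiff C (n - 2) (g (n - 1) q) = \<dots>" .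
    have cl: "-[X$n] cdiff X (n - 1) ?x \<in> el X n" "f (n - 1) ?x +[Y$(n - 1)] cdiff Y (n - 2) ?y \<in> el Y (n - 1)"
      using x y dX(7) fs(1) dY(7)[of ?y "n - 1"] by simp_all
    have \<theta>q: "\<theta> (n - 1) q = cdiff C (n - 2) (g (n - 1) q) +[C$(n - 1)] g n (-[Q$(n + 1)] cdiff Q n q)"
      using g(2)[of q "n - 1"] q by (simp add: add.commute)
    have dgl: "cdiff C (n - 2) (g (n - 1) q) \<in> el C (n - 1)" using dC(7)[of "g (n - 1) q" "n - 1"] gl by simp
    have "\<psi> n q = \<pi>1 (n - 1) (\<theta> (n - 1) q)"
      unfolding \<theta>_def using \<psi>s(1)[OF q] hs(1)[OF q] by (subst \<pi>_\<phi>) simp_all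
    also have "\<dots> = \<pi>1 (n - 1) (cdiff C (n - 2) (g (n - 1) q)) +[X$n] \<pi>1 (n - 1) (g n (-[Q$(n + 1)] cdiff Q n q))"
      unfolding \<theta>q using lin_simps(2)[OF Cm Xm \<pi>1_lin dgl gn] by simp
    also have "\<pi>1 (n - 1) (cdiff C (n - 2) (g (n - 1) q)) = cdiff X (n - 1) (k n q)"
      unfolding e1 using cl x by (subst \<pi>_\<phi>) (simp_all add: k_def dX)
    also have "\<pi>1 (n - 1) (g n (-[Q$(n + 1)] cdiff Q n q)) = k (n + 1) (cdiff Q n q)"
      using lin_simps(5)[OF Qm Xm \<pi>gl, of "cdiff Q n q" "n + 1"] dq by (simp add: k_def)
    finally show "\<psi> n q = cdiff X (n - 1) (k n q) +[X$n] k (n + 1) (cdiff Q n q)" .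
  qed
qed

end

subsection \<open>Transport of structure and existence of cones\<close>

text \<open>The structure of \<open>M\<close> carried over to the image of an injection, so that
  direct sums and free modules get carriers inside the fixed type \<open>'m\<close>.\<close>

definition tmod :: "('x \<Rightarrow> 'm) \<Rightarrow> ('a, 'x) module \<Rightarrow> ('a, 'm) module" where
  "tmod e M = \<lparr>carrier = e ` carrier M, mult = (\<lambda>u v. u), one = e 0[M], zero = e 0[M],
     add = (\<lambda>u v. e (inv_into (carrier M) e u +[M] inv_into (carrier M) e v)),
     smult = (\<lambda>r u. e (r *[M] inv_into (carrier M) e u))\<rparr>"

lemma tmod_simps:
  assumes "inj_on e (carrier M)"
  shows "carrier (tmod e M) = e ` carrier M" "0[tmod e M] = e 0[M]"
    "x \<in> carrier M ==> y \<in> carrier M ==> e x +[tmod e M] e y = e (x +[M] y)"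
    "x \<in> carrier M ==> r *[tmod e M] e x = e (r *[M] x)"
  using assms by (simp_all add: tmod_def)

lemma tmod_module:
  assumes M: "module R M" and e: "inj_on e (carrier M)"
  shows "module R (tmod e M)"
proof -
  interpret M: module R M by fact
  note t = tmod_simps[OF e]
  show ?thesis
  proof (rule moduleI)
    show "cring R" by (rule M.R.cring_axioms)
    show "abelian_group (tmod e M)"
    proof (rule abelian_groupI)
      fix x assume "x \<in> carrier (tmod e M)"
      then obtain x' where x: "x' \<in> carrier M" "x = e x'" using t by auto
      show "\<exists>y\<in>carrier (tmod e M). y +[tmod e M] x = 0[tmod e M]"
        using x by (intro bexI[of _ "e (-[M] x')"]) (simp_all add: t M.l_neg)
    qed (auto simp: t M.a_ac)
  qed (auto simp: t M.smult_l_distr M.smult_r_distr M.smult_assoc1)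
qed

definition dsum :: "('a, 'm) module \<Rightarrow> ('a, 'n) module \<Rightarrow> ('a, 'm \<times> 'n) module" where
  "dsum M N = \<lparr>carrier = carrier M \<times> carrier N, mult = (\<lambda>u v. u), one = (0[M], 0[N]), zero = (0[M], 0[N]),
     add = (\<lambda>u v. (fst u +[M] fst v, snd u +[N] snd v)),
     smult = (\<lambda>r u. (r *[M] fst u, r *[N] snd u))\<rparr>"

lemma dsum_simps [simp]:
  "carrier (dsum M N) = carrier M \<times> carrier N" "0[dsum M N] = (0[M], 0[N])"
  "u +[dsum M N] v = (fst u +[M] fst v, snd u +[N] snd v)" "r *[dsum M N] u = (r *[M] fst u, r *[N] snd u)"
  by (simp_all add: dsum_def)

lemma dsum_module:
  assumes M: "module R M" and N: "module R N" shows "module R (dsum M N)"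
proof -
  interpret M: module R M by fact
  interpret N: module R N by fact
  show ?thesis
  proof (rule moduleI)
    show "cring R" by (rule M.R.cring_axioms)
    show "abelian_group (dsum M N)"
    proof (rule abelian_groupI)
      fix x assume "x \<in> carrier (dsum M N)"
      then show "\<exists>y\<in>carrier (dsum M N). y +[dsum M N] x = 0[dsum M N]"
        by (intro bexI[of _ "(-[M] fst x, -[N] snd x)"]) (auto simp: M.l_neg N.l_neg)
    qed (auto simp: M.a_ac N.a_ac)
  qed (auto simp: M.smult_l_distr M.smult_r_distr M.smult_assoc1 N.smult_l_distr N.smult_r_distr N.smult_assoc1)
qed

lemma infinite_pairing:
  assumes "infinite (UNIV :: 'm set)"
  obtains e :: "'m \<times> 'm \<Rightarrow> 'm" where "inj e"
proof -
  have "(card_of (UNIV \<times> UNIV :: ('m \<times> 'm) set), card_of (UNIV :: 'm set)) \<in> ordIso" by (rule card_of_Times_same_infinite[OF assms])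
  then obtain e where "bij_betw e (UNIV \<times> UNIV :: ('m \<times> 'm) set) (UNIV :: 'm set)" using card_of_ordIso by blast
  then show ?thesis using that by (auto simp: bij_betw_def)
qed

text \<open>An infinite type embeds its own square: the cone is built on pairs of elements of
  \<open>'m\<close> and transported back.\<close>

lemma mcone_exists:
  fixes X Y :: "('a, 'm) cpx"
  assumes inf: "infinite (UNIV :: 'm set)" and X: "X \<in> complexes R" and Y: "Y \<in> complexes R" and f: "f \<in> chain_maps R X Y"
  obtains C \<phi> where "mcone R X Y f C \<phi>"
proof -
  obtain e :: "'m \<times> 'm \<Rightarrow> 'm" where e: "inj e" by (rule infinite_pairing[OF inf])
  note Xm = cpxD(1)[OF X] and Ym = cpxD(1)[OF Y]
  note dX = cpx_simps[OF X] and dY = cpx_simps[OF Y] and fs = cmap_simps[OF X Y f]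
  have ei: "inj_on e A" for A using e by (rule inj_on_subset) simp
  have [simp]: "e u = e v \<longleftrightarrow> u = v" for u v using e by (simp add: inj_eq)
  define D where "D n = dsum (X$(n + 1)) (Y$n)" for n
  define \<delta> where "\<delta> n u = (-[X$(n + 2)] cdiff X (n + 1) (fst u), f (n + 1) (fst u) +[Y$(n + 1)] cdiff Y n (snd u))" for n u
  define C where "C = \<lparr>cmod = (\<lambda>n. tmod e (D n)), cdiff = (\<lambda>n c. e (\<delta> n (inv_into UNIV e c)))\<rparr>"
  have Dm: "module R (D n)" for n unfolding D_def by (rule dsum_module[OF Xm Ym])
  note t = tmod_simps[OF ei]
  have cd: "cdiff C n (e u) = e (\<delta> n u)" for n u unfolding C_def using inv_into_f_f[OF e] by simp
  have cm: "C$n = tmod e (D n)" for n by (simp add: C_def)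
  have e12: "n + 1 + 1 = n + 2" for n :: int by simp
  have dX1: "cdiff X (n + 1) x \<in> el X (n + 2)" if "x \<in> el X (n + 1)" for n x
    using dX(1)[OF that] by (simp add: add.assoc)
  have \<delta>_lin: "\<delta> n \<in> lin_maps R (D n) (D (n + 1))" for n
  proof (rule lin_mapsI)
    interpret X2: module R "X$(n + 2)" by (rule Xm)
    interpret Y1: module R "Y$(n + 1)" by (rule Ym)
    note dX' = dX[where n = "n + 1", unfolded e12]
    fix u assume u: "u \<in> carrier (D n)"
    then have uc: "fst u \<in> el X (n + 1)" "snd u \<in> el Y n" by (auto simp: D_def)
    then have c: "cdiff X (n + 1) (fst u) \<in> el X (n + 2)" "f (n + 1) (fst u) \<in> el Y (n + 1)"
       "cdiff Y n (snd u) \<in> el Y (n + 1)" using dX1 fs dY by auto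
    show "\<delta> n u \<in> carrier (D (n + 1))" using c by (simp add: \<delta>_def D_def e12)
    show "\<delta> n (r *[D n] u) = r *[D (n + 1)] \<delta> n u" if "r \<in> carrier R" for r
      using that uc c by (simp add: \<delta>_def D_def e12 dX' dY fs X2.smult_r_minus Y1.smult_r_distr)
    fix v assume v: "v \<in> carrier (D n)"
    then have vc: "fst v \<in> el X (n + 1)" "snd v \<in> el Y n" by (auto simp: D_def)
    then have c': "cdiff X (n + 1) (fst v) \<in> el X (n + 2)" "f (n + 1) (fst v) \<in> el Y (n + 1)"
       "cdiff Y n (snd v) \<in> el Y (n + 1)" using dX1 fs dY by auto
    show "\<delta> n (u +[D n] v) = \<delta> n u +[D (n + 1)] \<delta> n v"
      using uc vc c c' by (simp add: \<delta>_def D_def e12 dX' dY fs X2.minus_add Y1.a_ac X2.a_comm)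
  qed
  have \<delta>\<delta>: "\<delta> (n + 1) (\<delta> n u) = 0[D (n + 2)]" if u: "u \<in> carrier (D n)" for n u
  proof -
    interpret X2: module R "X$(n + 2)" by (rule Xm)
    interpret X3: module R "X$(n + 2 + 1)" by (rule Xm)
    interpret Y1: module R "Y$(n + 1)" by (rule Ym)
    interpret Y2: module R "Y$(n + 2)" by (rule Ym)
    have uc: "fst u \<in> el X (n + 1)" "snd u \<in> el Y n" using u by (auto simp: D_def)
    then have c: "cdiff X (n + 1) (fst u) \<in> el X (n + 2)" "f (n + 1) (fst u) \<in> el Y (n + 1)"
       "cdiff Y n (snd u) \<in> el Y (n + 1)" using dX1 fs dY by auto
    have 1: "cdiff X (n + 2) (-[X$(n + 2)] cdiff X (n + 1) (fst u)) = 0[X$(n + 2 + 1)]"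
    proof -
      have "cdiff X (n + 2) (cdiff X (n + 1) (fst u)) = 0[X$(n + 2 + 1)]"
        using cpxD(4)[OF X uc(1)] by (simp add: add.assoc)
      then show ?thesis by (simp only: dX(5)[OF c(1)] X3.a_inv_zero)
    qed
    have 2: "f (n + 2) (-[X$(n + 2)] cdiff X (n + 1) (fst u)) = -[Y$(n + 2)] cdiff Y (n + 1) (f (n + 1) (fst u))"
      using c fs(5)[of "cdiff X (n + 1) (fst u)" "n + 2"] chain_mapsD(2)[OF f uc(1)] by (simp add: add.assoc)
    have 3: "cdiff Y (n + 1) (f (n + 1) (fst u) +[Y$(n + 1)] cdiff Y n (snd u)) = cdiff Y (n + 1) (f (n + 1) (fst u))"
      using c dY(2)[of "f (n + 1) (fst u)" "n + 1" "cdiff Y n (snd u)"] cpxD(4)[OF Y uc(2)] dY(1)[of "f (n + 1) (fst u)" "n + 1"]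
      by (simp add: add.assoc)
    have 4: "cdiff Y (n + 1) (f (n + 1) (fst u)) \<in> el Y (n + 2)" using dY(1)[OF c(2)] by (simp add: add.assoc)
    have e3: "n + 1 + 2 = n + 2 + 1" by simp
    show ?thesis unfolding \<delta>_def D_def dsum_simps fst_conv snd_conv e12 e3 1 2 3 X3.a_inv_zero Y2.l_neg[OF 4] ..
  qed
  have Cc: "C \<in> complexes R" unfolding complexes_def
  proof (intro CollectI conjI allI ballI)
    fix n show "module R (C$n)" unfolding cm by (rule tmod_module[OF Dm ei])
    note ls = lin_simps[OF Dm Dm \<delta>_lin]
    interpret D: module R "D n" by (rule Dm)
    show "cdiff C n \<in> lin_maps R (C$n) (C$(n + 1))"
      by (rule lin_mapsI) (auto simp: cm t cd ls)
    fix c assume "c \<in> el C n"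
    then obtain u where "u \<in> carrier (D n)" "c = e u" unfolding cm t by auto
    then show "cdiff C (n + 1) (cdiff C n c) = 0[C$(n + 2)]" by (simp add: cd \<delta>\<delta> cm t)
  qed
  have "mcone R X Y f C (\<lambda>n x y. e (x, y))"
  proof (rule mcone.intro[OF X Y f Cc])
    fix n
    show "bij_betw (\<lambda>(x, y). e (x, y)) (el X (n + 1) \<times> el Y n) (el C n)"
      unfolding cm t(1) D_def bij_betw_def by (auto simp: inj_on_def)
    fix x y assume xy: "x \<in> el X (n + 1)" "y \<in> el Y n"
    then have u: "(x, y) \<in> carrier (D n)" by (simp add: D_def)
    show "cdiff C n (e (x, y)) = e (-[X$(n + 2)] cdiff X (n + 1) x, f (n + 1) x +[Y$(n + 1)] cdiff Y n y)"
      by (simp add: cd \<delta>_def)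
    show "e (r *[X$(n + 1)] x, r *[Y$n] y) = r *[C$n] e (x, y)" for r
      unfolding cm using u by (subst t) (simp_all add: D_def)
    fix x' y' assume "x' \<in> el X (n + 1)" "y' \<in> el Y n"
    then have u': "(x', y') \<in> carrier (D n)" by (simp add: D_def)
    show "e (x +[X$(n + 1)] x', y +[Y$n] y') = e (x, y) +[C$n] e (x', y')"
      unfolding cm using u u' by (subst t) (simp_all add: D_def)
  qed
  then show ?thesis by (rule that)
qed

lemma mapping_cone_mcone:
  assumes X: "X \<in> complexes R" and Y: "Y \<in> complexes R" and f: "f \<in> chain_maps R X Y"
    and C: "mapping_cone R X Y f C i p"
  obtains \<phi> where "mcone R X Y f C \<phi>"
proof -
  obtain \<phi> where \<phi>: "\<forall>n. bij_betw (\<lambda>(x, y). \<phi> n x y)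
          (el X (n + 1) \<times> el Y n) (el C n) \<and>
        (\<forall>x\<in>el X (n + 1). \<forall>y\<in>el Y n.
           (\<forall>x'\<in>el X (n + 1). \<forall>y'\<in>el Y n.
              \<phi> n (x +[X$(n + 1)] x') (y +[Y$n] y') =
                \<phi> n x y +[C$n] \<phi> n x' y') \<and>
           (\<forall>r\<in>carrier R.
              \<phi> n (r *[X$(n + 1)] x) (r *[Y$n] y) = r *[C$n] \<phi> n x y) \<and>
           cdiff C n (\<phi> n x y) =
             \<phi> (n + 1) (-[X$(n + 2)] cdiff X (n + 1) x)
               (f (n + 1) x +[Y$(n + 1)] cdiff Y n y) \<and>
           p n (\<phi> n x y) = x \<and>
           i n y = \<phi> n 0[X$(n + 1)] y)" and Cc: "C \<in> complexes R"
    using C unfolding mapping_cone_def by auto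
  have "mcone R X Y f C \<phi>"
    by (rule mcone.intro[OF X Y f Cc]) (use \<phi> in simp_all)
  then show ?thesis by (rule that)
qed

subsection \<open>Quasi-isomorphisms\<close>

lemma (in module) coset_eq_iff:
  assumes B: "submodule B R M" and z: "z \<in> carrier M" "z' \<in> carrier M"
  shows "B +>\<^bsub>M\<^esub> z = B +>\<^bsub>M\<^esub> z' \<longleftrightarrow> z -[M] z' \<in> B"
proof -
  note D = submoduleD[OF B]
  have mem: "c \<in> B +>\<^bsub>M\<^esub> y \<longleftrightarrow> (\<exists>b\<in>B. c = b +[M] y)" for c y by (auto simp: a_r_coset_def')
  have sub: "B +>\<^bsub>M\<^esub> y \<subseteq> B +>\<^bsub>M\<^esub> y'" if y: "y \<in> carrier M" "y' \<in> carrier M" and d: "y -[M] y' \<in> B" for y y'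
  proof
    fix c assume "c \<in> B +>\<^bsub>M\<^esub> y"
    then obtain b where b: "b \<in> B" "c = b +[M] y" using mem by auto
    have "c = (b +[M] (y -[M] y')) +[M] y'" unfolding b(2) using y D(1)[OF b(1)] by algebra
    then show "c \<in> B +>\<^bsub>M\<^esub> y'" using mem D(3)[OF b(1) d] by blast
  qed
  have "z' -[M] z \<in> B" if "z -[M] z' \<in> B"
  proof -
    have "z' -[M] z = -[M] (z -[M] z')" using z by algebra
    then show ?thesis using D(4)[OF that] by simp
  qed
  moreover have "z -[M] z' \<in> B" if e: "B +>\<^bsub>M\<^esub> z = B +>\<^bsub>M\<^esub> z'"
  proof -
    have "0[M] +[M] z \<in> B +>\<^bsub>M\<^esub> z" using mem D(2) by blast
    then obtain b where "b \<in> B" "z = b +[M] z'" using e mem z by auto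
    moreover have "b +[M] z' -[M] z' = b" using z D(1)[OF \<open>b \<in> B\<close>] by algebra
    ultimately show ?thesis by simp
  qed
  ultimately show ?thesis using sub z by blast
qed

lemma cohomology_map_coset:
  assumes X: "X \<in> complexes R" and Y: "Y \<in> complexes R" and f: "f \<in> chain_maps R X Y" and z: "z \<in> el X n"
  shows "cohomology_map Y f n (bd X n +>\<^bsub>X$n\<^esub> z) = bd Y n +>\<^bsub>Y$n\<^esub> f n z"
proof -
  interpret Xn: module R "X$n" by (rule cpxD(1)[OF X])
  interpret Yn: module R "Y$n" by (rule cpxD(1)[OF Y])
  note DX = Xn.submoduleD[OF coboundaries_submodule[OF X]] and DY = Yn.submoduleD[OF coboundaries_submodule[OF Y]]
  note fs = cmap_simps[OF X Y f]
  have fB: "f n b \<in> bd Y n" if "b \<in> bd X n" for b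
    using that chain_mapsD(3)[OF f] fs by (auto simp: mem_coboundaries)
  show ?thesis
  proof (intro equalityI subsetI)
    fix c assume "c \<in> cohomology_map Y f n (bd X n +>\<^bsub>X$n\<^esub> z)"
    then obtain b b' where b: "b \<in> bd Y n" "b' \<in> bd X n" "c = b +[Y$n] f n (b' +[X$n] z)"
      by (auto simp: cohomology_map_def set_add_def' a_r_coset_def')
    have "c = (b +[Y$n] f n b') +[Y$n] f n z"
      unfolding b(3) using DX(1)[OF b(2)] DY(1)[OF b(1)] z by (simp add: fs Yn.a_assoc)
    then show "c \<in> bd Y n +>\<^bsub>Y$n\<^esub> f n z" using DY(3)[OF b(1) fB[OF b(2)]] by (auto simp: a_r_coset_def')
  next
    fix c assume "c \<in> bd Y n +>\<^bsub>Y$n\<^esub> f n z"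
    then obtain b where b: "b \<in> bd Y n" "c = b +[Y$n] f n z" by (auto simp: a_r_coset_def')
    have "0[X$n] +[X$n] z \<in> bd X n +>\<^bsub>X$n\<^esub> z" using DX(2) by (auto simp: a_r_coset_def')
    then have "z \<in> bd X n +>\<^bsub>X$n\<^esub> z" using z by simp
    then show "c \<in> cohomology_map Y f n (bd X n +>\<^bsub>X$n\<^esub> z)"
      using b by (auto simp: cohomology_map_def set_add_def')
  qed
qed

lemma chain_map_cocycle:
  assumes X: "X \<in> complexes R" and Y: "Y \<in> complexes R" and f: "f \<in> chain_maps R X Y" and z: "z \<in> cyc X n"
  shows "f n z \<in> cyc Y n"
  using z chain_mapsD(2)[OF f, of z n] cmap_simps(1,4)[OF X Y f] by (auto simp: mem_cocycles)

text \<open>Injectivity is tested at the zero class and surjectivity on representatives, which keeps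
  cosets out of the later arguments.\<close>

lemma quasi_isos_iff:
  assumes X: "X \<in> complexes R" and Y: "Y \<in> complexes R" and f: "f \<in> chain_maps R X Y"
  shows "f \<in> quasi_isos R X Y \<longleftrightarrow>
    (\<forall>n. (\<forall>z\<in>cyc X n. f n z \<in> bd Y n \<longrightarrow> z \<in> bd X n) \<and>
         (\<forall>w\<in>cyc Y n. \<exists>z\<in>cyc X n. w -[Y$n] f n z \<in> bd Y n))"
proof -
  have "bij_betw (cohomology_map Y f n) (cohomology X n) (cohomology Y n) \<longleftrightarrow>
     (\<forall>z\<in>cyc X n. f n z \<in> bd Y n \<longrightarrow> z \<in> bd X n) \<and>
     (\<forall>w\<in>cyc Y n. \<exists>z\<in>cyc X n. w -[Y$n] f n z \<in> bd Y n)" (is "_ \<longleftrightarrow> ?I \<and> ?J") for n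
  proof -
    interpret Xn: module R "X$n" by (rule cpxD(1)[OF X])
    interpret Yn: module R "Y$n" by (rule cpxD(1)[OF Y])
    note ZX = Xn.submoduleD[OF cocycles_submodule[OF X]] and ZY = Yn.submoduleD[OF cocycles_submodule[OF Y]]
    note BX = Xn.submoduleD[OF coboundaries_submodule[OF X]] and BY = Yn.submoduleD[OF coboundaries_submodule[OF Y]]
    note fs = cmap_simps[OF X Y f]
    note cX = Xn.coset_eq_iff[OF coboundaries_submodule[OF X]] and cY = Yn.coset_eq_iff[OF coboundaries_submodule[OF Y]]
    note cm = cohomology_map_coset[OF X Y f]
    have fZ: "f n z \<in> cyc Y n" if "z \<in> cyc X n" for z by (rule chain_map_cocycle[OF X Y f that])
    have inj: "inj_on (cohomology_map Y f n) (cohomology X n) \<longleftrightarrow> ?I"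
    proof
      assume i: "inj_on (cohomology_map Y f n) (cohomology X n)"
      show ?I
      proof (intro ballI impI)
        fix z assume z: "z \<in> cyc X n" and fz: "f n z \<in> bd Y n"
        have "cohomology_map Y f n (bd X n +>\<^bsub>X$n\<^esub> z) = cohomology_map Y f n (bd X n +>\<^bsub>X$n\<^esub> 0[X$n])"
          using fz ZX(1)[OF z] by (simp add: cm cY fs a_minus_def)
        then have "bd X n +>\<^bsub>X$n\<^esub> z = bd X n +>\<^bsub>X$n\<^esub> 0[X$n]"
          using i z ZX(2) unfolding inj_on_def cohomology_def by blast
        then show "z \<in> bd X n" using ZX(1)[OF z] by (simp add: cX a_minus_def)
      qed
    next
      assume I: ?I
      show "inj_on (cohomology_map Y f n) (cohomology X n)"
      proof (rule inj_onI)
        fix c c' assume "c \<in> cohomology X n" "c' \<in> cohomology X n" and e: "cohomology_map Y f n c = cohomology_map Y f n c'"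
        then obtain z z' where z: "z \<in> cyc X n" "z' \<in> cyc X n" "c = bd X n +>\<^bsub>X$n\<^esub> z" "c' = bd X n +>\<^bsub>X$n\<^esub> z'"
          unfolding cohomology_def by auto
        have "f n (z -[X$n] z') \<in> bd Y n"
          using e ZX(1)[OF z(1)] ZX(1)[OF z(2)] unfolding z(3,4) by (simp add: cm cY fs)
        then have "z -[X$n] z' \<in> bd X n" using I ZX(6)[OF z(1,2)] by blast
        then show "c = c'" unfolding z(3,4) using ZX(1)[OF z(1)] ZX(1)[OF z(2)] by (simp add: cX)
      qed
    qed
    have im: "cohomology_map Y f n ` cohomology X n = (\<lambda>z. bd Y n +>\<^bsub>Y$n\<^esub> f n z) ` cyc X n"
      unfolding cohomology_def image_image using ZX(1) by (intro image_cong refl) (simp add: cm)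
    have surj: "cohomology_map Y f n ` cohomology X n = cohomology Y n \<longleftrightarrow> ?J"
    proof -
      have "cohomology_map Y f n ` cohomology X n \<subseteq> cohomology Y n" unfolding im unfolding cohomology_def using fZ by auto
      moreover have "cohomology Y n \<subseteq> cohomology_map Y f n ` cohomology X n \<longleftrightarrow>
        (\<forall>w\<in>cyc Y n. \<exists>z\<in>cyc X n. bd Y n +>\<^bsub>Y$n\<^esub> w = bd Y n +>\<^bsub>Y$n\<^esub> f n z)"
        unfolding im unfolding cohomology_def by auto
      moreover have "\<dots> \<longleftrightarrow> ?J" using ZY(1) ZX(1) by (intro ball_cong bex_cong refl) (simp add: cY fs)
      ultimately show ?thesis by blast
    qed
    show ?thesis unfolding bij_betw_def inj surj ..
  qed
  then show ?thesis using f unfolding quasi_isos_def by auto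
qed

lemma quasi_isosD:
  assumes "f \<in> quasi_isos R X Y" shows "f \<in> chain_maps R X Y"
  using assms by (simp add: quasi_isos_def)

lemma sat_one: "module R M ==> N \<subseteq> carrier M ==> N \<subseteq> sat R {\<one>\<^bsub>R\<^esub>} M K \<longleftrightarrow> N \<subseteq> K"
  by (auto simp: sat_def module.smult_one subset_iff)

lemma exact_at_one:
  assumes X: "X \<in> complexes R" shows "exact_at R {\<one>\<^bsub>R\<^esub>} X n \<longleftrightarrow> cyc X n \<subseteq> bd X n"
  unfolding exact_at_def by (rule sat_one[OF cpxD(1)[OF X]]) (auto simp: mem_cocycles)

lemma (in mcone) exact_of_quasi_iso:
  assumes q: "f \<in> quasi_isos R X Y"
  shows "exact_at R {\<one>\<^bsub>R\<^esub>} C n"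
proof -
  note Q = q[unfolded quasi_isos_iff[OF X Y f], rule_format]
  show ?thesis
  proof (rule exact_coneI[OF X.R.msys_one])
    fix x assume x: "x \<in> cyc X (n + 1)" "f (n + 1) x \<in> sat R {\<one>\<^bsub>R\<^esub>} (Y$(n + 1)) (bd Y (n + 1))"
    then have "f (n + 1) x \<in> bd Y (n + 1)" by (auto simp: sat_def)
    then have "x \<in> bd X (n + 1)" using Q x(1) by blast
    then show "x \<in> sat R {\<one>\<^bsub>R\<^esub>} (X$(n + 1)) (bd X (n + 1))" using x(1) by (auto simp: sat_def mem_cocycles)
  next
    fix y assume y: "y \<in> cyc Y n"
    then obtain x where "x \<in> cyc X n" "y -[Y$n] f n x \<in> bd Y n" using Q by blast
    then show "\<exists>t\<in>{\<one>\<^bsub>R\<^esub>}. \<exists>x\<in>cyc X n. t *[Y$n] y -[Y$n] f n x \<in> bd Y n" using y by (auto simp: mem_cocycles)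
  qed
qed

section \<open>Maps into a cone, and cones of strictly perfect complexes\<close>

context mcone begin

text \<open>Exactness of the Hom sequence at the cone. A map \<open>(x, y)\<close> into the cone
  gives a map \<open>x\<close> out of the desuspension \<open>Q'\<close>, which injectivity makes
  null; what remains is a map into \<open>Y\<close>, which surjectivity absorbs. \<open>Q'\<close>
  is specified by equations on carriers because iterated shifts agree only there.\<close>

lemma null_into_cone:
  assumes Q: "Q \<in> complexes R" and Q': "Q' \<in> complexes R"
    and QQ: "\<And>n. Q'$n = Q$(n - 1)"
      "\<And>n q. q \<in> el Q (n - 1) ==> cdiff Q' n q = -[Q$n] cdiff Q (n - 1) q"
    and inj: "\<And>x. x \<in> chain_maps R Q' X ==> homotopic_maps R Q' Y (f \<circ>\<^sub>c x) (zmap Y) ==> homotopic_maps R Q' X x (zmap X)"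
    and surj: "\<And>y. y \<in> chain_maps R Q Y ==> \<exists>g\<in>chain_maps R Q X. homotopic_maps R Q Y y (f \<circ>\<^sub>c g)"
  shows "null_maps R Q C"
  unfolding null_maps_def
proof
  fix \<psi> assume \<psi>: "\<psi> \<in> chain_maps R Q C"
  note Qm = cpxD(1)[OF Q] and dQ = cpx_simps[OF Q] and \<psi>s = cmap_simps[OF Q C \<psi>]
  define x where "x n q = \<pi>1 n (\<psi> n q)" for n q
  define y where "y n q = \<pi>2 n (\<psi> n q)" for n q
  have xl: "x n \<in> lin_maps R (Q$n) (X$(n + 1))" for n
    unfolding x_def by (rule lin_maps_comp[OF chain_mapsD(1)[OF \<psi>] \<pi>1_lin])
  have yl: "y n \<in> lin_maps R (Q$n) (Y$n)" for n
    unfolding y_def by (rule lin_maps_comp[OF chain_mapsD(1)[OF \<psi>] \<pi>2_lin])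
  note xs = lin_simps[OF Qm Xm xl] and ys = lin_simps[OF Qm Ym yl]
  have \<psi>_eq: "\<psi> n q = \<phi> n (x n q) (y n q)" if "q \<in> el Q n" for n q
    using \<phi>_\<pi>[OF \<psi>s(1)[OF that]] by (simp add: x_def y_def)
  have e2: "n + 1 + 1 = n + 2" for n :: int by simp
  have E: "x (n + 1) (cdiff Q n q) = -[X$(n + 2)] cdiff X (n + 1) (x n q)"
    "y (n + 1) (cdiff Q n q) = f (n + 1) (x n q) +[Y$(n + 1)] cdiff Y n (y n q)" if q: "q \<in> el Q n" for n q
  proof -
    have "cdiff X (n + 1) (x n q) \<in> el X (n + 2)" using dX(1)[OF xs(1)[OF q]] by (simp only: e2)
    then have c: "-[X$(n + 2)] cdiff X (n + 1) (x n q) \<in> el X (n + 1 + 1)"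
      "f (n + 1) (x n q) +[Y$(n + 1)] cdiff Y n (y n q) \<in> el Y (n + 1)"
      using xs(1)[OF q] ys(1)[OF q] fs dY unfolding e2 by auto
    have *: "\<psi> (n + 1) (cdiff Q n q) = \<phi> (n + 1) (-[X$(n + 2)] cdiff X (n + 1) (x n q))
               (f (n + 1) (x n q) +[Y$(n + 1)] cdiff Y n (y n q))"
      using chain_mapsD(2)[OF \<psi> q] \<psi>_eq[OF q] \<phi>_diff[OF xs(1)[OF q] ys(1)[OF q]] by simp
    show "x (n + 1) (cdiff Q n q) = -[X$(n + 2)] cdiff X (n + 1) (x n q)"
      "y (n + 1) (cdiff Q n q) = f (n + 1) (x n q) +[Y$(n + 1)] cdiff Y n (y n q)"
      unfolding x_def[of "n + 1"] y_def[of "n + 1"] * by (rule \<pi>_\<phi>[OF c])+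
  qed
  \<comment> \<open>The first component, renumbered, is a chain map out of \<open>Q'\<close>; up to
    sign, the second one is a null homotopy of its composite with \<open>f\<close>.\<close>
  define X' where "X' n = x (n - 1)" for n
  have X': "X' \<in> chain_maps R Q' X"
  proof (rule chain_mapsI)
    fix n show "X' n \<in> lin_maps R (Q'$n) (X$n)" using xl[of "n - 1"] by (simp add: X'_def QQ)
    fix q assume "q \<in> el Q' n"
    then have q: "q \<in> el Q (n - 1)" by (simp add: QQ)
    have dq: "cdiff Q (n - 1) q \<in> el Q n" using dQ(7)[OF q] .
    have "x n (cdiff Q (n - 1) q) = -[X$(n + 1)] cdiff X n (x (n - 1) q)"
      using E(1)[OF q] by (simp add: add.commute)
    moreover have "cdiff X n (x (n - 1) q) \<in> el X (n + 1)" using xs(1)[OF q] dX(1) by simp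
    ultimately show "X' (n + 1) (cdiff Q' n q) = cdiff X n (X' n q)"
      using q dq by (simp add: X'_def QQ xs(5))
  qed
  have "homotopic_maps R Q' Y (f \<circ>\<^sub>c X') (zmap Y)"
  proof (rule nullI[OF Y Q' chain_maps_comp[OF X' f]])
    fix n
    show "(\<lambda>q. -[Y$(n - 1)] y (n - 1) q) \<in> lin_maps R (Q'$n) (Y$(n - 1))"
      using lin_maps_neg[OF Qm Ym yl, of "n - 1"] by (simp add: QQ)
    fix q assume "q \<in> el Q' n"
    then have q: "q \<in> el Q (n - 1)" by (simp add: QQ)
    have c: "y n (cdiff Q (n - 1) q) \<in> el Y n" "f n (x (n - 1) q) \<in> el Y n"
      "cdiff Y (n - 1) (y (n - 1) q) \<in> el Y n"
      using ys(1)[OF dQ(7)[OF q]] xs(1)[OF q] ys(1)[OF q] fs(1) dY(7) by auto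
    have "y n (cdiff Q (n - 1) q) = f n (x (n - 1) q) +[Y$n] cdiff Y (n - 1) (y (n - 1) q)" using E(2)[OF q] by simp
    then have "f n (x (n - 1) q) = -[Y$n] cdiff Y (n - 1) (y (n - 1) q) +[Y$n] y n (cdiff Q (n - 1) q)"
      using c by (simp add: Y.a_lcomm Y.l_neg)
    then show "(f \<circ>\<^sub>c X') n q = cdiff Y (n - 1) (-[Y$(n - 1)] y (n - 1) q) +[Y$n]
       -[Y$(n + 1 - 1)] y (n + 1 - 1) (cdiff Q' n q)"
      using q ys(1)[OF q] ys(5)[OF dQ(7)[OF q]] c dQ(7)[OF q] by (simp add: cmap_comp_def X'_def QQ dY)
  qed
  then have "homotopic_maps R Q' X X' (zmap X)" by (rule inj[OF X'])
  from nullE[OF X Q' this] obtain k where k: "\<And>n. k n \<in> lin_maps R (Q'$n) (X$(n - 1))"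
    "\<And>n q. q \<in> el Q' n ==> X' n q = cdiff X (n - 1) (k n q) +[X$n] k (n + 1) (cdiff Q' n q)" by metis
  define m' where "m' n = k (n + 1)" for n
  have m'l: "m' n \<in> lin_maps R (Q$n) (X$n)" for n using k(1)[of "n + 1"] by (simp add: m'_def QQ)
  note m's = lin_simps[OF Qm Xm m'l]
  have E0: "x n q = cdiff X n (m' n q) -[X$(n + 1)] m' (n + 1) (cdiff Q n q)" if q: "q \<in> el Q n" for n q
  proof -
    have "x n q = cdiff X n (k (n + 1) q) +[X$(n + 1)] k (n + 1 + 1) (-[Q$(n + 1)] cdiff Q n q)"
      using k(2)[of q "n + 1"] q QQ(2)[of q "n + 1"] by (simp add: X'_def QQ)
    then show ?thesis using m's(5)[OF dQ(1)[OF q]] by (simp add: m'_def a_minus_def)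
  qed
  \<comment> \<open>The null homotopy of \<open>x\<close> turns the second component into a chain
    map to \<open>Y\<close> by this correction.\<close>
  define Y' where "Y' n q = y n q +[Y$n] f n (m' n q)" for n q
  have Y'l: "Y' n \<in> lin_maps R (Q$n) (Y$n)" for n unfolding Y'_def
    by (intro lin_maps_add Qm Ym yl lin_maps_comp[OF m'l chain_mapsD(1)[OF f]])
  have Y': "Y' \<in> chain_maps R Q Y"
  proof (rule chain_mapsI[OF Y'l])
    fix n q assume q: "q \<in> el Q n"
    have dq: "cdiff Q n q \<in> el Q (n + 1)" using dQ(1)[OF q] .
    have c: "m' n q \<in> el X n" "m' (n + 1) (cdiff Q n q) \<in> el X (n + 1)" "y n q \<in> el Y n"
      using m's q dq ys by auto
    have c': "cdiff Y n (y n q) \<in> el Y (n + 1)" "cdiff Y n (f n (m' n q)) \<in> el Y (n + 1)"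
      "f (n + 1) (m' (n + 1) (cdiff Q n q)) \<in> el Y (n + 1)" "cdiff X n (m' n q) \<in> el X (n + 1)"
      using c fs dY dX by auto
    have 1: "f (n + 1) (x n q) = cdiff Y n (f n (m' n q)) -[Y$(n + 1)] f (n + 1) (m' (n + 1) (cdiff Q n q))"
      unfolding E0[OF q] using c c' by (simp add: fs chain_mapsD(2)[OF f])
    have "Y' (n + 1) (cdiff Q n q) = f (n + 1) (x n q) +[Y$(n + 1)] cdiff Y n (y n q) +[Y$(n + 1)] f (n + 1) (m' (n + 1) (cdiff Q n q))"
      unfolding Y'_def E(2)[OF q] ..
    also have "\<dots> = cdiff Y n (y n q) +[Y$(n + 1)] cdiff Y n (f n (m' n q))" unfolding 1 using c' by algebra
    also have "\<dots> = cdiff Y n (Y' n q)" unfolding Y'_def using c by (simp add: dY fs)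
    finally show "Y' (n + 1) (cdiff Q n q) = cdiff Y n (Y' n q)" .
  qed
  obtain g where g: "g \<in> chain_maps R Q X" and "homotopic_maps R Q Y Y' (f \<circ>\<^sub>c g)" using surj[OF Y'] by blast
  from htE[OF Y Q this(2)] obtain l where l: "\<And>n. l n \<in> lin_maps R (Q$n) (Y$(n - 1))"
    "\<And>n q. q \<in> el Q n ==> Y' n q = f n (g n q) +[Y$n] (cdiff Y (n - 1) (l n q) +[Y$n] l (n + 1) (cdiff Q n q))"
    unfolding cmap_comp_def by metis
  note ls = lin_simps[OF Qm Ym l(1)] and gs = cmap_simps[OF Q X g]
  \<comment> \<open>As \<open>g\<close> commutes with the differentials, subtracting it preserves
    the formula for \<open>x\<close>, while the corrected second component becomes a boundary
    expression in \<open>l\<close>.\<close>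
  define k' where "k' n q = m' n q -[X$n] g n q" for n q
  have k'l: "k' n \<in> lin_maps R (Q$n) (X$n)" for n
    unfolding k'_def by (intro lin_maps_diff Qm Xm m'l chain_mapsD(1)[OF g])
  note k's = lin_simps[OF Qm Xm k'l]
  have E3: "x n q = cdiff X n (k' n q) -[X$(n + 1)] k' (n + 1) (cdiff Q n q)" if q: "q \<in> el Q n" for n q
  proof -
    have dq: "cdiff Q n q \<in> el Q (n + 1)" using dQ(1)[OF q] .
    have c: "m' n q \<in> el X n" "g n q \<in> el X n" using m's(1) gs(1) q by auto
    have "cdiff X n (m' n q) \<in> el X (n + 1)" "cdiff X n (g n q) \<in> el X (n + 1)"
      "m' (n + 1) (cdiff Q n q) \<in> el X (n + 1)" using c dX m's(1)[OF dq] by auto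
    then show ?thesis unfolding E0[OF q] k'_def chain_mapsD(2)[OF g q] dX(6)[OF c] by algebra
  qed
  have KY: "y n q +[Y$n] f n (k' n q) = cdiff Y (n - 1) (l n q) +[Y$n] l (n + 1) (cdiff Q n q)" if q: "q \<in> el Q n" for n q
  proof -
    have c: "m' n q \<in> el X n" "g n q \<in> el X n" using m's(1) gs(1) q by auto
    have c': "f n (m' n q) \<in> el Y n" "f n (g n q) \<in> el Y n" "y n q \<in> el Y n"
      "cdiff Y (n - 1) (l n q) \<in> el Y n" "l (n + 1) (cdiff Q n q) \<in> el Y n"
      using c fs ys(1)[OF q] ls(1)[OF q] ls(1)[OF dQ(1)[OF q]] dY(7) by auto
    have "y n q +[Y$n] f n (k' n q) = Y' n q -[Y$n] f n (g n q)"
      unfolding k'_def Y'_def fs(6)[OF c] using c' by algebra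
    also have "\<dots> = cdiff Y (n - 1) (l n q) +[Y$n] l (n + 1) (cdiff Q n q)" unfolding l(2)[OF q] using c' by algebra
    finally show ?thesis .
  qed
  show "homotopic_maps R Q C \<psi> (zmap C)"
  proof (rule nullI[OF C Q \<psi>])
    fix n
    have "(\<lambda>q. -[X$n] k' n q) \<in> lin_maps R (Q$n) (X$(n - 1 + 1))" using lin_maps_neg[OF Qm Xm k'l] by simp
    then show "(\<lambda>q. \<phi> (n - 1) (-[X$n] k' n q) (l n q)) \<in> lin_maps R (Q$n) (C$(n - 1))" by (rule \<phi>_lin[OF _ l(1)])
    fix q assume q: "q \<in> el Q n"
    have dq: "cdiff Q n q \<in> el Q (n + 1)" using dQ(1)[OF q] .
    have c: "k' n q \<in> el X n" "k' (n + 1) (cdiff Q n q) \<in> el X (n + 1)" "y n q \<in> el Y n"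
      "l n q \<in> el Y (n - 1)" "l (n + 1) (cdiff Q n q) \<in> el Y n"
      using k's q dq ys ls(1)[OF q] ls(1)[OF dq] by simp_all
    have c': "cdiff Y (n - 1) (l n q) \<in> el Y n" "cdiff X n (k' n q) \<in> el X (n + 1)" "f n (k' n q) \<in> el Y n"
      using c fs dY dX by auto
    have d1: "cdiff C (n - 1) (\<phi> (n - 1) (-[X$n] k' n q) (l n q)) =
       \<phi> n (cdiff X n (k' n q)) (-[Y$n] f n (k' n q) +[Y$n] cdiff Y (n - 1) (l n q))"
      using c c' by (simp add: \<phi>_diff' dX fs)
    have "cdiff C (n - 1) (\<phi> (n - 1) (-[X$n] k' n q) (l n q)) +[C$n]
       \<phi> n (-[X$(n + 1)] k' (n + 1) (cdiff Q n q)) (l (n + 1) (cdiff Q n q)) =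
       \<phi> n (cdiff X n (k' n q) +[X$(n + 1)] -[X$(n + 1)] k' (n + 1) (cdiff Q n q))
         (-[Y$n] f n (k' n q) +[Y$n] cdiff Y (n - 1) (l n q) +[Y$n] l (n + 1) (cdiff Q n q))"
      unfolding d1 using c c' by (subst \<phi>_add) auto
    also have "cdiff X n (k' n q) +[X$(n + 1)] -[X$(n + 1)] k' (n + 1) (cdiff Q n q) = x n q"
      using E3[OF q] by (simp add: a_minus_def)
    also have "-[Y$n] f n (k' n q) +[Y$n] cdiff Y (n - 1) (l n q) +[Y$n] l (n + 1) (cdiff Q n q) = y n q"
    proof -
      have "-[Y$n] f n (k' n q) +[Y$n] cdiff Y (n - 1) (l n q) +[Y$n] l (n + 1) (cdiff Q n q) =
        (cdiff Y (n - 1) (l n q) +[Y$n] l (n + 1) (cdiff Q n q)) -[Y$n] f n (k' n q)" using c c' by algebra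
      also have "\<dots> = (y n q +[Y$n] f n (k' n q)) -[Y$n] f n (k' n q)" using KY[OF q] by simp
      also have "\<dots> = y n q" using c c' by algebra
      finally show ?thesis .
    qed
    finally show "\<psi> n q = cdiff C (n - 1) (\<phi> (n - 1) (-[X$n] k' n q) (l n q)) +[C$n]
       \<phi> (n + 1 - 1) (-[X$(n + 1)] k' (n + 1) (cdiff Q n q)) (l (n + 1) (cdiff Q n q))"
      using \<psi>_eq[OF q] by simp
  qed
qed

text \<open>The dual bases of the two summands are concatenated.\<close>

lemma fgp_cone:
  assumes "fgp R (X$(n + 1))" "fgp R (Y$n)"
  shows "fgp R (C$n)"
proof -
  obtain m b u where b: "\<And>i. i < m ==> b i \<in> el X (n + 1)" "\<And>i. i < m ==> u i \<in> lin_maps R (X$(n + 1)) (selfmod R)"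
      "\<And>x. x \<in> el X (n + 1) ==> x = lc (X$(n + 1)) (\<lambda>i. u i x) b m"
    using assms(1) unfolding fgp_def by blast
  obtain m' b' u' where b': "\<And>i. i < m' ==> b' i \<in> el Y n" "\<And>i. i < m' ==> u' i \<in> lin_maps R (Y$n) (selfmod R)"
      "\<And>x. x \<in> el Y n ==> x = lc (Y$n) (\<lambda>i. u' i x) b' m'"
    using assms(2) unfolding fgp_def by blast
  define B where "B i = (if i < m then \<phi> n (b i) 0[Y$n] else \<phi> n 0[X$(n + 1)] (b' (i - m)))" for i
  define U where "U i = (if i < m then (\<lambda>c. u i (\<pi>1 n c)) else (\<lambda>c. u' (i - m) (\<pi>2 n c)))" for i
  have il: "(\<lambda>x. \<phi> n x 0[Y$n]) \<in> lin_maps R (X$(n + 1)) (C$n)" by (intro \<phi>_lin lin_maps_id lin_maps_zero Xm Ym)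
  have jl: "(\<lambda>y. \<phi> n 0[X$(n + 1)] y) \<in> lin_maps R (Y$n) (C$n)" by (intro \<phi>_lin lin_maps_id lin_maps_zero Xm Ym)
  have uc: "i < m ==> x \<in> el X (n + 1) ==> u i x \<in> carrier R" for i x
    using lin_simps(1)[OF Xm X.R.selfmod_module b(2)] by simp
  have u'c: "i < m' ==> x \<in> el Y n ==> u' i x \<in> carrier R" for i x
    using lin_simps(1)[OF Ym X.R.selfmod_module b'(2)] by simp
  show ?thesis unfolding fgp_def
  proof (intro conjI exI[of _ "m + m'"] exI[of _ B] exI[of _ U] allI impI ballI)
    show "module R (C$n)" by (rule Cm)
    fix i assume i: "i < m + m'"
    show "B i \<in> el C n" using b b' i by (auto simp: B_def intro!: \<phi>_closed)
    show "U i \<in> lin_maps R (C$n) (selfmod R)"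
      using i lin_maps_comp[OF \<pi>1_lin b(2)] lin_maps_comp[OF \<pi>2_lin b'(2)] by (auto simp: U_def)
  next
    fix c assume "c \<in> el C n"
    then obtain x y where xy: "x \<in> el X (n + 1)" "y \<in> el Y n" "c = \<phi> n x y" by (rule \<phi>_surj)
    have 1: "lc (C$n) (\<lambda>i. U i c) B m = \<phi> n x 0[Y$n]"
    proof -
      have "lc (C$n) (\<lambda>i. U i c) B m = lc (C$n) (\<lambda>i. u i x) (\<lambda>i. \<phi> n (b i) 0[Y$n]) m"
        by (rule lc_cong) (simp add: U_def B_def xy \<pi>_\<phi>)
      also have "\<dots> = \<phi> n (lc (X$(n + 1)) (\<lambda>i. u i x) b m) 0[Y$n]"
        using lin_maps_lc[OF Xm Cm il, of m "\<lambda>i. u i x" b] uc xy b by simp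
      finally show ?thesis using b(3)[OF xy(1)] by simp
    qed
    have 2: "lc (C$n) (\<lambda>i. U i c) B (m + k) = \<phi> n x (lc (Y$n) (\<lambda>i. u' i y) b' k)" if "k \<le> m'" for k
      using that
    proof (induction k)
      case 0 then show ?case using 1 by simp
    next
      case (Suc k)
      have l: "lc (Y$n) (\<lambda>i. u' i y) b' k \<in> el Y n" using Suc u'c b' xy by (intro Y.lc_closed) auto
      have k: "k < m'" using Suc by simp
      have "lc (C$n) (\<lambda>i. U i c) B (m + Suc k) = \<phi> n x (lc (Y$n) (\<lambda>i. u' i y) b' k) +[C$n]
          u' k y *[C$n] \<phi> n 0[X$(n + 1)] (b' k)"
      proof -
        have "U (m + k) c = u' k y" "B (m + k) = \<phi> n 0[X$(n + 1)] (b' k)"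
          by (simp_all add: U_def B_def xy \<pi>_\<phi>)
        then show ?thesis using Suc by simp
      qed
      also have "\<dots> = \<phi> n x (lc (Y$n) (\<lambda>i. u' i y) b' k) +[C$n] \<phi> n 0[X$(n + 1)] (u' k y *[Y$n] b' k)"
        using \<phi>_smult[of "0[X$(n + 1)]" n "b' k" "u' k y"] u'c[OF k xy(2)] b'(1)[OF k] by simp
      also have "\<dots> = \<phi> n x (lc (Y$n) (\<lambda>i. u' i y) b' (Suc k))"
        using \<phi>_add[OF xy(1) l, of "0[X$(n + 1)]" "u' k y *[Y$n] b' k"] u'c[OF k xy(2)] b'(1)[OF k] xy by simp
      finally show ?case .
    qed
    from 2[of m'] show "c = lc (C$n) (\<lambda>i. U i c) B (m + m')" using b'(3)[OF xy(2)] xy(3) by simp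
  qed
qed

lemma perf_cone:
  assumes PX: "perf_cpx R X" and PY: "perf_cpx R Y"
  shows "perf_cpx R C"
proof -
  obtain a b where ab: "\<And>n. n < a \<or> b < n ==> el X n = {0[X$n]}"
    using perfD(2)[OF PX] unfolding bounded_cpx_def by blast
  obtain a' b' where ab': "\<And>n. n < a' \<or> b' < n ==> el Y n = {0[Y$n]}"
    using perfD(2)[OF PY] unfolding bounded_cpx_def by blast
  have "bounded_cpx C" unfolding bounded_cpx_def
  proof (intro exI allI impI)
    fix n assume n: "n < min (a - 1) a' \<or> max b b' < n"
    have "el X (n + 1) = {0[X$(n + 1)]}" "el Y n = {0[Y$n]}"
      using n by (auto intro!: ab ab')
    then have "c = 0[C$n]" if "c \<in> el C n" for c
      using \<phi>_surj[OF that] \<phi>_zero by (metis singletonD)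
    then show "el C n = {0[C$n]}" using C.M.zero_closed by blast
  qed
  then show ?thesis using fgp_cone perfD(3)[OF PX] perfD(3)[OF PY] C by (auto simp: perf_cpx_def)
qed

end

section \<open>Koszul cones\<close>

lemma chain_maps_mult:
  assumes X: "X \<in> complexes R" and x: "x \<in> carrier R"
  shows "(\<lambda>n b. x *[X$n] b) \<in> chain_maps R X X"
  using lin_maps_smult[OF cpxD(1)[OF X] cpxD(1)[OF X] lin_maps_id x] x
  by (intro chain_mapsI) (simp_all add: cpx_simps[OF X])

lemma perf_noeth:
  assumes "noeth_cring R" "perf_cpx R X" shows "noeth_module R (X$n)"
proof -
  interpret noeth_cring R by fact
  show ?thesis using noeth_moduleI[OF cpxD(1)[OF perfD(1)] fgp_fin_gen[OF perfD(3)]] assms(2) by blast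
qed

text \<open>Exactness of the cone in degree \<open>n\<close> makes multiplication by
  \<open>x\<close> surjective on the cohomology of \<open>B\<close> at \<open>p\<close>; since
  \<open>x\<close> lies in \<open>p\<close>, Nakayama's lemma applies.\<close>

lemma koszul_exact:
  assumes R: "noeth_cring R" and B: "perf_cpx R B" and p: "primeideal p R" and x: "x \<in> p"
    and K: "mcone R B B (\<lambda>n b. x *[B$n] b) C \<phi>" and e: "exact_at R (carrier R - p) C n"
  shows "exact_at R (carrier R - p) B n"
  unfolding exact_at_def
proof -
  interpret noeth_cring R by fact
  interpret K: mcone R B B "\<lambda>n b. x *[B$n] b" C \<phi> by fact
  interpret p: primeideal p R by fact
  have S: "msys R (carrier R - p)" by (rule msys_compl_prime[OF p])
  have xc: "x \<in> carrier R" using x p.a_subset by blast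
  have fg: "fgs R (B$n) (cyc B n)"
    using perf_noeth[OF R B] cocycles_submodule[OF K.X] unfolding noeth_module_def by blast
  show "cyc B n \<subseteq> sat R (carrier R - p) (B$n) (bd B n)"
  proof (rule K.X.nakayama[OF p fg cocycles_submodule[OF K.X] coboundaries_submodule[OF K.X] coboundaries_subset_cocycles[OF K.X] x])
    fix y assume y: "y \<in> cyc B n"
    then have yc: "y \<in> el B n" "cdiff B n y = 0[B$(n + 1)]" by (auto simp: mem_cocycles)
    have dz: "cdiff B (n + 1) 0[B$(n + 1)] = 0[B$(n + 2)]" using K.dX(4)[of "n + 1"] by (simp add: add.assoc)
    have "\<phi> n 0[B$(n + 1)] y \<in> cyc C n"
      using yc dz xc by (subst K.mem_cocycles_iff) simp_all
    then obtain t where t: "t \<in> carrier R - p" "t *[C$n] \<phi> n 0[B$(n + 1)] y \<in> bd C n"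
      using e unfolding exact_at_def sat_def by blast
    have "\<phi> n 0[B$(n + 1)] (t *[B$n] y) \<in> bd C n"
      using t K.\<phi>_smult[of "0[B$(n + 1)]" n y t] yc by simp
    then obtain x' y' where *: "x' \<in> el B n" "y' \<in> el B (n - 1)"
       "0[B$(n + 1)] = -[B$(n + 1)] cdiff B n x'" "t *[B$n] y = x *[B$n] x' +[B$n] cdiff B (n - 1) y'"
      using K.mem_coboundaries_iff[of "0[B$(n + 1)]" n "t *[B$n] y"] yc t by auto
    have "cdiff B n x' = 0[B$(n + 1)]" using *(3) K.dX(1)[OF *(1)] by (metis K.X.minus_minus K.X.a_inv_zero)
    then have "x' \<in> cyc B n" using * by (simp add: mem_cocycles)
    moreover have "cdiff B (n - 1) y' \<in> bd B n" using * by (auto simp: mem_coboundaries)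
    moreover have "t *[B$n] y = cdiff B (n - 1) y' +[B$n] x *[B$n] x'"
      using * xc K.dX(7)[OF *(2)] by (simp add: K.X.a_comm)
    ultimately show "\<exists>t\<in>carrier R - p. \<exists>k\<in>bd B n. \<exists>w\<in>cyc B n. t *[B$n] y = k +[B$n] x *[B$n] w"
      using t(1) by blast
  qed
qed

text \<open>The cohomology is \<open>y\<close>-power torsion, with an exponent that may depend on
  the class. Torsion in this sense passes to cones, whereas being annihilated by \<open>y\<close>
  itself need not.\<close>

definition kills :: "('a, 'r) ring_scheme \<Rightarrow> 'a \<Rightarrow> ('a, 'm) cpx \<Rightarrow> bool" where
  "kills R y X \<longleftrightarrow> (\<forall>n. \<forall>z\<in>cyc X n. \<exists>m::nat. (y [^]\<^bsub>R\<^esub> m) *[X$n] z \<in> bd X n)"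

text \<open>A cocycle \<open>(u, v)\<close> satisfies \<open>x u = - d v\<close>, so
  \<open>x\<close> times it is the coboundary of \<open>(v, 0)\<close>.\<close>

lemma koszul_kills_self:
  assumes x: "x \<in> carrier R" and K: "mcone R B B (\<lambda>n b. x *[B$n] b) C \<phi>"
  shows "kills R x C"
  unfolding kills_def
proof (intro allI ballI)
  interpret K: mcone R B B "\<lambda>n b. x *[B$n] b" C \<phi> by fact
  fix n c assume c: "c \<in> cyc C n"
  have "c \<in> el C n" using c by (simp add: mem_cocycles)
  then obtain u v where uv: "u \<in> el B (n + 1)" "v \<in> el B n" "c = \<phi> n u v" by (rule K.\<phi>_surj)
  have z: "x *[B$(n + 1)] u +[B$(n + 1)] cdiff B n v = 0[B$(n + 1)]"
    using c uv K.mem_cocycles_iff[OF uv(1,2)] by auto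
  have dv: "cdiff B n v \<in> el B (n + 1)" using K.dX uv by auto
  have "x *[B$(n + 1)] u = (x *[B$(n + 1)] u +[B$(n + 1)] cdiff B n v) -[B$(n + 1)] cdiff B n v"
    using uv(1) x dv by algebra
  then have e: "x *[B$(n + 1)] u = -[B$(n + 1)] cdiff B n v" using dv unfolding z by (simp add: a_minus_def)
  have "x *[C$n] c = \<phi> n (x *[B$(n + 1)] u) (x *[B$n] v)" using uv x by (simp add: K.\<phi>_smult)
  also have "\<dots> \<in> bd C n"
    using uv x by (subst K.mem_coboundaries_iff)
      (simp, simp, rule bexI[of _ v], rule bexI[of _ "0[B$(n - 1)]"], simp_all add: e K.dX)
  finally show "\<exists>m::nat. (x [^]\<^bsub>R\<^esub> m) *[C$n] c \<in> bd C n" using x by (intro exI[of _ 1]) simp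
qed

text \<open>The cohomology of the cone is an extension of pieces of that of \<open>B\<close> in
  degrees \<open>n + 1\<close> and \<open>n\<close>; the two exponents add up.\<close>

lemma koszul_kills:
  assumes x: "x \<in> carrier R" and y: "y \<in> carrier R" and K: "mcone R B B (\<lambda>n b. x *[B$n] b) C \<phi>" and k: "kills R y B"
  shows "kills R y C"
  unfolding kills_def
proof (intro allI ballI)
  interpret K: mcone R B B "\<lambda>n b. x *[B$n] b" C \<phi> by fact
  fix n c assume c: "c \<in> cyc C n"
  have cc: "c \<in> el C n" using c by (simp add: mem_cocycles)
  then obtain u v where uv: "u \<in> el B (n + 1)" "v \<in> el B n" "c = \<phi> n u v" by (rule K.\<phi>_surj)
  have z: "cdiff B (n + 1) u = 0[B$(n + 1 + 1)]" "x *[B$(n + 1)] u +[B$(n + 1)] cdiff B n v = 0[B$(n + 1)]"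
    using c uv K.mem_cocycles_iff[OF uv(1,2)] by (auto simp: add.assoc)
  have dv: "cdiff B n v \<in> el B (n + 1)" using K.dX uv by auto
  have "u \<in> cyc B (n + 1)" using uv z by (simp add: mem_cocycles)
  then obtain m :: nat where "(y [^]\<^bsub>R\<^esub> m) *[B$(n + 1)] u \<in> bd B (n + 1)" using k unfolding kills_def by blast
  then obtain b where b: "b \<in> el B n" "(y [^]\<^bsub>R\<^esub> m) *[B$(n + 1)] u = cdiff B n b" by (auto simp: mem_coboundaries)
  define s where "s = y [^]\<^bsub>R\<^esub> m"
  have s: "s \<in> carrier R" using y by (simp add: s_def)
  let ?w = "s *[B$n] v +[B$n] x *[B$n] b"
  have w: "?w \<in> el B n" using s x uv b by simp
  have "cdiff B n ?w = s *[B$(n + 1)] cdiff B n v +[B$(n + 1)] x *[B$(n + 1)] (s *[B$(n + 1)] u)"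
    using s x uv b by (simp add: K.dX s_def)
  also have "\<dots> = s *[B$(n + 1)] (x *[B$(n + 1)] u +[B$(n + 1)] cdiff B n v)" using s x uv(1) dv by algebra
  also have "\<dots> = 0[B$(n + 1)]" unfolding z(2) using s by simp
  finally have "?w \<in> cyc B n" using w by (simp add: mem_cocycles)
  then obtain m' :: nat where "(y [^]\<^bsub>R\<^esub> m') *[B$n] ?w \<in> bd B n" using k unfolding kills_def by blast
  then obtain b' where b': "b' \<in> el B (n - 1)" "(y [^]\<^bsub>R\<^esub> m') *[B$n] ?w = cdiff B (n - 1) b'" by (auto simp: mem_coboundaries)
  define s' where "s' = y [^]\<^bsub>R\<^esub> m'"
  have s': "s' \<in> carrier R" using y by (simp add: s'_def)
  have "(s' \<otimes>\<^bsub>R\<^esub> s) *[C$n] c = \<phi> n ((s' \<otimes>\<^bsub>R\<^esub> s) *[B$(n + 1)] u) ((s' \<otimes>\<^bsub>R\<^esub> s) *[B$n] v)"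
    using uv s s' by (simp add: K.\<phi>_smult)
  also have "\<dots> \<in> bd C n"
  proof (subst K.mem_coboundaries_iff)
    show "\<exists>x'\<in>el B n. \<exists>y'\<in>el B (n - 1).
        (s' \<otimes>\<^bsub>R\<^esub> s) *[B$(n + 1)] u = -[B$(n + 1)] cdiff B n x' \<and>
        (s' \<otimes>\<^bsub>R\<^esub> s) *[B$n] v = x *[B$n] x' +[B$n] cdiff B (n - 1) y'"
    proof (intro bexI conjI)
      show "-[B$n] (s' *[B$n] b) \<in> el B n" using s' b by simp
      show "b' \<in> el B (n - 1)" by fact
      show "(s' \<otimes>\<^bsub>R\<^esub> s) *[B$(n + 1)] u = -[B$(n + 1)] cdiff B n (-[B$n] (s' *[B$n] b))"
        using s s' b uv by (simp add: K.dX K.X.smult_assoc1 s_def)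
      have "x *[B$n] (-[B$n] (s' *[B$n] b)) +[B$n] s' *[B$n] ?w = (s' \<otimes>\<^bsub>R\<^esub> s) *[B$n] v"
        using s s' x b(1) uv(2) by algebra
      then show "(s' \<otimes>\<^bsub>R\<^esub> s) *[B$n] v = x *[B$n] (-[B$n] (s' *[B$n] b)) +[B$n] cdiff B (n - 1) b'"
        using b'(2) by (simp add: s_def s'_def)
    qed
  qed (use uv s s' in auto)
  finally have "(s' \<otimes>\<^bsub>R\<^esub> s) *[C$n] c \<in> bd C n" .
  moreover have "s' \<otimes>\<^bsub>R\<^esub> s = y [^]\<^bsub>R\<^esub> (m' + m)" using y by (simp add: s_def s'_def K.X.R.nat_pow_mult)
  ultimately show "\<exists>m::nat. (y [^]\<^bsub>R\<^esub> m) *[C$n] c \<in> bd C n" by auto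
qed

text \<open>The bound \<open>m\<close> records by how much Koszul cones have weakened the
  orthogonality; \<open>m = 0\<close> is the original one.\<close>

definition orth :: "('a, 'r) ring_scheme \<Rightarrow> ('a, 'm) cpx \<Rightarrow> ('a, 'm) cpx \<Rightarrow> int \<Rightarrow> bool" where
  "orth R P B m \<longleftrightarrow> (\<forall>j\<ge>m. null_maps R (shift_cpx j P) B)"

text \<open>The Hom sequence for the shift by \<open>j\<close> involves \<open>B'\<close> at
  \<open>j\<close> and \<open>B\<close> at \<open>j - 1\<close>, hence the loss of one.\<close>

lemma orth_cone:
  assumes P: "P \<in> complexes R" and K: "mcone R B B' f C \<phi>" and o: "orth R P B m" "orth R P B' m"
  shows "orth R P C (m + 1)"
  unfolding orth_def
proof (intro allI impI)
  interpret K: mcone R B B' f C \<phi> by fact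
  fix j assume j: "m + 1 \<le> j"
  have e: "n - 1 + j = n + (j - 1)" "n + 1 - 1 + j = n + j" "n + 1 + (j - 1) = n + j" "n - 1 + 1 + j = n + j" for n by simp_all
  show "null_maps R (shift_cpx j P) C"
  proof (rule K.null_into_cone[of _ "shift_cpx (j - 1) P"])
    have n: "null_maps R (shift_cpx (j - 1) P) B" "null_maps R (shift_cpx j P) B'"
      using o j unfolding orth_def by auto
    show "homotopic_maps R (shift_cpx (j - 1) P) B x (zmap B)" if "x \<in> chain_maps R (shift_cpx (j - 1) P) B" for x
      using n(1) that unfolding null_maps_def by blast
    note Pj = shift_complexes[OF P, of j]
    show "\<exists>g\<in>chain_maps R (shift_cpx j P) B. homotopic_maps R (shift_cpx j P) B' y (f \<circ>\<^sub>c g)" if "y \<in> chain_maps R (shift_cpx j P) B'" for y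
    proof (intro bexI)
      show z: "zmap B \<in> chain_maps R (shift_cpx j P) B" by (rule chain_maps_zero[OF Pj K.X])
      have "homotopic_maps R (shift_cpx j P) B' (zmap B') (f \<circ>\<^sub>c zmap B)"
        by (rule ht_eqI[OF K.Y Pj chain_maps_zero[OF Pj K.Y]])
          (simp add: cmap_comp_def zmap_def K.fs)
      then show "homotopic_maps R (shift_cpx j P) B' y (f \<circ>\<^sub>c zmap B)"
        using n(2) that ht_trans[OF K.Y Pj] unfolding null_maps_def by blast
    qed
    fix n show "(shift_cpx (j - 1) P)$n = (shift_cpx j P)$(n - 1)" by (simp add: e)
    fix q assume "q \<in> el (shift_cpx j P) (n - 1)"
    then have q: "q \<in> el P (n + (j - 1))" by (simp add: e)
    interpret M: module R "P$(n + j)" by (rule cpxD(1)[OF P])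
    have "cdiff P (n + (j - 1)) q \<in> el P (n + j)"
      using cpx_simps(1)[OF P q] by (simp add: add.assoc)
    then show "cdiff (shift_cpx (j - 1) P) n q = -[(shift_cpx j P)$n] cdiff (shift_cpx j P) (n - 1) q"
      unfolding shift_cpx_simps e by (cases "even j") simp_all
  qed (simp_all add: shift_complexes[OF P])
qed

section \<open>Orthogonality and depth\<close>

lemma int_least:
  fixes k a :: int
  assumes "Q k" "\<And>i. i < a ==> \<not> Q i"
  obtains l where "Q l" "l \<le> k" "\<And>i. i < l ==> \<not> Q i"
proof -
  obtain l where l: "Q l" "\<And>i. Q i ==> nat (l - a) \<le> nat (i - a)"
    using ex_has_least_nat[of Q k "\<lambda>i. nat (i - a)"] assms(1) by blast
  have *: "Q i ==> a \<le> i" for i using assms(2)[of i] by force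
  have "Q i ==> l \<le> i" for i using l(2)[of i] *[of i] *[OF l(1)] by simp
  then show ?thesis using that[of l] l(1) assms(1) by force
qed

lemma int_greatest:
  fixes k b :: int
  assumes "Q k" "\<And>i. b < i ==> \<not> Q i"
  obtains l where "Q l" "k \<le> l" "\<And>i. l < i ==> \<not> Q i"
proof -
  have 1: "Q (- (- k))" using assms by simp
  have 2: "\<And>i. i < - b ==> \<not> Q (- i)" by (rule assms(2)) simp
  obtain l where l: "Q (- l)" "l \<le> - k" "\<And>i. i < l ==> \<not> Q (- i)"
    by (rule int_least[of "\<lambda>i. Q (- i)", OF 1 2]) (assumption, rule that, assumption, assumption, blast)
  show ?thesis
  proof (rule that[OF l(1)])
    show "k \<le> - l" using l(2) by simp
    fix i assume "- l < i" then show "\<not> Q i" using l(3)[of "- i"] by simp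
  qed
qed

lemma perf_bounds:
  assumes "perf_cpx R P"
  obtains a b where "\<And>n S. msys R S ==> n < a ==> exact_at R S P n" "\<And>n S. msys R S ==> b < n ==> exact_at R S P n"
proof -
  obtain a b where ab: "\<And>n. n < a \<or> b < n ==> el P n = {0[P$n]}"
    using perfD(2)[OF assms] unfolding bounded_cpx_def by blast
  show ?thesis
    by (rule that[of a b]) (use exact_at_zero[OF perfD(1)[OF assms]] ab in blast)+
qed

lemma (in cring) prime_power:
  assumes p: "primeideal p R" and x: "x \<in> carrier R" and xm: "x [^] (m::nat) \<in> p"
  shows "x \<in> p"
proof -
  interpret p: primeideal p R by fact
  show ?thesis using xm
  proof (induction m)
    case 0
    then have "carrier R = p" using p.one_imp_carrier by simp
    then show ?case using p.I_notcarr by simp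
  next
    case (Suc m)
    then show ?case using p.I_prime[of "x [^] m" x] x by auto
  qed
qed

lemma (in noeth_cring) proper_ideal_in_prime:
  assumes I: "ideal I R" "I \<noteq> carrier R"
  obtains p where "primeideal p R" "I \<subseteq> p"
proof -
  let ?F = "{J. ideal J R \<and> I \<subseteq> J \<and> J \<noteq> carrier R}"
  have "?F \<noteq> {}" using I by auto
  then obtain p where p: "p \<in> ?F" "\<And>J. J \<in> ?F ==> p \<subseteq> J ==> J = p"
    by (rule maximal_ideal_in_family) (auto intro: that)
  have "maximalideal p R"
  proof (rule maximalidealI)
    show "ideal p R" "carrier R \<noteq> p" using p by auto
    fix J assume "ideal J R" "p \<subseteq> J" "J \<subseteq> carrier R"
    then show "J = p \<or> J = carrier R" using p by blast
  qed
  from maximalideal_prime[OF this] show ?thesis using that p by auto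
qed

lemma not_exact_atE:
  assumes "\<not> exact_at R S X n"
  obtains z where "z \<in> cyc X n" "z \<notin> sat R S (X$n) (bd X n)"
  using assms unfolding exact_at_def by blast

lemma compl_mono: "q \<subseteq> p ==> carrier R - p \<subseteq> carrier R - q" by blast

context noeth_cring begin

text \<open>Shift the top degree \<open>u\<close> of \<open>P\<close> at \<open>q\<close> to the
  bottom degree \<open>l\<close> of \<open>B\<close>, where the class of \<open>w\<close> has
  annihilator \<open>q\<close>. The shift is by \<open>u - l\<close>, which is at least
  \<open>m\<close>, so orthogonality contradicts \<open>not_null_maps\<close>.\<close>

lemma orth_associated_prime:
  assumes q: "primeideal q R" and P: "perf_cpx R P" and B: "B \<in> complexes R" and o: "orth R P B m"
    and w: "w \<in> cyc B l" "\<And>r. r \<in> carrier R ==> r *[B$l] w \<in> bd B l \<longleftrightarrow> r \<in> q"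
    and bot: "\<And>k. k < l ==> exact_at R (carrier R - q) B k"
    and nz: "\<not> exact_at R (carrier R - q) P s" and ls: "l + m \<le> s"
  shows False
proof -
  have S: "msys R (carrier R - q)" by (rule msys_compl_prime[OF q])
  note PD = perfD[OF P]
  obtain b where b: "\<And>n. b < n ==> exact_at R (carrier R - q) P n" using perf_bounds[OF P] S by metis
  have b': "\<And>n. b < n ==> \<not> \<not> exact_at R (carrier R - q) P n" using b by simp
  obtain u where u: "\<not> exact_at R (carrier R - q) P u" "s \<le> u" "\<And>i. u < i ==> exact_at R (carrier R - q) P i"
    using int_greatest[of "\<lambda>i. \<not> exact_at R (carrier R - q) P i", OF nz b'] by metis
  have "\<not> null_maps R (shift_cpx (u - l) P) B"
  proof (rule not_null_maps[OF q shift_perf_cpx[OF P] B _ _ bot w])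
    show "\<not> exact_at R (carrier R - q) (shift_cpx (u - l) P) l" using u(1) by (simp add: shift_exact_at[OF PD(1)])
    fix k assume "l < k"
    then have "u < k + (u - l)" by simp
    then show "exact_at R (carrier R - q) (shift_cpx (u - l) P) k" using u(3) by (simp add: shift_exact_at[OF PD(1)])
  qed
  then show False using o u(2) ls unfolding orth_def by auto
qed

lemma associated_cocycle:
  assumes B: "B \<in> complexes R" and p: "primeideal p R" and nz: "\<not> exact_at R (carrier R - p) B l"
  obtains q w where "primeideal q R" "q \<subseteq> p" "w \<in> cyc B l"
    "\<And>r. r \<in> carrier R ==> r *[B$l] w \<in> bd B l \<longleftrightarrow> r \<in> q"
proof -
  interpret M: module R "B$l" by (rule cpxD(1)[OF B])
  obtain z where z: "z \<in> cyc B l" "z \<notin> sat R (carrier R - p) (B$l) (bd B l)"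
    by (rule not_exact_atE[OF nz])
  have zc: "z \<in> el B l" using z by (simp add: mem_cocycles)
  obtain q r where q: "primeideal q R" "q \<subseteq> p" "r \<in> carrier R"
    "\<And>a. a \<in> carrier R ==> a *[B$l] (r *[B$l] z) \<in> bd B l \<longleftrightarrow> a \<in> q"
    by (rule associated_prime[OF M.module_axioms coboundaries_submodule[OF B] p zc z(2)]) (rule that, assumption, assumption, assumption, blast)
  then show ?thesis using that[of q "r *[B$l] z"] M.submoduleD(5)[OF cocycles_submodule[OF B]] z(1) by blast
qed

text \<open>Iterated Koszul cones over the list: each step keeps the torsion obtained so far, adds
  that for the new element, creates no new degree of exactness at \<open>p\<close>, and costs one
  degree of orthogonality.\<close>

lemma koszul_sequence:
  fixes B :: "('a, 'm) cpx"
  assumes inf: "infinite (UNIV :: 'm set)" and B: "perf_cpx R B" and p: "primeideal p R" and xs: "set xs \<subseteq> p"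
  obtains L where "perf_cpx R L" "\<And>x. x \<in> set xs ==> kills R x L"
    "\<And>n. exact_at R (carrier R - p) L n ==> exact_at R (carrier R - p) B n"
    "\<And>P m. P \<in> complexes R ==> orth R P B m ==> orth R P L (m + int (length xs))"
proof -
  interpret p: primeideal p R by fact
  have "\<exists>L. perf_cpx R L \<and> (\<forall>x\<in>set xs. kills R x L) \<and>
    (\<forall>n. exact_at R (carrier R - p) L n \<longrightarrow> exact_at R (carrier R - p) B n) \<and>
    (\<forall>P m. P \<in> complexes R \<longrightarrow> orth R P B m \<longrightarrow> orth R P L (m + int (length xs)))"
    using xs
  proof (induction xs)
    case Nil then show ?case using B by auto
  next
    case (Cons x xs)
    then obtain L where L: "perf_cpx R L" "\<forall>x\<in>set xs. kills R x L"
      "\<forall>n. exact_at R (carrier R - p) L n \<longrightarrow> exact_at R (carrier R - p) B n"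
      "\<forall>P m. P \<in> complexes R \<longrightarrow> orth R P B m \<longrightarrow> orth R P L (m + int (length xs))" by auto
    have x: "x \<in> p" "x \<in> carrier R" using Cons p.a_subset by auto
    obtain C \<phi> where C: "mcone R L L (\<lambda>n b. x *[L$n] b) C \<phi>"
      using mcone_exists[OF inf perfD(1)[OF L(1)] perfD(1)[OF L(1)] chain_maps_mult[OF perfD(1)[OF L(1)] x(2)]] .
    interpret C: mcone R L L "\<lambda>n b. x *[L$n] b" C \<phi> by (rule C)
    show ?case
    proof (intro exI conjI ballI allI impI)
      show "perf_cpx R C" by (rule C.perf_cone[OF L(1) L(1)])
      show "kills R y C" if "y \<in> set (x # xs)" for y
        using that koszul_kills_self[OF x(2) C] koszul_kills[OF x(2) _ C] L(2) Cons.prems p.a_subset by auto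
      show "exact_at R (carrier R - p) B n" if "exact_at R (carrier R - p) C n" for n
        using koszul_exact[OF noeth_cring_axioms L(1) p x(1) C that] L(3) by blast
      fix P :: "('a, 'm) cpx" and m assume "P \<in> complexes R" "orth R P B m"
      then show "orth R P C (m + int (length (x # xs)))"
        using orth_cone[OF _ C, of P "m + int (length xs)"] L(4) by (simp add: algebra_simps)
    qed
  qed
  then show ?thesis using that by metis
qed

text \<open>The depth of \<open>B\<close> at \<open>p\<close> exceeds the top degree of \<open>P\<close> at \<open>p\<close>, and the depth is bounded by
  the lowest degree plus the number of generators of \<open>p\<close>.\<close>

lemma exact_below:
  fixes B P :: "('a, 'm) cpx"
  assumes inf: "infinite (UNIV :: 'm set)" and p: "primeideal p R" and xs: "set xs \<subseteq> p" "p = Idl (set xs)"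
    and P: "perf_cpx R P" and B: "perf_cpx R B" and o: "orth R P B 0"
    and nz: "\<not> exact_at R (carrier R - p) P s" and k: "k + int (length xs) \<le> s"
  shows "exact_at R (carrier R - p) B k"
proof (rule ccontr)
  assume nB: "\<not> ?thesis"
  interpret p: primeideal p R by fact
  have S: "msys R (carrier R - p)" by (rule msys_compl_prime[OF p])
  obtain L where L: "perf_cpx R L" "\<And>x. x \<in> set xs ==> kills R x L"
    "\<And>n. exact_at R (carrier R - p) L n ==> exact_at R (carrier R - p) B n"
    "\<And>P m. P \<in> complexes R ==> orth R P B m ==> orth R P L (m + int (length xs))"
    by (rule koszul_sequence[OF inf B p xs(1)]) (rule that, assumption, blast, blast, blast)
  note Lc = perfD(1)[OF L(1)]
  have nL: "\<not> exact_at R (carrier R - p) L k" using nB L(3) by blast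
  obtain a where a: "\<And>n. n < a ==> \<not> \<not> exact_at R (carrier R - p) L n" using perf_bounds[OF L(1)] S by metis
  obtain l where l: "\<not> exact_at R (carrier R - p) L l" "l \<le> k" "\<And>i. i < l ==> exact_at R (carrier R - p) L i"
    using int_least[of "\<lambda>i. \<not> exact_at R (carrier R - p) L i", OF nL a] by metis
  obtain q w where q: "primeideal q R" "q \<subseteq> p" and w: "w \<in> cyc L l"
    "\<And>r. r \<in> carrier R ==> r *[L$l] w \<in> bd L l \<longleftrightarrow> r \<in> q"
    by (rule associated_cocycle[OF Lc p l(1)]) (rule that, assumption, assumption, assumption, blast)
  interpret q: primeideal q R by fact
  \<comment> \<open>A power of each generator annihilates the class of \<open>w\<close>, so the
    associated prime contains every generator of \<open>p\<close>.\<close>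
  have "set xs \<subseteq> q"
  proof
    fix x assume x: "x \<in> set xs"
    then have xc: "x \<in> carrier R" using xs p.a_subset by blast
    obtain m :: nat where "(x [^] m) *[L$l] w \<in> bd L l" using L(2)[OF x] w(1) unfolding kills_def by blast
    then show "x \<in> q" using w(2) xc prime_power[OF q(1) xc] by simp
  qed
  then have "p \<subseteq> q" unfolding xs(2) by (rule genideal_minimal[OF q.is_ideal])
  then have qp: "q = p" using q(2) by blast
  show False
  proof (rule orth_associated_prime[OF p P Lc L(4)[OF perfD(1)[OF P] o] w(1) w(2)[unfolded qp] _ nz])
    show "\<And>i. i < l ==> exact_at R (carrier R - p) L i" using l(3) by blast
    show "l + (0 + int (length xs)) \<le> s" using l(2) k by simp
  qed
qed

text \<open>A complex that is not exact at the smallest prime is not exact at any prime in that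
  degree. The associated prime found at the lowest cohomology of \<open>B\<close> can therefore be
  used as it stands: no degree is lost, and the conclusion holds over \<open>R\<close>
  itself.\<close>

lemma exact_below_generic:
  assumes \<eta>: "primeideal \<eta> R" "\<And>q. primeideal q R ==> \<eta> \<subseteq> q" and P: "perf_cpx R P" and B: "perf_cpx R B"
    and o: "orth R P B 0" and nz: "\<not> exact_at R (carrier R - \<eta>) P s" and k: "k \<le> s"
  shows "exact_at R {\<one>} B k"
proof (rule ccontr)
  assume nB: "\<not> ?thesis"
  note Bc = perfD(1)[OF B]
  obtain a where a: "\<And>n. n < a ==> \<not> \<not> exact_at R {\<one>} B n" using perf_bounds[OF B] msys_one by metis
  obtain l where l: "\<not> exact_at R {\<one>} B l" "l \<le> k" "\<And>i. i < l ==> exact_at R {\<one>} B i"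
    using int_least[of "\<lambda>i. \<not> exact_at R {\<one>} B i", OF nB a] by metis
  interpret M: module R "B$l" by (rule cpxD(1)[OF Bc])
  obtain z where z: "z \<in> cyc B l" "z \<notin> bd B l" using l(1) unfolding exact_at_one[OF Bc] by blast
  have zc: "z \<in> el B l" using z by (simp add: mem_cocycles)
  let ?I = "{a \<in> carrier R. a *[B$l] z \<in> bd B l}"
  have "\<one> \<notin> ?I" using z zc by simp
  then have "?I \<noteq> carrier R" by blast
  then obtain p where p: "primeideal p R" "?I \<subseteq> p"
    using proper_ideal_in_prime[OF M.annihilator_ideal[OF coboundaries_submodule[OF Bc] zc]] by blast
  have "z \<notin> sat R (carrier R - p) (B$l) (bd B l)" using p(2) unfolding sat_def by blast
  then have np: "\<not> exact_at R (carrier R - p) B l" using z(1) unfolding exact_at_def by blast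
  obtain q w where q: "primeideal q R" "q \<subseteq> p" and w: "w \<in> cyc B l"
    "\<And>r. r \<in> carrier R ==> r *[B$l] w \<in> bd B l \<longleftrightarrow> r \<in> q"
    by (rule associated_cocycle[OF Bc p(1) np]) (rule that, assumption, assumption, assumption, blast)
  interpret q: primeideal q R by fact
  have S1: "{\<one>} \<subseteq> carrier R - q" using q.I_notcarr q.one_imp_carrier by auto
  have nzq: "\<not> exact_at R (carrier R - q) P s" using nz exact_at_mono[OF _ compl_mono[OF \<eta>(2)[OF q(1)]]] by blast
  show False
    by (rule orth_associated_prime[OF q(1) P Bc o w _ nzq]) (use l(2,3) k exact_at_mono[OF _ S1] in auto)
qed

end

section \<open>Free modules and minimal resolutions\<close>

text \<open>Fills the degrees outside the range of a bounded complex.\<close>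

definition zmod :: "('a, 'm) module" where
  "zmod = \<lparr>carrier = {undefined}, mult = (\<lambda>u v. undefined), one = undefined, zero = undefined,
     add = (\<lambda>u v. undefined), smult = (\<lambda>r u. undefined)\<rparr>"

lemma zmod_simps [simp]:
  "carrier zmod = {undefined}" "0[zmod] = undefined" "u +[zmod] v = undefined" "r *[zmod] u = undefined"
  by (simp_all add: zmod_def)

lemma (in cring) zmod_module: "module R zmod"
  by (rule moduleI) (auto intro!: abelian_groupI simp: cring_axioms)

lemma (in cring) zmod_fgp: "fgp R zmod"
  unfolding fgp_def using zmod_module by (intro conjI exI[of _ 0]) auto

section \<open>Free modules of finite rank inside the type \<open>'m\<close>\<close>

definition freevec :: "('a, 'r) ring_scheme \<Rightarrow> nat \<Rightarrow> ('a, nat \<Rightarrow> 'a) module" where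
  "freevec R r = \<lparr>carrier = {v. (\<forall>i<r. v i \<in> carrier R) \<and> (\<forall>i\<ge>r. v i = 0[R])}, mult = (\<lambda>u v. u), one = (\<lambda>i. 0[R]),
     zero = (\<lambda>i. 0[R]), add = (\<lambda>u v i. u i +[R] v i), smult = (\<lambda>a u i. a \<otimes>\<^bsub>R\<^esub> u i)\<rparr>"

lemma freevec_simps [simp]:
  "carrier (freevec R r) = {v. (\<forall>i<r. v i \<in> carrier R) \<and> (\<forall>i\<ge>r. v i = 0[R])}"
  "0[freevec R r] = (\<lambda>i. 0[R])" "u +[freevec R r] v = (\<lambda>i. u i +[R] v i)" "a *[freevec R r] u = (\<lambda>i. a \<otimes>\<^bsub>R\<^esub> u i)"
  by (simp_all add: freevec_def)

lemma (in cring) freevec_carrier: "v \<in> carrier (freevec R r) ==> v i \<in> carrier R"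
  by (cases "i < r") auto

lemma (in cring) freevec_module: "module R (freevec R r)"
proof (rule moduleI)
  note c = freevec_carrier[of _ r]
  show "abelian_group (freevec R r)"
  proof (rule abelian_groupI)
    fix x assume x: "x \<in> carrier (freevec R r)"
    show "\<exists>y\<in>carrier (freevec R r). y +[freevec R r] x = 0[freevec R r]"
      using x c[OF x] by (intro bexI[of _ "\<lambda>i. \<ominus> x i"]) (auto simp: l_neg)
    show "0[freevec R r] +[freevec R r] x = x" using c[OF x] by (simp add: fun_eq_iff)
    fix y assume y: "y \<in> carrier (freevec R r)"
    show "x +[freevec R r] y \<in> carrier (freevec R r)" using x y by auto
    show "x +[freevec R r] y = y +[freevec R r] x" using c[OF x] c[OF y] by (simp add: fun_eq_iff a_comm)
    fix z assume z: "z \<in> carrier (freevec R r)"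
    show "x +[freevec R r] y +[freevec R r] z = x +[freevec R r] (y +[freevec R r] z)"
      using c[OF x] c[OF y] c[OF z] by (simp add: fun_eq_iff a_assoc)
  qed auto
  fix a x assume a: "a \<in> carrier R" and x: "x \<in> carrier (freevec R r)"
  show "a *[freevec R r] x \<in> carrier (freevec R r)" using a x by auto
  fix b assume b: "b \<in> carrier R"
  show "(a \<oplus> b) *[freevec R r] x = a *[freevec R r] x +[freevec R r] b *[freevec R r] x"
    using a b c[OF x] by (simp add: fun_eq_iff l_distr)
  show "a \<otimes> b *[freevec R r] x = a *[freevec R r] (b *[freevec R r] x)"
    using a b c[OF x] by (simp add: fun_eq_iff m_assoc)
next
  fix x assume "x \<in> carrier (freevec R r)"
  from freevec_carrier[OF this] show "\<one> *[freevec R r] x = x" by (simp add: fun_eq_iff)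
next
  note c = freevec_carrier[of _ r]
  fix a x y assume a: "a \<in> carrier R" and x: "x \<in> carrier (freevec R r)" and y: "y \<in> carrier (freevec R r)"
  show "a *[freevec R r] (x +[freevec R r] y) = a *[freevec R r] x +[freevec R r] a *[freevec R r] y"
    using a c[OF x] c[OF y] by (simp add: fun_eq_iff r_distr)
qed (rule cring_axioms)

text \<open>The basis \<open>b\<close> and the dual basis \<open>\<phi>\<close> are explicit because
  minimality is expressed through coordinates.\<close>

definition free_mod :: "('a, 'r) ring_scheme \<Rightarrow> ('a, 'm) module \<Rightarrow> nat \<Rightarrow> (nat \<Rightarrow> 'm) \<Rightarrow> (nat \<Rightarrow> 'm \<Rightarrow> 'a) \<Rightarrow> bool" where
  "free_mod R M r b \<phi> \<longleftrightarrow> module R M \<and> (\<forall>i<r. b i \<in> carrier M \<and> \<phi> i \<in> lin_maps R M (selfmod R)) \<and>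
     (\<forall>x\<in>carrier M. x = lc M (\<lambda>i. \<phi> i x) b r) \<and> (\<forall>i<r. \<forall>j<r. \<phi> i (b j) = (if i = j then \<one>\<^bsub>R\<^esub> else 0[R]))"

lemma free_modD:
  assumes "free_mod R M r b \<phi>"
  shows "module R M" "i < r ==> b i \<in> carrier M" "i < r ==> \<phi> i \<in> lin_maps R M (selfmod R)"
    "x \<in> carrier M ==> lc M (\<lambda>i. \<phi> i x) b r = x" "i < r ==> j < r ==> \<phi> i (b j) = (if i = j then \<one>\<^bsub>R\<^esub> else 0[R])"
    "fgp R M"
proof -
  show "module R M" "i < r ==> b i \<in> carrier M" "i < r ==> \<phi> i \<in> lin_maps R M (selfmod R)" for i
    using assms unfolding free_mod_def by blast+
  show "x \<in> carrier M ==> lc M (\<lambda>i. \<phi> i x) b r = x" for x using assms unfolding free_mod_def by metis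
  show "i < r ==> j < r ==> \<phi> i (b j) = (if i = j then \<one>\<^bsub>R\<^esub> else 0[R])" using assms unfolding free_mod_def by blast
  show "fgp R M" using assms unfolding free_mod_def fgp_def by blast
qed

lemma free_mod_coord:
  assumes F: "free_mod R M r b \<phi>" and i: "i < r" and x: "x \<in> carrier M" shows "\<phi> i x \<in> carrier R"
proof -
  interpret M: module R M by (rule free_modD(1)[OF F])
  show ?thesis using lin_simps(1)[OF M.module_axioms M.R.selfmod_module free_modD(3)[OF F i] x] by simp
qed

lemma free_mod_coord_lc:
  assumes F: "free_mod R M r b \<phi>" and c: "\<And>i. i < r ==> c i \<in> carrier R" and i: "i < r"
  shows "\<phi> i (lc M c b r) = c i"
proof -
  interpret M: module R M by (rule free_modD(1)[OF F])
  have "\<phi> i (lc M c b r) = lc (selfmod R) c (\<lambda>j. \<phi> i (b j)) r"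
    by (rule lin_maps_lc[OF M.module_axioms M.R.selfmod_module free_modD(3)[OF F i]]) (use c free_modD(2)[OF F] in auto)
  also have "\<dots> = lc (selfmod R) c (\<lambda>j. if i = j then \<one>\<^bsub>R\<^esub> else 0[R]) r"
    using free_modD(5)[OF F i] by (intro lc_cong) auto
  also have "lc (selfmod R) c (\<lambda>j. if i = j then \<one>\<^bsub>R\<^esub> else 0[R]) n = (if i < n then c i else 0[R])" if "n \<le> r" for n
    using that
  proof (induction n)
    case (Suc n)
    then have "c n \<in> carrier R" "c i \<in> carrier R" using c i by auto
    then show ?case using Suc by (auto simp: less_Suc_eq)
  qed simp
  from this[of r] have "lc (selfmod R) c (\<lambda>j. if i = j then \<one>\<^bsub>R\<^esub> else 0[R]) r = c i" using i by simp
  finally show ?thesis .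
qed

text \<open>Iterates the pairing of \<open>'m\<close> with itself. A tuple is a function of which
  only the first \<open>r\<close> values are coded, so injectivity is claimed for these values
  alone.\<close>

lemma inj_encoding:
  fixes \<iota> :: "'a \<Rightarrow> 'm"
  assumes inf: "infinite (UNIV :: 'm set)" and \<iota>: "inj_on \<iota> A"
  obtains enc :: "(nat \<Rightarrow> 'a) \<Rightarrow> 'm" where
    "\<forall>v w. (\<forall>i<r. v i \<in> A \<and> w i \<in> A) \<longrightarrow> enc v = enc w \<longrightarrow> (\<forall>i<r::nat. v i = w i)"
proof -
  obtain e :: "'m \<times> 'm \<Rightarrow> 'm" where e: "inj e" by (rule infinite_pairing[OF inf])
  have "\<exists>enc :: (nat \<Rightarrow> 'a) \<Rightarrow> 'm. \<forall>v w. (\<forall>i<r. v i \<in> A \<and> w i \<in> A) \<longrightarrow> enc v = enc w \<longrightarrow> (\<forall>i<r. v i = w i)"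
  proof (induction r)
    case (Suc r)
    then obtain enc :: "(nat \<Rightarrow> 'a) \<Rightarrow> 'm" where enc: "\<forall>v w. (\<forall>i<r. v i \<in> A \<and> w i \<in> A) \<longrightarrow> enc v = enc w \<longrightarrow> (\<forall>i<r. v i = w i)" ..
    show ?case
    proof (intro exI[of _ "\<lambda>v. e (\<iota> (v r), enc v)"] allI impI)
      fix v w i assume a: "\<forall>i<Suc r. v i \<in> A \<and> w i \<in> A" and eq: "e (\<iota> (v r), enc v) = e (\<iota> (w r), enc w)" and i: "i < Suc r"
      have "\<iota> (v r) = \<iota> (w r)" "enc v = enc w" using injD[OF e eq] by auto
      moreover have "v r \<in> A" "w r \<in> A" using a by auto
      ultimately have "v r = w r" "\<forall>i<r. v i = w i" using inj_onD[OF \<iota>] enc a by auto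
      then show "v i = w i" using i by (auto simp: less_Suc_eq)
    qed
  qed simp
  then show ?thesis using that by blast
qed

lemma (in cring) free_mod_exists:
  fixes \<iota> :: "'a \<Rightarrow> 'm"
  assumes inf: "infinite (UNIV :: 'm set)" and \<iota>: "inj_on \<iota> (carrier R)"
  obtains M :: "('a, 'm) module" and b \<phi> where "free_mod R M r b \<phi>"
proof -
  obtain enc :: "(nat \<Rightarrow> 'a) \<Rightarrow> 'm" where enc: "\<forall>v w. (\<forall>i<r. v i \<in> carrier R \<and> w i \<in> carrier R) \<longrightarrow> enc v = enc w \<longrightarrow> (\<forall>i<r. v i = w i)"
    by (rule inj_encoding[OF inf \<iota>, of r]) (rule that)
  let ?V = "freevec R r"
  have e: "inj_on enc (carrier ?V)"
  proof (rule inj_onI)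
    fix v w assume v: "v \<in> carrier ?V" and w: "w \<in> carrier ?V" and eq: "enc v = enc w"
    have "\<forall>i<r. v i = w i" using enc[rule_format, of v w] v w eq by auto
    then have "v i = w i" for i using v w by (cases "i < r") auto
    then show "v = w" by (simp add: fun_eq_iff)
  qed
  interpret V: module R ?V by (rule freevec_module)
  let ?M = "tmod enc ?V"
  have M: "module R ?M" by (rule tmod_module[OF freevec_module e])
  note t = tmod_simps[OF e]
  define u where "u j = (\<lambda>i. if i = j then \<one> else \<zero>)" for j :: nat
  have uc: "j < r ==> u j \<in> carrier ?V" for j by (auto simp: u_def)
  have lcV: "lc ?V c u n = (\<lambda>i. if i < n then c i else \<zero>)" if "\<And>i. i < n ==> c i \<in> carrier R" for c n
    using that
  proof (induction n)
    case (Suc n)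
    then have "c n \<in> carrier R" "\<And>i. i < n ==> c i \<in> carrier R" by auto
    then show ?case using Suc by (auto simp: fun_eq_iff u_def less_Suc_eq)
  qed simp
  define \<phi> where "\<phi> i x = inv_into (carrier ?V) enc x i" for i x
  have \<phi>e: "\<phi> i (enc v) = v i" if "v \<in> carrier ?V" for i v using inv_into_f_f[OF e that] by (simp add: \<phi>_def)
  have encl: "enc \<in> lin_maps R ?V ?M" by (rule lin_mapsI) (simp_all only: t imageI)
  have "free_mod R ?M r (\<lambda>j. enc (u j)) \<phi>" unfolding free_mod_def
  proof (intro conjI allI impI ballI)
    fix i assume i: "i < r"
    show "enc (u i) \<in> carrier ?M" using uc[OF i] by (simp only: t imageI)
    show "\<phi> i \<in> lin_maps R ?M (selfmod R)"
    proof (rule lin_mapsI)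
      fix x assume "x \<in> carrier ?M"
      then obtain v where v: "v \<in> carrier ?V" "x = enc v" unfolding t by blast
      show "\<phi> i x \<in> carrier (selfmod R)" using freevec_carrier[OF v(1)] v by (simp add: \<phi>e del: freevec_simps)
      show "\<phi> i (a *[?M] x) = a *[selfmod R] \<phi> i x" if "a \<in> carrier R" for a
        unfolding v(2) t(4)[OF v(1)] \<phi>e[OF v(1)] \<phi>e[OF V.smult_closed[OF that v(1)]] by simp
      fix y assume "y \<in> carrier ?M"
      then obtain w where w: "w \<in> carrier ?V" "y = enc w" unfolding t by blast
      show "\<phi> i (x +[?M] y) = \<phi> i x +[selfmod R] \<phi> i y"
        unfolding v(2) w(2) t(3)[OF v(1) w(1)] \<phi>e[OF v(1)] \<phi>e[OF w(1)] \<phi>e[OF V.M.a_closed[OF v(1) w(1)]] by simp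
    qed
    show "\<phi> i (enc (u j)) = (if i = j then \<one> else \<zero>)" if "j < r" for j
      unfolding \<phi>e[OF uc[OF that]] by (simp add: u_def)
  next
    fix x assume "x \<in> carrier ?M"
    then obtain v where v: "v \<in> carrier ?V" "x = enc v" unfolding t by blast
    have "lc ?M v (\<lambda>j. enc (u j)) r = enc (lc ?V v u r)"
      by (rule lin_maps_lc[OF V.module_axioms M encl, symmetric]) (use freevec_carrier[OF v(1)] uc in auto)
    also have "lc ?V v u r = v"
    proof -
      have "lc ?V v u r = (\<lambda>i. if i < r then v i else \<zero>)" by (rule lcV) (rule freevec_carrier[OF v(1)])
      then show ?thesis using v(1) by (auto simp: fun_eq_iff)
    qed
    finally show "x = lc ?M (\<lambda>i. \<phi> i x) (\<lambda>j. enc (u j)) r" unfolding v(2) \<phi>e[OF v(1)] by simp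
  qed (rule M)
  then show ?thesis by (rule that)
qed

section \<open>Minimal covers and minimal resolutions\<close>

definition gen :: "('a, 'r) ring_scheme \<Rightarrow> ('a, 'm) module \<Rightarrow> 'm set \<Rightarrow> 'm set" where
  "gen R M G = {x \<in> carrier M. \<forall>N. submodule N R M \<and> G \<subseteq> N \<longrightarrow> x \<in> N}"

lemma gen_minimal: "submodule N R M ==> G \<subseteq> N ==> gen R M G \<subseteq> N"
  unfolding gen_def by auto

lemma gen_superset: "G \<subseteq> carrier M ==> G \<subseteq> gen R M G"
  unfolding gen_def by auto

lemma gen_submodule:
  assumes M: "module R M" shows "submodule (gen R M G) R M"
proof -
  interpret M: module R M by fact
  show ?thesis by (rule M.submoduleI') (auto simp: gen_def M.submoduleD)
qed

text \<open>Isolates one generator in a relation whose other terms lie in \<open>N\<close>; a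
  coefficient outside \<open>p\<close> then makes that generator redundant at
  \<open>p\<close>.\<close>

lemma (in module) lc_remove:
  assumes N: "submodule N R M" and j: "j < n" and c: "\<And>i. i < n ==> c i \<in> carrier R" and g: "\<And>i. i < n ==> g i \<in> carrier M"
    "\<And>i. i < n ==> i \<noteq> j ==> g i \<in> N"
  shows "lc M c g n -[M] c j *[M] g j \<in> N"
  using j c g
proof (induction n)
  case (Suc n)
  note ND = submoduleD[OF N]
  have gc: "c n \<in> carrier R" "g n \<in> carrier M" "c j \<in> carrier R" "g j \<in> carrier M" using Suc by auto
  have lcc: "lc M c g n \<in> carrier M" using Suc by (intro lc_closed) auto
  show ?case
  proof (cases "j = n")
    case True
    have "lc M c g n \<in> N" using Suc True by (intro lc_mem[OF N]) auto
    moreover have "lc M c g n +[M] c n *[M] g n -[M] c n *[M] g n = lc M c g n" using gc lcc by algebra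
    ultimately show ?thesis using True by simp
  next
    case False
    have "lc M c g n -[M] c j *[M] g j \<in> N" using Suc False by auto
    moreover have "c n *[M] g n \<in> N" using Suc False gc by (intro ND(5)) auto
    ultimately have "(lc M c g n -[M] c j *[M] g j) +[M] c n *[M] g n \<in> N" by (rule ND(3))
    moreover have "(lc M c g n -[M] c j *[M] g j) +[M] c n *[M] g n = lc M c g n +[M] c n *[M] g n -[M] c j *[M] g j"
      using gc lcc by algebra
    ultimately show ?thesis by simp
  qed
qed simp

text \<open>\<open>G\<close> has the least size among the finite subsets of \<open>K\<close> that
  generate it at \<open>p\<close>. In a relation between its elements no coefficient lies outside
  \<open>p\<close>, since the generator with that coefficient could be dropped.\<close>

lemma (in noeth_cring) minimal_cover:
  fixes \<iota> :: "'a \<Rightarrow> 'm" and N :: "('a, 'm) module"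
  assumes inf: "infinite (UNIV :: 'm set)" and \<iota>: "inj_on \<iota> (carrier R)" and p: "primeideal p R"
    and N: "noeth_module R N" and K: "submodule K R N"
  obtains M :: "('a, 'm) module" and r b \<phi> d where "free_mod R M r b \<phi>" "d \<in> lin_maps R M N" "d ` carrier M \<subseteq> K"
    "K \<subseteq> sat R (carrier R - p) N (d ` carrier M)"
    "\<And>x i. x \<in> carrier M ==> d x = 0[N] ==> i < r ==> \<phi> i x \<in> p"
proof -
  let ?S = "carrier R - p"
  have S: "msys R ?S" by (rule msys_compl_prime[OF p])
  have Nm: "module R N" using N unfolding noeth_module_def by blast
  interpret N: module R N by (rule Nm)
  note KD = N.submoduleD[OF K]
  define Gp where "Gp G \<longleftrightarrow> finite G \<and> G \<subseteq> K \<and> K \<subseteq> sat R ?S N (gen R N G)" for G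
  have "fgs R N K" using N K unfolding noeth_module_def by blast
  then obtain G0 where G0: "finite G0" "G0 \<subseteq> K" "\<forall>L. submodule L R N \<longrightarrow> G0 \<subseteq> L \<longrightarrow> K \<subseteq> L" by (rule fgsE)
  have G0c: "G0 \<subseteq> carrier N" using G0(2) KD(1) by blast
  have "K \<subseteq> gen R N G0" using G0(3) gen_submodule[OF Nm] gen_superset[OF G0c] by blast
  also have "gen R N G0 \<subseteq> sat R ?S N (gen R N G0)" by (rule N.subset_sat[OF S]) (auto simp: gen_def)
  finally have "Gp G0" using G0 by (simp add: Gp_def)
  then obtain G where G: "Gp G" "\<And>G'. Gp G' ==> card G \<le> card G'"
    using ex_has_least_nat[of Gp G0 card] by blast
  have Gf: "finite G" "G \<subseteq> K" "K \<subseteq> sat R ?S N (gen R N G)" using G(1) by (auto simp: Gp_def)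
  obtain g where g: "bij_betw g {0..<card G} G" using ex_bij_betw_nat_finite[OF Gf(1)] by blast
  define r where "r = card G"
  have gK: "i < r ==> g i \<in> K" for i using g Gf(2) by (auto simp: bij_betw_def r_def)
  have gN: "i < r ==> g i \<in> carrier N" for i using gK KD(1) by blast
  obtain M :: "('a, 'm) module" and b \<phi> where F: "free_mod R M r b \<phi>" by (rule free_mod_exists[OF inf \<iota>])
  interpret M: module R M by (rule free_modD(1)[OF F])
  define d where "d x = lc N (\<lambda>i. \<phi> i x) g r" for x
  have d: "d \<in> lin_maps R M N" unfolding d_def by (rule lc_lin_maps[OF M.module_axioms Nm]) (use free_modD(3)[OF F] gN in auto)
  note ds = lin_simps[OF M.module_axioms Nm d]
  have dK: "d ` carrier M \<subseteq> K" unfolding d_def using free_mod_coord[OF F] gK by (auto intro!: N.lc_mem[OF K])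
  have dsub: "submodule (d ` carrier M) R N"
  proof (rule N.submoduleI')
    show "d ` carrier M \<subseteq> carrier N" using ds by auto
    show "0[N] \<in> d ` carrier M" using ds(4) by (metis M.M.zero_closed imageI)
    fix u v assume "u \<in> d ` carrier M" "v \<in> d ` carrier M"
    then obtain x y where "x \<in> carrier M" "y \<in> carrier M" "u = d x" "v = d y" by auto
    then show "u +[N] v \<in> d ` carrier M" using ds(2) by (metis M.M.a_closed imageI)
  next
    fix a u assume "a \<in> carrier R" "u \<in> d ` carrier M"
    then obtain x where "x \<in> carrier M" "u = d x" by auto
    then show "a *[N] u \<in> d ` carrier M" using ds(3) \<open>a \<in> carrier R\<close> by (metis M.smult_closed imageI)
  qed
  have db: "d (b j) = g j" if j: "j < r" for j
  proof -
    have "d (b j) = lc N (\<lambda>i. if i = j then \<one> else \<zero>) g r" unfolding d_def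
      by (rule lc_cong) (use free_modD(5)[OF F _ j] in auto)
    also have "lc N (\<lambda>i. if i = j then \<one> else \<zero>) g n = (if j < n then g j else 0[N])" if "n \<le> r" for n
      using that
    proof (induction n)
      case (Suc n)
      then have "g n \<in> carrier N" "g j \<in> carrier N" using gN j by auto
      then show ?case using Suc by (auto simp: less_Suc_eq)
    qed simp
    from this[of r] have "lc N (\<lambda>i. if i = j then \<one> else \<zero>) g r = g j" using j by simp
    finally show ?thesis .
  qed
  have "G \<subseteq> d ` carrier M"
  proof
    fix x assume "x \<in> G"
    then have "x \<in> g ` {0..<card G}" using g by (simp add: bij_betw_def)
    then obtain j where "j < r" "x = g j" by (auto simp: r_def)
    then show "x \<in> d ` carrier M" using db free_modD(2)[OF F] by (metis imageI)
  qed
  then have "gen R N G \<subseteq> d ` carrier M" by (rule gen_minimal[OF dsub])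
  then have Kd: "K \<subseteq> sat R ?S N (d ` carrier M)" by (rule subset_trans[OF Gf(3) sat_mono])
  have min: "\<phi> j x \<in> p" if x: "x \<in> carrier M" and dx: "d x = 0[N]" and j: "j < r" for x j
  proof (rule ccontr)
    assume np: "\<phi> j x \<notin> p"
    let ?c = "\<phi> j x" and ?G' = "G - {g j}"
    have cc: "?c \<in> ?S" using free_mod_coord[OF F j x] np by simp
    have G'c: "?G' \<subseteq> carrier N" using Gf(2) KD(1) by blast
    let ?H = "gen R N ?G'"
    have H: "submodule ?H R N" by (rule gen_submodule[OF Nm])
    note HD = N.submoduleD[OF H]
    have "g i \<in> ?H" if "i < r" "i \<noteq> j" for i
    proof -
      have i: "i \<in> {0..<card G}" "j \<in> {0..<card G}" using that j by (auto simp: r_def)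
      have "g i \<noteq> g j" using inj_onD[OF bij_betw_imp_inj_on[OF g] _ i] that(2) by blast
      moreover have "g i \<in> G" using bij_betwE[OF g] i by blast
      ultimately have "g i \<in> ?G'" by simp
      then show ?thesis using gen_superset[OF G'c] by blast
    qed
    then have "lc N (\<lambda>i. \<phi> i x) g r -[N] ?c *[N] g j \<in> ?H"
      by (intro N.lc_remove[OF H j]) (use free_mod_coord[OF F _ x] gN in auto)
    then have "0[N] -[N] ?c *[N] g j \<in> ?H" using dx unfolding d_def by simp
    then have "-[N] (0[N] -[N] ?c *[N] g j) \<in> ?H" by (rule HD(4))
    moreover have "-[N] (0[N] -[N] ?c *[N] g j) = ?c *[N] g j" using cc gN[OF j] by (simp add: a_minus_def)
    ultimately have gj: "g j \<in> sat R ?S N ?H" using gN[OF j] cc unfolding sat_def by auto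
    have Hs: "?H \<subseteq> sat R ?S N ?H" by (rule N.subset_sat[OF S]) (auto simp: gen_def)
    have "?G' \<subseteq> sat R ?S N ?H" by (rule subset_trans[OF gen_superset[OF G'c] Hs])
    then have "G \<subseteq> sat R ?S N ?H" using gj by auto
    then have "gen R N G \<subseteq> sat R ?S N ?H" by (rule gen_minimal[OF N.sat_submodule[OF S H]])
    then have "sat R ?S N (gen R N G) \<subseteq> sat R ?S N (sat R ?S N ?H)" by (rule sat_mono)
    then have "K \<subseteq> sat R ?S N ?H" using Gf(3) unfolding N.sat_sat[OF S] by (rule subset_trans[rotated])
    then have "Gp ?G'" using Gf by (auto simp: Gp_def)
    from G(2)[OF this] have "card G \<le> card ?G'" .
    moreover have "g j \<in> G" using g j by (auto simp: bij_betw_def r_def)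
    ultimately show False using Gf(1) by (metis card_Diff1_less not_le)
  qed
  show ?thesis by (rule that[OF F d dK Kd min])
qed

lemma free_noeth: "noeth_cring R ==> free_mod R M r b \<phi> ==> noeth_module R M"
proof -
  assume "noeth_cring R" and F: "free_mod R M r b \<phi>"
  then interpret noeth_cring R by simp
  show ?thesis by (rule noeth_moduleI[OF free_modD(1)[OF F] fgp_fin_gen[OF free_modD(6)[OF F]]])
qed

lemma free_mod_lin_ideal:
  assumes F: "free_mod R M r b \<phi>" and F': "free_mod R M' r' b' \<phi>'" and L: "L \<in> lin_maps R M M'"
    and I: "ideal I R" and x: "x \<in> carrier M" "\<And>j. j < r ==> \<phi> j x \<in> I" and k: "k < r'"
  shows "\<phi>' k (L x) \<in> I"
proof -
  interpret M: module R M by (rule free_modD(1)[OF F])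
  interpret M': module R M' by (rule free_modD(1)[OF F'])
  interpret s: module R "selfmod R" by (rule M.R.selfmod_module)
  interpret I: ideal I R by fact
  have c: "j < r ==> \<phi> j x \<in> carrier R" for j using x(2) I.Icarr by blast
  have l: "(\<lambda>x. \<phi>' k (L x)) \<in> lin_maps R M (selfmod R)" by (rule lin_maps_comp[OF L free_modD(3)[OF F' k]])
  have v: "\<phi>' k (L (b j)) \<in> carrier R" if "j < r" for j
    using lin_simps(1)[OF M.module_axioms s.module_axioms l free_modD(2)[OF F that]] by simp
  have "\<phi>' k (L x) = lc (selfmod R) (\<lambda>j. \<phi> j x) (\<lambda>j. \<phi>' k (L (b j))) r"
    using lin_maps_lc[OF M.module_axioms s.module_axioms l, of r "\<lambda>j. \<phi> j x" b] free_modD(4)[OF F x(1)] free_modD(2)[OF F] c by simp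
  also have "lc (selfmod R) (\<lambda>j. \<phi> j x) (\<lambda>j. \<phi>' k (L (b j))) n \<in> I" if "n \<le> r" for n
    using that
  proof (induction n)
    case (Suc n)
    then have "\<phi> n x \<otimes>\<^bsub>R\<^esub> \<phi>' k (L (b n)) \<in> I" using I.I_r_closed[OF x(2) v] by simp
    then show ?case using Suc by simp
  qed simp
  finally show ?thesis by simp
qed

text \<open>A minimal free resolution of the residue field of \<open>p\<close>, with maps over
  \<open>R\<close> and exactness at \<open>p\<close>: \<open>M 0\<close> has rank one, the image of
  \<open>d 0\<close> is the copy of \<open>p\<close> up to factors outside \<open>p\<close>, and
  minimality says that the kernels have all coordinates in \<open>p\<close>.\<close>

locale min_res = noeth_cring R for R (structure) +
  fixes p :: "'a set" and M :: "nat \<Rightarrow> ('a, 'm) module" and r b \<phi> d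
  assumes p: "primeideal p R"
    and free: "\<And>i. free_mod R (M i) (r i) (b i) (\<phi> i)"
    and d: "\<And>i. d i \<in> lin_maps R (M (Suc i)) (M i)"
    and r0: "r 0 = 1"
    and d0: "\<And>x. x \<in> carrier (M (Suc 0)) ==> \<phi> 0 0 (d 0 x) \<in> p"
    and d0_ex: "\<And>y. y \<in> carrier (M 0) ==> \<phi> 0 0 y \<in> p ==> y \<in> sat R (carrier R - p) (M 0) (d 0 ` carrier (M (Suc 0)))"
    and dd: "\<And>i x. x \<in> carrier (M (Suc (Suc i))) ==> d i (d (Suc i) x) = 0[M i]"
    and d_ex: "\<And>i x. x \<in> carrier (M (Suc i)) ==> d i x = 0[M i] ==>
        x \<in> sat R (carrier R - p) (M (Suc i)) (d (Suc i) ` carrier (M (Suc (Suc i))))"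
    and d_min: "\<And>i x j. x \<in> carrier (M (Suc i)) ==> d i x = 0[M i] ==> j < r (Suc i) ==> \<phi> (Suc i) j x \<in> p"
begin

lemmas Mm = free_modD(1)[OF free]

sublocale pp: primeideal p R by (rule p)
sublocale Mm: module R "M i" for i by (rule Mm)

abbreviation "Sp \<equiv> carrier R - p"

lemmas ds = lin_simps[OF Mm Mm d]
lemmas coord = free_mod_coord[OF free]
lemmas coord_lin = lin_simps[OF Mm selfmod_module free_modD(3)[OF free], simplified]

lemma S: "msys R Sp" by (rule msys_compl_prime[OF p])

lemma d_in_p: "x \<in> carrier (M (Suc i)) ==> j < r i ==> \<phi> i j (d i x) \<in> p"
proof (cases i)
  case 0 then show "x \<in> carrier (M (Suc i)) ==> j < r i ==> \<phi> i j (d i x) \<in> p" using d0 r0 by auto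
next
  case (Suc k)
  then show "x \<in> carrier (M (Suc i)) ==> j < r i ==> \<phi> i j (d i x) \<in> p" using d_min dd ds(1) by auto
qed

end

text \<open>Dependent choice over states that carry a free module with its basis and the submodule
  to be covered next: the copy of \<open>p\<close> at the start, afterwards the kernel of the
  differential just chosen.\<close>

lemma (in noeth_cring) min_res_exists:
  fixes \<iota> :: "'a \<Rightarrow> 'm"
  assumes inf: "infinite (UNIV :: 'm set)" and \<iota>: "inj_on \<iota> (carrier R)" and p: "primeideal p R"
  obtains M :: "nat \<Rightarrow> ('a, 'm) module" and r b \<phi> d where "min_res R p M r b \<phi> d"
proof -
  interpret p: primeideal p R by fact
  let ?S = "carrier R - p"
  let ?Mo = "\<lambda>s. fst s :: ('a, 'm) module" and ?K = "\<lambda>s. fst (snd s) :: 'm set" and ?r = "\<lambda>s. fst (snd (snd s)) :: nat"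
  let ?b = "\<lambda>s. fst (snd (snd (snd s))) :: nat \<Rightarrow> 'm" and ?\<phi> = "\<lambda>s. fst (snd (snd (snd (snd s)))) :: nat \<Rightarrow> 'm \<Rightarrow> 'a"
  let ?d = "\<lambda>s. snd (snd (snd (snd (snd s)))) :: 'm \<Rightarrow> 'm"
  define P where "P n s \<longleftrightarrow> free_mod R (?Mo s) (?r s) (?b s) (?\<phi> s) \<and> submodule (?K s) R (?Mo s) \<and>
    (n = 0 \<longrightarrow> ?r s = 1 \<and> ?K s = {x \<in> carrier (?Mo s). ?\<phi> s 0 x \<in> p})" for n :: nat and s :: "('a, 'm) module \<times> 'm set \<times> nat \<times> (nat \<Rightarrow> 'm) \<times> (nat \<Rightarrow> 'm \<Rightarrow> 'a) \<times> ('m \<Rightarrow> 'm)"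
  define Q where "Q n s s' \<longleftrightarrow> ?d s' \<in> lin_maps R (?Mo s') (?Mo s) \<and> ?d s' ` carrier (?Mo s') \<subseteq> ?K s \<and>
    ?K s \<subseteq> sat R ?S (?Mo s) (?d s' ` carrier (?Mo s')) \<and> ?K s' = {x \<in> carrier (?Mo s'). ?d s' x = 0[?Mo s]} \<and>
    (\<forall>x\<in>?K s'. \<forall>j<?r s'. ?\<phi> s' j x \<in> p)" for n :: nat and s s' :: "('a, 'm) module \<times> 'm set \<times> nat \<times> (nat \<Rightarrow> 'm) \<times> (nat \<Rightarrow> 'm \<Rightarrow> 'a) \<times> ('m \<Rightarrow> 'm)"
  have "\<exists>f. \<forall>n. P n (f n) \<and> Q n (f n) (f (Suc n))"
  proof (rule dependent_nat_choice)
    obtain M :: "('a, 'm) module" and b \<phi> where F: "free_mod R M 1 b \<phi>" by (rule free_mod_exists[OF inf \<iota>])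
    interpret M: module R M by (rule free_modD(1)[OF F])
    have \<phi>0: "\<phi> 0 \<in> lin_maps R M (selfmod R)" using free_modD(3)[OF F] by simp
    note fs = lin_simps[OF M.module_axioms selfmod_module \<phi>0, simplified]
    have "submodule {x \<in> carrier M. \<phi> 0 x \<in> p} R M"
      by (rule M.submoduleI') (auto simp: fs intro: p.I_l_closed)
    then show "\<exists>s. P 0 s" using F unfolding P_def
      by (intro exI[of _ "(M, {x \<in> carrier M. \<phi> 0 x \<in> p}, 1, b, \<phi>, \<lambda>x. x)"]) auto
  next
    fix s :: "('a, 'm) module \<times> 'm set \<times> nat \<times> (nat \<Rightarrow> 'm) \<times> (nat \<Rightarrow> 'm \<Rightarrow> 'a) \<times> ('m \<Rightarrow> 'm)" and n
    assume s: "P n s"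
    then have F: "free_mod R (?Mo s) (?r s) (?b s) (?\<phi> s)" and K: "submodule (?K s) R (?Mo s)" by (auto simp: P_def)
    obtain M :: "('a, 'm) module" and r b \<phi> d where *: "free_mod R M r b \<phi>" "d \<in> lin_maps R M (?Mo s)" "d ` carrier M \<subseteq> ?K s"
      "?K s \<subseteq> sat R ?S (?Mo s) (d ` carrier M)"
      "\<And>x i. x \<in> carrier M ==> d x = 0[?Mo s] ==> i < r ==> \<phi> i x \<in> p"
      by (rule minimal_cover[OF inf \<iota> p free_noeth[OF noeth_cring_axioms F] K]) (rule that, assumption, assumption, assumption, assumption, blast)
    interpret M: module R M by (rule free_modD(1)[OF *(1)])
    interpret N: module R "?Mo s" by (rule free_modD(1)[OF F])
    have "submodule {x \<in> carrier M. d x = 0[?Mo s]} R M"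
      by (rule M.submoduleI') (auto simp: lin_simps[OF M.module_axioms N.module_axioms *(2)])
    then show "\<exists>s'. P (Suc n) s' \<and> Q n s s'" using * unfolding P_def Q_def
      by (intro exI[of _ "(M, {x \<in> carrier M. d x = 0[?Mo s]}, r, b, \<phi>, d)"]) auto
  qed
  then obtain f where f: "\<And>n. P n (f n)" "\<And>n. Q n (f n) (f (Suc n))" by blast
  have "min_res R p (\<lambda>i. ?Mo (f i)) (\<lambda>i. ?r (f i)) (\<lambda>i. ?b (f i)) (\<lambda>i. ?\<phi> (f i)) (\<lambda>i. ?d (f (Suc i)))"
  proof (rule min_res.intro[OF noeth_cring_axioms], rule min_res_axioms.intro[OF p])
    fix i
    show "free_mod R (?Mo (f i)) (?r (f i)) (?b (f i)) (?\<phi> (f i))" using f(1)[of i] by (simp add: P_def)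
    show "?d (f (Suc i)) \<in> lin_maps R (?Mo (f (Suc i))) (?Mo (f i))" using f(2)[of i] by (simp add: Q_def)
    show "?r (f 0) = 1" using f(1)[of 0] by (simp add: P_def)
    show "?\<phi> (f 0) 0 (?d (f (Suc 0)) x) \<in> p" if "x \<in> carrier (?Mo (f (Suc 0)))" for x
      using f(1)[of 0] f(2)[of 0] that by (auto simp: P_def Q_def)
    show "y \<in> sat R ?S (?Mo (f 0)) (?d (f (Suc 0)) ` carrier (?Mo (f (Suc 0))))" if "y \<in> carrier (?Mo (f 0))" "?\<phi> (f 0) 0 y \<in> p" for y
      using f(1)[of 0] f(2)[of 0] that by (auto simp: P_def Q_def)
    show "?d (f (Suc i)) (?d (f (Suc (Suc i))) x) = 0[?Mo (f i)]" if "x \<in> carrier (?Mo (f (Suc (Suc i))))" for x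
      using f(2)[of i] f(2)[of "Suc i"] that by (auto simp: Q_def)
    show "x \<in> sat R ?S (?Mo (f (Suc i))) (?d (f (Suc (Suc i))) ` carrier (?Mo (f (Suc (Suc i)))))"
      if "x \<in> carrier (?Mo (f (Suc i)))" "?d (f (Suc i)) x = 0[?Mo (f i)]" for x
      using f(2)[of i] f(2)[of "Suc i"] that by (auto simp: Q_def)
    show "?\<phi> (f (Suc i)) j x \<in> p" if "x \<in> carrier (?Mo (f (Suc i)))" "?d (f (Suc i)) x = 0[?Mo (f i)]" "j < ?r (f (Suc i))" for x j
      using f(2)[of i] that by (auto simp: Q_def)
  qed
  then show ?thesis by (rule that)
qed

section \<open>Complexes in degrees at most \<open>n\<close>\<close>

text \<open>\<open>M i\<close> sits in cohomological degree \<open>n - i\<close>, so the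
  differential out of degree \<open>n - i - 1\<close> is \<open>d i\<close>. Elsewhere the
  differential has to be the zero of its actual target, hence the nested conditional.\<close>

definition desc :: "int \<Rightarrow> nat \<Rightarrow> (nat \<Rightarrow> ('a, 'm) module) \<Rightarrow> (nat \<Rightarrow> 'm \<Rightarrow> 'm) \<Rightarrow> ('a, 'm) cpx" where
  "desc n N M d = \<lparr>cmod = (\<lambda>k. if n - int N \<le> k \<and> k \<le> n then M (nat (n - k)) else zmod),
     cdiff = (\<lambda>k x. if n - int N \<le> k \<and> k < n then d (nat (n - k - 1)) x
       else zero (if n - int N \<le> k + 1 \<and> k + 1 \<le> n then M (nat (n - k - 1)) else zmod))\<rparr>"

lemma desc_simps:
  "i \<le> N ==> (desc n N M d)$(n - int i) = M i"
  "Suc i \<le> N ==> cdiff (desc n N M d) (n - int (Suc i)) = d i"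
  "k < n - int N \<or> n < k ==> (desc n N M d)$k = zmod"
  by (auto simp: desc_def fun_eq_iff nat_diff_distrib)

lemma desc_cases:
  fixes k n :: int
  obtains i where "i \<le> N" "k = n - int i" | "k < n - int N \<or> n < k"
proof (cases "k < n - int N \<or> n < k")
  case False
  then show ?thesis using that(1)[of "nat (n - k)"] by auto
qed (use that in blast)

lemma (in cring) desc_perf:
  assumes M: "\<And>i. i \<le> N ==> fgp R (M i)" and d: "\<And>i. Suc i \<le> N ==> d i \<in> lin_maps R (M (Suc i)) (M i)"
    and dd: "\<And>i x. Suc (Suc i) \<le> N ==> x \<in> carrier (M (Suc (Suc i))) ==> d i (d (Suc i) x) = 0[M i]"
  shows "perf_cpx R (desc n N M d)"
proof -
  let ?D = "desc n N M d"
  have fg: "fgp R (?D$k)" for k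
    by (rule desc_cases[of N k n]) (auto simp: desc_simps M zmod_fgp)
  have Mm: "module R (?D$k)" for k using fg by (simp add: fgp_def)
  have z: "cdiff ?D k = (\<lambda>x. 0[?D$(k + 1)])" if "\<not> (n - int N \<le> k \<and> k < n)" for k
    using that by (auto simp: desc_def fun_eq_iff algebra_simps)
  have lin: "cdiff ?D k \<in> lin_maps R (?D$k) (?D$(k + 1))" for k
  proof (cases "n - int N \<le> k \<and> k < n")
    case True
    define i where "i = nat (n - k - 1)"
    have k: "k = n - int (Suc i)" "Suc i \<le> N" "k + 1 = n - int i" using True by (auto simp: i_def)
    have e: "cdiff ?D k = d i" "?D$k = M (Suc i)" "?D$(k + 1) = M i"
      unfolding k(3) unfolding k(1) using k(2) by (simp_all only: desc_simps Suc_leD)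
    show ?thesis unfolding e using d k(2) .
  next
    case False
    then show ?thesis unfolding z[OF False] by (rule_tac lin_maps_zero[OF Mm Mm])
  qed
  have "?D \<in> complexes R" unfolding complexes_def
  proof (intro CollectI conjI allI ballI Mm lin)
    fix k x assume x: "x \<in> el ?D k"
    show "cdiff ?D (k + 1) (cdiff ?D k x) = 0[?D$(k + 2)]"
    proof (cases "n - int N \<le> k + 1 \<and> k + 1 < n \<and> n - int N \<le> k \<and> k < n")
      case True
      define i where "i = nat (n - k - 2)"
      have k: "k = n - int (Suc (Suc i))" "Suc (Suc i) \<le> N" "k + 1 = n - int (Suc i)" "k + 2 = n - int i" using True by (auto simp: i_def)
      have e: "cdiff ?D (k + 1) = d i" "cdiff ?D k = d (Suc i)" "?D$k = M (Suc (Suc i))" "?D$(k + 2) = M i"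
        unfolding k(4) unfolding k(3) unfolding k(1) using k(2) by (simp_all only: desc_simps Suc_leD)
      show ?thesis using dd[OF k(2)] x unfolding e by simp
    next
      case False
      show ?thesis
      proof (cases "n - int N \<le> k + 1 \<and> k + 1 < n")
        case True
        then have F1: "\<not> (n - int N \<le> k \<and> k < n)" using False by auto
        show ?thesis unfolding z[OF F1] using lin_simps(4)[OF Mm Mm lin, of "k + 1"] by (simp add: add.assoc)
      next
        case F2: False
        then show ?thesis unfolding z[OF F2] by (simp add: add.assoc)
      qed
    qed
  qed
  moreover have "bounded_cpx ?D" unfolding bounded_cpx_def
    by (intro exI[of _ "n - int N"] exI[of _ n]) (auto simp: desc_simps)
  ultimately show ?thesis using fg by (simp add: perf_cpx_def)
qed

lemma desc_exact:
  assumes D: "desc n N M d \<in> complexes R" and i: "Suc (Suc i) \<le> N"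
    and ex: "\<And>x. x \<in> carrier (M (Suc i)) ==> d i x = 0[M i] ==> x \<in> sat R S (M (Suc i)) (d (Suc i) ` carrier (M (Suc (Suc i))))"
  shows "exact_at R S (desc n N M d) (n - int (Suc i))"
proof -
  let ?D = "desc n N M d"
  have k: "n - int (Suc i) + 1 = n - int i" "n - int (Suc i) - 1 = n - int (Suc (Suc i))" by simp_all
  have e: "?D$(n - int (Suc i)) = M (Suc i)" "?D$(n - int i) = M i" "cmod ?D (n - int (Suc (Suc i))) = M (Suc (Suc i))"
    "cdiff ?D (n - int (Suc i)) = d i" "cdiff ?D (n - int (Suc (Suc i))) = d (Suc i)"
    using i by (simp_all only: desc_simps Suc_leD)
  show ?thesis unfolding exact_at_def coboundaries_def k e
  proof
    fix x assume "x \<in> cyc ?D (n - int (Suc i))"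
    then show "x \<in> sat R S (M (Suc i)) (d (Suc i) ` carrier (M (Suc (Suc i))))"
      using ex by (simp only: mem_cocycles k e)
  qed
qed

lemma (in cring) desc_exact_outside:
  assumes D: "desc n N M d \<in> complexes R" and S: "msys R S" and k: "k < n - int N \<or> n < k"
  shows "exact_at R S (desc n N M d) k"
  by (rule exact_at_zero[OF D S]) (simp add: desc_simps(3)[OF k])

section \<open>Truncations by an aisle\<close>

lemma (in noeth_cring) prime_generators:
  assumes p: "primeideal p R" obtains xs where "set xs \<subseteq> p" "p = Idl (set xs)"
proof -
  interpret p: primeideal p R by fact
  obtain G where G: "G \<subseteq> carrier R" "finite G" "p = Idl G" using finetely_gen[OF p.is_ideal] by blast
  obtain xs where "set xs = G" using finite_list[OF G(2)] by blast
  then show ?thesis using that[of xs] G genideal_self[OF G(1)] by simp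
qed

text \<open>The annihilator of a nonzero class is a proper ideal, and the class survives at any
  prime containing it.\<close>

lemma (in noeth_cring) not_exact_prime:
  assumes B: "B \<in> complexes R" and n: "\<not> exact_at R {\<one>} B l"
  obtains p where "primeideal p R" "\<not> exact_at R (carrier R - p) B l"
proof -
  interpret M: module R "B$l" by (rule cpxD(1)[OF B])
  obtain z where z: "z \<in> cyc B l" "z \<notin> bd B l" using n unfolding exact_at_one[OF B] by blast
  have zc: "z \<in> el B l" using z by (simp add: mem_cocycles)
  let ?I = "{a \<in> carrier R. a *[B$l] z \<in> bd B l}"
  have "\<one> \<notin> ?I" using z zc by simp
  then have "?I \<noteq> carrier R" by blast
  then obtain p where p: "primeideal p R" "?I \<subseteq> p"
    using proper_ideal_in_prime[OF M.annihilator_ideal[OF coboundaries_submodule[OF B] zc]] by blast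
  have "z \<notin> sat R (carrier R - p) (B$l) (bd B l)" using p(2) unfolding sat_def by blast
  then have "\<not> exact_at R (carrier R - p) B l" using z(1) unfolding exact_at_def by blast
  with p(1) show ?thesis by (rule that)
qed

text \<open>The facts about the t-structure used below, freed from roofs: \<open>UU\<close> stands
  for the strictly perfect members of the aisle, and \<open>UU_orth\<close> is the truncation
  triangle as an explicit cone.\<close>

locale truncation = noeth_cring R for R (structure) +
  fixes UU :: "('a, 'm) cpx set" and \<eta> :: "'a set"
  assumes inf: "infinite (UNIV :: 'm set)" and enc: "\<exists>\<iota> :: 'a \<Rightarrow> 'm. inj_on \<iota> (carrier R)"
    and UU_perf: "P \<in> UU ==> perf_cpx R P"
    and UU_orth: "perf_cpx R F ==> \<exists>A\<in>UU. \<exists>a C \<phi>. mcone R A F a C \<phi> \<and> (\<forall>P\<in>UU. orth R P C 0)"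
    and \<eta>: "primeideal \<eta> R" and \<eta>_min: "primeideal q R ==> \<eta> \<subseteq> q"
begin

lemma sphere_exists:
  obtains F :: "('a, 'm) cpx" where "perf_cpx R F" "\<not> exact_at R (carrier R - \<eta>) F k"
proof -
  obtain \<iota> :: "'a \<Rightarrow> 'm" where \<iota>: "inj_on \<iota> (carrier R)" using enc by blast
  obtain M :: "('a, 'm) module" and b \<phi> where F: "free_mod R M 1 b \<phi>" by (rule free_mod_exists[OF inf \<iota>])
  interpret M: module R M by (rule free_modD(1)[OF F])
  interpret \<eta>: primeideal \<eta> R by (rule \<eta>)
  let ?F = "desc k 0 (\<lambda>_. M) (\<lambda>_ x. x)"
  have P: "perf_cpx R ?F" by (rule desc_perf) (auto intro: free_modD(6)[OF F])
  have m: "?F$k = M" "?F$(k - 1) = zmod" "?F$(k + 1) = zmod" by (simp_all add: desc_def)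
  have d: "cdiff ?F k x = undefined" "cdiff ?F (k - 1) x = 0[M]" for x by (simp_all add: desc_def)
  have b: "b 0 \<in> carrier M" using free_modD(2)[OF F] by simp
  have "b 0 \<notin> sat R (carrier R - \<eta>) (?F$k) (bd ?F k)"
  proof
    assume "b 0 \<in> sat R (carrier R - \<eta>) (?F$k) (bd ?F k)"
    then obtain t where t: "t \<in> carrier R" "t \<notin> \<eta>" "t *[M] b 0 = 0[M]" unfolding sat_def mem_coboundaries m d by auto
    have \<phi>0: "\<phi> 0 \<in> lin_maps R M (selfmod R)" using free_modD(3)[OF F] by simp
    note l = lin_simps[OF M.module_axioms selfmod_module \<phi>0, simplified]
    have "\<phi> 0 (t *[M] b 0) = t" using l(3)[OF t(1) b] free_modD(5)[OF F, of 0 0] t(1) by simp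
    then have "t = \<zero>" using t(3) l(4) by simp
    then show False using t(2) \<eta>.zero_closed by simp
  qed
  moreover have "b 0 \<in> cyc ?F k" unfolding mem_cocycles m d using b by simp
  ultimately show ?thesis using that[OF P] unfolding exact_at_def by blast
qed

text \<open>Truncate a copy of \<open>R\<close> placed in degree \<open>k\<close>. By the depth
  estimate the cone is exact there at \<open>p\<close>, hence at the smaller prime
  \<open>\<eta>\<close>; the copy of \<open>R\<close> is not, so neither is \<open>A\<close>. The
  drop from \<open>s\<close> to \<open>k\<close> is at least the number of generators of
  \<open>p\<close>.\<close>

lemma generic_degree:
  assumes p: "primeideal p R" and xs: "set xs \<subseteq> p" "p = Idl (set xs)" and P: "P \<in> UU"
    and nz: "\<not> exact_at R (carrier R - p) P s" and k: "k + int (length xs) \<le> s"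
  obtains A where "A \<in> UU" "\<not> exact_at R (carrier R - \<eta>) A k"
proof -
  have S\<eta>: "msys R (carrier R - \<eta>)" by (rule msys_compl_prime[OF \<eta>])
  obtain F :: "('a, 'm) cpx" where F: "perf_cpx R F" "\<not> exact_at R (carrier R - \<eta>) F k" by (rule sphere_exists)
  obtain A a C \<phi> where A: "A \<in> UU" "mcone R A F a C \<phi>" "\<forall>P\<in>UU. orth R P C 0" using UU_orth[OF F(1)] by blast
  interpret C: mcone R A F a C \<phi> by (rule A(2))
  have PC: "perf_cpx R C" by (rule C.perf_cone[OF UU_perf[OF A(1)] F(1)])
  have "exact_at R (carrier R - p) C k"
    by (rule exact_below[OF inf p xs UU_perf[OF P] PC _ nz k]) (use A P in blast)
  then have "exact_at R (carrier R - \<eta>) C k" using exact_at_mono[OF _ compl_mono[OF \<eta>_min[OF p]]] by blast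
  then have "\<not> exact_at R (carrier R - \<eta>) A k" using C.exact_target[OF S\<eta>] F(2) by blast
  then show ?thesis using that A(1) by blast
qed

text \<open>Cohomology at any prime would force cohomology at \<open>\<eta>\<close> some degrees
  lower.\<close>

lemma all_exact:
  assumes none: "\<And>P s. P \<in> UU ==> exact_at R (carrier R - \<eta>) P s" and P: "P \<in> UU"
  shows "exact_at R {\<one>} P s"
proof (rule ccontr)
  assume "\<not> ?thesis"
  from not_exact_prime[OF perfD(1)[OF UU_perf[OF P]] this]
  obtain p where p: "primeideal p R" "\<not> exact_at R (carrier R - p) P s" .
  obtain xs where xs: "set xs \<subseteq> p" "p = Idl (set xs)" by (rule prime_generators[OF p(1)])
  obtain A where "A \<in> UU" "\<not> exact_at R (carrier R - \<eta>) A (s - int (length xs))"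
    by (rule generic_degree[OF p(1) xs P p(2), of "s - int (length xs)"]) auto
  then show False using none by blast
qed

lemma orth_exact:
  assumes unb: "\<And>m. \<exists>P\<in>UU. \<exists>s\<ge>m. \<not> exact_at R (carrier R - \<eta>) P s"
    and C: "perf_cpx R C" "\<And>P. P \<in> UU ==> orth R P C 0"
  shows "exact_at R {\<one>} C k"
proof -
  obtain P s where P: "P \<in> UU" "k \<le> s" "\<not> exact_at R (carrier R - \<eta>) P s" using unb[of k] by blast
  show ?thesis by (rule exact_below_generic[OF \<eta> \<eta>_min UU_perf[OF P(1)] C(1) C(2)[OF P(1)] P(3,2)])
qed

text \<open>Degrees at \<open>p\<close> exceed the generic bound \<open>e\<close> by at most the
  number of generators of \<open>p\<close>, so a largest one exists.\<close>

lemma top_degree: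
  assumes e: "P0 \<in> UU" "\<not> exact_at R (carrier R - \<eta>) P0 e"
    and bd: "\<And>P k. P \<in> UU ==> e < k ==> exact_at R (carrier R - \<eta>) P k" and p: "primeideal p R"
  obtains n where "e \<le> n" "\<And>P k. P \<in> UU ==> n < k ==> exact_at R (carrier R - p) P k"
    "\<exists>P\<in>UU. \<not> exact_at R (carrier R - p) P n"
proof -
  obtain xs where xs: "set xs \<subseteq> p" "p = Idl (set xs)" by (rule prime_generators[OF p])
  let ?Q = "\<lambda>s. \<exists>P\<in>UU. \<not> exact_at R (carrier R - p) P s"
  have Qe: "?Q e" using e exact_at_mono[OF _ compl_mono[OF \<eta>_min[OF p]]] by blast
  have Qb: "\<not> ?Q s" if s: "e + int (length xs) < s" for s
  proof
    assume "?Q s"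
    then obtain P where P: "P \<in> UU" "\<not> exact_at R (carrier R - p) P s" by blast
    obtain A where "A \<in> UU" "\<not> exact_at R (carrier R - \<eta>) A (s - int (length xs))"
      by (rule generic_degree[OF p xs P, of "s - int (length xs)"]) auto
    then show False using bd[of A "s - int (length xs)"] s by simp
  qed
  obtain n where n: "?Q n" "e \<le> n" "\<And>i. n < i ==> \<not> ?Q i"
    using int_greatest[of ?Q, OF Qe Qb] by metis
  show ?thesis by (rule that[OF n(2) _ n(1)]) (use n(3) in blast)
qed

text \<open>The residue field of \<open>R\<^sub>p\<close> has finite projective dimension: for the truncation \<open>D\<close> of its minimal
  resolution placed in degrees \<open>e, \<dots>, n + 1\<close>, just above the top degree of the aisle at \<open>p\<close>, the part \<open>A\<close> in
  the aisle is at \<open>p\<close> the syzygy module in degree \<open>e\<close>. The tail \<open>T\<close> of the resolution is a minimal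
  resolution of the same module, so it is as bounded as \<open>A\<close>.\<close>

lemma finite_min_res:
  assumes e: "P0 \<in> UU" "\<not> exact_at R (carrier R - \<eta>) P0 e"
    and bd: "\<And>P k. P \<in> UU ==> e < k ==> exact_at R (carrier R - \<eta>) P k" and p: "primeideal p R"
  obtains M :: "nat \<Rightarrow> ('a, 'm) module" and r b \<phi> d N where "min_res R p M r b \<phi> d" "r N = 0"
proof -
  let ?S = "carrier R - p"
  interpret pp: primeideal p R by (rule p)
  have S: "msys R ?S" by (rule msys_compl_prime[OF p])
  note SD = msysD[OF S]
  obtain n where n: "e \<le> n" "\<And>P k. P \<in> UU ==> n < k ==> exact_at R ?S P k" "\<exists>P\<in>UU. \<not> exact_at R ?S P n"
    by (rule top_degree[OF e bd p]) (assumption, assumption, rule that, assumption, assumption, blast)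
  obtain \<iota> :: "'a \<Rightarrow> 'm" where \<iota>: "inj_on \<iota> (carrier R)" using enc by blast
  obtain M :: "nat \<Rightarrow> ('a, 'm) module" and r b \<phi> d where MR: "min_res R p M r b \<phi> d"
    by (rule min_res_exists[OF inf \<iota> p])
  interpret M: min_res R p M r b \<phi> d by (rule MR)
  \<comment> \<open>\<open>N0\<close> and \<open>N\<close> are the positions in the resolution of
    the degrees \<open>e + 1\<close> and \<open>e\<close>, its start being in degree
    \<open>n + 1\<close>.\<close>
  define N0 where "N0 = nat (n - e)"
  define N where "N = Suc N0"
  define D where "D = desc (n + 1) N M d"
  have N: "e = n + 1 - int N" "e + 1 = n + 1 - int N0" using n(1) by (simp_all add: N_def N0_def)
  have DP: "perf_cpx R D" unfolding D_def
    by (rule desc_perf) (auto intro: free_modD(6)[OF M.free] M.d M.dd)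
  note Dc = perfD(1)[OF DP]
  have De: "D$e = M N" "D$(e + 1) = M N0" "cdiff D e = d N0" "D$(e - 1) = zmod"
  proof -
    show "D$e = M N" unfolding D_def N(1) by (rule desc_simps(1)) simp
    show "D$(e + 1) = M N0" unfolding D_def N(2) by (rule desc_simps(1)) (simp add: N_def)
    have "cdiff D (n + 1 - int (Suc N0)) = d N0" unfolding D_def by (rule desc_simps(2)) (simp add: N_def)
    then show "cdiff D e = d N0" by (simp add: N(1) N_def)
    show "D$(e - 1) = zmod" unfolding D_def N(1) by (rule desc_simps(3)) simp
  qed
  have Dex: "exact_at R ?S D k" if "k \<noteq> e" "k \<noteq> n + 1" for k
  proof (cases "k < e \<or> n + 1 < k")
    case True then show ?thesis using desc_exact_outside[OF Dc[unfolded D_def] S] unfolding D_def N(1) by blast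
  next
    case False
    define i where "i = nat (n - k)"
    have i: "k = n + 1 - int (Suc i)" "Suc (Suc i) \<le> N" using that False N by (auto simp: i_def)
    show ?thesis unfolding i(1) D_def by (rule desc_exact[OF Dc[unfolded D_def] i(2) M.d_ex])
  qed
  obtain A a C \<psi> where A: "A \<in> UU" "mcone R A D a C \<psi>" "\<forall>P\<in>UU. orth R P C 0" using UU_orth[OF DP] by blast
  interpret C: mcone R A D a C \<psi> by (rule A(2))
  have PA: "perf_cpx R A" by (rule UU_perf[OF A(1)])
  have PC: "perf_cpx R C" by (rule C.perf_cone[OF PA DP])
  \<comment> \<open>\<open>P0\<close> is not exact at \<open>\<eta>\<close> in degree
    \<open>e\<close>, so the generic estimate applies without loss.\<close>
  have Cex1: "exact_at R {\<one>} C k" if "k \<le> e" for k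
    by (rule exact_below_generic[OF \<eta> \<eta>_min UU_perf[OF e(1)] PC bspec[OF A(3) e(1)] e(2) that])
  have S1: "{\<one>} \<subseteq> carrier R - q" if "primeideal q R" for q
  proof -
    interpret q: primeideal q R by fact
    show ?thesis using q.I_notcarr q.one_imp_carrier by auto
  qed
  \<comment> \<open>Consider an associated prime \<open>q\<close> of the lowest cohomology of
    \<open>C\<close>, in degree \<open>l\<close> with \<open>e < l \<le> n\<close>. There
    \<open>A\<close> is exact in degree \<open>l + 1\<close>, because it is orthogonal to
    \<open>C\<close>, and \<open>D\<close> is exact in degree \<open>l\<close>. So \<open>C\<close>
    would be exact as well.\<close>
  have Clow: "exact_at R ?S C k" if k: "k \<le> n" for k
  proof (rule ccontr)
    assume nk: "\<not> ?thesis"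
    have lo: "\<And>i. i < e ==> \<not> \<not> exact_at R ?S C i" using exact_at_mono[OF Cex1 S1[OF p]] by simp
    obtain l where l: "\<not> exact_at R ?S C l" "l \<le> k" "\<And>i. i < l ==> exact_at R ?S C i"
      using int_least[of "\<lambda>i. \<not> exact_at R ?S C i", OF nk lo] by metis
    have le: "e < l" using l(1) exact_at_mono[OF Cex1 S1[OF p], of l] by force
    obtain q w where q: "primeideal q R" "q \<subseteq> p" and w: "w \<in> cyc C l"
      "\<And>r. r \<in> carrier R ==> r *[C$l] w \<in> bd C l \<longleftrightarrow> r \<in> q"
      by (rule associated_cocycle[OF C.C p l(1)]) (rule that, assumption, assumption, assumption, blast)
    have Sq: "msys R (carrier R - q)" by (rule msys_compl_prime[OF q(1)])
    have bot: "exact_at R (carrier R - q) C i" if "i < l" for i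
      using l(3)[OF that] exact_at_mono[OF _ compl_mono[OF q(2)]] by blast
    have "exact_at R (carrier R - q) A (l + 1)"
    proof (rule ccontr)
      assume nz: "\<not> ?thesis"
      show False by (rule orth_associated_prime[OF q(1) PA C.C _ w bot nz]) (use A in auto)
    qed
    moreover have "exact_at R (carrier R - q) D l"
      by (rule exact_at_mono[OF Dex compl_mono[OF q(2)]]) (use le l(2) k in auto)
    ultimately have "exact_at R (carrier R - q) C l" by (rule C.exact_cone[OF Sq])
    then have "w \<in> sat R (carrier R - q) (C$l) (bd C l)" using w(1) unfolding exact_at_def by blast
    then show False using w(2) unfolding sat_def by blast
  qed
  \<comment> \<open>Exactness of the cone one degree lower makes \<open>a\<close> injective on
    cohomology at \<open>p\<close> in degrees up to \<open>n + 1\<close>.\<close>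
  have Asat: "z \<in> sat R ?S (A$k) (bd A k)" if "z \<in> cyc A k" "a k z \<in> sat R ?S (D$k) (bd D k)" "k \<le> n + 1" for z k
    using C.source_sat[OF S Clow, of "k - 1" z] that by simp
  \<comment> \<open>Up to degree \<open>n\<close> the cohomology of \<open>A\<close> at
    \<open>p\<close> embeds into that of \<open>D\<close>, which lives only in degree
    \<open>e\<close> there; above \<open>n\<close> it vanishes by the choice of
    \<open>n\<close>.\<close>
  have Aex: "exact_at R ?S A k" if k: "k \<noteq> e" for k
  proof (cases "k \<le> n")
    case True
    show ?thesis unfolding exact_at_def
    proof
      fix z assume z: "z \<in> cyc A k"
      then show "z \<in> sat R ?S (A$k) (bd A k)"
        using chain_map_cocycle[OF C.X Dc C.f z] Dex[of k] k True by (intro Asat) (auto simp: exact_at_def)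
    qed
  qed (use n(2)[OF A(1)] in simp)
  have D0s: "0[D$e] \<in> sat R ?S (D$e) (bd D e)"
  proof -
    show ?thesis by (rule C.Y.submoduleD(2)[OF C.Y.sat_submodule[OF S coboundaries_submodule[OF Dc]]])
  qed
  have ae0: "a e z = 0[M N]" if "z \<in> bd A e" for z
  proof -
    obtain y where y: "y \<in> el A (e - 1)" "z = cdiff A (e - 1) y" using \<open>z \<in> bd A e\<close> unfolding mem_coboundaries by blast
    have "a (e - 1) y \<in> el D (e - 1)" by (rule C.fs(1)[OF y(1)])
    then have "a (e - 1) y = 0[D$(e - 1)]" unfolding De(4) by simp
    then show ?thesis using chain_mapsD(3)[OF C.f y(1)] C.dY(10)[of e] unfolding y(2) De(1)[symmetric] by simp
  qed
  \<comment> \<open>The prescribed image under \<open>a\<close> and the cocycle condition are lifted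
    together, as one map into a direct sum, so that a single linear \<open>h\<close> meets
    both.\<close>
  obtain t h where t: "t \<in> ?S" and h: "h \<in> lin_maps R (M (Suc N)) (A$e)"
    "\<And>x. x \<in> carrier (M (Suc N)) ==> a e (h x) = t *[M N] d N x \<and> cdiff A e (h x) = 0[A$(e + 1)]"
  proof -
    let ?W = "dsum (D$e) (A$(e + 1))"
    have W: "module R ?W" by (rule dsum_module[OF C.Ym C.Xm])
    have g: "(\<lambda>x. (d N x, 0[A$(e + 1)])) \<in> lin_maps R (M (Suc N)) ?W"
      by (rule lin_mapsI) (simp_all add: De(1) M.ds)
    have \<delta>: "(\<lambda>z. (a e z, cdiff A e z)) \<in> lin_maps R (A$e) ?W"
      by (rule lin_mapsI) (simp_all add: C.fs C.dX)
    have "(d N x, 0[A$(e + 1)]) \<in> sat R ?S ?W ((\<lambda>z. (a e z, cdiff A e z)) ` el A e)" if x: "x \<in> carrier (M (Suc N))" for x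
    proof -
      have dx: "d N x \<in> el D e" using M.ds(1)[OF x] De(1) by simp
      have "d N x \<in> cyc D e" using dx M.dd[of x N0] x unfolding mem_cocycles De(2,3) N_def by simp
      then obtain t z y where t: "t \<in> ?S" "z \<in> cyc A e" "y \<in> el D (e - 1)" "t *[D$e] d N x = a e z +[D$e] cdiff D (e - 1) y"
        by (rule C.target_sat[OF S Clow[OF n(1)]])
      have "y = 0[D$(e - 1)]" using t(3) unfolding De(4) by simp
      then have "t *[D$e] d N x = a e z" using t(2,4) C.fs(1)[of z e] C.dY(10)[of e] by (simp add: mem_cocycles De(1))
      then show ?thesis using t(1,2) dx unfolding sat_def by (auto simp: mem_cocycles image_iff intro!: bexI[of _ t] bexI[of _ z])
    qed
    then obtain t h where "t \<in> ?S" "h \<in> lin_maps R (M (Suc N)) (A$e)"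
      and *: "\<And>x. x \<in> carrier (M (Suc N)) ==> (a e (h x), cdiff A e (h x)) = t *[?W] (d N x, 0[A$(e + 1)])"
      by (rule fgp_lift[OF S free_modD(6)[OF M.free] W C.Xm g \<delta>]) (assumption, rule that, assumption, assumption, blast)
    moreover have "t \<in> carrier R" using \<open>t \<in> ?S\<close> by simp
    ultimately show ?thesis by (intro that) (simp_all add: De(1))
  qed
  obtain a0 b0 where a0: "\<And>k. k < a0 \<or> b0 < k ==> el A k = {0[A$k]}"
    using perfD(2)[OF PA] unfolding bounded_cpx_def by blast
  \<comment> \<open>The tail reaches down to degree \<open>m\<close>, low enough that
    \<open>A\<close> vanishes in degrees \<open>m\<close> and \<open>m + 1\<close>: there the cone
    of the comparison map is the tail alone. The two extra steps in \<open>L\<close> make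
    \<open>m + 2 \<le> e\<close>.\<close>
  define L0 where "L0 = nat (e + 2 - a0)"
  define L where "L = Suc (Suc L0)"
  define m where "m = e - int L"
  have m: "m + 1 < a0" "m + 2 \<le> e" by (simp_all add: m_def L_def L0_def)
  define T where "T = desc e L (\<lambda>i. M (Suc N + i)) (\<lambda>i. d (Suc N + i))"
  have TP: "perf_cpx R T" unfolding T_def
    by (rule desc_perf) (use free_modD(6)[OF M.free] M.d[of "Suc N + _"] M.dd[of _ "Suc N + _"] in auto)
  note Tc = perfD(1)[OF TP]
  have Tm: "T$(e - int i) = M (Suc N + i)" if "i \<le> L" for i unfolding T_def using that by (rule desc_simps)
  have Td: "cdiff T (e - int (Suc i)) = d (Suc N + i)" if "Suc i \<le> L" for i unfolding T_def using that by (rule desc_simps)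
  have Tz: "T$k = zmod" if "k < m \<or> e < k" for k unfolding T_def using that unfolding m_def by (rule desc_simps)
  have Te: "T$e = M (Suc N)" "cdiff T (e - 1) = d (Suc N)" "T$(e - 1) = M (Suc (Suc N))" using Tm[of 0] Td[of 0] Tm[of 1] by (simp_all add: L_def)
  have Tex: "exact_at R ?S T k" if "m < k" "k \<noteq> e" for k
  proof (cases "e < k")
    case True then show ?thesis using desc_exact_outside[OF Tc[unfolded T_def] S] unfolding T_def by blast
  next
    case False
    define i where "i = nat (e - k - 1)"
    have i: "k = e - int (Suc i)" "Suc (Suc i) \<le> L" using that False by (auto simp: i_def m_def)
    show ?thesis unfolding i(1) T_def by (rule desc_exact[OF Tc[unfolded T_def] i(2)]) (use M.d_ex[of _ "Suc N + i"] in simp)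
  qed
  define f where "f k = (if k = e then h else (\<lambda>x. 0[A$k]))" for k
  \<comment> \<open>\<open>h\<close> in degree \<open>e\<close>, extended downwards, compares the
    tail \<open>T\<close> with \<open>A\<close>, whose only cohomology at \<open>p\<close> is in
    degree \<open>e\<close>.\<close>
  have "\<exists>u\<in>?S. \<exists>g\<in>chain_maps R T A. \<forall>k\<ge>e. \<forall>x\<in>el T k. g k x = u *[A$k] f k x"
  proof (rule extend_chain_map[OF S Tc perfD(3)[OF TP] C.X, where a = m])
    show "el T k = {0[T$k]}" if "k < m" for k using Tz[of k] that by simp
    show "f k \<in> lin_maps R (T$k) (A$k)" for k using h(1) Te(1) lin_maps_zero[OF cpxD(1)[OF Tc] C.Xm] by (simp add: f_def)
    show "f (k + 1) (cdiff T k x) = cdiff A k (f k x)" if "e \<le> k" "x \<in> el T k" for k x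
      using that h(2)[of x] Te(1) C.dX(4) by (auto simp: f_def)
    show "exact_at R ?S A k" if "k < e" for k using Aex that by simp
    fix x assume x: "x \<in> el T (e - 1)"
    then have x': "x \<in> carrier (M (Suc (Suc N)))" using Te by simp
    have dx: "d (Suc N) x \<in> carrier (M (Suc N))" by (rule M.ds(1)[OF x'])
    have "a e (h (d (Suc N) x)) = 0[M N]" using h(2)[OF dx] M.dd[OF x'] t by simp
    moreover have "h (d (Suc N) x) \<in> cyc A e" using h(2)[OF dx] lin_simps(1)[OF M.Mm C.Xm h(1) dx] by (simp add: mem_cocycles)
    ultimately show "f e (cdiff T (e - 1) x) \<in> sat R ?S (A$e) (bd A e)" using n(1) D0s by (auto simp: f_def Te De(1) intro: Asat)
  qed
  then obtain u g where u: "u \<in> ?S" and g: "g \<in> chain_maps R T A" and "\<And>x. x \<in> el T e ==> g e x = u *[A$e] h x"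
    by (auto simp: f_def)
  then have ag: "a e (g e x) = (u \<otimes> t) *[M N] d N x" if x: "x \<in> carrier (M (Suc N))" for x
  proof -
    have "a e (u *[A$e] h x) = u *[M N] a e (h x)" using C.fs(3)[OF _ lin_simps(1)[OF M.Mm C.Xm h(1) x], of u] u De(1) by simp
    then show ?thesis using h(2)[OF x] u t M.ds(1)[OF x] x \<open>\<And>x. x \<in> el T e ==> g e x = u *[A$e] h x\<close>[of x] Te(1) by (simp add: M.Mm.smult_assoc1)
  qed
  have ut: "u \<otimes> t \<in> ?S" by (rule SD(3)[OF u t])
  obtain E \<theta> where E: "mcone R T A g E \<theta>" by (rule mcone_exists[OF inf Tc C.X g])
  interpret E: mcone R T A g E \<theta> by (rule E)
  have PE: "perf_cpx R E" by (rule E.perf_cone[OF TP PA])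
  \<comment> \<open>In degree \<open>e\<close> the map \<open>d N\<close> on \<open>T\<close> and
    the map \<open>a\<close> on \<open>A\<close> identify both cohomologies at \<open>p\<close> with
    the image of \<open>d N\<close>, up to factors; in the other degrees above \<open>m\<close> both
    complexes are exact at \<open>p\<close>.\<close>
  have Eex: "exact_at R ?S E k" if k: "m \<le> k" for k
  proof -
    show ?thesis
    proof (rule E.exact_coneI[OF S])
      fix x assume x: "x \<in> cyc T (k + 1)" "g (k + 1) x \<in> sat R ?S (A$(k + 1)) (bd A (k + 1))"
      show "x \<in> sat R ?S (T$(k + 1)) (bd T (k + 1))"
      proof (cases "k + 1 = e")
        case False then show ?thesis using Tex[of "k + 1"] k x(1) unfolding exact_at_def by auto
      next
        case True
        obtain s where s: "s \<in> ?S" "s *[A$e] g e x \<in> bd A e" "g e x \<in> el A e" using x(2) unfolding True sat_def by blast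
        have xM: "x \<in> carrier (M (Suc N))" using x(1) True Te(1) by (simp add: mem_cocycles)
        have ss: "s \<otimes> (u \<otimes> t) \<in> ?S" by (rule SD(3)[OF s(1) ut])
        have "s *[M N] a e (g e x) = 0[M N]" using ae0[OF s(2)] C.fs(3)[OF _ s(3), of s] s(1) De(1) by simp
        then have "d N ((s \<otimes> (u \<otimes> t)) *[M (Suc N)] x) = 0[M N]"
          using ag[OF xM] M.ds(3)[OF SD(1)[OF ss] xM] M.ds(1)[OF xM] s(1) ut by (simp add: M.Mm.smult_assoc1)
        then have "(s \<otimes> (u \<otimes> t)) *[M (Suc N)] x \<in> sat R ?S (M (Suc N)) (bd T e)"
          using M.d_ex[of "(s \<otimes> (u \<otimes> t)) *[M (Suc N)] x" N] xM SD(1)[OF ss] unfolding coboundaries_def Te by simp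
        then have "x \<in> sat R ?S (M (Suc N)) (sat R ?S (M (Suc N)) (bd T e))" using xM ss unfolding sat_def[of _ _ _ "sat _ _ _ _"] by blast
        then show ?thesis unfolding M.Mm.sat_sat[OF S] True Te(1) .
      qed
    next
      fix c assume c: "c \<in> cyc A k"
      show "\<exists>t\<in>?S. \<exists>x\<in>cyc T k. t *[A$k] c -[A$k] g k x \<in> bd A k"
      proof (cases "k = e")
        case False
        obtain s where s: "s \<in> ?S" "s *[A$k] c \<in> bd A k" using Aex[of k] c False unfolding exact_at_def sat_def by blast
        have "s *[A$k] c -[A$k] g k 0[T$k] \<in> bd A k"
          using s(2) C.X.submoduleD(1)[OF coboundaries_submodule[OF C.X] s(2)] by (simp add: E.fs a_minus_def)
        then show ?thesis using s(1) E.X.submoduleD(2)[OF cocycles_submodule[OF Tc]] by blast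
      next
        case True
        have T1: "T$(e + 1) = zmod" by (simp add: Tz)
        have cA: "c \<in> el A e" and dc: "cdiff A e c = 0[A$(e + 1)]" using c True by (auto simp: mem_cocycles)
        have ac: "a e c \<in> carrier (M N)" using C.fs(1)[OF cA] De(1) by simp
        have "d N0 (a e c) = 0[M N0]" using chain_mapsD(2)[OF C.f cA] C.fs(4)[of "e + 1"] by (simp add: dc De)
        then obtain w x where w: "w \<in> ?S" "x \<in> carrier (M (Suc N))" "w *[M N] a e c = d N x"
          using M.d_ex[of "a e c" N0] ac unfolding sat_def N_def by auto
        have wc: "w \<in> carrier R" "u \<otimes> t \<in> carrier R" using w ut by auto
        have xT: "x \<in> el T e" using w(2) Te(1) by simp
        have xz: "x \<in> cyc T e" using E.dX(1)[OF xT] xT unfolding mem_cocycles T1 by simp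
        have gx: "g e x \<in> cyc A e" by (rule chain_map_cocycle[OF Tc C.X g xz])
        let ?s = "(u \<otimes> t) \<otimes> w"
        let ?z = "?s *[A$e] c -[A$e] g e x"
        have "?z \<in> cyc A e" using C.X.submoduleD(5,6)[OF cocycles_submodule[OF C.X]] gx c wc True by simp
        moreover have "a e ?z = 0[D$e]"
          using ag[OF w(2)] w(3)[symmetric] ac wc gx cA by (simp add: mem_cocycles C.fs De(1) M.Mm.smult_assoc1 M.Mm.r_neg a_minus_def)
        ultimately have "?z \<in> sat R ?S (A$e) (bd A e)" using n(1) D0s by (auto intro: Asat)
        then obtain v where v: "v \<in> ?S" "v *[A$e] ?z \<in> bd A e" unfolding sat_def by blast
        have "v *[A$e] ?z = (v \<otimes> ?s) *[A$e] c -[A$e] g e (v *[T$e] x)"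
          using v(1) wc cA gx E.fs(3)[OF _ xT, of v] by (simp add: mem_cocycles C.X.smult_r_distr C.X.smult_assoc1 C.X.smult_r_minus a_minus_def)
        moreover have "v *[T$e] x \<in> cyc T e" using E.X.submoduleD(5)[OF cocycles_submodule[OF Tc], of v x] xz v(1) by simp
        ultimately show ?thesis using v(2) SD(3)[OF v(1) SD(3)[OF ut w(1)]] unfolding True by (intro bexI[of _ "v \<otimes> ?s"] bexI[of _ "v *[T$e] x"]) simp_all
      qed
    qed
  qed
  obtain aE bE where bE: "\<And>k. k < aE \<or> bE < k ==> el E k = {0[E$k]}"
    using perfD(2)[OF PE] unfolding bounded_cpx_def by blast
  \<comment> \<open>Exactness of \<open>E\<close> at \<open>p\<close> from \<open>m\<close> upwards
    contracts its identity there, up to a factor outside \<open>p\<close>.\<close>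
  have "\<exists>t\<in>?S. \<exists>h. (\<forall>n. h n \<in> lin_maps R (E$n) (E$(n - 1))) \<and>
    (\<forall>n\<ge>m. \<forall>x\<in>el E n. t *[E$n] cmap_id n x =
       cdiff E (n - 1) (h n x) +[E$n] h (n + 1) (cdiff E n x))"
  proof (rule descend_homotopy[OF S E.C perfD(3)[OF PE] E.C chain_maps_id[OF E.C], where b = "bE + 1"])
    fix x assume "x \<in> el E (bE + 1)"
    then have "x = 0[E$(bE + 1)]" using bE[of "bE + 1"] by auto
    show "cmap_id (bE + 1) x \<in> sat R ?S (E$(bE + 1)) (bd E (bE + 1))"
      using E.C.submoduleD(2)[OF E.C.sat_submodule[OF S coboundaries_submodule[OF E.C]]]
      unfolding \<open>x = _\<close> cmap_id_def .
  qed (use bE Eex in auto)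
  then obtain v h where v: "v \<in> ?S" and h: "\<And>k. h k \<in> lin_maps R (E$k) (E$(k - 1))"
    and vh: "\<And>x. x \<in> el E m ==> v *[E$m] x =
       cdiff E (m - 1) (h m x) +[E$m] h (m + 1) (cdiff E m x)" unfolding cmap_id_def by blast
  have vc: "v \<in> carrier R" "v \<notin> p" using v by auto
  have Am0: "el A m = {0[A$m]}" "el A (m + 1) = {0[A$(m + 1)]}" using a0 m(1) by auto
  \<comment> \<open>The position in the resolution of \<open>T$(m + 1)\<close>, the only nonzero
    component of \<open>E$m\<close>.\<close>
  define i where "i = Suc N + Suc L0"
  have ms: "m = e - int (Suc (Suc L0))" "m + 1 = e - int (Suc L0)" "m + 2 = e - int L0" by (simp_all add: m_def L_def)
  have Mi: "T$(m + 1) = M i" "T$m = M (Suc i)" "T$(m + 2) = M (i - 1)"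
    using Tm[of "Suc L0"] Tm[of "Suc (Suc L0)"] Tm[of L0] unfolding ms(2,3) ms(1)[symmetric] by (simp_all add: L_def i_def)
  have di: "cdiff T m = d i" "cdiff T (m + 1) = d (i - 1)"
    using Td[of "Suc L0"] Td[of L0] unfolding ms(2) ms(1)[symmetric] by (simp_all add: L_def i_def)
  have i: "1 \<le> i" by (simp add: i_def)
  \<comment> \<open>On a basis element \<open>?x\<close> the contraction writes \<open>v\<close>
    times \<open>?x\<close> as a boundary plus the image of a boundary under the linear map
    \<open>L\<close>. By minimality both have coordinates in \<open>p\<close>, which would put
    \<open>v\<close> into \<open>p\<close>.\<close>
  have "r i = 0"
  proof (rule ccontr)
    assume ri: "r i \<noteq> 0"
    let ?x = "b i 0"
    have x: "?x \<in> carrier (M i)" using free_modD(2)[OF M.free] ri by simp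
    have x': "?x \<in> el T (m + 1)" using x Mi by simp
    have zC: "0[A$m] \<in> el A m" "0[A$(m + 1)] \<in> el A (m + 1)" by simp_all
    let ?z = "\<theta> m ?x 0[A$m]"
    have z: "?z \<in> el E m" by (rule E.\<phi>_closed[OF x' zC(1)])
    have hz: "h m ?z \<in> el E (m - 1)" using lin_simps(1)[OF E.Cm E.Cm h z] .
    obtain y c where yc: "y \<in> el T (m - 1 + 1)" "c \<in> el A (m - 1)" "h m ?z = \<theta> (m - 1) y c"
      using E.\<phi>_surj[OF hz] .
    have y: "y \<in> el T m" "y \<in> carrier (M (Suc i))" using yc(1) Mi by simp_all
    have dx: "d (i - 1) ?x \<in> carrier (M (i - 1))" using M.ds(1)[of ?x "i - 1"] x i by simp
    have gx: "g (m + 1) ?x +[A$(m + 1)] cdiff A m 0[A$m] = 0[A$(m + 1)]"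
      using E.fs(1)[OF x'] Am0(2) C.dX(4)[of m] by simp
    have m2: "m + 1 + 1 = m + 2" by simp
    define L where "L u = E.\<pi>1 m (h (m + 1) (\<theta> (m + 1) u 0[A$(m + 1)]))" for u
    have Ll: "L \<in> lin_maps R (M (i - 1)) (M i)"
    proof -
      have "(\<lambda>u. \<theta> (m + 1) u 0[A$(m + 1)]) \<in> lin_maps R (T$(m + 1 + 1)) (E$(m + 1))"
        by (intro E.\<phi>_lin lin_maps_id lin_maps_zero E.Xm E.Ym)
      then have 1: "(\<lambda>u. \<theta> (m + 1) u 0[A$(m + 1)]) \<in> lin_maps R (M (i - 1)) (E$(m + 1))" unfolding m2 Mi .
      have 2: "h (m + 1) \<in> lin_maps R (E$(m + 1)) (E$m)" using h[of "m + 1"] by simp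
      have 3: "E.\<pi>1 m \<in> lin_maps R (E$m) (M i)" using E.\<pi>1_lin[of m] unfolding Mi .
      show ?thesis unfolding L_def by (rule lin_maps_comp[OF lin_maps_comp[OF 1 2] 3])
    qed
    have dz: "cdiff E m ?z = \<theta> (m + 1) (-[M (i - 1)] d (i - 1) ?x) 0[A$(m + 1)]"
      using E.\<phi>_diff[OF x' zC(1)] unfolding gx di Mi .
    have ndx: "-[M (i - 1)] d (i - 1) ?x \<in> carrier (M (i - 1))" using dx by simp
    have hdz: "h (m + 1) (cdiff E m ?z) \<in> el E m"
      using lin_simps(1)[OF E.Cm E.Cm h E.dC(1)[OF z]] by simp
    have dhz: "cdiff E (m - 1) (h m ?z) \<in> el E m" using E.dC(7)[OF hz] .
    have \<pi>dh: "E.\<pi>1 m (cdiff E (m - 1) (h m ?z)) = -[M i] d i y"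
    proof -
      have "cdiff E (m - 1) (h m ?z) = \<theta> m (-[T$(m + 1)] cdiff T m y) (g m y +[A$m] cdiff A (m - 1) c)"
        unfolding yc(3) by (rule E.\<phi>_diff'[OF y(1) yc(2)])
      moreover have "-[T$(m + 1)] cdiff T m y \<in> el T (m + 1)"
        unfolding di Mi using M.ds(1)[OF y(2)] by simp
      moreover have "g m y +[A$m] cdiff A (m - 1) c \<in> el A m" using E.fs(1)[OF y(1)] C.dX(7)[OF yc(2)] by simp
      ultimately show ?thesis using E.\<pi>_\<phi>(1) di Mi by simp
    qed
    have "v *[M i] ?x = E.\<pi>1 m (v *[E$m] ?z)"
      using lin_simps(3)[OF E.Cm E.Xm E.\<pi>1_lin vc(1) z] E.\<pi>_\<phi>(1)[OF x' zC(1)] Mi by simp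
    also have "\<dots> = E.\<pi>1 m (cdiff E (m - 1) (h m ?z)) +[M i] E.\<pi>1 m (h (m + 1) (cdiff E m ?z))"
      unfolding vh[OF z] using lin_simps(2)[OF E.Cm E.Xm E.\<pi>1_lin dhz hdz] Mi by simp
    also have "\<dots> = (-[M i] d i y) +[M i] L (-[M (i - 1)] d (i - 1) ?x)" unfolding \<pi>dh dz L_def ..
    finally have eq: "v *[M i] ?x = (-[M i] d i y) +[M i] L (-[M (i - 1)] d (i - 1) ?x)" .
    have diy: "d i y \<in> carrier (M i)" using M.ds(1)[OF y(2)] .
    have Ldx: "L (-[M (i - 1)] d (i - 1) ?x) \<in> carrier (M i)" using lin_simps(1)[OF M.Mm M.Mm Ll ndx] .
    have 1: "\<phi> i 0 (d i y) \<in> p" using M.d_in_p[OF y(2)] ri by simp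
    have 2: "\<phi> (i - 1) j (-[M (i - 1)] d (i - 1) ?x) \<in> p" if "j < r (i - 1)" for j
      using M.coord_lin(5)[OF that dx] M.d_in_p[of ?x "i - 1" j] x i that by simp
    have 3: "\<phi> i 0 (L (-[M (i - 1)] d (i - 1) ?x)) \<in> p"
      by (rule free_mod_lin_ideal[OF M.free M.free Ll pp.is_ideal ndx 2]) (use ri in auto)
    have "\<phi> i 0 (v *[M i] ?x) = v"
      using M.coord_lin(3)[of 0 i v ?x] x vc ri free_modD(5)[OF M.free, of 0 i 0] by simp
    moreover have "\<phi> i 0 (v *[M i] ?x) = \<ominus> \<phi> i 0 (d i y) \<oplus> \<phi> i 0 (L (-[M (i - 1)] d (i - 1) ?x))"
      unfolding eq using M.coord_lin(2,5)[of 0 i] ri diy Ldx by simp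
    ultimately have "v \<in> p" using pp.a_closed[OF pp.a_inv_closed[OF 1] 3] by simp
    then show False using vc(2) by simp
  qed
  then show ?thesis using that[OF MR] by blast
qed

end

section \<open>Finite minimal resolutions of residue fields\<close>

lemma lin_form_ideal:
  assumes F: "free_mod R M r b \<phi>" and l: "l \<in> lin_maps R M (selfmod R)" and I: "ideal I R"
    and x: "x \<in> carrier M" "\<And>j. j < r ==> \<phi> j x \<in> I"
  shows "l x \<in> I"
proof -
  interpret M: module R M by (rule free_modD(1)[OF F])
  interpret I: ideal I R by fact
  have "l x = lc (selfmod R) (\<lambda>j. \<phi> j x) (\<lambda>j. l (b j)) r"
    using lin_maps_lc[OF M.module_axioms M.R.selfmod_module l, of r "\<lambda>j. \<phi> j x" b] free_modD(2)[OF F] free_mod_coord[OF F _ x(1)] free_modD(4)[OF F x(1)] by simp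
  moreover have "lc (selfmod R) (\<lambda>j. \<phi> j x) (\<lambda>j. l (b j)) n \<in> I" if "n \<le> r" for n using that
  proof (induction n)
    case (Suc n)
    then show ?case using x(2)[of n] lin_simps(1)[OF M.module_axioms M.R.selfmod_module l free_modD(2)[OF F, of n]]
      by (simp add: I.I_r_closed)
  qed simp
  ultimately show ?thesis by simp
qed

section \<open>The Koszul complex inside a minimal resolution\<close>

context min_res begin

text \<open>The first differential read in \<open>R\<close>. Its values on the basis of
  \<open>M (Suc 0)\<close> generate \<open>p\<close> up to factors outside \<open>p\<close>,
  minimally so by \<open>X_kernel\<close>.\<close>

definition X where "X v = \<phi> 0 0 (d 0 v)"

lemma X_lin: "X \<in> lin_maps R (M (Suc 0)) (selfmod R)"
  unfolding X_def by (rule lin_maps_comp[OF d free_modD(3)[OF free]]) (simp add: r0)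

lemmas Xs = lin_simps[OF Mm selfmod_module X_lin, simplified]

lemma p_sat: assumes y: "y \<in> p" shows "y \<in> sat R Sp (selfmod R) (X ` carrier (M (Suc 0)))"
proof -
  have yc: "y \<in> carrier R" using y pp.Icarr by blast
  have b: "b 0 0 \<in> carrier (M 0)" using free_modD(2)[OF free] r0 by simp
  have c: "\<phi> 0 0 (a *[M 0] b 0 0) = a" if "a \<in> carrier R" for a
    using coord_lin(3)[of 0 0 a "b 0 0"] free_modD(5)[OF free, of 0 0 0] r0 that b by simp
  obtain t v where t: "t \<in> Sp" "v \<in> carrier (M (Suc 0))" "t *[M 0] (y *[M 0] b 0 0) = d 0 v"
    using d0_ex[of "y *[M 0] b 0 0"] c[OF yc] yc y b unfolding sat_def by auto
  then have "t \<otimes> y = X v" using c[of "t \<otimes> y"] yc b unfolding X_def by (simp add: Mm.smult_assoc1)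
  then show ?thesis using t yc unfolding sat_def by auto
qed

lemma X_kernel:
  assumes v: "v \<in> carrier (M (Suc 0))" "X v = \<zero>" and s: "s < r (Suc 0)" shows "\<phi> (Suc 0) s v \<in> p"
proof -
  have dv: "d 0 v \<in> carrier (M 0)" using ds(1) v by simp
  have b: "b 0 0 \<in> carrier (M 0)" using free_modD(2)[OF free] r0 by simp
  have "d 0 v = 0[M 0]" using free_modD(4)[OF free dv] v(2) b unfolding r0 X_def by simp
  then show ?thesis using d_min v s by simp
qed

text \<open>By minimality \<open>l (d k v)\<close> lies in \<open>p\<close>, which is covered by
  \<open>X\<close> up to a factor; freeness of the source provides the quotient
  \<open>\<Theta>\<close> as a linear map.\<close>

lemma divide_form:
  assumes l: "l \<in> lin_maps R (M k) (selfmod R)"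
  obtains t \<Theta> where "t \<in> Sp" "\<Theta> \<in> lin_maps R (M (Suc k)) (M (Suc 0))"
    "\<forall>v\<in>carrier (M (Suc k)). X (\<Theta> v) = t \<otimes> l (d k v)"
proof -
  have "l (d k v) \<in> p" if v: "v \<in> carrier (M (Suc k))" for v
    by (rule lin_form_ideal[OF free l pp.is_ideal ds(1)[OF v] d_in_p[OF v]])
  then have "\<And>v. v \<in> carrier (M (Suc k)) ==> l (d k v) \<in> sat R Sp (selfmod R) (X ` carrier (M (Suc 0)))"
    using p_sat by blast
  from fgp_lift[OF S free_modD(6)[OF free] selfmod_module Mm lin_maps_comp[OF d l] X_lin this]
  show ?thesis using that by (metis selfmod_simps(4))
qed

lemma homotopy_0:
  assumes x: "x \<in> p"
  obtains t h where "t \<in> Sp" "h \<in> lin_maps R (M 0) (M (Suc 0))" "\<forall>y\<in>carrier (M 0). d 0 (h y) = (t \<otimes> x) *[M 0] y"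
proof -
  have xc: "x \<in> carrier R" using x pp.Icarr by blast
  have g: "(\<lambda>y. x *[M 0] y) \<in> lin_maps R (M 0) (M 0)" by (intro lin_maps_smult Mm lin_maps_id xc)
  have "x *[M 0] y \<in> sat R Sp (M 0) (d 0 ` carrier (M (Suc 0)))" if y: "y \<in> carrier (M 0)" for y
    by (rule d0_ex) (use y xc x coord_lin(3)[of 0 0 x y] r0 coord[of 0 0 y] in \<open>auto intro: pp.I_r_closed\<close>)
  then obtain t h where t: "t \<in> Sp" and h: "h \<in> lin_maps R (M 0) (M (Suc 0))" "\<And>y. y \<in> carrier (M 0) ==> d 0 (h y) = t *[M 0] (x *[M 0] y)"
    by (rule fgp_lift[OF S free_modD(6)[OF free] Mm Mm g d]) (assumption, rule that, assumption, assumption, blast)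
  then show ?thesis using that[OF t h(1)] t xc by (simp add: Mm.smult_assoc1)
qed

text \<open>The remainder of multiplication by \<open>x\<close> after the homotopy \<open>h\<close>
  is a cycle, so a multiple of it lifts through the next differential. This multiple rescales the
  earlier homotopy, which returns as \<open>g\<close>.\<close>

lemma homotopy_step:
  assumes x: "x \<in> carrier R" and t: "t \<in> Sp" and h: "h \<in> lin_maps R (M k) (M (Suc k))"
    and th: "\<And>v. v \<in> carrier (M (Suc k)) ==> d k (h (d k v)) = (t \<otimes> x) *[M k] d k v"
  obtains t' h' g where "t' \<in> Sp" "h' \<in> lin_maps R (M (Suc k)) (M (Suc (Suc k)))" "g \<in> lin_maps R (M k) (M (Suc k))"
    "\<forall>y\<in>carrier (M (Suc k)). d (Suc k) (h' y) = (t' \<otimes> x) *[M (Suc k)] y -[M (Suc k)] g (d k y)"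
proof -
  note hs = lin_simps[OF Mm Mm h] and SD = msysD[OF S]
  have tc: "t \<in> carrier R" using t by simp
  have txc: "t \<otimes> x \<in> carrier R" using tc x by simp
  let ?f = "\<lambda>y. (t \<otimes> x) *[M (Suc k)] y -[M (Suc k)] h (d k y)"
  have f: "?f \<in> lin_maps R (M (Suc k)) (M (Suc k))"
    by (intro lin_maps_diff lin_maps_smult Mm lin_maps_id txc lin_maps_comp[OF d h])
  have "?f y \<in> sat R Sp (M (Suc k)) (d (Suc k) ` carrier (M (Suc (Suc k))))" if y: "y \<in> carrier (M (Suc k))" for y
  proof (rule d_ex)
    show "?f y \<in> carrier (M (Suc k))" using lin_simps(1)[OF Mm Mm f y] .
    show "d k (?f y) = 0[M k]" using th[OF y] y hs(1)[OF ds(1)[OF y]] ds(1)[OF y] txc by (simp add: ds Mm.r_neg a_minus_def)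
  qed
  then obtain s h' where s: "s \<in> Sp" and h': "h' \<in> lin_maps R (M (Suc k)) (M (Suc (Suc k)))"
    "\<And>y. y \<in> carrier (M (Suc k)) ==> d (Suc k) (h' y) = s *[M (Suc k)] ?f y"
    by (rule fgp_lift[OF S free_modD(6)[OF free] Mm Mm f d]) (assumption, rule that, assumption, assumption, blast)
  have sc: "s \<in> carrier R" using s by simp
  have "d (Suc k) (h' y) = ((s \<otimes> t) \<otimes> x) *[M (Suc k)] y -[M (Suc k)] s *[M (Suc k)] h (d k y)" if y: "y \<in> carrier (M (Suc k))" for y
    unfolding h'(2)[OF y] using hs(1)[OF ds(1)[OF y]] sc tc x y by algebra
  then show ?thesis using that[OF SD(3)[OF s t] h'(1) lin_maps_smult[OF Mm Mm h sc]] by blast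
qed

text \<open>An element of \<open>p\<close> acts as zero on the residue field, hence
  null-homotopically on its resolution, up to factors outside \<open>p\<close>.\<close>

lemma homotopy_Suc:
  assumes x: "x \<in> p"
  obtains t h g where "t \<in> Sp" "h \<in> lin_maps R (M (Suc k)) (M (Suc (Suc k)))" "g \<in> lin_maps R (M k) (M (Suc k))"
    "\<forall>y\<in>carrier (M (Suc k)). d (Suc k) (h y) = (t \<otimes> x) *[M (Suc k)] y -[M (Suc k)] g (d k y)"
proof -
  have xc: "x \<in> carrier R" using x pp.Icarr by blast
  have "\<exists>t\<in>Sp. \<exists>h\<in>lin_maps R (M k) (M (Suc k)). \<forall>v\<in>carrier (M (Suc k)). d k (h (d k v)) = (t \<otimes> x) *[M k] d k v"
  proof (induction k)
    case 0
    show ?case using homotopy_0[OF x] ds(1) by metis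
  next
    case (Suc k)
    then obtain t h where t: "t \<in> Sp" and h: "h \<in> lin_maps R (M k) (M (Suc k))"
      "\<And>v. v \<in> carrier (M (Suc k)) ==> d k (h (d k v)) = (t \<otimes> x) *[M k] d k v" by blast
    obtain t' h' g where 1: "t' \<in> Sp" "h' \<in> lin_maps R (M (Suc k)) (M (Suc (Suc k)))" and g: "g \<in> lin_maps R (M k) (M (Suc k))"
      and 2: "\<forall>y\<in>carrier (M (Suc k)). d (Suc k) (h' y) = (t' \<otimes> x) *[M (Suc k)] y -[M (Suc k)] g (d k y)"
      by (rule homotopy_step[OF xc t h])
    have "d (Suc k) (h' (d (Suc k) v)) = (t' \<otimes> x) *[M (Suc k)] d (Suc k) v" if v: "v \<in> carrier (M (Suc (Suc k)))" for v
      using bspec[OF 2 ds(1)[OF v]] lin_simps(4)[OF Mm Mm g] ds(1)[OF v] 1(1) xc by (simp add: dd[OF v] a_minus_def)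
    then show ?case using 1 by blast
  qed
  then obtain t h where t: "t \<in> Sp" and h: "h \<in> lin_maps R (M k) (M (Suc k))"
      "\<And>v. v \<in> carrier (M (Suc k)) ==> d k (h (d k v)) = (t \<otimes> x) *[M k] d k v" by blast
  show ?thesis by (rule homotopy_step[OF xc t h]) (assumption, rule that)
qed

text \<open>Serre's argument that the Koszul complex of a minimal generating system embeds into the minimal
  resolution: \<open>u\<close> is the image of \<open>e\<^sub>1 \<and> \<dots> \<and> e\<^sub>k\<close>, and the form \<open>l\<close> detects it modulo \<open>p\<close>.\<close>

lemma koszul_element:
  assumes "k \<le> r (Suc 0)"
  obtains u l where "u \<in> carrier (M k)" "l \<in> lin_maps R (M k) (selfmod R)" "l u \<notin> p"
    "\<forall>j \<mu>. k = Suc j \<longrightarrow> \<mu> \<in> lin_maps R (M j) (selfmod R) \<longrightarrow>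
       (\<exists>v\<in>carrier (M (Suc 0)). X v = \<mu> (d j u) \<and> (\<forall>s. k \<le> s \<longrightarrow> s < r (Suc 0) \<longrightarrow> \<phi> (Suc 0) s v = \<zero>))"
proof -
  \<comment> \<open>The boundary of \<open>u\<close> involves only the first \<open>k\<close>
    generators of \<open>p\<close>: each form takes on it a value that is a combination of
    them.\<close>
  define P where "P k u = (\<forall>j \<mu>. k = Suc j \<longrightarrow> \<mu> \<in> lin_maps R (M j) (selfmod R) \<longrightarrow>
       (\<exists>v\<in>carrier (M (Suc 0)). X v = \<mu> (d j u) \<and> (\<forall>s. k \<le> s \<longrightarrow> s < r (Suc 0) \<longrightarrow> \<phi> (Suc 0) s v = \<zero>)))" for k u
  have "\<exists>u\<in>carrier (M k). \<exists>l\<in>lin_maps R (M k) (selfmod R). l u \<notin> p \<and> P k u"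
    using assms
  proof (induction k)
    case 0
    have "b 0 0 \<in> carrier (M 0)" "\<phi> 0 0 \<in> lin_maps R (M 0) (selfmod R)" "\<phi> 0 0 (b 0 0) = \<one>"
      using free_modD(2,3)[OF free, of 0] free_modD(5)[OF free, of 0 0 0] r0 by simp_all
    moreover have "P 0 (b 0 0)" by (simp add: P_def)
    moreover have "\<one> \<notin> p" using pp.I_notcarr pp.one_imp_carrier by blast
    ultimately show ?case by metis
  next
    case (Suc k)
    then obtain u l where u: "u \<in> carrier (M k)" and l: "l \<in> lin_maps R (M k) (selfmod R)" "l u \<notin> p" and Pu: "P k u" by auto
    let ?b = "b (Suc 0) k"
    have b: "?b \<in> carrier (M (Suc 0))" using free_modD(2)[OF free] Suc by simp
    \<comment> \<open>The next generator of \<open>p\<close>. A homotopy \<open>h\<close> for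
      multiplication by it plays the part of the exterior product with the new basis vector.\<close>
    define x where "x = X ?b"
    have x: "x \<in> p" unfolding x_def X_def using d0[OF b] .
    have xc: "x \<in> carrier R" using x pp.Icarr by blast
    have "\<exists>t\<in>Sp. \<exists>h\<in>lin_maps R (M k) (M (Suc k)). \<forall>\<mu>\<in>lin_maps R (M k) (selfmod R). \<exists>v\<in>carrier (M (Suc 0)).
       \<mu> (d k (h u)) = X v \<and> \<phi> (Suc 0) k v = t \<otimes> \<mu> u \<and> (\<forall>s. k < s \<longrightarrow> s < r (Suc 0) \<longrightarrow> \<phi> (Suc 0) s v = \<zero>)"
    proof -
      have *: "\<phi> (Suc 0) s (a *[M (Suc 0)] ?b) = (if s = k then a else \<zero>)" if "a \<in> carrier R" "s < r (Suc 0)" for a s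
        using coord_lin(3)[OF that(2,1) b] free_modD(5)[OF free that(2), of k] Suc that by simp
      show ?thesis
      proof (cases k)
        case 0
        obtain t h where t: "t \<in> Sp" "h \<in> lin_maps R (M 0) (M (Suc 0))" "\<forall>y\<in>carrier (M 0). d 0 (h y) = (t \<otimes> x) *[M 0] y"
          by (rule homotopy_0[OF x])
        have "\<exists>v\<in>carrier (M (Suc 0)). \<mu> (d 0 (h u)) = X v \<and> \<phi> (Suc 0) k v = t \<otimes> \<mu> u \<and> (\<forall>s. k < s \<longrightarrow> s < r (Suc 0) \<longrightarrow> \<phi> (Suc 0) s v = \<zero>)"
          if \<mu>: "\<mu> \<in> lin_maps R (M 0) (selfmod R)" for \<mu>
        proof -
          note ls = lin_simps[OF Mm selfmod_module \<mu>, simplified]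
          have u0: "u \<in> carrier (M 0)" using u 0 by simp
          have c: "t \<otimes> \<mu> u \<in> carrier R" "\<mu> u \<in> carrier R" using ls(1)[OF u0] t(1) by simp_all
          have "\<mu> (d 0 (h u)) = X ((t \<otimes> \<mu> u) *[M (Suc 0)] ?b)"
            using t xc u0 c b by (simp add: ls Xs x_def[symmetric] m_ac)
          then show ?thesis using *[OF c(1)] c b Suc.prems by (intro bexI[of _ "(t \<otimes> \<mu> u) *[M (Suc 0)] ?b"]) auto
        qed
        then show ?thesis using t unfolding 0 by blast
      next
        case (Suc j)
        obtain t h g where t: "t \<in> Sp" and h: "h \<in> lin_maps R (M (Suc j)) (M (Suc (Suc j)))" and g: "g \<in> lin_maps R (M j) (M (Suc j))"
          and th: "\<forall>y\<in>carrier (M (Suc j)). d (Suc j) (h y) = (t \<otimes> x) *[M (Suc j)] y -[M (Suc j)] g (d j y)"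
          by (rule homotopy_Suc[OF x, of j])
        have "\<exists>v\<in>carrier (M (Suc 0)). \<mu> (d k (h u)) = X v \<and> \<phi> (Suc 0) k v = t \<otimes> \<mu> u \<and> (\<forall>s. k < s \<longrightarrow> s < r (Suc 0) \<longrightarrow> \<phi> (Suc 0) s v = \<zero>)"
          if \<mu>: "\<mu> \<in> lin_maps R (M k) (selfmod R)" for \<mu>
        proof -
          note ls = lin_simps[OF Mm selfmod_module \<mu>, simplified]
          obtain v where v: "v \<in> carrier (M (Suc 0))" "X v = \<mu> (g (d j u))" "\<forall>s. k \<le> s \<longrightarrow> s < r (Suc 0) \<longrightarrow> \<phi> (Suc 0) s v = \<zero>"
            using Pu lin_maps_comp[OF g \<mu>[unfolded Suc]] unfolding P_def Suc by blast
          have du: "d j u \<in> carrier (M j)" using ds(1)[of u j] u Suc by simp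
          have gdu: "g (d j u) \<in> carrier (M k)" using lin_simps(1)[OF Mm Mm g du] Suc by simp
          have tc: "t \<in> carrier R" using t by simp
          have c: "t \<otimes> \<mu> u \<in> carrier R" "\<mu> u \<in> carrier R" using ls(1)[OF u] tc by simp_all
          let ?v = "(t \<otimes> \<mu> u) *[M (Suc 0)] ?b -[M (Suc 0)] v"
          have "d k (h u) = (t \<otimes> x) *[M k] u -[M k] g (d j u)" using th u unfolding Suc by blast
          then have "\<mu> (d k (h u)) = X ?v"
            using tc xc u gdu c b v(1,2) by (simp add: ls Xs x_def[symmetric] m_ac)
          moreover have "\<phi> (Suc 0) s ?v = (if s = k then t \<otimes> \<mu> u else \<zero>)" if "k \<le> s" "s < r (Suc 0)" for s
            using coord_lin(6)[OF that(2), of "(t \<otimes> \<mu> u) *[M (Suc 0)] ?b" v] *[OF c(1) that(2)] v(1,3) that b c by (simp add: a_minus_def)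
          ultimately show ?thesis using v(1) c b Suc.prems by (intro bexI[of _ ?v]) auto
        qed
        then show ?thesis using t h unfolding Suc by blast
      qed
    qed
    then obtain t h where t: "t \<in> Sp" and h: "h \<in> lin_maps R (M k) (M (Suc k))"
      and hu: "\<And>\<mu>. \<mu> \<in> lin_maps R (M k) (selfmod R) ==> \<exists>v\<in>carrier (M (Suc 0)). \<mu> (d k (h u)) = X v \<and>
         \<phi> (Suc 0) k v = t \<otimes> \<mu> u \<and> (\<forall>s. k < s \<longrightarrow> s < r (Suc 0) \<longrightarrow> \<phi> (Suc 0) s v = \<zero>)" by blast
    have hc: "h u \<in> carrier (M (Suc k))" using lin_simps(1)[OF Mm Mm h u] .
    obtain \<tau> \<Theta> where \<Theta>: "\<tau> \<in> Sp" "\<Theta> \<in> lin_maps R (M (Suc k)) (M (Suc 0))"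
      "\<forall>v\<in>carrier (M (Suc k)). X (\<Theta> v) = \<tau> \<otimes> l (d k v)" by (rule divide_form[OF l(1)])
    have \<tau>: "\<tau> \<in> carrier R" using \<Theta> by simp
    have \<Theta>c: "\<Theta> (h u) \<in> carrier (M (Suc 0))" using lin_simps(1)[OF Mm Mm \<Theta>(2) hc] .
    have lu: "l u \<in> carrier R" using lin_simps(1)[OF Mm selfmod_module l(1) u] by simp
    have kr: "k < r (Suc 0)" using Suc by simp
    obtain v where v: "v \<in> carrier (M (Suc 0))" "l (d k (h u)) = X v" "\<phi> (Suc 0) k v = t \<otimes> l u" using hu[OF l(1)] by blast
    have Xc: "X v \<in> carrier R" using Xs(1)[OF v(1)] .
    \<comment> \<open>\<open>\<Theta> (h u)\<close> and \<open>\<tau>\<close> times \<open>v\<close>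
      have the same image under \<open>X\<close>, so their coordinates agree modulo
      \<open>p\<close>. That of \<open>v\<close> at \<open>k\<close> is
      \<open>t \<otimes> l u\<close>, outside \<open>p\<close>; hence coordinate \<open>k\<close> of
      \<open>\<Theta>\<close> is the new detecting form.\<close>
    have "X (\<Theta> (h u) -[M (Suc 0)] \<tau> *[M (Suc 0)] v) = \<zero>"
      using \<Theta>(3) hc v(1,2) \<tau> \<Theta>c Xc by (simp add: Xs r_neg a_minus_def)
    from X_kernel[OF _ this kr] have "\<phi> (Suc 0) k (\<Theta> (h u)) \<ominus> \<tau> \<otimes> (t \<otimes> l u) \<in> p"
      using coord_lin(3,6)[OF kr] v \<tau> \<Theta>c by simp
    then have 1: "\<phi> (Suc 0) k (\<Theta> (h u)) \<oplus> \<ominus> (\<phi> (Suc 0) k (\<Theta> (h u)) \<ominus> \<tau> \<otimes> (t \<otimes> l u)) \<in> p"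
      if "\<phi> (Suc 0) k (\<Theta> (h u)) \<in> p" by (intro pp.a_closed pp.a_inv_closed that)
    have 2: "\<phi> (Suc 0) k (\<Theta> (h u)) \<oplus> \<ominus> (\<phi> (Suc 0) k (\<Theta> (h u)) \<ominus> \<tau> \<otimes> (t \<otimes> l u)) = \<tau> \<otimes> (t \<otimes> l u)"
      using coord[OF kr \<Theta>c] \<tau> t lu by simp algebra
    have "\<phi> (Suc 0) k (\<Theta> (h u)) \<notin> p"
      using 1 pp.I_prime \<Theta>(1) t l(2) lu unfolding 2 by (metis DiffD1 DiffD2 m_closed)
    moreover have "(\<lambda>v. \<phi> (Suc 0) k (\<Theta> v)) \<in> lin_maps R (M (Suc k)) (selfmod R)"
      by (rule lin_maps_comp[OF \<Theta>(2) free_modD(3)[OF free kr]])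
    moreover have "P (Suc k) (h u)" unfolding P_def using hu by (metis Suc_inject Suc_le_eq)
    ultimately show ?case using hc by (intro bexI[of _ "h u"] bexI[of _ "\<lambda>v. \<phi> (Suc 0) k (\<Theta> v)"] conjI)
  qed
  then show ?thesis using that unfolding P_def by blast
qed

text \<open>Every form on a module of rank zero vanishes, so it could not detect the Koszul element.
  This bounds the length of the resolution from below.\<close>

lemma rank_nonzero:
  assumes "k \<le> r (Suc 0)" shows "r k \<noteq> 0"
proof
  assume rk: "r k = 0"
  obtain u l where u: "u \<in> carrier (M k)" "l \<in> lin_maps R (M k) (selfmod R)" "l u \<notin> p"
    by (rule koszul_element[OF assms])
  show False using u(3) lin_form_ideal[OF free u(2) pp.is_ideal u(1)] rk by simp
qed

end

section \<open>Regular sequences and heights\<close>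

context cring begin

text \<open>The witness is a product of elements chosen outside \<open>P\<close> from the members of
  \<open>T\<close>.\<close>

lemma primes_avoid_common:
  assumes P: "primeideal P R" and T: "finite T" "\<And>Q. Q \<in> T ==> ideal Q R \<and> \<not> Q \<subseteq> P"
  obtains x where "x \<in> carrier R" "x \<notin> P" "\<forall>Q\<in>T. x \<in> Q"
proof -
  interpret P: primeideal P R by fact
  have "\<exists>x\<in>carrier R. x \<notin> P \<and> (\<forall>Q\<in>T. x \<in> Q)" using T
  proof (induction T)
    case empty
    show ?case using P.I_notcarr P.one_imp_carrier by blast
  next
    case (insert Q T)
    then obtain x where x: "x \<in> carrier R" "x \<notin> P" "\<forall>Q\<in>T. x \<in> Q" by auto
    obtain z where z: "z \<in> Q" "z \<notin> P" using insert by blast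
    interpret Q: ideal Q R using insert by blast
    have "x \<otimes> z \<in> Q'" if "Q' \<in> insert Q T" for Q'
    proof -
      interpret Q': ideal Q' R using insert that by blast
      show ?thesis using that z x Q.Icarr[OF z(1)] Q'.I_l_closed Q'.I_r_closed by blast
    qed
    moreover have "x \<otimes> z \<notin> P" using P.I_prime[OF x(1) Q.Icarr[OF z(1)]] x z by blast
    ultimately show ?case using x(1) Q.Icarr[OF z(1)] by blast
  qed
  then show ?thesis using that by blast
qed

text \<open>When \<open>y\<close> avoids the earlier primes but lies in \<open>Q\<close>, a term
  \<open>x \<otimes> z\<close> is added that lies in all earlier primes and in \<open>p\<close> but
  not in \<open>Q\<close>; it exists because the primes are incomparable.\<close>

lemma prime_avoidance:
  assumes p: "ideal p R" and T: "finite T" "\<And>Q. Q \<in> T ==> primeideal Q R \<and> \<not> p \<subseteq> Q"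
    and inc: "\<And>Q Q'. Q \<in> T ==> Q' \<in> T ==> Q \<subseteq> Q' ==> Q = Q'"
  obtains y where "y \<in> p" "\<forall>Q\<in>T. y \<notin> Q"
proof -
  interpret p: ideal p R by fact
  have "\<exists>y\<in>p. \<forall>Q\<in>T. y \<notin> Q" using T inc
  proof (induction T)
    case empty
    show ?case using p.zero_closed by blast
  next
    case (insert Q T)
    have "\<exists>y\<in>p. \<forall>Q\<in>T. y \<notin> Q" by (rule insert.IH) (use insert.prems in blast)+
    then obtain y where y: "y \<in> p" "\<forall>Q\<in>T. y \<notin> Q" by blast
    have Q: "primeideal Q R" "\<not> p \<subseteq> Q" using insert.prems(1)[of Q] by auto
    interpret Q: primeideal Q R by (rule Q(1))
    have id: "ideal Q' R" "\<not> Q' \<subseteq> Q" if "Q' \<in> T" for Q'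
      using insert.prems insert.hyps(2) that primeideal.axioms(1)[of Q' R] by (metis insertI1 insertI2)+
    obtain x where x: "x \<in> carrier R" "x \<notin> Q" "\<forall>Q\<in>T. x \<in> Q"
      by (rule primes_avoid_common[OF Q(1) insert.hyps(1)]) (use id in blast, rule that)
    obtain z where z: "z \<in> p" "z \<notin> Q" using Q(2) by blast
    have yc: "y \<in> carrier R" and zc: "z \<in> carrier R" using y z p.Icarr by auto
    have xz: "x \<otimes> z \<in> p" using z x p.I_l_closed by blast
    show ?case
    proof (cases "y \<in> Q")
      case False then show ?thesis using y by blast
    next
      case True
      have 1: "y \<oplus> x \<otimes> z \<notin> Q"
      proof
        assume a: "y \<oplus> x \<otimes> z \<in> Q"
        have "(y \<oplus> x \<otimes> z) \<oplus> \<ominus> y \<in> Q" using Q.a_closed[OF a Q.a_inv_closed[OF True]] .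
        moreover have "(y \<oplus> x \<otimes> z) \<oplus> \<ominus> y = x \<otimes> z" using x(1) yc zc by algebra
        ultimately show False using Q.I_prime[OF x(1) zc] x z by auto
      qed
      have 2: "y \<oplus> x \<otimes> z \<notin> Q'" if Q': "Q' \<in> T" for Q'
      proof
        interpret Q': ideal Q' R by (rule id(1)[OF Q'])
        assume a: "y \<oplus> x \<otimes> z \<in> Q'"
        have "x \<otimes> z \<in> Q'" using x(3) Q' Q'.I_r_closed zc by blast
        then have "(y \<oplus> x \<otimes> z) \<oplus> \<ominus> (x \<otimes> z) \<in> Q'" using Q'.a_closed[OF a Q'.a_inv_closed] by blast
        moreover have "(y \<oplus> x \<otimes> z) \<oplus> \<ominus> (x \<otimes> z) = y" using x(1) yc zc by algebra
        ultimately show False using y Q' by simp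
      qed
      show ?thesis using 1 2 p.a_closed[OF y(1) xz] by blast
    qed
  qed
  then show ?thesis using that by blast
qed

end

text \<open>The zero divisors modulo \<open>J\<close> form the union of the maximal ideals of the form \<open>(J : z)\<close>, which are
  prime and, by the Noetherian property, finite in number.\<close>

lemma (in noeth_cring) nonzerodivisor_exists:
  assumes p: "ideal p R" and J: "ideal J R" and no: "\<And>z. z \<in> carrier R ==> (\<And>y. y \<in> p ==> y \<otimes> z \<in> J) ==> z \<in> J"
  obtains y where "y \<in> p" "\<forall>a\<in>carrier R. y \<otimes> a \<in> J \<longrightarrow> a \<in> J"
proof -
  interpret J: ideal J R by fact
  interpret p: ideal p R by fact
  interpret s: module R "selfmod R" by (rule selfmod_module)
  define col where "col z = {a \<in> carrier R. a \<otimes> z \<in> J}" for z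
  have colid: "ideal (col z) R" if "z \<in> carrier R" for z
    using s.annihilator_ideal[of J z] that J submodule_selfmod_iff unfolding col_def by simp
  define F where "F = {col z | z. z \<in> carrier R \<and> z \<notin> J}"
  define Mx where "Mx = {P \<in> F. \<forall>Q\<in>F. P \<subseteq> Q \<longrightarrow> Q = P}"
  have "\<forall>P\<in>Mx. \<exists>z. P = col z \<and> z \<in> carrier R \<and> z \<notin> J" unfolding Mx_def F_def by auto
  then obtain g where g: "P = col (g P)" "g P \<in> carrier R" "g P \<notin> J" if "P \<in> Mx" for P by metis
  have prime: "primeideal P R" if P: "P \<in> Mx" for P
  proof (rule primeidealI)
    note gP = g[OF P]
    show id: "ideal P R" using colid[OF gP(2)] gP(1) by simp
    show "cring R" by (rule cring_axioms)
    have "\<one> \<notin> P" using gP(2,3) by (subst gP(1)) (simp add: col_def)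
    then show "carrier R \<noteq> P" by blast
    fix a b assume ab: "a \<in> carrier R" "b \<in> carrier R" "a \<otimes> b \<in> P"
    show "a \<in> P \<or> b \<in> P"
    proof (rule ccontr)
      assume n: "\<not> ?thesis"
      let ?z = "b \<otimes> g P"
      have zJ: "?z \<notin> J" using n ab(2) by (subst (asm) (1 2) gP(1)) (simp add: col_def)
      have zc: "?z \<in> carrier R" using ab gP by simp
      have "P \<subseteq> col ?z"
      proof
        fix x assume "x \<in> P"
        then have x: "x \<in> carrier R" "x \<otimes> g P \<in> J" by (subst (asm) gP(1), simp add: col_def)+
        have "x \<otimes> ?z = b \<otimes> (x \<otimes> g P)" using x ab gP by (simp add: m_lcomm)
        then show "x \<in> col ?z" using x J.I_l_closed[OF x(2) ab(2)] by (simp add: col_def)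
      qed
      moreover have "col ?z \<in> F" using zc zJ unfolding F_def by blast
      ultimately have "col ?z = P" using P unfolding Mx_def by blast
      moreover have "a \<in> col ?z" using ab gP by (subst (asm) gP(1)) (simp add: col_def m_assoc)
      ultimately show False using n by blast
    qed
  qed
  \<comment> \<open>Finiteness of \<open>Mx\<close>: choose a finite \<open>T\<close> whose elements
    \<open>g Q\<close> generate a largest possible ideal. If \<open>P\<close> contained no member of
    \<open>T\<close>, some \<open>x\<close> outside \<open>P\<close> would multiply all these
    elements, and therefore \<open>g P\<close>, into \<open>J\<close>, although the colon ideal of
    \<open>g P\<close> is \<open>P\<close>.\<close>
  obtain I where I: "I \<in> {Idl (g ` T) | T. finite T \<and> T \<subseteq> Mx}" and Imax: "\<And>I'. I' \<in> {Idl (g ` T) | T. finite T \<and> T \<subseteq> Mx} ==> I \<subseteq> I' ==> I' = I"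
  proof (rule maximal_ideal_in_family)
    show "{Idl (g ` T) | T. finite T \<and> T \<subseteq> Mx} \<noteq> {}" by blast
    fix I assume "I \<in> {Idl (g ` T) | T. finite T \<and> T \<subseteq> Mx}"
    then show "ideal I R" using g(2) by (auto intro!: genideal_ideal)
  qed (rule that)
  obtain T where T: "finite T" "T \<subseteq> Mx" "I = Idl (g ` T)" using I by blast
  have fin: "Mx \<subseteq> T"
  proof
    fix P assume P: "P \<in> Mx"
    note gP = g[OF P]
    have sub: "g ` insert P T \<subseteq> carrier R" using T(2) P g(2) by auto
    have "I \<subseteq> Idl (g ` insert P T)" unfolding T(3) by (rule genideal_minimal[OF genideal_ideal[OF sub]]) (use genideal_self[OF sub] in auto)
    then have "Idl (g ` insert P T) = I" using Imax[of "Idl (g ` insert P T)"] T P by blast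
    then have gI: "g P \<in> I" using genideal_self[OF sub] by auto
    have "\<exists>Q\<in>T. Q \<subseteq> P"
    proof (rule ccontr)
      assume n: "\<not> ?thesis"
      obtain x where x: "x \<in> carrier R" "x \<notin> P" "\<forall>Q\<in>T. x \<in> Q"
        by (rule primes_avoid_common[OF prime[OF P] T(1)]) (use n T(2) primeideal.axioms(1)[OF prime] in blast, rule that)
      have "g ` T \<subseteq> col x"
      proof (rule image_subsetI)
        fix Q assume Q: "Q \<in> T"
        then have Q': "Q \<in> Mx" using T by blast
        have "x \<in> col (g Q)" using x(3) Q g(1)[OF Q'] by blast
        then show "g Q \<in> col x" using x(1) g(2)[OF Q'] by (simp add: col_def m_comm)
      qed
      then have "I \<subseteq> col x" unfolding T(3) by (rule genideal_minimal[OF colid[OF x(1)]])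
      then have "x \<in> col (g P)" using gI x(1) gP(2) by (auto simp: col_def m_comm)
      then show False using x(2) gP(1) by blast
    qed
    then obtain Q where Q: "Q \<in> T" "Q \<subseteq> P" by blast
    then have "P = Q" using T(2) P unfolding Mx_def by blast
    then show "P \<in> T" using Q by simp
  qed
  have "T = Mx" using fin T by blast
  have np: "\<not> p \<subseteq> P" if P: "P \<in> Mx" for P
  proof
    assume "p \<subseteq> P"
    then have "y \<otimes> g P \<in> J" if "y \<in> p" for y using that g(1)[OF P] unfolding col_def by blast
    then show False using no[OF g(2)[OF P]] g(3)[OF P] by blast
  qed
  obtain y where y: "y \<in> p" "\<forall>Q\<in>Mx. y \<notin> Q"
  proof (rule prime_avoidance[OF p, of Mx])
    show "finite Mx" using T \<open>T = Mx\<close> by simp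
    show "primeideal Q R \<and> \<not> p \<subseteq> Q" if "Q \<in> Mx" for Q using prime[OF that] np[OF that] ..
    show "Q = Q'" if "Q \<in> Mx" "Q' \<in> Mx" "Q \<subseteq> Q'" for Q Q' using that unfolding Mx_def by blast
  qed (rule that)
  \<comment> \<open>A zero divisor modulo \<open>J\<close> lies in a colon ideal from
    \<open>F\<close>, hence in a maximal one, and \<open>y\<close> avoids those.\<close>
  have "a \<in> J" if a: "a \<in> carrier R" "y \<otimes> a \<in> J" for a
  proof (rule ccontr)
    assume n: "a \<notin> J"
    have aF: "col a \<in> {Q \<in> F. col a \<subseteq> Q}" using a n unfolding F_def by blast
    obtain Q where Q: "Q \<in> {Q \<in> F. col a \<subseteq> Q}" "\<And>Q'. Q' \<in> {Q \<in> F. col a \<subseteq> Q} ==> Q \<subseteq> Q' ==> Q' = Q"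
    proof (rule maximal_ideal_in_family)
      show "{Q \<in> F. col a \<subseteq> Q} \<noteq> {}" using aF by blast
      show "ideal Q R" if "Q \<in> {Q \<in> F. col a \<subseteq> Q}" for Q using that colid unfolding F_def by blast
    qed (rule that)
    have "Q \<in> Mx" using Q unfolding Mx_def by blast
    moreover have "y \<in> col a" using a y(1) p.Icarr unfolding col_def by blast
    ultimately show False using Q(1) y(2) by blast
  qed
  then show ?thesis using that y(1) by blast
qed

text \<open>Expresses that the height of \<open>q\<close> is at least \<open>n\<close>.\<close>

definition prime_chain :: "('a, 'r) ring_scheme \<Rightarrow> nat \<Rightarrow> 'a set \<Rightarrow> bool" where
  "prime_chain R n q \<longleftrightarrow> (\<exists>P. (\<forall>i\<le>n. primeideal (P i) R) \<and> (\<forall>i<n. P i \<subset> P (Suc i)) \<and> P n = q)"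

lemma prime_chain_0: "primeideal q R ==> prime_chain R 0 q"
  unfolding prime_chain_def by (intro exI[of _ "\<lambda>_. q"]) simp

lemma prime_chain_Suc:
  assumes "prime_chain R n q'" "q' \<subset> q" "primeideal q R" shows "prime_chain R (Suc n) q"
proof -
  obtain P where P: "\<forall>i\<le>n. primeideal (P i) R" "\<forall>i<n. P i \<subset> P (Suc i)" "P n = q'" using assms(1) unfolding prime_chain_def by blast
  show ?thesis unfolding prime_chain_def
    by (intro exI[of _ "P(Suc n := q)"]) (use P assms in \<open>auto simp: le_Suc_eq less_Suc_eq\<close>)
qed

lemma prime_chain_mono:
  assumes "prime_chain R n q" "m \<le> n" shows "prime_chain R m q"
proof -
  obtain P where P: "\<forall>i\<le>n. primeideal (P i) R" "\<forall>i<n. P i \<subset> P (Suc i)" "P n = q" using assms(1) unfolding prime_chain_def by blast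
  show ?thesis unfolding prime_chain_def
    by (intro exI[of _ "\<lambda>i. P (i + (n - m))"]) (use P assms(2) in auto)
qed

section \<open>Successive nonzerodivisors from a finite minimal resolution\<close>

context min_res begin

text \<open>The product of \<open>I\<close> with \<open>M i\<close>, described by
  coordinates.\<close>

definition IM where
  "IM I i = {x \<in> carrier (M i). \<forall>k<r i. \<phi> i k x \<in> I}"

lemma IM_submodule: assumes I: "ideal I R" shows "submodule (IM I i) R (M i)"
proof -
  interpret I: ideal I R by fact
  show ?thesis
    by (rule Mm.submoduleI') (auto simp: IM_def coord_lin I.I_l_closed)
qed

lemma IM_smult: assumes I: "ideal I R" and y: "y \<in> I" and x: "x \<in> carrier (M i)" shows "y *[M i] x \<in> IM I i"
proof -
  interpret I: ideal I R by fact
  show ?thesis using x y I.Icarr[OF y] coord[of _ i x] by (auto simp: IM_def coord_lin intro: I.I_r_closed)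
qed

lemma IM_d: assumes I: "ideal I R" and x: "x \<in> IM I (Suc i)" shows "d i x \<in> IM I i"
  using x ds(1) free_mod_lin_ideal[OF free free d I] unfolding IM_def by auto

lemma IM_sat:
  assumes I: "ideal I R" and x: "x \<in> IM (sat R Sp (selfmod R) I) i"
  shows "x \<in> sat R Sp (M i) (IM I i)"
proof -
  interpret I: ideal I R by fact
  note SD = msysD[OF S]
  have x: "x \<in> carrier (M i)" "\<And>k. k < r i ==> \<exists>t\<in>Sp. t \<otimes> \<phi> i k x \<in> I" using x unfolding IM_def sat_def by auto
  have "\<exists>t\<in>Sp. \<forall>k<m. t \<otimes> \<phi> i k x \<in> I" if "m \<le> r i" for m using that
  proof (induction m)
    case 0 show ?case using SD(2) by blast
  next
    case (Suc m)
    then obtain t where t: "t \<in> Sp" "\<forall>k<m. t \<otimes> \<phi> i k x \<in> I" by auto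
    obtain s where s: "s \<in> Sp" "s \<otimes> \<phi> i m x \<in> I" using x(2)[of m] Suc.prems by auto
    have c: "\<phi> i k x \<in> carrier R" if "k < Suc m" for k using coord[OF _ x(1)] that Suc.prems by auto
    have "(s \<otimes> t) \<otimes> \<phi> i k x \<in> I" if k: "k < Suc m" for k
    proof (cases "k = m")
      case True
      have "(s \<otimes> t) \<otimes> \<phi> i m x = t \<otimes> (s \<otimes> \<phi> i m x)" using s t c[of m] by (simp add: m_ac)
      then show ?thesis using True I.I_l_closed[OF s(2)] t by simp
    next
      case False
      have "(s \<otimes> t) \<otimes> \<phi> i k x = s \<otimes> (t \<otimes> \<phi> i k x)" using s t c[of k] k by (simp add: m_ac)
      then show ?thesis using False k I.I_l_closed[of "t \<otimes> \<phi> i k x"] s t by simp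
    qed
    then show ?case using SD(3)[OF s(1) t(1)] by blast
  qed
  then obtain t where "t \<in> Sp" "\<forall>k<r i. t \<otimes> \<phi> i k x \<in> I" by blast
  then show ?thesis using x(1) unfolding sat_def IM_def by (auto simp: coord_lin)
qed

text \<open>Exactness at \<open>p\<close>, in the positions above \<open>j\<close>, of the
  resolution reduced modulo \<open>I\<close>: the vanishing of the Tor modules of the residue field
  with \<open>R / I\<close> from \<open>j + 1\<close> on.\<close>

definition exact_mod :: "'a set \<Rightarrow> nat \<Rightarrow> bool" where
  "exact_mod I j \<longleftrightarrow> (\<forall>i\<ge>j. \<forall>v\<in>carrier (M (Suc i)). d i v \<in> IM I i \<longrightarrow>
     (\<exists>t\<in>Sp. \<exists>w\<in>carrier (M (Suc (Suc i))). t *[M (Suc i)] v -[M (Suc i)] d (Suc i) w \<in> IM I (Suc i)))"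

lemma exact_mod_zero: "exact_mod {\<zero>} 0"
  unfolding exact_mod_def
proof (intro allI impI ballI)
  fix i v assume v: "v \<in> carrier (M (Suc i))" and dv: "d i v \<in> IM {\<zero>} i"
  have "lc (M i) (\<lambda>k. \<phi> i k (d i v)) (b i) (r i) \<in> {0[M i]}"
  proof -
    have "lc (M i) (\<lambda>k. \<phi> i k (d i v)) (b i) m = 0[M i]" if "m \<le> r i" for m using that
      by (induction m) (use dv free_modD(2)[OF free] in \<open>auto simp: IM_def\<close>)
    then show ?thesis by simp
  qed
  then have "d i v = 0[M i]" using free_modD(4)[OF free ds(1)[OF v]] by simp
  from d_ex[OF v this] obtain t w where t: "t \<in> Sp" "w \<in> carrier (M (Suc (Suc i)))" "t *[M (Suc i)] v = d (Suc i) w"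
    unfolding sat_def by auto
  have "t *[M (Suc i)] v -[M (Suc i)] d (Suc i) w = 0[M (Suc i)]" using t(3) ds(1)[OF t(2)] by (simp add: Mm.r_neg a_minus_def)
  then show "\<exists>t\<in>Sp. \<exists>w\<in>carrier (M (Suc (Suc i))). t *[M (Suc i)] v -[M (Suc i)] d (Suc i) w \<in> IM {\<zero>} (Suc i)"
    using t(1,2) Mm.submoduleD(2)[OF IM_submodule[OF zeroideal]] by metis
qed

text \<open>If \<open>p\<close> multiplies \<open>z\<close> into the saturation of \<open>I\<close>,
  then \<open>z\<close> times a basis element of \<open>M n\<close> is a cycle modulo that
  saturation, as \<open>d\<close> has coefficients in \<open>p\<close>. The next term is zero, so
  exactness puts \<open>z\<close> itself into the saturation, and
  \<open>nonzerodivisor_exists\<close> applies.\<close>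

lemma exact_mod_regular:
  assumes E: "exact_mod I j" and r: "r (Suc n) = 0" "r n \<noteq> 0" and j: "j < n" and I: "ideal I R"
  obtains y where "y \<in> p" "\<forall>a\<in>carrier R. y \<otimes> a \<in> I \<longrightarrow> a \<in> sat R Sp (selfmod R) I"
proof -
  interpret I: ideal I R by fact
  interpret s: module R "selfmod R" by (rule selfmod_module)
  let ?J = "sat R Sp (selfmod R) I"
  note SD = msysD[OF S]
  have Ism: "submodule I R (selfmod R)" using I submodule_selfmod_iff by simp
  have J: "ideal ?J R" using s.sat_submodule[OF S Ism] submodule_selfmod_iff by simp
  have IJ: "I \<subseteq> ?J" by (rule s.subset_sat[OF S]) (use I.Icarr in auto)
  have "z \<in> ?J" if z: "z \<in> carrier R" and zp: "\<And>y. y \<in> p ==> y \<otimes> z \<in> ?J" for z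
  proof -
    obtain m where m: "n = Suc m" using j by (cases n) auto
    let ?b = "b (Suc m) 0"
    have b: "?b \<in> carrier (M (Suc m))" using free_modD(2)[OF free] r m by simp
    have v: "z *[M (Suc m)] ?b \<in> carrier (M (Suc m))" using b z by simp
    have db: "d m ?b \<in> carrier (M m)" using ds(1)[OF b] .
    have zp': "z \<otimes> y \<in> ?J" if "y \<in> p" for y using zp[OF that] m_comm[OF z] pp.Icarr[OF that] by simp
    have "d m (z *[M (Suc m)] ?b) \<in> IM ?J m"
      unfolding IM_def using ds(1)[OF v] db b z zp' d_in_p[OF b] by (auto simp: ds coord_lin)
    from IM_sat[OF I this] obtain t where t: "t \<in> Sp" "t *[M m] d m (z *[M (Suc m)] ?b) \<in> IM I m" unfolding sat_def by blast
    have tc: "t \<in> carrier R" using t by simp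
    have "d m (t *[M (Suc m)] (z *[M (Suc m)] ?b)) \<in> IM I m" using t(2) ds(3)[OF tc v] by simp
    moreover have "t *[M (Suc m)] (z *[M (Suc m)] ?b) \<in> carrier (M (Suc m))" using tc v by simp
    moreover have "j \<le> m" using j m by simp
    ultimately obtain s w where s: "s \<in> Sp" and w: "w \<in> carrier (M (Suc (Suc m)))"
      and sw: "s *[M (Suc m)] (t *[M (Suc m)] (z *[M (Suc m)] ?b)) -[M (Suc m)] d (Suc m) w \<in> IM I (Suc m)"
      using E unfolding exact_mod_def by meson
    have sc: "s \<in> carrier R" using s by simp
    have "w = 0[M (Suc (Suc m))]" using free_modD(4)[OF free w] r(1) unfolding m by simp
    then have dw: "d (Suc m) w = 0[M (Suc m)]" using ds(4) by simp
    have "s *[M (Suc m)] (t *[M (Suc m)] (z *[M (Suc m)] ?b)) -[M (Suc m)] d (Suc m) w = ((s \<otimes> t) \<otimes> z) *[M (Suc m)] ?b"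
      unfolding dw using sc tc z b by algebra
    moreover have "\<phi> (Suc m) 0 (((s \<otimes> t) \<otimes> z) *[M (Suc m)] ?b) = (s \<otimes> t) \<otimes> z"
      using coord_lin(3)[of 0 "Suc m" "(s \<otimes> t) \<otimes> z" ?b] free_modD(5)[OF free, of 0 "Suc m" 0] r(2) m b sc tc z by simp
    ultimately have "(s \<otimes> t) \<otimes> z \<in> I" using sw r(2) m unfolding IM_def by auto
    then show ?thesis using SD(3)[OF s t(1)] z unfolding sat_def by auto
  qed
  from nonzerodivisor_exists[OF pp.is_ideal J this] obtain y where "y \<in> p" "\<forall>a\<in>carrier R. y \<otimes> a \<in> ?J \<longrightarrow> a \<in> ?J" by blast
  then show ?thesis using that IJ by blast
qed

text \<open>The long exact sequence of multiplication by \<open>y\<close>, which is a nonzerodivisor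
  modulo \<open>I\<close> at \<open>p\<close>: vanishing for \<open>I\<close> in two neighbouring
  positions gives vanishing for \<open>I'\<close> in the upper one. This is why the bound grows by
  one.\<close>

lemma exact_mod_step:
  assumes E: "exact_mod I j" and I: "ideal I R" and I': "ideal I' R" "I \<subseteq> I'" "y \<in> I'" "\<And>a. a \<in> I' ==> \<exists>k\<in>I. \<exists>c\<in>carrier R. a = k \<oplus> c \<otimes> y"
    and y: "\<And>a. a \<in> carrier R ==> y \<otimes> a \<in> I ==> a \<in> sat R Sp (selfmod R) I"
  shows "exact_mod I' (Suc j)"
  unfolding exact_mod_def
proof (intro allI impI ballI)
  fix i v assume ij: "Suc j \<le> i" and v: "v \<in> carrier (M (Suc i))" and dv: "d i v \<in> IM I' i"
  obtain i' where i': "i = Suc i'" "j \<le> i'" using ij by (cases i) auto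
  interpret I: ideal I R by fact
  interpret I': ideal I' R by fact
  note SD = msysD[OF S] and D0 = Mm.submoduleD[OF IM_submodule[OF I]] and D1 = Mm.submoduleD[OF IM_submodule[OF I]]
    and D2 = Mm.submoduleD[OF IM_submodule[OF I]] and D2' = Mm.submoduleD[OF IM_submodule[OF I'(1)]]
  have d': "d i' x \<in> carrier (M i')" if "x \<in> carrier (M i)" for x using ds(1)[of x i'] that i' by simp
  have yc: "y \<in> carrier R" using I'.Icarr I' by blast
  have dvc: "d i v \<in> carrier (M i)" by (rule ds(1)[OF v])
  have "\<forall>k\<in>{..<r i}. \<exists>c\<in>carrier R. \<phi> i k (d i v) \<ominus> c \<otimes> y \<in> I"
  proof
    fix k assume k: "k \<in> {..<r i}"
    then obtain a c where ac: "a \<in> I" "c \<in> carrier R" "\<phi> i k (d i v) = a \<oplus> c \<otimes> y" using dv I'(4)[of "\<phi> i k (d i v)"] unfolding IM_def by auto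
    have "\<phi> i k (d i v) \<ominus> c \<otimes> y = a" unfolding ac(3) using I.Icarr[OF ac(1)] ac(2) yc by algebra
    then show "\<exists>c\<in>carrier R. \<phi> i k (d i v) \<ominus> c \<otimes> y \<in> I" using ac by (intro bexI[of _ c]) auto
  qed
  then obtain c where c: "\<And>k. k < r i ==> c k \<in> carrier R" "\<And>k. k < r i ==> \<phi> i k (d i v) \<ominus> c k \<otimes> y \<in> I" by (metis lessThan_iff)
  define w where "w = lc (M i) c (b i) (r i)"
  have w: "w \<in> carrier (M i)" unfolding w_def by (rule Mm.lc_closed) (use c free_modD(2)[OF free] in auto)
  \<comment> \<open>The boundary of \<open>v\<close> is \<open>y\<close> times \<open>w\<close> plus
    \<open>u\<close>, with \<open>u\<close> in the submodule for \<open>I\<close>. Another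
    application of the differential puts \<open>y\<close> times the boundary of \<open>w\<close>
    into that submodule too, and \<open>y\<close> is cancelled.\<close>
  define u where "u = d i v -[M i] y *[M i] w"
  have wk: "\<phi> i k w = c k" if "k < r i" for k unfolding w_def by (rule free_mod_coord_lc[OF free c(1) that])
  have u: "u \<in> IM I i" unfolding IM_def u_def
    using c w yc dvc by (auto simp: coord_lin wk m_comm)
  have uc: "u \<in> carrier (M i)" by (rule D1(1)[OF u])
  have dw: "d i' w \<in> carrier (M i')" by (rule d'[OF w])
  have "d i' u = d i' (d i v) -[M i'] y *[M i'] d i' w"
    using ds(3)[OF yc, of w i'] ds(6)[of "d i v" i' "y *[M i] w"] Mm.smult_closed[OF yc w] w dvc unfolding u_def i'(1) by simp
  also have "\<dots> = -[M i'] (y *[M i'] d i' w)" using dd[of v i'] v dw yc unfolding i'(1) by (simp add: a_minus_def)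
  finally have "y *[M i'] d i' w = -[M i'] d i' u" using dw yc by simp
  moreover have "d i' u \<in> IM I i'" by (rule IM_d[OF I u[unfolded i'(1)]])
  ultimately have "y *[M i'] d i' w \<in> IM I i'" using D0(4) by simp
  then have "d i' w \<in> IM (sat R Sp (selfmod R) I) i'"
    using dw y yc coord[OF _ dw] unfolding IM_def by (auto simp: coord_lin)
  from IM_sat[OF I this] obtain t where t: "t \<in> Sp" "t *[M i'] d i' w \<in> IM I i'" unfolding sat_def by blast
  have tc: "t \<in> carrier R" using t by simp
  have twc: "t *[M i] w \<in> carrier (M i)" using tc w by simp
  have "d i' (t *[M i] w) \<in> IM I i'" using t(2) ds(3)[OF tc, of w i'] w i'(1) by simp
  then obtain s w' where s: "s \<in> Sp" and w': "w' \<in> carrier (M (Suc i))"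
    and sw: "s *[M i] (t *[M i] w) -[M i] d i w' \<in> IM I i"
    using E i'(2) twc unfolding exact_mod_def i'(1) by meson
  have sc: "s \<in> carrier R" using s by simp
  have dw': "d i w' \<in> carrier (M i)" by (rule ds(1)[OF w'])
  \<comment> \<open>Up to a factor outside \<open>p\<close> this differs from \<open>v\<close> by a
    multiple of \<open>y\<close>, and its boundary lies in the submodule for
    \<open>I\<close>.\<close>
  let ?v = "(s \<otimes> t) *[M (Suc i)] v -[M (Suc i)] y *[M (Suc i)] w'"
  have v2: "?v \<in> carrier (M (Suc i))" using sc tc yc v w' by simp
  have "d i ?v = (s \<otimes> t) *[M i] d i v -[M i] y *[M i] d i w'"
    using sc tc yc v w' by (simp add: ds)
  also have "\<dots> = (s \<otimes> t) *[M i] u +[M i] y *[M i] (s *[M i] (t *[M i] w) -[M i] d i w')"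
    unfolding u_def using sc tc yc w dvc dw' by algebra
  also have "\<dots> \<in> IM I i" using D1(3)[OF D1(5)[OF _ u] D1(5)[OF yc sw]] sc tc by simp
  finally obtain s2 w2 where s2: "s2 \<in> Sp" and w2: "w2 \<in> carrier (M (Suc (Suc i)))"
    and sw2: "s2 *[M (Suc i)] ?v -[M (Suc i)] d (Suc i) w2 \<in> IM I (Suc i)"
    using E ij v2 unfolding exact_mod_def by (meson Suc_leD)
  have s2c: "s2 \<in> carrier R" using s2 by simp
  have dw2: "d (Suc i) w2 \<in> carrier (M (Suc i))" by (rule ds(1)[OF w2])
  have "(s2 \<otimes> (s \<otimes> t)) *[M (Suc i)] v -[M (Suc i)] d (Suc i) w2 =
    (s2 *[M (Suc i)] ?v -[M (Suc i)] d (Suc i) w2) +[M (Suc i)] y *[M (Suc i)] (s2 *[M (Suc i)] w')"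
    using sc tc s2c yc v w' dw2 by algebra
  also have "\<dots> \<in> IM I' (Suc i)"
  proof (rule D2'(3))
    show "s2 *[M (Suc i)] ?v -[M (Suc i)] d (Suc i) w2 \<in> IM I' (Suc i)" using sw2 I'(2) unfolding IM_def by auto
    show "y *[M (Suc i)] (s2 *[M (Suc i)] w') \<in> IM I' (Suc i)" by (rule IM_smult[OF I'(1,3)]) (use s2c w' in simp)
  qed
  finally show "\<exists>t\<in>Sp. \<exists>w\<in>carrier (M (Suc (Suc i))). t *[M (Suc i)] v -[M (Suc i)] d (Suc i) w \<in> IM I' (Suc i)"
    using SD(3)[OF s2 SD(3)[OF s t(1)]] w2 by blast
qed

text \<open>A prime \<open>q\<close> over \<open>I'\<close> contains an associated prime
  \<open>q'\<close> of \<open>R / I\<close>. The new element \<open>y\<close> is a nonzerodivisor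
  modulo \<open>I\<close> at \<open>p\<close>, so it lies in \<open>q\<close> but not in
  \<open>q'\<close>, and a chain ending at \<open>q'\<close> is prolonged by
  \<open>q\<close>.\<close>

lemma regular_sequence:
  assumes r: "r (Suc n) = 0" "r n \<noteq> 0" and j: "j \<le> n"
  obtains I where "ideal I R" "I \<subseteq> p" "exact_mod I j" "\<forall>q. primeideal q R \<longrightarrow> I \<subseteq> q \<longrightarrow> q \<subseteq> p \<longrightarrow> prime_chain R j q"
proof -
  interpret s: module R "selfmod R" by (rule selfmod_module)
  have "\<exists>I. ideal I R \<and> I \<subseteq> p \<and> exact_mod I j \<and> (\<forall>q. primeideal q R \<longrightarrow> I \<subseteq> q \<longrightarrow> q \<subseteq> p \<longrightarrow> prime_chain R j q)"
    using j
  proof (induction j)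
    case 0
    then show ?case using zeroideal exact_mod_zero prime_chain_0 pp.zero_closed by (intro exI[of _ "{\<zero>}"]) auto
  next
    case (Suc j)
    then obtain I where I: "ideal I R" "I \<subseteq> p" "exact_mod I j" and ch: "\<And>q. primeideal q R ==> I \<subseteq> q ==> q \<subseteq> p ==> prime_chain R j q" by auto
    interpret I: ideal I R by (rule I(1))
    have "j < n" using Suc by simp
    obtain y where y: "y \<in> p" "\<forall>a\<in>carrier R. y \<otimes> a \<in> I \<longrightarrow> a \<in> sat R Sp (selfmod R) I"
      by (rule exact_mod_regular[OF I(3) r \<open>j < n\<close> I(1)])
    have yc: "y \<in> carrier (selfmod R)" using y pp.Icarr by simp
    have Ism: "submodule I R (selfmod R)" using I submodule_selfmod_iff by simp
    define I' where "I' = {k +[selfmod R] r *[selfmod R] y | k r. k \<in> I \<and> r \<in> carrier R}"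
    note L = s.add_line_submodule[OF Ism yc, folded I'_def]
    have I': "ideal I' R" using L(1) submodule_selfmod_iff by simp
    have "I' \<subseteq> p" unfolding I'_def using I(2) y(1) by (auto intro!: pp.a_closed pp.I_l_closed)
    moreover have "exact_mod I' (Suc j)"
      by (rule exact_mod_step[OF I(3,1) I' L(2,3)]) (use y(2) in \<open>auto simp: I'_def\<close>)
    moreover have "prime_chain R (Suc j) q" if q: "primeideal q R" "I' \<subseteq> q" "q \<subseteq> p" for q
    proof -
      interpret q: primeideal q R by (rule q(1))
      have "\<one> \<notin> sat R (carrier R - q) (selfmod R) I"
        using L(2) q(2) unfolding sat_def by auto
      then obtain q' c where q': "primeideal q' R" "q' \<subseteq> q" "c \<in> carrier R"
        and "\<And>a. a \<in> carrier R ==> a *[selfmod R] (c *[selfmod R] \<one>) \<in> I \<longleftrightarrow> a \<in> q'"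
        using associated_prime[OF selfmod_module Ism q(1), of \<one>] by (metis one_closed selfmod_simps(1))
      then have q'4: "a \<otimes> c \<in> I \<longleftrightarrow> a \<in> q'" if "a \<in> carrier R" for a using that by simp
      have "I \<subseteq> q'" using q'(3) q'4 I.I_r_closed I.Icarr by blast
      moreover have "y \<notin> q'"
      proof
        assume "y \<in> q'"
        then have "y \<otimes> c \<in> I" using q'4[of y] yc by simp
        then obtain t where "t \<in> carrier R" "t \<notin> p" "t \<otimes> c \<in> I" using y(2) q'(3) unfolding sat_def by auto
        then show False using q'4 q'(2) q(3) by blast
      qed
      moreover have "y \<in> q" using L(3) q(2) by blast
      ultimately show ?thesis using prime_chain_Suc[OF ch[OF q'(1)] _ q(1)] q'(2) q(3) by blast
    qed
    ultimately show ?case using I' by blast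
  qed
  then show ?thesis using that by blast
qed

text \<open>Let \<open>n\<close> be the position just before the first zero term. The Koszul
  elements give that \<open>n\<close> is at least the rank of \<open>M (Suc 0)\<close>, and
  \<open>n\<close> successive nonzerodivisors give a chain of length \<open>n\<close>, which is then
  shortened.\<close>

lemma prime_chain_rank:
  assumes N: "r N = 0" shows "prime_chain R (r (Suc 0)) p"
proof -
  define m where "m = (LEAST N. r N = 0)"
  have m: "r m = 0" "\<And>k. k < m ==> r k \<noteq> 0" unfolding m_def using LeastI[of "\<lambda>N. r N = 0", OF N] not_less_Least by auto
  have lt: "r (Suc 0) < m" using rank_nonzero[of m] m(1) by (metis not_le)
  then obtain n where n: "m = Suc n" by (cases m) auto
  obtain I where "I \<subseteq> p" "\<forall>q. primeideal q R \<longrightarrow> I \<subseteq> q \<longrightarrow> q \<subseteq> p \<longrightarrow> prime_chain R n q"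
    by (rule regular_sequence[of n n]) (use m n in auto)
  then have "prime_chain R n p" using p by blast
  then show ?thesis using prime_chain_mono lt n by (metis less_Suc_eq_le)
qed

text \<open>The generators are the values of \<open>X\<close> on the basis of
  \<open>M (Suc 0)\<close>.\<close>

lemma local_generators:
  obtains G where "G \<subseteq> p" "finite G" "card G \<le> r (Suc 0)" "\<forall>y\<in>p. \<exists>t\<in>Sp. t \<otimes> y \<in> Idl G"
proof
  let ?G = "(\<lambda>s. X (b (Suc 0) s)) ` {..<r (Suc 0)}"
  have b: "b (Suc 0) s \<in> carrier (M (Suc 0))" if "s < r (Suc 0)" for s using free_modD(2)[OF free that] .
  show Gp: "?G \<subseteq> p" using d0[OF b] unfolding X_def by auto
  show "finite ?G" "card ?G \<le> r (Suc 0)" using card_image_le[of "{..<r (Suc 0)}"] by auto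
  have Gc: "?G \<subseteq> carrier R" using Gp pp.Icarr by blast
  interpret G: ideal "Idl ?G" R by (rule genideal_ideal[OF Gc])
  have XG: "X v \<in> Idl ?G" if v: "v \<in> carrier (M (Suc 0))" for v
  proof -
    have "X v = lc (selfmod R) (\<lambda>s. \<phi> (Suc 0) s v) (\<lambda>s. X (b (Suc 0) s)) (r (Suc 0))"
      using lin_maps_lc[OF Mm selfmod_module X_lin, of "r (Suc 0)" "\<lambda>s. \<phi> (Suc 0) s v" "b (Suc 0)"] b coord[OF _ v] free_modD(4)[OF free v] by simp
    moreover have "lc (selfmod R) (\<lambda>s. \<phi> (Suc 0) s v) (\<lambda>s. X (b (Suc 0) s)) m \<in> Idl ?G" if "m \<le> r (Suc 0)" for m using that
    proof (induction m)
      case (Suc m)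
      then show ?case using genideal_self[OF Gc] coord[of m "Suc 0", OF _ v] by (auto intro!: G.a_closed G.I_l_closed)
    qed simp
    ultimately show ?thesis by simp
  qed
  show "\<forall>y\<in>p. \<exists>t\<in>Sp. t \<otimes> y \<in> Idl ?G"
  proof
    fix y assume "y \<in> p"
    then obtain t v where "t \<in> Sp" "v \<in> carrier (M (Suc 0))" "t \<otimes> y = X v" using p_sat[of y] unfolding sat_def by auto
    then show "\<exists>t\<in>Sp. t \<otimes> y \<in> Idl ?G" using XG[of v] by (intro bexI[of _ t]) simp_all
  qed
qed

end

section \<open>Localisation at a prime\<close>

text \<open>The operations of \<open>localization\<close> are unions over representatives; once the
  result does not depend on them, the union is the common value.\<close>

lemma UN_pair_const:
  assumes "(a, s) \<in> X" "(b, t) \<in> Y" "\<And>a s b t. (a, s) \<in> X ==> (b, t) \<in> Y ==> f a s b t = c"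
  shows "(\<Union>(a, s)\<in>X. \<Union>(b, t)\<in>Y. f a s b t) = c"
proof -
  have "(\<Union>(a, s)\<in>X. \<Union>(b, t)\<in>Y. f a s b t) = (\<Union>x\<in>X. \<Union>y\<in>Y. c)"
    by (intro SUP_cong refl) (auto simp: assms(3))
  then show ?thesis using assms(1,2) by auto
qed

locale local_at = noeth_cring R for R (structure) + fixes p assumes p: "primeideal p R"
begin

sublocale pp: primeideal p R by (rule p)

abbreviation "S \<equiv> carrier R - p"
abbreviation "A \<equiv> localization R S"
abbreviation "fr \<equiv> frac R S"

lemma S: "s \<in> S ==> s \<in> carrier R" "\<one> \<in> S" "s \<in> S ==> t \<in> S ==> s \<otimes> t \<in> S"
  using msysD[OF msys_compl_prime[OF p]] by auto

lemma frac_rel_equiv: "equiv (carrier R \<times> S) (frac_rel R S)"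
proof (rule equivI)
  show "frac_rel R S \<subseteq> (carrier R \<times> S) \<times> carrier R \<times> S" unfolding frac_rel_def by auto
  show "refl_on (carrier R \<times> S) (frac_rel R S)" unfolding frac_rel_def using S(2) by (auto simp: refl_on_def)
  show "sym (frac_rel R S)" unfolding frac_rel_def by (rule symI) (auto intro: sym)
  show "trans (frac_rel R S)"
  proof (rule transI)
    fix x y z assume "(x, y) \<in> frac_rel R S" "(y, z) \<in> frac_rel R S"
    then obtain a s b t c v u w where x: "x = (a, s)" "y = (b, t)" "z = (c, v)" and c: "a \<in> carrier R" "b \<in> carrier R" "c \<in> carrier R"
      and sS: "s \<in> S" "t \<in> S" "v \<in> S" "u \<in> S" "w \<in> S" and e: "u \<otimes> (a \<otimes> t) = u \<otimes> (b \<otimes> s)" "w \<otimes> (b \<otimes> v) = w \<otimes> (c \<otimes> t)"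
      unfolding frac_rel_def by auto
    note sc = sS[THEN S(1)]
    have "(u \<otimes> (w \<otimes> t)) \<otimes> (a \<otimes> v) = (u \<otimes> (a \<otimes> t)) \<otimes> (w \<otimes> v)" using c sc by algebra
    also have "\<dots> = (w \<otimes> (b \<otimes> v)) \<otimes> (u \<otimes> s)" unfolding e(1) using c sc by algebra
    also have "\<dots> = (u \<otimes> (w \<otimes> t)) \<otimes> (c \<otimes> s)" unfolding e(2) using c sc by algebra
    finally show "(x, z) \<in> frac_rel R S" unfolding frac_rel_def x using c sS S(3)[OF sS(4) S(3)[OF sS(5,2)]] by auto
  qed
qed

lemma fr_eq:
  assumes "a \<in> carrier R" "s \<in> S" "b \<in> carrier R" "t \<in> S"
  shows "fr a s = fr b t \<longleftrightarrow> (\<exists>u\<in>S. u \<otimes> (a \<otimes> t) = u \<otimes> (b \<otimes> s))"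
  unfolding frac_def using eq_equiv_class_iff[OF frac_rel_equiv, of "(a, s)" "(b, t)"] assms by (simp add: frac_rel_def)

lemma fr_eqI:
  assumes "a \<in> carrier R" "s \<in> S" "b \<in> carrier R" "t \<in> S" "a \<otimes> t = b \<otimes> s" shows "fr a s = fr b t"
  using fr_eq[OF assms(1-4)] assms(5) S(2) by auto

lemma fr_mem: "(b, t) \<in> fr a s \<longleftrightarrow> a \<in> carrier R \<and> s \<in> S \<and> b \<in> carrier R \<and> t \<in> S \<and> (\<exists>u\<in>S. u \<otimes> (a \<otimes> t) = u \<otimes> (b \<otimes> s))"
  unfolding frac_def frac_rel_def by auto

lemma fr_closed: "a \<in> carrier R ==> s \<in> S ==> fr a s \<in> carrier A"
  unfolding localization_def frac_def by (auto intro: quotientI)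

lemma frE:
  assumes "x \<in> carrier A" obtains a s where "a \<in> carrier R" "s \<in> S" "x = fr a s"
  using assms unfolding localization_def frac_def by (auto elim!: quotientE)

lemma fr_mult:
  assumes "a \<in> carrier R" "s \<in> S" "b \<in> carrier R" "t \<in> S"
  shows "fr a s \<otimes>\<^bsub>A\<^esub> fr b t = fr (a \<otimes> b) (s \<otimes> t)"
proof -
  have *: "fr (a' \<otimes> b') (s' \<otimes> t') = fr (a \<otimes> b) (s \<otimes> t)" if "(a', s') \<in> fr a s" "(b', t') \<in> fr b t" for a' s' b' t'
  proof -
    obtain u v where *: "a' \<in> carrier R" "s' \<in> S" "b' \<in> carrier R" "t' \<in> S" "u \<in> S" "v \<in> S"
      and e: "u \<otimes> (a \<otimes> s') = u \<otimes> (a' \<otimes> s)" "v \<otimes> (b \<otimes> t') = v \<otimes> (b' \<otimes> t)" using \<open>_ \<in> fr a s\<close> \<open>_ \<in> fr b t\<close> unfolding fr_mem by blast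
    note c = assms(1,3) assms(2,4)[THEN S(1)] *(1,3) *(2,4-6)[THEN S(1)]
    have "(u \<otimes> v) \<otimes> ((a' \<otimes> b') \<otimes> (s \<otimes> t)) = (u \<otimes> (a' \<otimes> s)) \<otimes> (v \<otimes> (b' \<otimes> t))" using c by algebra
    also have "\<dots> = (u \<otimes> v) \<otimes> ((a \<otimes> b) \<otimes> (s' \<otimes> t'))" unfolding e[symmetric] using c by algebra
    finally show ?thesis
      unfolding fr_eq[OF m_closed[OF *(1,3)] S(3)[OF *(2,4)] m_closed[OF assms(1,3)] S(3)[OF assms(2,4)]] using S(3)[OF *(5,6)] by blast
  qed
  have "(a, s) \<in> fr a s" "(b, t) \<in> fr b t" using assms S(2) by (auto simp: fr_mem)
  from UN_pair_const[where f = "\<lambda>a s b t. fr (a \<otimes> b) (s \<otimes> t)", OF this *]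
  show ?thesis unfolding localization_def by simp
qed

lemma fr_add:
  assumes "a \<in> carrier R" "s \<in> S" "b \<in> carrier R" "t \<in> S"
  shows "fr a s +[A] fr b t = fr (a \<otimes> t \<oplus> b \<otimes> s) (s \<otimes> t)"
proof -
  have *: "fr (a' \<otimes> t' \<oplus> b' \<otimes> s') (s' \<otimes> t') = fr (a \<otimes> t \<oplus> b \<otimes> s) (s \<otimes> t)" if "(a', s') \<in> fr a s" "(b', t') \<in> fr b t" for a' s' b' t'
  proof -
    obtain u v where *: "a' \<in> carrier R" "s' \<in> S" "b' \<in> carrier R" "t' \<in> S" "u \<in> S" "v \<in> S"
      and e: "u \<otimes> (a \<otimes> s') = u \<otimes> (a' \<otimes> s)" "v \<otimes> (b \<otimes> t') = v \<otimes> (b' \<otimes> t)" using \<open>_ \<in> fr a s\<close> \<open>_ \<in> fr b t\<close> unfolding fr_mem by blast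
    note c = assms(1,3) assms(2,4)[THEN S(1)] *(1,3) *(2,4-6)[THEN S(1)]
    have "(u \<otimes> v) \<otimes> ((a' \<otimes> t' \<oplus> b' \<otimes> s') \<otimes> (s \<otimes> t)) = (u \<otimes> (a' \<otimes> s)) \<otimes> (v \<otimes> (t \<otimes> t')) \<oplus> (v \<otimes> (b' \<otimes> t)) \<otimes> (u \<otimes> (s \<otimes> s'))" using c by algebra
    also have "\<dots> = (u \<otimes> v) \<otimes> ((a \<otimes> t \<oplus> b \<otimes> s) \<otimes> (s' \<otimes> t'))" unfolding e[symmetric] using c by algebra
    finally show ?thesis
      unfolding fr_eq[OF a_closed[OF m_closed[OF *(1) S(1)[OF *(4)]] m_closed[OF *(3) S(1)[OF *(2)]]] S(3)[OF *(2,4)]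
          a_closed[OF m_closed[OF assms(1) S(1)[OF assms(4)]] m_closed[OF assms(3) S(1)[OF assms(2)]]] S(3)[OF assms(2,4)]]
      using S(3)[OF *(5,6)] by blast
  qed
  have "(a, s) \<in> fr a s" "(b, t) \<in> fr b t" using assms S(2) by (auto simp: fr_mem)
  from UN_pair_const[where f = "\<lambda>a s b t. fr (a \<otimes> t \<oplus> b \<otimes> s) (s \<otimes> t)", OF this *]
  show ?thesis unfolding localization_def by simp
qed

lemma fr_one: "\<one>\<^bsub>A\<^esub> = fr \<one> \<one>" and fr_zero: "0[A] = fr \<zero> \<one>"
  unfolding localization_def by auto

lemma A_cring: "cring A"
proof (rule cringI)
  show "abelian_group A"
  proof (rule abelian_groupI)
    show "0[A] \<in> carrier A" unfolding fr_zero using S(2) by (intro fr_closed) auto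
    fix x assume "x \<in> carrier A" then obtain a s where x: "a \<in> carrier R" "s \<in> S" "x = fr a s" by (rule frE)
    note xc = x(1) S(1)[OF x(2)]
    show "0[A] +[A] x = x" unfolding fr_zero x(3) using x S xc by (simp add: fr_add)
    show "\<exists>y\<in>carrier A. y +[A] x = 0[A]"
    proof (intro bexI)
      show "fr (\<ominus> a) s +[A] x = 0[A]" unfolding fr_zero x(3) fr_add[OF a_inv_closed[OF x(1)] x(2) x(1,2)]
        by (rule fr_eqI) (use x S xc in \<open>auto simp: l_minus l_neg\<close>)
    qed (use x in \<open>auto intro: fr_closed\<close>)
    fix y assume "y \<in> carrier A" then obtain b t where y: "b \<in> carrier R" "t \<in> S" "y = fr b t" by (rule frE)
    note yc = y(1) S(1)[OF y(2)]
    have st: "s \<otimes> t \<in> S" "t \<otimes> s \<in> S" using x y S(3) by auto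
    show "x +[A] y \<in> carrier A" unfolding x(3) y(3) fr_add[OF x(1,2) y(1,2)] using st xc yc by (intro fr_closed) auto
    show "x +[A] y = y +[A] x" unfolding x(3) y(3) fr_add[OF x(1,2) y(1,2)] fr_add[OF y(1,2) x(1,2)]
      using xc yc by (simp add: m_comm[of s t] a_comm)
    fix z assume "z \<in> carrier A" then obtain c v where z: "c \<in> carrier R" "v \<in> S" "z = fr c v" by (rule frE)
    note zc = z(1) S(1)[OF z(2)]
    have stv: "s \<otimes> t \<otimes> v \<in> S" "s \<otimes> (t \<otimes> v) \<in> S" "t \<otimes> v \<in> S" using st z y x S(3) by blast+
    have 1: "a \<otimes> t \<oplus> b \<otimes> s \<in> carrier R" "b \<otimes> v \<oplus> c \<otimes> t \<in> carrier R" using xc yc zc by auto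
    show "x +[A] y +[A] z = x +[A] (y +[A] z)"
      unfolding x(3) y(3) z(3) fr_add[OF x(1,2) y(1,2)] fr_add[OF y(1,2) z(1,2)] fr_add[OF 1(1) st(1) z(1,2)] fr_add[OF x(1,2) 1(2) stv(3)]
      using xc yc zc by (intro fr_eqI stv) (simp_all, algebra)
  qed
  show "comm_monoid A"
  proof (rule comm_monoidI)
    show "\<one>\<^bsub>A\<^esub> \<in> carrier A" unfolding fr_one using S(2) by (intro fr_closed) auto
    fix x assume "x \<in> carrier A" then obtain a s where x: "a \<in> carrier R" "s \<in> S" "x = fr a s" by (rule frE)
    show "\<one>\<^bsub>A\<^esub> \<otimes>\<^bsub>A\<^esub> x = x" unfolding fr_one x(3) using x S by (simp add: fr_mult)
    fix y assume "y \<in> carrier A" then obtain b t where y: "b \<in> carrier R" "t \<in> S" "y = fr b t" by (rule frE)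
    have st: "s \<otimes> t \<in> S" using x y S(3) by auto
    show "x \<otimes>\<^bsub>A\<^esub> y \<in> carrier A" unfolding x(3) y(3) fr_mult[OF x(1,2) y(1,2)] using st x y by (intro fr_closed) auto
    show "x \<otimes>\<^bsub>A\<^esub> y = y \<otimes>\<^bsub>A\<^esub> x" unfolding x(3) y(3) fr_mult[OF x(1,2) y(1,2)] fr_mult[OF y(1,2) x(1,2)]
      using x y S(1) by (simp add: m_comm)
    fix z assume "z \<in> carrier A" then obtain c v where z: "c \<in> carrier R" "v \<in> S" "z = fr c v" by (rule frE)
    have tv: "t \<otimes> v \<in> S" using z y S(3) by auto
    show "x \<otimes>\<^bsub>A\<^esub> y \<otimes>\<^bsub>A\<^esub> z = x \<otimes>\<^bsub>A\<^esub> (y \<otimes>\<^bsub>A\<^esub> z)"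
      unfolding x(3) y(3) z(3) fr_mult[OF x(1,2) y(1,2)] fr_mult[OF y(1,2) z(1,2)] fr_mult[OF m_closed[OF x(1) y(1)] st z(1,2)] fr_mult[OF x(1,2) m_closed[OF y(1) z(1)] tv]
      using x y z S(1) by (simp add: m_assoc)
  qed
  fix x y z assume "x \<in> carrier A" "y \<in> carrier A" "z \<in> carrier A"
  then obtain a s b t c v where x: "a \<in> carrier R" "s \<in> S" "x = fr a s" and y: "b \<in> carrier R" "t \<in> S" "y = fr b t"
    and z: "c \<in> carrier R" "v \<in> S" "z = fr c v" by (meson frE)
  note xc = x(1) S(1)[OF x(2)] y(1) S(1)[OF y(2)] z(1) S(1)[OF z(2)]
  have st: "s \<otimes> t \<in> S" "s \<otimes> v \<in> S" "t \<otimes> v \<in> S" "(s \<otimes> t) \<otimes> v \<in> S" "(s \<otimes> v) \<otimes> (t \<otimes> v) \<in> S" using x y z by (simp_all add: S(3) del: DiffD1 DiffD2 Diff_iff)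
  have 1: "a \<otimes> t \<oplus> b \<otimes> s \<in> carrier R" using xc by auto
  show "(x +[A] y) \<otimes>\<^bsub>A\<^esub> z = x \<otimes>\<^bsub>A\<^esub> z +[A] y \<otimes>\<^bsub>A\<^esub> z"
    unfolding x(3) y(3) z(3) fr_add[OF x(1,2) y(1,2)] fr_mult[OF 1 st(1) z(1,2)] fr_mult[OF x(1,2) z(1,2)] fr_mult[OF y(1,2) z(1,2)]
      fr_add[OF m_closed[OF x(1) z(1)] st(2) m_closed[OF y(1) z(1)] st(3)]
    using xc by (intro fr_eqI st) (simp_all, algebra)
qed

sublocale A: cring A by (rule A_cring)

section \<open>Contraction and extension of ideals\<close>

definition con :: "('a \<times> 'a) set set \<Rightarrow> 'a set" where "con I = {a \<in> carrier R. fr a \<one> \<in> I}"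
definition ext :: "'a set \<Rightarrow> ('a \<times> 'a) set set" where "ext I = {fr a s | a s. a \<in> I \<and> s \<in> S}"

text \<open>\<open>fr s \<one>\<close> and \<open>fr \<one> s\<close> are mutually inverse, so
  denominators do not affect membership in an ideal.\<close>

lemma con_iff:
  assumes I: "ideal I A" and a: "a \<in> carrier R" "s \<in> S" shows "fr a s \<in> I \<longleftrightarrow> a \<in> con I"
proof -
  interpret I: ideal I A by fact
  have 1: "fr a \<one> = fr s \<one> \<otimes>\<^bsub>A\<^esub> fr a s" "fr a s = fr \<one> s \<otimes>\<^bsub>A\<^esub> fr a \<one>"
    unfolding fr_mult[OF S(1)[OF a(2)] S(2) a] fr_mult[OF one_closed a(2) a(1) S(2)]
    by ((rule fr_eqI; use a S in \<open>auto simp: m_comm\<close>)+)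
  have c: "fr s \<one> \<in> carrier A" "fr \<one> s \<in> carrier A" using a S by (auto intro: fr_closed)
  have "fr a s \<in> I \<longleftrightarrow> fr a \<one> \<in> I" using I.I_l_closed[OF _ c(1)] I.I_l_closed[OF _ c(2)] 1 by metis
  then show ?thesis unfolding con_def using a(1) by simp
qed

lemma con_mono:
  assumes I: "ideal I A" and J: "ideal J A" shows "I \<subseteq> J \<longleftrightarrow> con I \<subseteq> con J"
proof
  assume c: "con I \<subseteq> con J"
  interpret I: ideal I A by fact
  show "I \<subseteq> J"
  proof
    fix x assume "x \<in> I"
    moreover from I.Icarr[OF this] obtain a s where x: "a \<in> carrier R" "s \<in> S" "x = fr a s" by (rule frE)
    ultimately show "x \<in> J" using con_iff[OF I x(1,2)] con_iff[OF J x(1,2)] c by auto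
  qed
qed (auto simp: con_def)

lemma con_ideal: assumes I: "ideal I A" shows "ideal (con I) R"
proof (rule idealI')
  interpret I: ideal I A by fact
  show "con I \<subseteq> carrier R" unfolding con_def by auto
  show "\<zero> \<in> con I" unfolding con_def using I.zero_closed fr_zero by simp
  fix a assume a: "a \<in> con I"
  then have ac: "a \<in> carrier R" "fr a \<one> \<in> I" unfolding con_def by auto
  show "x \<otimes> a \<in> con I" if x: "x \<in> carrier R" for x
    using I.I_l_closed[OF ac(2) fr_closed[OF x S(2)]] fr_mult[OF x S(2) ac(1) S(2)] x ac unfolding con_def by simp
  fix b assume b: "b \<in> con I"
  then have bc: "b \<in> carrier R" "fr b \<one> \<in> I" unfolding con_def by auto
  show "a \<oplus> b \<in> con I"
    using I.a_closed[OF ac(2) bc(2)] fr_add[OF ac(1) S(2) bc(1) S(2)] bc ac unfolding con_def by simp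
qed

lemma con_prime: assumes I: "primeideal I A" shows "primeideal (con I) R"
proof (rule primeidealI[OF con_ideal[OF primeideal.axioms(1)[OF I]]])
  interpret I: primeideal I A by fact
  have "\<one> \<notin> con I" unfolding con_def using I.I_notcarr I.one_imp_carrier fr_one by auto
  then show "carrier R \<noteq> con I" by blast
  fix a b assume ab: "a \<in> carrier R" "b \<in> carrier R" "a \<otimes> b \<in> con I"
  then have "fr a \<one> \<otimes>\<^bsub>A\<^esub> fr b \<one> \<in> I" unfolding con_def by (simp add: fr_mult[OF _ S(2) _ S(2)])
  then show "a \<in> con I \<or> b \<in> con I" using I.I_prime[OF fr_closed fr_closed] ab S(2) unfolding con_def by blast
qed (rule cring_axioms)

lemma ext_ideal: assumes I: "ideal I R" shows "ideal (ext I) A"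
proof (rule A.idealI')
  interpret I: ideal I R by fact
  show "ext I \<subseteq> carrier A" unfolding ext_def using I.Icarr by (auto intro: fr_closed)
  show "0[A] \<in> ext I" unfolding ext_def fr_zero using I.zero_closed S(2) by blast
  fix x assume "x \<in> ext I"
  then obtain a s where x: "a \<in> I" "s \<in> S" "x = fr a s" unfolding ext_def by blast
  note ac = I.Icarr[OF x(1)]
  show "y \<otimes>\<^bsub>A\<^esub> x \<in> ext I" if "y \<in> carrier A" for y
  proof -
    from that obtain b t where y: "b \<in> carrier R" "t \<in> S" "y = fr b t" by (rule frE)
    show ?thesis unfolding x(3) y(3) fr_mult[OF y(1,2) ac x(2)] ext_def using I.I_l_closed[OF x(1) y(1)] S(3)[OF y(2) x(2)] by blast
  qed
  fix y assume "y \<in> ext I"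
  then obtain b t where y: "b \<in> I" "t \<in> S" "y = fr b t" unfolding ext_def by blast
  show "x +[A] y \<in> ext I" unfolding x(3) y(3) fr_add[OF ac x(2) I.Icarr[OF y(1)] y(2)] ext_def
    using I.a_closed[OF I.I_r_closed[OF x(1) S(1)[OF y(2)]] I.I_r_closed[OF y(1) S(1)[OF x(2)]]] S(3)[OF x(2) y(2)] by blast
qed

lemma con_ext:
  assumes q: "primeideal q R" "q \<subseteq> p" shows "con (ext q) = q"
proof -
  interpret q: primeideal q R by (rule q(1))
  have "a \<in> q" if a: "a \<in> carrier R" "fr a \<one> \<in> ext q" for a
  proof -
    obtain b t where b: "b \<in> q" "t \<in> S" "fr a \<one> = fr b t" using a(2) unfolding ext_def by blast
    then obtain u where u: "u \<in> S" "u \<otimes> (a \<otimes> t) = u \<otimes> (b \<otimes> \<one>)" using fr_eq[OF a(1) S(2) q.Icarr[OF b(1)] b(2)] by blast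
    have "u \<otimes> (b \<otimes> \<one>) \<in> q" by (rule q.I_l_closed[OF q.I_r_closed[OF b(1) one_closed] S(1)[OF u(1)]])
    then have "u \<in> q \<or> a \<in> q \<or> t \<in> q" using q.I_prime[of u "a \<otimes> t"] q.I_prime[of a t] u(2) S(1)[OF u(1)] a(1) S(1)[OF b(2)] by auto
    then show ?thesis using u(1) b(2) q(2) by blast
  qed
  moreover have "fr a \<one> \<in> ext q" if "a \<in> q" for a unfolding ext_def using that S(2) by blast
  ultimately show ?thesis unfolding con_def using q.Icarr by blast
qed

lemma ext_prime:
  assumes q: "primeideal q R" "q \<subseteq> p" shows "primeideal (ext q) A"
proof (rule primeidealI[OF ext_ideal[OF primeideal.axioms(1)[OF q(1)]] A_cring])
  interpret q: primeideal q R by (rule q(1))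
  have id: "ideal (ext q) A" by (rule ext_ideal[OF q.is_ideal])
  note iff = con_iff[OF id, unfolded con_ext[OF q]]
  have "\<one>\<^bsub>A\<^esub> \<notin> ext q" unfolding fr_one using iff[OF one_closed S(2)] q.I_notcarr q.one_imp_carrier by blast
  then show "carrier A \<noteq> ext q" by blast
  fix x y assume "x \<in> carrier A" "y \<in> carrier A" and xy: "x \<otimes>\<^bsub>A\<^esub> y \<in> ext q"
  then obtain a s b t where x: "a \<in> carrier R" "s \<in> S" "x = fr a s" and y: "b \<in> carrier R" "t \<in> S" "y = fr b t" by (meson frE)
  have "a \<otimes> b \<in> q" using xy iff[OF m_closed[OF x(1) y(1)] S(3)[OF x(2) y(2)]] unfolding x(3) y(3) fr_mult[OF x(1,2) y(1,2)] by blast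
  then show "x \<in> ext q \<or> y \<in> ext q" using q.I_prime[OF x(1) y(1)] iff[OF x(1,2)] iff[OF y(1,2)] x(3) y(3) by blast
qed

lemma A_noetherian: "noetherian_ring A"
proof (rule A.noetherian_ringI)
  fix I assume I: "ideal I A"
  obtain K where K: "K \<subseteq> carrier R" "finite K" "con I = Idl K" using finetely_gen[OF con_ideal[OF I]] by blast
  let ?K = "(\<lambda>a. fr a \<one>) ` K"
  have Kc: "?K \<subseteq> carrier A" using K(1) S(2) by (auto intro: fr_closed)
  have id: "ideal (Idl\<^bsub>A\<^esub> ?K) A" by (rule A.genideal_ideal[OF Kc])
  have "?K \<subseteq> I" using genideal_self[OF K(1)] K(3) unfolding con_def by blast
  then have 1: "Idl\<^bsub>A\<^esub> ?K \<subseteq> I" by (rule A.genideal_minimal[OF I])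
  have "K \<subseteq> con (Idl\<^bsub>A\<^esub> ?K)" using A.genideal_self[OF Kc] K(1) unfolding con_def by blast
  then have "con I \<subseteq> con (Idl\<^bsub>A\<^esub> ?K)" unfolding K(3) by (rule genideal_minimal[OF con_ideal[OF id]])
  then have "I = Idl\<^bsub>A\<^esub> ?K" using 1 con_mono[OF I id] by blast
  then show "\<exists>K\<subseteq>carrier A. finite K \<and> I = Idl\<^bsub>A\<^esub> K" using Kc K(2) by blast
qed

text \<open>An element outside \<open>p\<close> becomes a unit in the localisation.\<close>

lemma proper_le: assumes I: "ideal I A" "I \<noteq> carrier A" shows "I \<subseteq> ext p"
proof -
  interpret I: ideal I A by (rule I(1))
  have id: "ideal (ext p) A" by (rule ext_ideal[OF pp.is_ideal])
  have "a \<in> p" if "a \<in> con I" for a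
  proof (rule ccontr)
    assume n: "a \<notin> p"
    then have a: "a \<in> S" "fr a \<one> \<in> I" "a \<in> carrier R" using that unfolding con_def by auto
    have "fr \<one> a \<otimes>\<^bsub>A\<^esub> fr a \<one> = \<one>\<^bsub>A\<^esub>" unfolding fr_one fr_mult[OF one_closed a(1,3) S(2)] by (rule fr_eqI) (use a S in auto)
    then have "\<one>\<^bsub>A\<^esub> \<in> I" using I.I_l_closed[OF a(2) fr_closed[OF one_closed a(1)]] by simp
    then show False using I.one_imp_carrier I(2) by blast
  qed
  then show ?thesis using con_mono[OF I(1) id] con_ext[OF p] by blast
qed

lemma maximal_ideals: "{M. maximalideal M A} = {ext p}"
proof -
  have id: "ideal (ext p) A" by (rule ext_ideal[OF pp.is_ideal])
  have pr: "ext p \<noteq> carrier A" using primeideal.I_notcarr[OF ext_prime[OF p order_refl]] by blast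
  have "maximalideal (ext p) A" by (rule maximalidealI[OF id]) (use pr proper_le in blast)+
  moreover have "M = ext p" if "maximalideal M A" for M
  proof -
    interpret M: maximalideal M A by fact
    have "M \<subseteq> ext p" using proper_le[OF M.is_ideal] M.I_notcarr by blast
    then show ?thesis using M.I_maximal[OF id] pr additive_subgroup.a_subset[OF ideal.axioms(1)[OF id]] by blast
  qed
  ultimately show ?thesis by blast
qed

text \<open>The chain gives \<open>A\<close> dimension at least \<open>e\<close>, and
  \<open>G\<close> generates its maximal ideal with at most \<open>e\<close> elements. Regularity
  asks for a generating set whose size is exactly the dimension, so \<open>G\<close> is padded to
  that size inside the maximal ideal.\<close>

lemma regular_localI:
  assumes G: "G \<subseteq> p" "finite G" "\<forall>y\<in>p. \<exists>t\<in>S. t \<otimes> y \<in> Idl G" and e: "card G \<le> e" "prime_chain R e p"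
    and d: "krull_dim R = enat d"
  shows "regular_local_ring A"
proof -
  have id: "ideal (ext p) A" by (rule ext_ideal[OF pp.is_ideal])
  define Q where "Q n \<longleftrightarrow> (\<exists>P. (\<forall>i\<le>n. primeideal (P i) A) \<and> (\<forall>i<n. P i \<subset> P (Suc i)))" for n :: nat
  have kd: "krull_dim A = Sup {enat n | n. Q n}" unfolding krull_dim_def Q_def by simp
  have bd: "n \<le> d" if "Q n" for n
  proof -
    from that obtain P where P: "\<forall>i\<le>n. primeideal (P i) A" "\<forall>i<n. P i \<subset> P (Suc i)" unfolding Q_def by blast
    have idP: "ideal (P i) A" if "i \<le> n" for i using P(1) that primeideal.axioms(1) by blast
    have "(\<forall>i\<le>n. primeideal (con (P i)) R) \<and> (\<forall>i<n. con (P i) \<subset> con (P (Suc i)))"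
    proof (intro conjI allI impI)
      show "primeideal (con (P i)) R" if "i \<le> n" for i using P(1) that con_prime by blast
      show "con (P i) \<subset> con (P (Suc i))" if "i < n" for i
        using P(2) that con_mono[OF idP[of i] idP[of "Suc i"]] con_mono[OF idP[of "Suc i"] idP[of i]] by auto
    qed
    then have "enat n \<in> {enat n | n. \<exists>p. (\<forall>i\<le>n. primeideal (p i) R) \<and> (\<forall>i<n. p i \<subset> p (Suc i))}"
      by (intro CollectI exI[of _ n] conjI refl exI[of _ "\<lambda>i. con (P i)"]) auto
    then have "enat n \<le> krull_dim R" unfolding krull_dim_def by (rule Sup_upper)
    then show ?thesis unfolding d by simp
  qed
  have Qe: "Q e"
  proof -
    obtain P where P: "\<forall>i\<le>e. primeideal (P i) R" "\<forall>i<e. P i \<subset> P (Suc i)" "P e = p" using e(2) unfolding prime_chain_def by blast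
    have Pp: "P i \<subseteq> p" if "i \<le> e" for i
      using that P(2,3) by (induction i rule: inc_induct) auto
    show ?thesis unfolding Q_def
    proof (intro exI[of _ "\<lambda>i. ext (P i)"] conjI allI impI)
      show "primeideal (ext (P i)) A" if "i \<le> e" for i using ext_prime P(1) Pp that by blast
      show "ext (P i) \<subset> ext (P (Suc i))" if "i < e" for i
      proof -
        have pr: "primeideal (P i) R" "primeideal (P (Suc i)) R" "P i \<subseteq> p" "P (Suc i) \<subseteq> p" using P(1) Pp that by auto
        have "P i \<noteq> P (Suc i)" "P i \<subseteq> P (Suc i)" using P(2) that by auto
        moreover from this have "ext (P i) \<subseteq> ext (P (Suc i))" unfolding ext_def by blast
        moreover have "ext (P i) \<noteq> ext (P (Suc i))" using con_ext[OF pr(1,3)] con_ext[OF pr(2,4)] \<open>P i \<noteq> _\<close> by metis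
        ultimately show ?thesis by blast
      qed
    qed
  qed
  \<comment> \<open>The finite Krull dimension of \<open>R\<close> bounds the chains in
    \<open>A\<close>, so the supremum is attained.\<close>
  obtain n where n: "Q n" "\<And>k. Q k ==> k \<le> n" using Qe bd by (metis Nat.ex_has_greatest_nat)
  have kn: "krull_dim A = enat n" unfolding kd by (rule antisym[OF Sup_least Sup_upper]) (use n in auto)
  let ?G = "(\<lambda>a. fr a \<one>) ` G"
  have Gc: "G \<subseteq> carrier R" using G(1) pp.Icarr by blast
  have GA: "?G \<subseteq> carrier A" using Gc S(2) by (auto intro: fr_closed)
  have Gm: "?G \<subseteq> ext p" unfolding ext_def using G(1) S(2) by blast
  have cardG: "card ?G \<le> n" using card_image_le[OF G(2), of "\<lambda>a. fr a \<one>"] e(1) n(2)[OF Qe] by linarith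
  have le: "ext p \<subseteq> Idl\<^bsub>A\<^esub> ?G"
  proof -
    have id': "ideal (Idl\<^bsub>A\<^esub> ?G) A" by (rule A.genideal_ideal[OF GA])
    interpret J: ideal "con (Idl\<^bsub>A\<^esub> ?G)" R by (rule con_ideal[OF id'])
    have "G \<subseteq> con (Idl\<^bsub>A\<^esub> ?G)" using A.genideal_self[OF GA] Gc unfolding con_def by blast
    then have GJ: "Idl G \<subseteq> con (Idl\<^bsub>A\<^esub> ?G)" by (rule genideal_minimal[OF J.is_ideal])
    have "y \<in> con (Idl\<^bsub>A\<^esub> ?G)" if y: "y \<in> p" for y
    proof -
      obtain t where t: "t \<in> S" "t \<otimes> y \<in> con (Idl\<^bsub>A\<^esub> ?G)" using G(3) y GJ by blast
      have yc: "y \<in> carrier R" using y by (rule pp.Icarr)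
      have "fr (t \<otimes> y) t \<in> Idl\<^bsub>A\<^esub> ?G" using t con_iff[OF id', of "t \<otimes> y" t] yc by simp
      moreover have "fr (t \<otimes> y) t = fr y \<one>" using t yc S(2) by (intro fr_eqI) (auto simp: m_comm)
      ultimately show ?thesis using yc unfolding con_def by simp
    qed
    then show ?thesis using con_mono[OF id id'] con_ext[OF p] by blast
  qed
  \<comment> \<open>A stock of \<open>n\<close> distinct elements of the maximal ideal for the
    padding, one from each step of a longest chain of primes.\<close>
  obtain H where H: "finite H" "H \<subseteq> ext p" "card H = n"
  proof -
    obtain P where P: "\<forall>i\<le>n. primeideal (P i) A" "\<forall>i<n. P i \<subset> P (Suc i)" using n(1) unfolding Q_def by blast
    have mono: "P i \<subseteq> P j" if "i \<le> j" "j \<le> n" for i j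
      using that
    proof (induction j rule: dec_induct)
      case (step k)
      then show ?case using P(2)[rule_format, of k] by auto
    qed simp
    have "\<forall>i<n. \<exists>x. x \<in> P (Suc i) \<and> x \<notin> P i" using P(2) by blast
    then obtain x where x: "\<forall>i<n. x i \<in> P (Suc i) \<and> x i \<notin> P i" by metis
    have "x i \<noteq> x j" if ij: "i < j" "j < n" for i j
    proof -
      have "x i \<in> P j" using mono[of "Suc i" j] x[rule_format, of i] ij by auto
      then show ?thesis using x[rule_format, OF ij(2)] by auto
    qed
    then have "inj_on x {..<n}" by (intro inj_onI) (metis lessThan_iff nat_neq_iff)
    moreover have "x ` {..<n} \<subseteq> ext p"
    proof -
      have "P n \<subseteq> ext p" using P(1) by (intro proper_le) (auto dest: primeideal.axioms(1) primeideal.I_notcarr)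
      moreover have "x i \<in> P n" if "i < n" for i using x[rule_format, OF that] mono[of "Suc i" n] that by auto
      ultimately show ?thesis by blast
    qed
    ultimately show ?thesis using that[of "x ` {..<n}"] by (simp add: card_image)
  qed
  have "\<exists>B. ?G \<subseteq> B \<and> B \<subseteq> ?G \<union> H \<and> card B = n"
    using exists_subset_between[of ?G n "?G \<union> H"] cardG G(2) H card_mono[of "?G \<union> H" H] by auto
  then obtain B where B: "?G \<subseteq> B" "B \<subseteq> ?G \<union> H" "card B = n" by blast
  have Bm: "B \<subseteq> ext p" using B(2) H(2) Gm by blast
  have BA: "B \<subseteq> carrier A" using Bm additive_subgroup.a_subset[OF ideal.axioms(1)[OF id]] by blast
  have "Idl\<^bsub>A\<^esub> B \<subseteq> ext p" by (rule A.genideal_minimal[OF id Bm])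
  moreover have "Idl\<^bsub>A\<^esub> ?G \<subseteq> Idl\<^bsub>A\<^esub> B" by (rule A.genideal_minimal[OF A.genideal_ideal[OF BA]]) (use A.genideal_self[OF BA] B(1) in blast)
  ultimately have "ext p = Idl\<^bsub>A\<^esub> B" using le by blast
  moreover have "finite B" using B(2) G(2) H(1) finite_subset by blast
  moreover have "enat (card B) = krull_dim A" using B(3) kn by simp
  ultimately show ?thesis unfolding regular_local_ring_def
    by (intro conjI exI[of _ "ext p"] exI[of _ B] A_cring A_noetherian maximal_ideals BA)
qed

end

lemma (in noeth_cring) regular_ringI:
  fixes M :: "'a set \<Rightarrow> nat \<Rightarrow> ('a, 'm) module"
  assumes d: "krull_dim R = enat n"
    and res: "\<And>p. primeideal p R ==> \<exists>M r b \<phi> d N. min_res R p (M :: nat \<Rightarrow> ('a, 'm) module) r b \<phi> d \<and> r N = 0"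
  shows "regular_ring R"
  unfolding regular_ring_def
proof (intro conjI allI impI)
  fix p assume p: "primeideal p R"
  obtain M :: "nat \<Rightarrow> ('a, 'm) module" and r b \<phi> d N where m: "min_res R p M r b \<phi> d" and N: "r N = 0" using res[OF p] by (elim exE conjE) (rule that)
  interpret m: min_res R p M r b \<phi> d by (rule m)
  interpret l: local_at R p by (intro local_at.intro local_at_axioms.intro noeth_cring_axioms p)
  obtain G where G: "G \<subseteq> p" "finite G" "card G \<le> r (Suc 0)" "\<forall>y\<in>p. \<exists>t\<in>carrier R - p. t \<otimes> y \<in> Idl G" by (rule m.local_generators)
  show "regular_local_ring (localization R (carrier R - p))" by (rule l.regular_localI[OF G(1,2,4,3) m.prime_chain_rank[OF N] d])
next
  show "cring R" by (rule cring_axioms)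
  show "noetherian_ring R" by (rule noetherian_ring_axioms)
qed

section \<open>Roofs out of perfect complexes\<close>

text \<open>\<open>dummy\<close> fixes the type of module elements, which the parameter
  \<open>R\<close> does not mention.\<close>

locale derived = noeth_cring R for R (structure) +
  fixes dummy :: "'m itself"
  assumes inf: "infinite (UNIV :: 'm set)" and enc: "\<exists>\<iota> :: 'a \<Rightarrow> 'm. inj_on \<iota> (carrier R)"
begin

abbreviation "ch \<equiv> chain_maps R"
abbreviation "cx \<equiv> complexes R"
abbreviation "ht \<equiv> homotopic_maps R"

text \<open>These are precisely the quasi-isomorphisms.\<close>

definition hqi :: "('a, 'm) cpx \<Rightarrow> ('a, 'm) cpx \<Rightarrow> 'm cmap \<Rightarrow> bool" where
  "hqi X Y f \<longleftrightarrow> f \<in> ch X Y \<and> (\<forall>Q. perf_cpx R Q \<longrightarrow>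
     (\<forall>\<psi>\<in>ch Q Y. \<exists>\<phi>\<in>ch Q X. ht Q Y (f \<circ>\<^sub>c \<phi>) \<psi>) \<and>
     (\<forall>\<phi>\<in>ch Q X. \<forall>\<phi>'\<in>ch Q X. ht Q Y (f \<circ>\<^sub>c \<phi>) (f \<circ>\<^sub>c \<phi>') \<longrightarrow> ht Q X \<phi> \<phi>'))"

lemma hqiD:
  assumes "hqi X Y f"
  shows "f \<in> ch X Y"
    "perf_cpx R Q ==> \<psi> \<in> ch Q Y ==> \<exists>\<phi>\<in>ch Q X. ht Q Y (f \<circ>\<^sub>c \<phi>) \<psi>"
    "perf_cpx R Q ==> \<phi> \<in> ch Q X ==> \<phi>' \<in> ch Q X ==>
       ht Q Y (f \<circ>\<^sub>c \<phi>) (f \<circ>\<^sub>c \<phi>') ==> ht Q X \<phi> \<phi>'"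
  using assms unfolding hqi_def by blast+

text \<open>Existence of lifts is \<open>lift_through\<close>; uniqueness is
  \<open>lift_unique\<close> applied to the difference of the two maps.\<close>

lemma acyclic_cone_hqi:
  assumes C: "mcone R X Y f C \<phi>" and null: "\<And>Q. perf_cpx R Q ==> null_maps R Q C"
  shows "hqi X Y f"
proof -
  interpret C: mcone R X Y f C \<phi> by (rule C)
  have "\<exists>\<phi>\<in>ch Q X. ht Q Y (f \<circ>\<^sub>c \<phi>) \<psi>" if Q: "perf_cpx R Q" and \<psi>: "\<psi> \<in> ch Q Y" for Q \<psi>
    using C.lift_through[OF perfD(1)[OF Q] null[OF Q] \<psi>] ht_sym[OF C.Y perfD(1)[OF Q]] by metis
  moreover have "ht Q X a b" if Q: "perf_cpx R Q" and a: "a \<in> ch Q X" and b: "b \<in> ch Q X"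
    and H: "ht Q Y (f \<circ>\<^sub>c a) (f \<circ>\<^sub>c b)" for Q a b
  proof -
    note Qc = perfD(1)[OF Q]
    let ?d = "\<lambda>n x. a n x -[X$n] b n x"
    have dc: "?d \<in> ch Q X" by (rule chain_maps_diff[OF Qc C.X a b])
    note as = cmap_simps[OF Qc C.X a] and bs = cmap_simps[OF Qc C.X b]
    obtain h where h: "\<And>n. h n \<in> lin_maps R (Q$n) (Y$(n - 1))"
      "\<And>n x. x \<in> el Q n ==> f n (a n x) = f n (b n x) +[Y$n] (cdiff Y (n - 1) (h n x) +[Y$n] h (n + 1) (cdiff Q n x))"
      by (rule htE[OF C.Y Qc H, unfolded cmap_comp_def]) (rule that)
    note hs = lin_simps[OF cpxD(1)[OF Qc] C.Ym h(1)]
    have "ht Q Y (f \<circ>\<^sub>c ?d) (zmap Y)"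
    proof (rule nullI[OF C.Y Qc chain_maps_comp[OF dc C.f] h(1)])
      fix n x assume x: "x \<in> el Q n"
      interpret Yn: module R "Y$n" by (rule C.Ym)
      have c: "f n (b n x) \<in> el Y n" "cdiff Y (n - 1) (h n x) \<in> el Y n" "h (n + 1) (cdiff Q n x) \<in> el Y n"
        using as(1)[OF x] bs(1)[OF x] C.fs(1) C.dY(7)[OF hs(1)[OF x]] hs(1)[OF cpx_simps(1)[OF Qc x]] by auto
      have "(f \<circ>\<^sub>c ?d) n x = f n (a n x) -[Y$n] f n (b n x)" unfolding cmap_comp_def by (rule C.fs(6)[OF as(1)[OF x] bs(1)[OF x]])
      also have "\<dots> = cdiff Y (n - 1) (h n x) +[Y$n] h (n + 1) (cdiff Q n x)" unfolding h(2)[OF x] using c by algebra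
      finally show "(f \<circ>\<^sub>c ?d) n x = cdiff Y (n - 1) (h n x) +[Y$n] h (n + 1) (cdiff Q n x)" .
    qed
    note H0 = C.lift_unique[OF Qc null[OF shift_perf_cpx[OF Q]] dc this]
    obtain k where k: "\<And>n. k n \<in> lin_maps R (Q$n) (X$(n - 1))"
      "\<And>n x. x \<in> el Q n ==> ?d n x = cdiff X (n - 1) (k n x) +[X$n] k (n + 1) (cdiff Q n x)"
      by (rule nullE[OF C.X Qc H0]) (rule that)
    show ?thesis
    proof (rule htI[OF C.X Qc a b k(1)])
      fix n x assume x: "x \<in> el Q n"
      interpret Xn: module R "X$n" by (rule C.Xm)
      have "a n x = b n x +[X$n] ?d n x" using as(1)[OF x] bs(1)[OF x] by algebra
      then show "a n x = b n x +[X$n] (cdiff X (n - 1) (k n x) +[X$n] k (n + 1) (cdiff Q n x))" unfolding k(2)[OF x] .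
    qed
  qed
  ultimately show ?thesis unfolding hqi_def using C.f by blast
qed

lemma quasi_iso_hqi:
  assumes X: "X \<in> cx" and Y: "Y \<in> cx" and f: "f \<in> quasi_isos R X Y"
  shows "hqi X Y f"
proof -
  obtain C \<phi> where C: "mcone R X Y f C \<phi>" by (rule mcone_exists[OF inf X Y quasi_isosD[OF f]])
  interpret C: mcone R X Y f C \<phi> by (rule C)
  show ?thesis by (rule acyclic_cone_hqi[OF C null_maps_acyclic[OF _ cring_axioms C.C C.exact_of_quasi_iso[OF f]]])
qed

text \<open>\<open>Q\<close> is a copy of \<open>R\<close> in degree \<open>n\<close> with basis
  vector \<open>e\<close>: cocycles are the values at \<open>e\<close> of chain maps out of
  \<open>Q\<close>, and a map whose value is a coboundary is null-homotopic.\<close>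

lemma sphere:
  obtains Q :: "('a, 'm) cpx" and e l where "perf_cpx R Q" "e \<in> el Q n" "cdiff Q n e = 0[Q$(n + 1)]"
    "\<forall>X z. X \<in> cx \<longrightarrow> z \<in> cyc X n \<longrightarrow> l X z \<in> ch Q X \<and> l X z n e = z"
    "\<forall>X f y. X \<in> cx \<longrightarrow> f \<in> ch Q X \<longrightarrow> y \<in> el X (n - 1) \<longrightarrow> f n e = cdiff X (n - 1) y \<longrightarrow>
       ht Q X f (zmap X)"
proof -
  obtain \<iota> :: "'a \<Rightarrow> 'm" where \<iota>: "inj_on \<iota> (carrier R)" using enc by blast
  obtain M :: "('a, 'm) module" and b \<phi> where F: "free_mod R M 1 b \<phi>" by (rule free_mod_exists[OF inf \<iota>])
  interpret M: module R M by (rule free_modD(1)[OF F])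
  let ?Q = "desc n 0 (\<lambda>_. M) (\<lambda>_ x. x)"
  have P: "perf_cpx R ?Q" by (rule desc_perf) (auto intro: free_modD(6)[OF F])
  note Qc = perfD(1)[OF P]
  have m: "?Q$k = (if k = n then M else zmod)" for k by (auto simp: desc_def)
  have d: "cdiff ?Q k x = 0[?Q$(k + 1)]" for k x by (auto simp: desc_def)
  have b: "b 0 \<in> carrier M" using free_modD(2)[OF F] by simp
  have \<phi>l: "\<phi> 0 \<in> lin_maps R M (selfmod R)" using free_modD(3)[OF F] by simp
  have \<phi>b: "\<phi> 0 (b 0) = \<one>" using free_modD(5)[OF F, of 0 0] by simp
  have xb: "\<phi> 0 x *[M] b 0 = x" if "x \<in> carrier M" for x
    using free_modD(4)[OF F that] b free_mod_coord[OF F _ that, of 0] by simp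
  have mult: "(\<lambda>x. \<phi> 0 x *[N] z) \<in> lin_maps R M N" if N: "module R N" and z: "z \<in> carrier N" for N :: "('a, 'm) module" and z
  proof -
    interpret N: module R N by (rule N)
    note \<phi>s = lin_simps[OF M.module_axioms selfmod_module \<phi>l, simplified]
    show ?thesis by (rule lin_mapsI) (use z in \<open>simp_all add: \<phi>s N.smult_l_distr N.smult_assoc1\<close>)
  qed
  define l where "l X z = (\<lambda>k x. if k = n then \<phi> 0 x *[X$k] z else 0[X$k])" for X :: "('a, 'm) cpx" and z
  have "l X z \<in> ch ?Q X \<and> l X z n (b 0) = z" if X: "X \<in> cx" and z: "z \<in> cyc X n" for X z
  proof
    interpret Xn: module R "X$n" by (rule cpxD(1)[OF X])
    have zc: "z \<in> el X n" "cdiff X n z = 0[X$(n + 1)]" using z unfolding mem_cocycles by auto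
    show "l X z n (b 0) = z" unfolding l_def using zc by (simp add: \<phi>b)
    have ll: "l X z k \<in> lin_maps R (?Q$k) (X$k)" for k
      using mult[OF cpxD(1)[OF X] zc(1)] lin_maps_zero[OF cpxD(1)[OF Qc, of k] cpxD(1)[OF X, of k]] by (auto simp: l_def m)
    show "l X z \<in> ch ?Q X"
    proof (rule chain_mapsI[OF ll])
      fix k x assume x: "x \<in> el ?Q k"
      have "l X z (k + 1) (cdiff ?Q k x) = 0[X$(k + 1)]"
        unfolding d by (rule lin_simps(4)[OF cpxD(1)[OF Qc] cpxD(1)[OF X] ll])
      moreover have "cdiff X k (l X z k x) = 0[X$(k + 1)]"
      proof (cases "k = n")
        case True
        interpret X1: module R "X$(n + 1)" by (rule cpxD(1)[OF X])
        have "\<phi> 0 x \<in> carrier R" using x True free_mod_coord[OF F, of 0 x] by (simp add: m)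
        then show ?thesis using True zc by (simp add: l_def cpx_simps[OF X])
      qed (simp add: l_def cpx_simps[OF X])
      ultimately show "l X z (k + 1) (cdiff ?Q k x) = cdiff X k (l X z k x)" by simp
    qed
  qed
  moreover have "ht ?Q X f (zmap X)"
    if X: "X \<in> cx" and f: "f \<in> ch ?Q X" and y: "y \<in> el X (n - 1)" "f n (b 0) = cdiff X (n - 1) y" for X f y
  proof (rule nullI[OF X Qc f])
    note Xm = cpxD(1)[OF X] and fs = cmap_simps[OF Qc X f]
    define h where "h = (\<lambda>k x. if k = n then \<phi> 0 x *[X$(k - 1)] y else 0[X$(k - 1)])"
    show hl: "h k \<in> lin_maps R (?Q$k) (X$(k - 1))" for k
      using mult[OF Xm y(1)] lin_maps_zero[OF cpxD(1)[OF Qc, of k] Xm[of "k - 1"]] by (auto simp: h_def m)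
    fix k x assume x: "x \<in> el ?Q k"
    interpret Xk: module R "X$k" by (rule Xm)
    have h0: "h (k + 1) (cdiff ?Q k x) = 0[X$k]"
      unfolding d using lin_simps(4)[OF cpxD(1)[OF Qc] Xm hl[of "k + 1"]] by simp
    show "f k x = cdiff X (k - 1) (h k x) +[X$k] h (k + 1) (cdiff ?Q k x)"
    proof (cases "k = n")
      case True
      interpret Xn: module R "X$n" by (rule Xm)
      have xM: "x \<in> carrier M" using x True by (simp add: m)
      have c: "\<phi> 0 x \<in> carrier R" using free_mod_coord[OF F _ xM, of 0] by simp
      have "f n x = f n (\<phi> 0 x *[M] b 0)" by (simp add: xb[OF xM])
      also have "\<dots> = \<phi> 0 x *[X$n] f n (b 0)" using fs(3)[of "\<phi> 0 x" "b 0" n] c b by (simp add: m)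
      also have "\<dots> = cdiff X (n - 1) (h n x)" unfolding y(2) using c y(1) by (simp add: h_def cpx_simps[OF X])
      finally show ?thesis unfolding h0 using True fs(1)[OF x] by simp
    next
      case False
      then have "x = 0[?Q$k]" using x by (simp add: m)
      then show ?thesis unfolding h0 using False fs(4) by (simp add: h_def cpx_simps[OF X])
    qed
  qed
  ultimately show ?thesis using that[of ?Q "b 0" l] P b by (simp add: m d)
qed

text \<open>Homotopy classes of maps out of the sphere in degree \<open>n\<close> are the cohomology
  in degree \<open>n\<close>, so the two lifting properties become surjectivity and injectivity
  there.\<close>

lemma hqi_quasi_iso:
  assumes X: "X \<in> cx" and Y: "Y \<in> cx" and f: "hqi X Y f"
  shows "f \<in> quasi_isos R X Y"
  unfolding quasi_isos_iff[OF X Y hqiD(1)[OF f]]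
proof (intro allI conjI ballI impI)
  fix n
  obtain Q :: "('a, 'm) cpx" and e l where Q: "perf_cpx R Q" "e \<in> el Q n" "cdiff Q n e = 0[Q$(n + 1)]"
    and l: "\<forall>X z. X \<in> cx \<longrightarrow> z \<in> cyc X n \<longrightarrow> l X z \<in> ch Q X \<and> l X z n e = z"
    and z: "\<forall>X f y. X \<in> cx \<longrightarrow> f \<in> ch Q X \<longrightarrow> y \<in> el X (n - 1) \<longrightarrow> f n e = cdiff X (n - 1) y \<longrightarrow>
       ht Q X f (zmap X)" by (rule sphere)
  note Qc = perfD(1)[OF Q(1)] and fs = cmap_simps[OF X Y hqiD(1)[OF f]]
  have bd: "g n e -[X$n] g' n e \<in> bd X n" if X: "X \<in> cx" and H: "ht Q X g g'" for X g g'
  proof -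
    interpret Xn: module R "X$n" by (rule cpxD(1)[OF X])
    obtain h where h: "\<And>k. h k \<in> lin_maps R (Q$k) (X$(k - 1))"
      "\<And>k x. x \<in> el Q k ==> g k x = g' k x +[X$k] (cdiff X (k - 1) (h k x) +[X$k] h (k + 1) (cdiff Q k x))"
      by (rule htE[OF X Qc H]) (rule that)
    have hc: "h n e \<in> el X (n - 1)" using lin_simps(1)[OF cpxD(1)[OF Qc] cpxD(1)[OF X] h(1) Q(2)] .
    have "h (n + 1) (cdiff Q n e) = 0[X$n]"
      unfolding Q(3) using lin_simps(4)[OF cpxD(1)[OF Qc] cpxD(1)[OF X] h(1)[of "n + 1"]] by simp
    then have "g n e = g' n e +[X$n] cdiff X (n - 1) (h n e)" using h(2)[OF Q(2)] cpx_simps(7)[OF X hc] by simp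
    moreover have "g' n e \<in> el X n" using cmap_simps(1)[OF Qc X htD(2)[OF H] Q(2)] .
    ultimately have "g n e -[X$n] g' n e = cdiff X (n - 1) (h n e)" using cpx_simps(7)[OF X hc] by simp algebra
    then show ?thesis using hc unfolding mem_coboundaries by blast
  qed
  show "x \<in> bd X n" if x: "x \<in> cyc X n" "f n x \<in> bd Y n" for x
  proof -
    interpret Xn: module R "X$n" by (rule cpxD(1)[OF X])
    have g: "l X x \<in> ch Q X" "l X x n e = x" using l X x(1) by blast+
    have g0: "zmap X \<in> ch Q X" by (rule chain_maps_zero[OF Qc X])
    obtain y where y: "y \<in> el Y (n - 1)" "f n x = cdiff Y (n - 1) y" using x(2) unfolding mem_coboundaries by blast
    have "ht Q Y (f \<circ>\<^sub>c l X x) (zmap Y)"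
      using z Y chain_maps_comp[OF g(1) hqiD(1)[OF f]] y g(2) unfolding cmap_comp_def by metis
    moreover have "ht Q Y (zmap Y) (f \<circ>\<^sub>c zmap X)"
      by (rule ht_eqI[OF Y Qc chain_maps_zero[OF Qc Y]]) (simp add: cmap_comp_def zmap_def fs)
    ultimately have "ht Q X (l X x) (zmap X)"
      using hqiD(3)[OF f Q(1) g(1) g0] ht_trans[OF Y Qc] by blast
    from bd[OF X this] show ?thesis using x(1) g(2) unfolding zmap_def mem_cocycles by (simp add: a_minus_def)
  qed
  show "\<exists>x\<in>cyc X n. w -[Y$n] f n x \<in> bd Y n" if w: "w \<in> cyc Y n" for w
  proof -
    have g: "l Y w \<in> ch Q Y" "l Y w n e = w" using l Y w by blast+
    obtain g' where g': "g' \<in> ch Q X" "ht Q Y (f \<circ>\<^sub>c g') (l Y w)" using hqiD(2)[OF f Q(1) g(1)] by blast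
    have ec: "e \<in> cyc Q n" using Q(2,3) by (simp add: mem_cocycles)
    show ?thesis using chain_map_cocycle[OF Qc X g'(1) ec] bd[OF Y ht_sym[OF Y Qc g'(2)]] g(2) unfolding cmap_comp_def by auto
  qed
qed

lemma hqi_id: assumes X: "X \<in> cx" shows "hqi X X cmap_id"
  unfolding hqi_def using chain_maps_id[OF X] ht_refl[OF X perfD(1)] by auto

lemma quasi_isos_id: "X \<in> cx ==> cmap_id \<in> quasi_isos R X (X :: ('a, 'm) cpx)"
  by (rule hqi_quasi_iso[OF _ _ hqi_id])

lemma hqi_comp:
  assumes X: "X \<in> cx" and Y: "Y \<in> cx" and Z: "Z \<in> cx" and f: "hqi X Y f" and g: "hqi Y Z g"
  shows "hqi X Z (g \<circ>\<^sub>c f)"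
  unfolding hqi_def
proof (intro conjI allI impI ballI)
  show "g \<circ>\<^sub>c f \<in> ch X Z" using chain_maps_comp hqiD(1) f g by blast
  fix Q :: "('a, 'm) cpx" assume Q: "perf_cpx R Q"
  note Qc = perfD(1)[OF Q]
  show "\<exists>\<phi>\<in>ch Q X. ht Q Z ((g \<circ>\<^sub>c f) \<circ>\<^sub>c \<phi>) \<psi>" if \<psi>: "\<psi> \<in> ch Q Z" for \<psi>
  proof -
    obtain \<psi>' where \<psi>': "\<psi>' \<in> ch Q Y" "ht Q Z (g \<circ>\<^sub>c \<psi>') \<psi>" using hqiD(2)[OF g Q \<psi>] by blast
    obtain \<phi> where \<phi>: "\<phi> \<in> ch Q X" "ht Q Y (f \<circ>\<^sub>c \<phi>) \<psi>'" using hqiD(2)[OF f Q \<psi>'(1)] by blast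
    show ?thesis using \<phi>(1) ht_trans[OF Z Qc ht_comp_left[OF Qc Y Z \<phi>(2) hqiD(1)[OF g]] \<psi>'(2)]
      unfolding cmap_comp_assoc by blast
  qed
  show "ht Q X \<phi> \<phi>'" if \<phi>: "\<phi> \<in> ch Q X" "\<phi>' \<in> ch Q X"
    and H: "ht Q Z ((g \<circ>\<^sub>c f) \<circ>\<^sub>c \<phi>) ((g \<circ>\<^sub>c f) \<circ>\<^sub>c \<phi>')" for \<phi> \<phi>'
    using hqiD(3)[OF f Q \<phi>] hqiD(3)[OF g Q chain_maps_comp[OF \<phi>(1) hqiD(1)[OF f]] chain_maps_comp[OF \<phi>(2) hqiD(1)[OF f]]] H
    unfolding cmap_comp_assoc by blast
qed

text \<open>Two out of three, for a triangle that commutes only up to homotopy.\<close>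

lemma hqi_cancel:
  assumes X: "X \<in> cx" and Y: "Y \<in> cx" and Z: "Z \<in> cx"
    and s: "hqi Y Z s" and x: "hqi X Z x" and t: "t \<in> ch X Y" and H: "ht X Z (s \<circ>\<^sub>c t) x"
  shows "hqi X Y t"
  unfolding hqi_def
proof (intro conjI allI impI ballI)
  show "t \<in> ch X Y" by (rule t)
  fix Q :: "('a, 'm) cpx" assume Q: "perf_cpx R Q"
  note Qc = perfD(1)[OF Q]
  have Hc: "ht Q Z (s \<circ>\<^sub>c (t \<circ>\<^sub>c \<phi>)) (x \<circ>\<^sub>c \<phi>)" if "\<phi> \<in> ch Q X" for \<phi>
    using ht_comp_right[OF Qc X Z H that] unfolding cmap_comp_assoc .
  show "\<exists>\<phi>\<in>ch Q X. ht Q Y (t \<circ>\<^sub>c \<phi>) \<psi>" if \<psi>: "\<psi> \<in> ch Q Y" for \<psi>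
  proof -
    obtain \<phi> where \<phi>: "\<phi> \<in> ch Q X" "ht Q Z (x \<circ>\<^sub>c \<phi>) (s \<circ>\<^sub>c \<psi>)"
      using hqiD(2)[OF x Q chain_maps_comp[OF \<psi> hqiD(1)[OF s]]] by blast
    show ?thesis using \<phi>(1) hqiD(3)[OF s Q chain_maps_comp[OF \<phi>(1) t] \<psi> ht_trans[OF Z Qc Hc[OF \<phi>(1)] \<phi>(2)]] by blast
  qed
  show "ht Q X \<phi> \<phi>'" if \<phi>: "\<phi> \<in> ch Q X" "\<phi>' \<in> ch Q X"
    and Ht: "ht Q Y (t \<circ>\<^sub>c \<phi>) (t \<circ>\<^sub>c \<phi>')" for \<phi> \<phi>'
  proof (rule hqiD(3)[OF x Q \<phi>])
    note T = ht_trans[OF Z Qc]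
    show "ht Q Z (x \<circ>\<^sub>c \<phi>) (x \<circ>\<^sub>c \<phi>')"
      by (rule T[OF T[OF ht_sym[OF Z Qc Hc[OF \<phi>(1)]] ht_comp_left[OF Qc Y Z Ht hqiD(1)[OF s]]] Hc[OF \<phi>(2)]])
  qed
qed

section \<open>Roofs tested on maps out of strictly perfect complexes\<close>

lemma roofsD:
  assumes "(Z, s, f) \<in> roofs R X Y" and X: "X \<in> cx"
  shows "Z \<in> cx" "hqi Z X s" "f \<in> ch Z Y"
  using assms quasi_iso_hqi[OF _ X] unfolding roofs_def by auto

lemma roof_refl:
  fixes X Y :: "('a, 'm) cpx"
  assumes X: "X \<in> cx" and Y: "Y \<in> cx" and r: "\<rho> \<in> roofs R X Y" shows "\<rho> \<in> roof_class R X Y \<rho>"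
proof -
  obtain Z s f where \<rho>: "\<rho> = (Z, s, f)" by (cases \<rho>)
  have Z: "Z \<in> cx" "s \<in> quasi_isos R Z X" "f \<in> ch Z Y" using r unfolding \<rho> roofs_def by auto
  show ?thesis unfolding roof_class_def roof_rel_def \<rho> using r[unfolded \<rho>] Z chain_maps_id[OF Z(1)]
      ht_refl[OF X Z(1) quasi_isosD[OF Z(2)]] ht_refl[OF Y Z(1) Z(3)]
    by (auto intro!: bexI[of _ Z] bexI[of _ cmap_id])
qed

text \<open>A roof acts on maps from a strictly perfect \<open>Q\<close>: lift through
  \<open>s\<close>, then apply \<open>f\<close>. Factoring through the dominating complex
  \<open>W\<close> shows that equivalent roofs act in the same way.\<close>

lemma roof_rel_eq:
  fixes X Y :: "('a, 'm) cpx"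
  assumes X: "X \<in> cx" and Y: "Y \<in> cx" and r: "((Z, s, f), (Z', s', f')) \<in> roof_rel R X Y"
    and Q: "perf_cpx R Q" and \<phi>: "\<phi> \<in> ch Q Z" "\<phi>' \<in> ch Q Z'"
    and H: "ht Q X (s \<circ>\<^sub>c \<phi>) (s' \<circ>\<^sub>c \<phi>')"
  shows "ht Q Y (f \<circ>\<^sub>c \<phi>) (f' \<circ>\<^sub>c \<phi>')"
proof -
  note Qc = perfD(1)[OF Q]
  note TX = ht_trans[OF X Qc] and TY = ht_trans[OF Y Qc] and SX = ht_sym[OF X Qc] and SY = ht_sym[OF Y Qc]
  obtain W u v where "(Z, s, f) \<in> roofs R X Y" "(Z', s', f') \<in> roofs R X Y" and W: "W \<in> cx"
    and u: "u \<in> ch W Z" and v: "v \<in> ch W Z'"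
    and su: "s \<circ>\<^sub>c u \<in> quasi_isos R W X" and h: "ht W X (s \<circ>\<^sub>c u) (s' \<circ>\<^sub>c v)" "ht W Y (f \<circ>\<^sub>c u) (f' \<circ>\<^sub>c v)"
    using r unfolding roof_rel_def by blast
  note r1 = roofsD[OF this(1) X] and r2 = roofsD[OF this(2) X]
  have s\<phi>: "s \<circ>\<^sub>c \<phi> \<in> ch Q X" by (rule chain_maps_comp[OF \<phi>(1) hqiD(1)[OF r1(2)]])
  obtain w where w: "w \<in> ch Q W" "ht Q X ((s \<circ>\<^sub>c u) \<circ>\<^sub>c w) (s \<circ>\<^sub>c \<phi>)"
    using hqiD(2)[OF quasi_iso_hqi[OF W X su] Q s\<phi>] by blast
  have 1: "ht Q Z (u \<circ>\<^sub>c w) \<phi>"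
    by (rule hqiD(3)[OF r1(2) Q chain_maps_comp[OF w(1) u] \<phi>(1)]) (use w(2) in \<open>simp only: cmap_comp_assoc\<close>)
  have "ht Q X ((s' \<circ>\<^sub>c v) \<circ>\<^sub>c w) (s' \<circ>\<^sub>c \<phi>')"
    by (rule TX[OF SX[OF ht_comp_right[OF Qc W X h(1) w(1)]] TX[OF w(2) H]])
  then have 2: "ht Q Z' (v \<circ>\<^sub>c w) \<phi>'"
    by (intro hqiD(3)[OF r2(2) Q chain_maps_comp[OF w(1) v] \<phi>(2)]) (simp only: cmap_comp_assoc)
  have 3: "ht Q Y (f \<circ>\<^sub>c (u \<circ>\<^sub>c w)) (f' \<circ>\<^sub>c (v \<circ>\<^sub>c w))"
    using ht_comp_right[OF Qc W Y h(2) w(1)] unfolding cmap_comp_assoc .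
  show ?thesis
    by (rule TY[OF SY[OF ht_comp_left[OF Qc r1(1) Y 1 r1(3)]] TY[OF 3 ht_comp_left[OF Qc r2(1) Y 2 r2(3)]]])
qed

text \<open>Both roofs are compared with the representative \<open>\<rho>\<close> of the
  class.\<close>

lemma roof_class_eq:
  fixes X Y :: "('a, 'm) cpx"
  assumes X: "X \<in> cx" and Y: "Y \<in> cx" and \<rho>: "(Z, s, f) \<in> roof_class R X Y \<rho>" "(Z', s', f') \<in> roof_class R X Y \<rho>"
    and Q: "perf_cpx R Q" and \<phi>: "\<phi> \<in> ch Q Z" "\<phi>' \<in> ch Q Z'"
    and H: "ht Q X (s \<circ>\<^sub>c \<phi>) (s' \<circ>\<^sub>c \<phi>')"
  shows "ht Q Y (f \<circ>\<^sub>c \<phi>) (f' \<circ>\<^sub>c \<phi>')"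
proof -
  note Qc = perfD(1)[OF Q]
  obtain Z0 s0 f0 where "\<rho> = (Z0, s0, f0)" by (cases \<rho>)
  then have r: "((Z0, s0, f0), (Z, s, f)) \<in> roof_rel R X Y" "((Z0, s0, f0), (Z', s', f')) \<in> roof_rel R X Y"
    using \<rho> unfolding roof_class_def by auto
  then have "(Z0, s0, f0) \<in> roofs R X Y" "(Z, s, f) \<in> roofs R X Y" unfolding roof_rel_def by auto
  note r0 = roofsD[OF this(1) X] and r1 = roofsD[OF this(2) X]
  obtain w where w: "w \<in> ch Q Z0" "ht Q X (s0 \<circ>\<^sub>c w) (s \<circ>\<^sub>c \<phi>)"
    using hqiD(2)[OF r0(2) Q chain_maps_comp[OF \<phi>(1) hqiD(1)[OF r1(2)]]] by blast
  show ?thesis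
    by (rule ht_trans[OF Y Qc ht_sym[OF Y Qc roof_rel_eq[OF X Y r(1) Q w(1) \<phi>(1) w(2)]]
          roof_rel_eq[OF X Y r(2) Q w(1) \<phi>(2) ht_trans[OF X Qc w(2) H]]])
qed

lemma derived_homD:
  fixes X Y :: "('a, 'm) cpx"
  assumes X: "X \<in> cx" and Y: "Y \<in> cx" and \<Phi>: "\<Phi> \<in> derived_hom R X Y"
  obtains \<rho> where "\<Phi> = roof_class R X Y \<rho>" "\<rho> \<in> \<Phi>" "\<Phi> \<subseteq> roofs R X Y"
proof -
  obtain \<rho> where \<rho>: "\<Phi> = roof_rel R X Y `` {\<rho>}" "\<rho> \<in> roofs R X Y" using \<Phi> unfolding derived_hom_def by (auto elim: quotientE)
  then show ?thesis using that[of \<rho>] roof_refl[OF X Y \<rho>(2)] unfolding roof_class_def roof_rel_def by auto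
qed

text \<open>The identity roof occurs in the composite and provides one pair of representatives for
  which the claim holds; \<open>roof_class_eq\<close> carries it over to the given pair.\<close>

lemma derived_comp_id:
  fixes X Y :: "('a, 'm) cpx"
  assumes X: "X \<in> cx" and Y: "Y \<in> cx" and \<Phi>: "\<Phi> \<in> derived_hom R X Y" and \<Psi>: "\<Psi> \<in> derived_hom R Y X"
    and c: "derived_comp R X Y X \<Psi> \<Phi> = derived_map R X X cmap_id"
    and z: "(Z, s, f) \<in> \<Phi>" "(Z', t, g) \<in> \<Psi>" and Q: "perf_cpx R Q" and \<phi>: "\<phi> \<in> ch Q Z" "\<psi> \<in> ch Q Z'"
    and H: "ht Q Y (f \<circ>\<^sub>c \<phi>) (t \<circ>\<^sub>c \<psi>)"
  shows "ht Q X (s \<circ>\<^sub>c \<phi>) (g \<circ>\<^sub>c \<psi>)"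
proof -
  note Qc = perfD(1)[OF Q]
  note TX = ht_trans[OF X Qc] and TY = ht_trans[OF Y Qc] and SX = ht_sym[OF X Qc] and SY = ht_sym[OF Y Qc]
  obtain \<rho>1 where \<rho>1: "\<Phi> = roof_class R X Y \<rho>1" "\<Phi> \<subseteq> roofs R X Y" by (rule derived_homD[OF X Y \<Phi>])
  obtain \<rho>2 where \<rho>2: "\<Psi> = roof_class R Y X \<rho>2" "\<Psi> \<subseteq> roofs R Y X" by (rule derived_homD[OF Y X \<Psi>])
  have "(X, cmap_id, cmap_id) \<in> roofs R X X" unfolding roofs_def using X quasi_isos_id chain_maps_id by blast
  then have "(X, cmap_id, cmap_id) \<in> derived_comp R X Y X \<Psi> \<Phi>" unfolding c derived_map_def by (rule roof_refl[OF X X])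
  then obtain Z1 s1 f1 Z2 t2 g2 T q e where zz: "(Z1, s1, f1) \<in> \<Phi>" "(Z2, t2, g2) \<in> \<Psi>" and T: "T \<in> cx" "q \<in> quasi_isos R T Z1" "e \<in> ch T Z2"
    and h: "ht T Y (f1 \<circ>\<^sub>c q) (t2 \<circ>\<^sub>c e)" and rr: "(X, cmap_id, cmap_id) \<in> roof_class R X X (T, s1 \<circ>\<^sub>c q, g2 \<circ>\<^sub>c e)"
    unfolding derived_comp_def by blast
  have r: "(Z, s, f) \<in> roofs R X Y" "(Z1, s1, f1) \<in> roofs R X Y" "(Z', t, g) \<in> roofs R Y X" "(Z2, t2, g2) \<in> roofs R Y X"
    using z zz \<rho>1(2) \<rho>2(2) by blast+
  note r1 = roofsD[OF r(1) X] and r2 = roofsD[OF r(2) X] and r3 = roofsD[OF r(3) Y] and r4 = roofsD[OF r(4) Y]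
  note q = quasi_iso_hqi[OF T(1) r2(1) T(2)]
  have s\<phi>: "s \<circ>\<^sub>c \<phi> \<in> ch Q X" by (rule chain_maps_comp[OF \<phi>(1) hqiD(1)[OF r1(2)]])
  obtain \<theta> where \<theta>: "\<theta> \<in> ch Q T" "ht Q X ((s1 \<circ>\<^sub>c q) \<circ>\<^sub>c \<theta>) (s \<circ>\<^sub>c \<phi>)"
    using hqiD(2)[OF hqi_comp[OF T(1) r2(1) X q r2(2)] Q s\<phi>] by blast
  have q\<theta>: "q \<circ>\<^sub>c \<theta> \<in> ch Q Z1" and e\<theta>: "e \<circ>\<^sub>c \<theta> \<in> ch Q Z2"
    using chain_maps_comp[OF \<theta>(1)] hqiD(1)[OF q] T(3) by blast+
  have 1: "ht Q Y (f1 \<circ>\<^sub>c (q \<circ>\<^sub>c \<theta>)) (f \<circ>\<^sub>c \<phi>)"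
    by (rule roof_class_eq[OF X Y _ _ Q q\<theta> \<phi>(1)]) (use zz(1) z(1) \<rho>1(1) \<theta>(2) in \<open>simp_all add: cmap_comp_assoc\<close>)
  have 2: "ht Q Y (f1 \<circ>\<^sub>c (q \<circ>\<^sub>c \<theta>)) (t2 \<circ>\<^sub>c (e \<circ>\<^sub>c \<theta>))"
    using ht_comp_right[OF Qc T(1) Y h \<theta>(1)] unfolding cmap_comp_assoc .
  have 3: "ht Q X (g2 \<circ>\<^sub>c (e \<circ>\<^sub>c \<theta>)) (g \<circ>\<^sub>c \<psi>)"
    by (rule roof_class_eq[OF Y X _ _ Q e\<theta> \<phi>(2) TY[OF SY[OF 2] TY[OF 1 H]]]) (use zz(2) z(2) \<rho>2(1) in simp_all)
  have "((T, s1 \<circ>\<^sub>c q, g2 \<circ>\<^sub>c e), (X, cmap_id, cmap_id)) \<in> roof_rel R X X" using rr unfolding roof_class_def by simp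
  from roof_rel_eq[OF X X this Q \<theta>(1) s\<phi>] have "ht Q X (g2 \<circ>\<^sub>c (e \<circ>\<^sub>c \<theta>)) (s \<circ>\<^sub>c \<phi>)"
    using \<theta>(2) by (simp add: cmap_comp_assoc)
  from TX[OF SX[OF this] 3] show ?thesis .
qed

definition linked :: "('a, 'm) cpx \<Rightarrow> ('a, 'm) cpx \<Rightarrow> bool" where
  "linked X Y \<longleftrightarrow> (\<exists>Z s f. Z \<in> cx \<and> hqi Z X s \<and> hqi Z Y f)"

lemma linked_sym: "linked X Y ==> linked Y X"
  unfolding linked_def by blast

text \<open>The left leg of a roof is a quasi-isomorphism by definition. The roof of the inverse
  morphism inverts, on maps from strictly perfect complexes, the action of the right leg.\<close>

lemma isomorphic_linked:
  assumes X: "X \<in> cx" and Y: "Y \<in> cx" and i: "isomorphic (derived_cat R) X Y"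
  shows "linked X Y"
proof -
  obtain \<Phi> \<Psi> where \<Phi>: "\<Phi> \<in> derived_hom R X Y" and \<Psi>: "\<Psi> \<in> derived_hom R Y X"
    and c: "derived_comp R X Y X \<Psi> \<Phi> = derived_map R X X cmap_id" "derived_comp R Y X Y \<Phi> \<Psi> = derived_map R Y Y cmap_id"
    using i unfolding isomorphic_def isos_def derived_cat_def by auto
  obtain Z s f where z: "(Z, s, f) \<in> \<Phi>" "(Z, s, f) \<in> roofs R X Y" by (rule derived_homD[OF X Y \<Phi>]) (auto simp: subset_iff)
  obtain Z' t g where z': "(Z', t, g) \<in> \<Psi>" "(Z', t, g) \<in> roofs R Y X" by (rule derived_homD[OF Y X \<Psi>]) (auto simp: subset_iff)
  note r = roofsD[OF z(2) X] and r' = roofsD[OF z'(2) Y]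
  note cX = derived_comp_id[OF X Y \<Phi> \<Psi> c(1) z(1) z'(1)] and cY = derived_comp_id[OF Y X \<Psi> \<Phi> c(2) z'(1) z(1)]
  have "hqi Z Y f" unfolding hqi_def
  proof (intro conjI allI impI ballI r(3))
    fix Q :: "('a, 'm) cpx" assume Q: "perf_cpx R Q"
    note Qc = perfD(1)[OF Q]
    show "\<exists>\<phi>\<in>ch Q Z. ht Q Y (f \<circ>\<^sub>c \<phi>) \<psi>" if \<psi>: "\<psi> \<in> ch Q Y" for \<psi>
    proof -
      obtain \<psi>' where \<psi>': "\<psi>' \<in> ch Q Z'" "ht Q Y (t \<circ>\<^sub>c \<psi>') \<psi>" using hqiD(2)[OF r'(2) Q \<psi>] by blast
      obtain \<phi> where \<phi>: "\<phi> \<in> ch Q Z" "ht Q X (s \<circ>\<^sub>c \<phi>) (g \<circ>\<^sub>c \<psi>')"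
        using hqiD(2)[OF r(2) Q chain_maps_comp[OF \<psi>'(1) r'(3)]] by blast
      have "ht Q Y (t \<circ>\<^sub>c \<psi>') (f \<circ>\<^sub>c \<phi>)" by (rule cY[OF Q \<psi>'(1) \<phi>(1) ht_sym[OF X Qc \<phi>(2)]])
      then show ?thesis using \<phi>(1) \<psi>'(2) ht_trans[OF Y Qc] ht_sym[OF Y Qc] by blast
    qed
    show "ht Q Z \<phi> \<phi>'" if \<phi>: "\<phi> \<in> ch Q Z" "\<phi>' \<in> ch Q Z"
      and H: "ht Q Y (f \<circ>\<^sub>c \<phi>) (f \<circ>\<^sub>c \<phi>')" for \<phi> \<phi>'
    proof -
      obtain \<psi> where \<psi>: "\<psi> \<in> ch Q Z'" "ht Q Y (t \<circ>\<^sub>c \<psi>) (f \<circ>\<^sub>c \<phi>)"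
        using hqiD(2)[OF r'(2) Q chain_maps_comp[OF \<phi>(1) r(3)]] by blast
      note h1 = ht_sym[OF Y Qc \<psi>(2)] and h2 = ht_sym[OF Y Qc ht_trans[OF Y Qc \<psi>(2) H]]
      show ?thesis
        by (rule hqiD(3)[OF r(2) Q \<phi> ht_trans[OF X Qc cX[OF Q \<phi>(1) \<psi>(1) h1] ht_sym[OF X Qc cX[OF Q \<phi>(2) \<psi>(1) h2]]]])
    qed
  qed
  then show ?thesis unfolding linked_def using r by blast
qed

text \<open>The resolution \<open>x\<close> lifts to the top of the roof, where cancellation keeps
  it an equivalence, and is then composed with the other leg.\<close>

lemma linked_perf:
  assumes P: "perf_cpx R P" and X: "X \<in> cx" and Y: "Y \<in> cx" and x: "hqi P X x" and l: "linked X Y"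
  obtains y where "hqi P Y y"
proof -
  note Pc = perfD(1)[OF P]
  obtain Z s f where Z: "Z \<in> cx" "hqi Z X s" "hqi Z Y f" using l unfolding linked_def by blast
  obtain t where t: "t \<in> ch P Z" "ht P X (s \<circ>\<^sub>c t) x" using hqiD(2)[OF Z(2) P hqiD(1)[OF x]] by blast
  show ?thesis by (rule that[OF hqi_comp[OF Pc Z(1) Y hqi_cancel[OF Pc Z(1) X Z(2) x t] Z(3)]])
qed

lemma hqi_null_maps:
  assumes X: "X \<in> cx" and Y: "Y \<in> cx" and f: "hqi X Y f" and Q: "perf_cpx R Q"
  shows "null_maps R Q X \<longleftrightarrow> null_maps R Q Y"
proof -
  note Qc = perfD(1)[OF Q] and fc = hqiD(1)[OF f]
  note zX = chain_maps_zero[OF Qc X]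
  have z: "ht Q Y (f \<circ>\<^sub>c zmap X) (zmap Y)"
    by (rule ht_sym[OF Y Qc ht_eqI[OF Y Qc chain_maps_zero[OF Qc Y]]]) (simp add: cmap_comp_def zmap_def cmap_simps[OF X Y fc])
  show ?thesis
  proof
    assume n: "null_maps R Q X"
    show "null_maps R Q Y" unfolding null_maps_def
    proof
      fix \<psi> assume "\<psi> \<in> ch Q Y"
      then obtain \<phi> where \<phi>: "\<phi> \<in> ch Q X" "ht Q Y (f \<circ>\<^sub>c \<phi>) \<psi>" using hqiD(2)[OF f Q] by blast
      have "ht Q X \<phi> (zmap X)" using n \<phi>(1) unfolding null_maps_def by blast
      from ht_trans[OF Y Qc ht_trans[OF Y Qc ht_sym[OF Y Qc \<phi>(2)] ht_comp_left[OF Qc X Y this fc]] z]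
      show "ht Q Y \<psi> (zmap Y)" .
    qed
  next
    assume n: "null_maps R Q Y"
    show "null_maps R Q X" unfolding null_maps_def
    proof
      fix \<phi> assume \<phi>: "\<phi> \<in> ch Q X"
      have "ht Q Y (f \<circ>\<^sub>c \<phi>) (zmap Y)" using n chain_maps_comp[OF \<phi> fc] unfolding null_maps_def by blast
      from hqiD(3)[OF f Q \<phi> zX ht_trans[OF Y Qc this ht_sym[OF Y Qc z]]]
      show "ht Q X \<phi> (zmap X)" .
    qed
  qed
qed

lemma linked_null_maps:
  assumes X: "X \<in> cx" and Y: "Y \<in> cx" and l: "linked X Y" and Q: "perf_cpx R Q"
  shows "null_maps R Q X \<longleftrightarrow> null_maps R Q Y"
  using l hqi_null_maps[OF _ X _ Q] hqi_null_maps[OF _ Y _ Q] unfolding linked_def by blast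

text \<open>The left leg of a roof over \<open>F\<close> has a section up to homotopy, so
  \<open>F\<close> itself dominates two roofs that induce the same \<open>\<psi>\<close>. Roofs out
  of \<open>F\<close> thus amount to homotopy classes of chain maps.\<close>

lemma roof_class_perf:
  fixes F Y :: "('a, 'm) cpx"
  assumes F: "perf_cpx R F" and Y: "Y \<in> cx" and r: "(Z, s, f) \<in> roofs R F Y"
    and \<phi>: "\<phi> \<in> ch F Z" "ht F F (s \<circ>\<^sub>c \<phi>) cmap_id" "ht F Y (f \<circ>\<^sub>c \<phi>) \<psi>"
  shows "roof_class R F Y (Z, s, f) = {(Z', s', f') \<in> roofs R F Y. \<exists>\<phi>'\<in>ch F Z'.
     ht F F (s' \<circ>\<^sub>c \<phi>') cmap_id \<and> ht F Y (f' \<circ>\<^sub>c \<phi>') \<psi>}"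
proof -
  note Fc = perfD(1)[OF F]
  note TF = ht_trans[OF Fc Fc] and SF = ht_sym[OF Fc Fc] and TY = ht_trans[OF Y Fc] and SY = ht_sym[OF Y Fc]
  have "((Z, s, f), (Z', s', f')) \<in> roof_rel R F Y \<longleftrightarrow> (Z', s', f') \<in> roofs R F Y \<and> (\<exists>\<phi>'\<in>ch F Z'.
     ht F F (s' \<circ>\<^sub>c \<phi>') cmap_id \<and> ht F Y (f' \<circ>\<^sub>c \<phi>') \<psi>)" for Z' s' f'
  proof
    assume rel: "((Z, s, f), (Z', s', f')) \<in> roof_rel R F Y"
    then have r': "(Z', s', f') \<in> roofs R F Y" unfolding roof_rel_def by auto
    obtain \<phi>' where \<phi>': "\<phi>' \<in> ch F Z'" "ht F F (s' \<circ>\<^sub>c \<phi>') cmap_id"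
      using hqiD(2)[OF roofsD(2)[OF r' Fc] F chain_maps_id[OF Fc]] by blast
    have "ht F Y (f \<circ>\<^sub>c \<phi>) (f' \<circ>\<^sub>c \<phi>')" by (rule roof_rel_eq[OF Fc Y rel F \<phi>(1) \<phi>'(1) TF[OF \<phi>(2) SF[OF \<phi>'(2)]]])
    then show "(Z', s', f') \<in> roofs R F Y \<and> (\<exists>\<phi>'\<in>ch F Z'.
     ht F F (s' \<circ>\<^sub>c \<phi>') cmap_id \<and> ht F Y (f' \<circ>\<^sub>c \<phi>') \<psi>)" using r' \<phi>' TY[OF SY \<phi>(3)] by blast
  next
    assume a: "(Z', s', f') \<in> roofs R F Y \<and> (\<exists>\<phi>'\<in>ch F Z'.
     ht F F (s' \<circ>\<^sub>c \<phi>') cmap_id \<and> ht F Y (f' \<circ>\<^sub>c \<phi>') \<psi>)"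
    then obtain \<phi>' where \<phi>': "\<phi>' \<in> ch F Z'" "ht F F (s' \<circ>\<^sub>c \<phi>') cmap_id" "ht F Y (f' \<circ>\<^sub>c \<phi>') \<psi>" by blast
    have "s \<circ>\<^sub>c \<phi> \<in> quasi_isos R F F" by (rule hqi_quasi_iso[OF Fc Fc hqi_cancel[OF Fc Fc Fc hqi_id[OF Fc] hqi_id[OF Fc] chain_maps_comp[OF \<phi>(1) hqiD(1)[OF roofsD(2)[OF r Fc]]]]])
      (use \<phi>(2) in simp)
    then show "((Z, s, f), (Z', s', f')) \<in> roof_rel R F Y"
      unfolding roof_rel_def using r a Fc \<phi>(1) \<phi>'(1) TF[OF \<phi>(2) SF[OF \<phi>'(2)]] TY[OF \<phi>(3) SY[OF \<phi>'(3)]] by blast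
  qed
  then show ?thesis unfolding roof_class_def by auto
qed

text \<open>The composite is a union over all admissible squares. Each of them induces a map
  homotopic to \<open>b \<circ>\<^sub>c a\<close>, hence gives the class of the identity, and the
  evident square shows that the union is not empty.\<close>

lemma derived_comp_maps:
  fixes F G :: "('a, 'm) cpx"
  assumes F: "perf_cpx R F" and G: "perf_cpx R G" and a: "a \<in> ch F G" and b: "b \<in> ch G F"
    and ba: "ht F F (b \<circ>\<^sub>c a) cmap_id"
  shows "derived_comp R F G F (derived_map R G F b) (derived_map R F G a) = derived_map R F F cmap_id"
proof -
  note Fc = perfD(1)[OF F] and Gc = perfD(1)[OF G]
  note TF = ht_trans[OF Fc Fc] and SF = ht_sym[OF Fc Fc] and TG = ht_trans[OF Gc Fc] and SG = ht_sym[OF Gc Fc]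
  have ra: "(F, cmap_id, a) \<in> roofs R F G" and rb: "(G, cmap_id, b) \<in> roofs R G F" and ri: "(F, cmap_id, cmap_id) \<in> roofs R F F"
    unfolding roofs_def using Fc Gc a b quasi_isos_id chain_maps_id by blast+
  have ref: "ht F F cmap_id cmap_id" "ht G G cmap_id cmap_id" "ht F G a a" "ht G F b b"
    by (intro ht_refl Fc Gc a b chain_maps_id)+
  note ca = roof_class_perf[OF F Gc ra chain_maps_id[OF Fc], simplified, OF ref(1,3), folded derived_map_def]
  note cb = roof_class_perf[OF G Fc rb chain_maps_id[OF Gc], simplified, OF ref(2,4), folded derived_map_def]
  note ci = roof_class_perf[OF F Fc ri chain_maps_id[OF Fc], simplified, OF ref(1,1), folded derived_map_def]
  have one: "roof_class R F F (T, s \<circ>\<^sub>c q, g \<circ>\<^sub>c e) = derived_map R F F cmap_id"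
    if z: "(Z, s, f) \<in> derived_map R F G a" "(Z', t, g) \<in> derived_map R G F b" and T: "T \<in> cx" "q \<in> quasi_isos R T Z" "e \<in> ch T Z'"
      and h: "ht T G (f \<circ>\<^sub>c q) (t \<circ>\<^sub>c e)" for Z s f Z' t g T q e
  proof -
    obtain \<phi> where r: "(Z, s, f) \<in> roofs R F G" and \<phi>: "\<phi> \<in> ch F Z" "ht F F (s \<circ>\<^sub>c \<phi>) cmap_id" "ht F G (f \<circ>\<^sub>c \<phi>) a"
      using z(1) unfolding ca by blast
    obtain \<phi>' where r': "(Z', t, g) \<in> roofs R G F" and \<phi>': "\<phi>' \<in> ch G Z'" "ht G G (t \<circ>\<^sub>c \<phi>') cmap_id" "ht G F (g \<circ>\<^sub>c \<phi>') b"
      using z(2) unfolding cb by blast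
    note r = roofsD[OF r Fc] and r' = roofsD[OF r' Gc]
    note q = quasi_iso_hqi[OF T(1) r(1) T(2)]
    note sq = hqi_comp[OF T(1) r(1) Fc q r(2)]
    obtain \<theta> where \<theta>: "\<theta> \<in> ch F T" "ht F F ((s \<circ>\<^sub>c q) \<circ>\<^sub>c \<theta>) cmap_id" using hqiD(2)[OF sq F chain_maps_id[OF Fc]] by blast
    have q\<theta>: "q \<circ>\<^sub>c \<theta> \<in> ch F Z" and e\<theta>: "e \<circ>\<^sub>c \<theta> \<in> ch F Z'" and \<phi>a: "\<phi>' \<circ>\<^sub>c a \<in> ch F Z'"
      using chain_maps_comp[OF \<theta>(1)] chain_maps_comp[OF a] hqiD(1)[OF q] T(3) \<phi>'(1) by blast+
    have 1: "ht F Z (q \<circ>\<^sub>c \<theta>) \<phi>"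
      by (rule hqiD(3)[OF r(2) F q\<theta> \<phi>(1) TF[OF _ SF[OF \<phi>(2)]]]) (use \<theta>(2) in \<open>simp only: cmap_comp_assoc\<close>)
    have 2: "ht F G (f \<circ>\<^sub>c (q \<circ>\<^sub>c \<theta>)) (t \<circ>\<^sub>c (e \<circ>\<^sub>c \<theta>))"
      using ht_comp_right[OF Fc T(1) Gc h \<theta>(1)] unfolding cmap_comp_assoc .
    have 3: "ht F G (t \<circ>\<^sub>c (\<phi>' \<circ>\<^sub>c a)) a"
      using ht_comp_right[OF Fc Gc Gc \<phi>'(2) a] by (simp add: cmap_comp_assoc)
    have "ht F G (t \<circ>\<^sub>c (e \<circ>\<^sub>c \<theta>)) (t \<circ>\<^sub>c (\<phi>' \<circ>\<^sub>c a))"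
      by (rule TG[OF SG[OF 2] TG[OF ht_comp_left[OF Fc r(1) Gc 1 r(3)] TG[OF \<phi>(3) SG[OF 3]]]])
    then have 4: "ht F Z' (e \<circ>\<^sub>c \<theta>) (\<phi>' \<circ>\<^sub>c a)" by (rule hqiD(3)[OF r'(2) F e\<theta> \<phi>a])
    have 5: "ht F F (g \<circ>\<^sub>c (\<phi>' \<circ>\<^sub>c a)) (b \<circ>\<^sub>c a)"
      using ht_comp_right[OF Fc Gc Fc \<phi>'(3) a] unfolding cmap_comp_assoc .
    have 6: "ht F F ((g \<circ>\<^sub>c e) \<circ>\<^sub>c \<theta>) cmap_id"
      unfolding cmap_comp_assoc by (rule TF[OF ht_comp_left[OF Fc r'(1) Fc 4 r'(3)] TF[OF 5 ba]])
    have "(T, s \<circ>\<^sub>c q, g \<circ>\<^sub>c e) \<in> roofs R F F"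
      unfolding roofs_def using T(1) hqi_quasi_iso[OF T(1) Fc sq] chain_maps_comp[OF T(3) r'(3)] by blast
    from roof_class_perf[OF F Fc this \<theta> 6] show ?thesis unfolding ci .
  qed
  have "(F, cmap_id, a) \<in> derived_map R F G a" "(G, cmap_id, b) \<in> derived_map R G F b"
    unfolding derived_map_def using roof_refl[OF Fc Gc ra] roof_refl[OF Gc Fc rb] .
  moreover have "ht F G (a \<circ>\<^sub>c cmap_id) (cmap_id \<circ>\<^sub>c a)" using ref(3) by simp
  ultimately have "roof_class R F F (F, cmap_id \<circ>\<^sub>c cmap_id, b \<circ>\<^sub>c a) \<in> {roof_class R F F (T, s \<circ>\<^sub>c q, g \<circ>\<^sub>c e) | Z s f Z' t g T q e.
        (Z, s, f) \<in> derived_map R F G a \<and> (Z', t, g) \<in> derived_map R G F b \<and>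
        T \<in> cx \<and> q \<in> quasi_isos R T Z \<and> e \<in> ch T Z' \<and>
        ht T G (f \<circ>\<^sub>c q) (t \<circ>\<^sub>c e)}" using Fc a quasi_isos_id[OF Fc] by blast
  then have "{roof_class R F F (T, s \<circ>\<^sub>c q, g \<circ>\<^sub>c e) | Z s f Z' t g T q e.
        (Z, s, f) \<in> derived_map R F G a \<and> (Z', t, g) \<in> derived_map R G F b \<and>
        T \<in> cx \<and> q \<in> quasi_isos R T Z \<and> e \<in> ch T Z' \<and>
        ht T G (f \<circ>\<^sub>c q) (t \<circ>\<^sub>c e)} = {derived_map R F F cmap_id}" using one by blast
  then show ?thesis unfolding derived_comp_def by simp
qed

lemma isomorphic_perf:
  assumes F: "perf_cpx R F" and G: "perf_cpx R G" and a: "hqi F G a"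
  shows "isomorphic (derived_cat R) F G"
proof -
  note Fc = perfD(1)[OF F] and Gc = perfD(1)[OF G] and ac = hqiD(1)[OF a]
  obtain b where b: "b \<in> ch G F" "ht G G (a \<circ>\<^sub>c b) cmap_id" using hqiD(2)[OF a G chain_maps_id[OF Gc]] by blast
  have "ht F G (a \<circ>\<^sub>c (b \<circ>\<^sub>c a)) (a \<circ>\<^sub>c cmap_id)"
    using ht_comp_right[OF Fc Gc Gc b(2) ac] by (simp add: cmap_comp_assoc)
  then have ba: "ht F F (b \<circ>\<^sub>c a) cmap_id" by (rule hqiD(3)[OF a F chain_maps_comp[OF ac b(1)] chain_maps_id[OF Fc]])
  have "derived_map R F G a \<in> derived_hom R F G" "derived_map R G F b \<in> derived_hom R G F"
    unfolding derived_map_def derived_hom_def roof_class_def using Fc Gc ac b(1) quasi_isos_id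
    by (auto intro!: quotientI simp: roofs_def)
  then show ?thesis unfolding isomorphic_def isos_def derived_cat_def
    using derived_comp_maps[OF F G ac b(1) ba] derived_comp_maps[OF G F b(1) ac b(2)] by auto
qed

end

section \<open>t-structures on perfect complexes\<close>

text \<open>For odd \<open>j\<close> two signs cancel, but only on carriers; so the iterated shift
  and the shift by \<open>j + 1\<close> need not be equal as records.\<close>

lemma shift_shift:
  assumes P: "P \<in> complexes R"
  shows "(shift_cpx 1 (shift_cpx j P))$n = (shift_cpx (j + 1) P)$n"
    "x \<in> el (shift_cpx (j + 1) P) n ==> cdiff (shift_cpx 1 (shift_cpx j P)) n x = cdiff (shift_cpx (j + 1) P) n x"
proof -
  have e: "n + 1 + j = n + (j + 1)" "n + 1 + 1 + j = n + 1 + (j + 1)" by simp_all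
  show "(shift_cpx 1 (shift_cpx j P))$n = (shift_cpx (j + 1) P)$n" unfolding shift_cpx_simps e ..
  assume "x \<in> el (shift_cpx (j + 1) P) n"
  then have x: "x \<in> el P (n + (j + 1))" by simp
  interpret M: module R "P$(2 + (n + j))" by (rule cpxD(1)[OF P])
  have "n + (j + 1) + 1 = n + 1 + (j + 1)" by simp
  then have "cdiff P (n + (j + 1)) x \<in> el P (n + 1 + (j + 1))" using cpx_simps(1)[OF P x] by (simp only:)
  then show "cdiff (shift_cpx 1 (shift_cpx j P)) n x = cdiff (shift_cpx (j + 1) P) n x" unfolding shift_cpx_simps e by (cases "even j") simp_all
qed

lemma shift_zero: "shift_cpx 0 P = (P :: ('a, 'm) cpx)"
  by (simp add: shift_cpx_def)

lemma null_maps_source_cong: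
  assumes P: "P \<in> complexes R" and P': "P' \<in> complexes R" and C: "C \<in> complexes R" and null: "null_maps R P C"
    and e: "\<And>n. P'$n = P$n" "\<And>n x. x \<in> el P n ==> cdiff P' n x = cdiff P n x"
  shows "null_maps R P' C"
  unfolding null_maps_def
proof
  fix f assume f: "f \<in> chain_maps R P' C"
  have "f \<in> chain_maps R P C" by (rule chain_mapsI) (use chain_mapsD(1,2)[OF f] e in auto)
  then have H: "homotopic_maps R P C f (zmap C)" using null unfolding null_maps_def by blast
  obtain h where h: "\<And>n. h n \<in> lin_maps R (P$n) (C$(n - 1))"
    "\<And>n x. x \<in> el P n ==> f n x = cdiff C (n - 1) (h n x) +[C$n] h (n + 1) (cdiff P n x)"
    by (rule nullE[OF C P H]) (rule that)
  show "homotopic_maps R P' C f (zmap C)" by (rule nullI[OF C P' f]) (use h e in auto)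
qed

text \<open>Maps from \<open>P\<close> to the desuspension of \<open>Y\<close> are maps from the
  suspension of \<open>P\<close> to \<open>Y\<close> after renumbering; the homotopy changes its
  sign along with the differentials.\<close>

lemma null_maps_unshift:
  assumes P: "P \<in> complexes R" and Y: "Y \<in> complexes R" and null: "null_maps R (shift_cpx 1 P) Y"
  shows "null_maps R P (shift_cpx (-1) Y)"
  unfolding null_maps_def
proof
  fix g assume g: "g \<in> chain_maps R P (shift_cpx (-1) Y)"
  note P1 = shift_complexes[OF P, of 1] and Y1 = shift_complexes[OF Y, of "-1"]
  note gs = cmap_simps[OF P Y1 g] and dP = cpx_simps[OF P] and dY = cpx_simps[OF Y]
  define G where "G n = g (n + 1)" for n
  have G: "G \<in> chain_maps R (shift_cpx 1 P) Y"
  proof (rule chain_mapsI)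
    fix n show "G n \<in> lin_maps R ((shift_cpx 1 P)$n) (Y$n)" using chain_mapsD(1)[OF g, of "n + 1"] by (simp add: G_def)
    fix x assume "x \<in> el (shift_cpx 1 P) n"
    then have x: "x \<in> el P (n + 1)" by simp
    interpret Y1: module R "Y$(n + 1)" by (rule cpxD(1)[OF Y])
    have gx: "g (n + 1) x \<in> el Y n" using gs(1)[OF x] by simp
    have "G (n + 1) (cdiff (shift_cpx 1 P) n x) = -[Y$(n + 1)] g (n + 1 + 1) (cdiff P (n + 1) x)"
      using gs(5)[OF dP(1)[OF x]] by (simp add: G_def add.commute[of 1 n])
    also have "\<dots> = cdiff Y n (G n x)" using chain_mapsD(2)[OF g x] dY(1)[OF gx] by (simp add: G_def add.commute[of 1 n])
    finally show "G (n + 1) (cdiff (shift_cpx 1 P) n x) = cdiff Y n (G n x)" .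
  qed
  then have H: "homotopic_maps R (shift_cpx 1 P) Y G (zmap Y)" using null unfolding null_maps_def by blast
  obtain h where h: "\<And>n. h n \<in> lin_maps R ((shift_cpx 1 P)$n) (Y$(n - 1))"
    "\<And>n x. x \<in> el (shift_cpx 1 P) n ==> G n x = cdiff Y (n - 1) (h n x) +[Y$n] h (n + 1) (cdiff (shift_cpx 1 P) n x)"
    by (rule nullE[OF Y P1 H]) (rule that)
  have h': "h (n - 1) \<in> lin_maps R (P$n) (Y$(n - 2))" for n using h(1)[of "n - 1"] by simp
  note hs = lin_simps[OF cpxD(1)[OF P] cpxD(1)[OF Y] h']
  show "homotopic_maps R P (shift_cpx (-1) Y) g (zmap (shift_cpx (-1) Y))"
  proof (rule nullI[OF Y1 P g])
    fix n
    show "(\<lambda>x. -[Y$(n - 2)] h (n - 1) x) \<in> lin_maps R (P$n) ((shift_cpx (-1) Y)$(n - 1))"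
      using lin_maps_neg[OF cpxD(1)[OF P] cpxD(1)[OF Y] h'[of n]] by simp
    fix x assume x: "x \<in> el P n"
    interpret Y1: module R "Y$(n - 1)" by (rule cpxD(1)[OF Y])
    have dx: "cdiff P n x \<in> el P (n + 1)" by (rule dP(1)[OF x])
    have hd: "h n (cdiff P n x) \<in> el Y (n - 1)" using hs(1)[OF dx] by simp
    have hx: "h (n - 1) x \<in> el Y (n - 2)" by (rule hs(1)[OF x])
    have e: "n - 1 - 1 = n - 2" "n - 2 + 1 = n - 1" by simp_all
    have dh: "cdiff Y (n - 2) (h (n - 1) x) \<in> el Y (n - 1)" using dY(1)[OF hx] unfolding e .
    have "g n x = cdiff Y (n - 2) (h (n - 1) x) +[Y$(n - 1)] h n (-[P$(n + 1)] cdiff P n x)"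
      using h(2)[of x "n - 1"] x by (simp add: G_def)
    also have "h n (-[P$(n + 1)] cdiff P n x) = -[Y$(n - 1)] h n (cdiff P n x)" using hs(5)[OF dx] by simp
    finally show "g n x = cdiff (shift_cpx (-1) Y) (n - 1) (-[Y$(n - 2)] h (n - 1) x) +[(shift_cpx (-1) Y)$n]
        -[Y$(n + 1 - 2)] h (n + 1 - 1) (cdiff P n x)"
      using dY(5)[OF hx] dh hd by simp
  qed
qed

section \<open>Perfect complexes and their strictly perfect models\<close>

context derived begin

lemma shift_shift_iso:
  fixes P :: "('a, 'm) cpx"
  assumes P: "perf_cpx R P" shows "isomorphic (derived_cat R) (shift_cpx (j + 1) P) (shift_cpx 1 (shift_cpx j P))"
proof -
  let ?X = "shift_cpx (j + 1) P" and ?Y = "shift_cpx 1 (shift_cpx j P)"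
  note Pc = perfD(1)[OF P]
  note X = shift_complexes[OF Pc, of "j + 1"] and Y = shift_complexes[OF shift_complexes[OF Pc, of j], of 1]
  note e = shift_shift[OF Pc]
  have id: "cmap_id \<in> ch ?X ?Y"
    unfolding cmap_id_def by (rule chain_mapsI) (use lin_maps_id e in \<open>auto simp del: shift_cpx_simps\<close>)
  have "cmap_id \<in> quasi_isos R ?X ?Y"
    unfolding quasi_isos_iff[OF X Y id]
  proof (intro allI conjI ballI impI)
    fix n
    show "z \<in> bd ?X n" if "z \<in> cyc ?X n" "cmap_id n z \<in> bd ?Y n" for z
      using that(2) e unfolding mem_coboundaries cmap_id_def by (auto simp del: shift_cpx_simps)
    interpret M: module R "?Y$n" by (rule cpxD(1)[OF Y])
    show "\<exists>z\<in>cyc ?X n. w -[?Y$n] cmap_id n z \<in> bd ?Y n" if w: "w \<in> cyc ?Y n" for w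
    proof (rule bexI)
      show "w \<in> cyc ?X n" using w e unfolding mem_cocycles by (auto simp del: shift_cpx_simps)
      have "w \<in> el ?Y n" using w unfolding mem_cocycles by blast
      then show "w -[?Y$n] cmap_id n w \<in> bd ?Y n"
        using M.submoduleD(2)[OF coboundaries_submodule[OF Y]] by (simp add: cmap_id_def M.r_neg a_minus_def del: shift_cpx_simps)
    qed
  qed
  then show ?thesis using isomorphic_perf[OF shift_perf_cpx[OF P] shift_perf_cpx[OF shift_perf_cpx[OF P]] quasi_iso_hqi[OF X Y]] by blast
qed

lemma fgp_projective:
  fixes M :: "('a, 'm) module"
  assumes P: "fgp R M" shows "projective_module R M"
  unfolding projective_module_def
proof (intro conjI allI impI)
  show M: "module R M" using P by (simp add: fgp_def)
  fix A B :: "('a, 'm) module" and g h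
  assume a: "module R A \<and> module R B \<and> g \<in> lin_maps R A B \<and> g ` carrier A = carrier B \<and> h \<in> lin_maps R M B"
  then interpret B: module R B by blast
  have "h x \<in> sat R {\<one>} B (g ` carrier A)" if x: "x \<in> carrier M" for x
    using a lin_simps(1)[OF M B.module_axioms _ x, of h] unfolding sat_def by auto
  with a obtain t \<sigma> where t: "t \<in> {\<one>}" "\<sigma> \<in> lin_maps R M A" "\<And>x. x \<in> carrier M ==> g (\<sigma> x) = t *[B] h x"
    using fgp_lift[OF msys_one P B.module_axioms, of A h g] by metis
  then have "g (\<sigma> x) = h x" if x: "x \<in> carrier M" for x using a lin_simps(1)[OF M B.module_axioms _ x, of h] x by simp
  then show "\<exists>l\<in>lin_maps R M A. \<forall>x\<in>carrier M. g (l x) = h x" using t(2) by blast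
qed

text \<open>A free module covering \<open>M\<close> has a copy inside \<open>'m\<close> and is
  therefore among the test modules; a splitting of the cover provides the dual basis.\<close>

lemma projective_fgp:
  fixes M :: "('a, 'm) module"
  assumes fg: "fin_gen_module R M" and pr: "projective_module R M" shows "fgp R M"
proof -
  have M: "module R M" using pr unfolding projective_module_def by blast
  interpret M: module R M by (rule M)
  obtain G where G: "G \<subseteq> carrier M" "finite G" "\<And>N. submodule N R M ==> G \<subseteq> N ==> N = carrier M"
    using fg unfolding fin_gen_module_def by blast
  obtain xs where xs: "set xs = G" using finite_list[OF G(2)] by blast
  define r where "r = length xs"
  have g: "xs ! i \<in> carrier M" if "i < r" for i using that xs G(1) nth_mem unfolding r_def by blast
  obtain \<iota> :: "'a \<Rightarrow> 'm" where \<iota>: "inj_on \<iota> (carrier R)" using enc by blast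
  obtain N :: "('a, 'm) module" and b \<phi> where N: "free_mod R N r b \<phi>" by (rule free_mod_exists[OF inf \<iota>])
  interpret N: module R N by (rule free_modD(1)[OF N])
  define \<pi> where "\<pi> y = lc M (\<lambda>i. \<phi> i y) (\<lambda>i. xs ! i) r" for y
  have \<pi>: "\<pi> \<in> lin_maps R N M" unfolding \<pi>_def by (rule lc_lin_maps[OF N.module_axioms M free_modD(3)[OF N] g])
  note \<pi>s = lin_simps[OF N.module_axioms M \<pi>]
  have "submodule (\<pi> ` carrier N) R M"
  proof (rule M.submoduleI')
    show "0[M] \<in> \<pi> ` carrier N" using \<pi>s(4) N.M.zero_closed by (metis imageI)
    show "x +[M] y \<in> \<pi> ` carrier N" if "x \<in> \<pi> ` carrier N" "y \<in> \<pi> ` carrier N" for x y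
      using that \<pi>s(2) N.M.a_closed by (metis (no_types, lifting) imageE imageI)
    show "a *[M] x \<in> \<pi> ` carrier N" if "a \<in> carrier R" "x \<in> \<pi> ` carrier N" for a x
      using that \<pi>s(3) N.smult_closed by (metis (no_types, lifting) imageE imageI)
  qed (use \<pi>s(1) in auto)
  moreover have "G \<subseteq> \<pi> ` carrier N"
  proof
    fix x assume "x \<in> G"
    then obtain j where j: "j < r" "x = xs ! j" using xs unfolding r_def by (metis in_set_conv_nth)
    \<comment> \<open>The first summand is an empty combination, hence zero, times \<open>x\<close>;
      the second one evaluates the cover at \<open>b j\<close>.\<close>
    have "\<pi> (b j) = lc (selfmod R) (\<lambda>i. \<phi> i (b j)) (\<lambda>i. if i = j then \<one> else \<zero>) 0 *[M] x +[M] lc M (\<lambda>i. if j = i then \<one> else \<zero>) (\<lambda>i. xs ! i) r"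
    proof -
      have "\<pi> (b j) = lc M (\<lambda>i. if j = i then \<one> else \<zero>) (\<lambda>i. xs ! i) r"
        unfolding \<pi>_def using free_modD(5)[OF N _ j(1)] by (intro lc_cong) auto
      then show ?thesis using g j by simp
    qed
    also have "lc M (\<lambda>i. if j = i then \<one> else \<zero>) (\<lambda>i. xs ! i) n = (if j < n then x else 0[M])" if "n \<le> r" for n
      using that by (induction n) (use g j in \<open>auto simp: less_Suc_eq\<close>)
    finally have "\<pi> (b j) = x" using g j by simp
    then show "x \<in> \<pi> ` carrier N" using free_modD(2)[OF N j(1)] by blast
  qed
  ultimately have surj: "\<pi> ` carrier N = carrier M" by (rule G(3))
  obtain l where l: "l \<in> lin_maps R M N" "\<forall>x\<in>carrier M. \<pi> (l x) = x"
    using pr N.module_axioms M \<pi> surj lin_maps_id unfolding projective_module_def by blast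
  show ?thesis unfolding fgp_def
    by (intro conjI exI[of _ r] exI[of _ "\<lambda>i. xs ! i"] exI[of _ "\<lambda>i x. \<phi> i (l x)"] allI impI ballI M g)
      (use l(2) lin_maps_comp[OF l(1) free_modD(3)[OF N]] in \<open>auto simp: \<pi>_def\<close>)
qed

lemma perf_perfect:
  fixes F :: "('a, 'm) cpx"
  assumes F: "perf_cpx R F" shows "perfect_cpx R F"
  unfolding perfect_cpx_def
  using perfD[OF F] isomorphic_perf[OF F F hqi_id] fgp_fin_gen fgp_projective by blast

lemma perfect_perf:
  fixes X :: "('a, 'm) cpx"
  assumes "perfect_cpx R X"
  obtains P where "X \<in> cx" "perf_cpx R P" "isomorphic (derived_cat R) X P" "linked X P"
proof -
  obtain P where P: "X \<in> cx" "P \<in> cx" "bounded_cpx P" "isomorphic (derived_cat R) X P"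
    "\<forall>n. fin_gen_module R (P$n) \<and> projective_module R (P$n)"
    using assms unfolding perfect_cpx_def by blast
  have "perf_cpx R P" unfolding perf_cpx_def using P projective_fgp by blast
  then show ?thesis using that P isomorphic_linked[OF P(1,2,4)] by blast
qed

lemma perfect_resolution:
  fixes X :: "('a, 'm) cpx"
  assumes "perfect_cpx R X"
  obtains P x where "perf_cpx R P" "isomorphic (derived_cat R) X P" "hqi P X x"
proof -
  obtain P where P: "X \<in> cx" "perf_cpx R P" "isomorphic (derived_cat R) X P" "linked X P" by (rule perfect_perf[OF assms])
  note Pc = perfD(1)[OF P(2)]
  obtain x where "hqi P X x" by (rule linked_perf[OF P(2) Pc P(1) hqi_id[OF Pc] linked_sym[OF P(4)]])
  then show ?thesis using that P by blast
qed

text \<open>When any two roofs are equivalent the only class is the set of all roofs, which contains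
  the zero roof.\<close>

lemma unique_derived_hom:
  fixes X Y :: "('a, 'm) cpx"
  assumes X: "X \<in> cx" and Y: "Y \<in> cx"
    and rel: "\<And>Z s f Z' s' f'. (Z, s, f) \<in> roofs R X Y ==> (Z', s', f') \<in> roofs R X Y ==> ((Z, s, f), (Z', s', f')) \<in> roof_rel R X Y"
  shows "\<exists>!\<Phi>. \<Phi> \<in> derived_hom R X Y"
proof -
  have r0: "(X, cmap_id, zmap Y) \<in> roofs R X Y" unfolding roofs_def using X Y quasi_isos_id chain_maps_zero by blast
  have "roof_rel R X Y `` {\<rho>} = roofs R X Y" if "\<rho> \<in> roofs R X Y" for \<rho>
  proof
    show "roof_rel R X Y `` {\<rho>} \<subseteq> roofs R X Y" unfolding roof_rel_def by auto
    show "roofs R X Y \<subseteq> roof_rel R X Y `` {\<rho>}" using rel that by (cases \<rho>) auto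
  qed
  then have "derived_hom R X Y = {roofs R X Y}" unfolding derived_hom_def quotient_def using r0 by blast
  then show ?thesis by simp
qed

end

section \<open>From the t-structure to strictly perfect complexes\<close>

lemma Perf_simps [simp]:
  "Ob (Perf R) = {X. X \<in> complexes R \<and> perfect_cpx R X}" "Hom (Perf R) = derived_hom R" "Shf (Perf R) = shift_cpx"
  "Dist (Perf R) = derived_triangle R" "Zer (Perf R) X Y = derived_map R X Y (zmap Y)"
  "isomorphic (Perf R) = isomorphic (derived_cat R)"
  by (auto simp: Perf_def full_subcat_def derived_tricat_def derived_cat_def cat.defs zmap_def isomorphic_def isos_def fun_eq_iff)

lemma isomorphic_sym: "isomorphic C X Y ==> isomorphic C Y X"
  unfolding isomorphic_def isos_def by blast

locale aisle = derived R dummy for R (structure) and dummy :: "'m itself" +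
  fixes U V :: "('a, 'm) cpx set"
  assumes ts: "t_structure (Perf R) U V"
begin

lemma U_closed: "X \<in> U ==> perfect_cpx R Y ==> isomorphic (derived_cat R) X Y ==> Y \<in> U"
  using ts unfolding t_structure_def strict_subcat_def by (auto simp: perfect_cpx_def)

lemma U_perfect: "X \<in> U ==> perfect_cpx R X"
  using ts unfolding t_structure_def strict_subcat_def by auto

lemma V_complex: "X \<in> V ==> X \<in> cx"
  using ts unfolding t_structure_def strict_subcat_def by auto

definition UU where "UU = {P \<in> U. perf_cpx R P}"

text \<open>Shifts compose only up to isomorphism, so the induction passes through
  \<open>shift_shift_iso\<close> and the closure of the aisle under isomorphism.\<close>

lemma UU_shift:
  assumes P: "P \<in> UU" shows "shift_cpx (int j) P \<in> UU"
proof (induction j)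
  case 0 then show ?case using P by (simp add: shift_zero)
next
  case (Suc j)
  note Q = shift_perf_cpx[of R P "int j + 1"]
  have pP: "perf_cpx R P" using P by (simp add: UU_def)
  have "shift_cpx (int j + 1) P \<in> shift_subcat (Perf R) 1 U"
    unfolding shift_subcat_def using Suc shift_shift_iso[OF pP, of "int j"] perf_perfect[OF Q[OF pP]] perfD(1)[OF Q[OF pP]] by (auto simp: UU_def)
  then have "shift_cpx (int j + 1) P \<in> U" using ts unfolding t_structure_def by blast
  then show ?case using Q[OF pP] by (simp add: UU_def add.commute)
qed

text \<open>Every chain map from the suspension of \<open>P\<close> to \<open>Y\<close> is
  equivalent to zero as a roof; its source is strictly perfect, so it is null-homotopic.\<close>

lemma null_to_V:
  assumes P: "P \<in> UU" and Y: "Y \<in> V" shows "null_maps R P (shift_cpx (-1) Y)"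
proof -
  have pP: "P \<in> U" "perf_cpx R P" using P by (auto simp: UU_def)
  let ?Q = "shift_cpx 1 P"
  have Q: "perf_cpx R ?Q" by (rule shift_perf_cpx[OF pP(2)])
  note Qc = perfD(1)[OF Q] and Yc = V_complex[OF Y]
  have hom: "derived_hom R ?Q Y = {derived_map R ?Q Y (zmap Y)}" using ts pP(1) Y unfolding t_structure_def by simp
  have "ht ?Q Y g (zmap Y)" if g: "g \<in> ch ?Q Y" for g
  proof -
    have r: "(?Q, cmap_id, g) \<in> roofs R ?Q Y" "(?Q, cmap_id, zmap Y) \<in> roofs R ?Q Y"
      unfolding roofs_def using Qc g quasi_isos_id[OF Qc] chain_maps_zero[OF Qc Yc] by blast+
    have "roof_rel R ?Q Y `` {(?Q, cmap_id, g)} \<in> derived_hom R ?Q Y" unfolding derived_hom_def by (rule quotientI[OF r(1)])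
    then have "roof_class R ?Q Y (?Q, cmap_id, g) = derived_map R ?Q Y (zmap Y)" using hom unfolding roof_class_def by simp
    then have "(?Q, cmap_id, g) \<in> roof_class R ?Q Y (?Q, cmap_id, zmap Y)"
      using roof_refl[OF Qc Yc r(1)] unfolding derived_map_def by simp
    then have "((?Q, cmap_id, zmap Y), (?Q, cmap_id, g)) \<in> roof_rel R ?Q Y" unfolding roof_class_def by simp
    from roof_rel_eq[OF Qc Yc this Q chain_maps_id[OF Qc] chain_maps_id[OF Qc] ht_refl[OF Qc Qc], simplified, OF chain_maps_id[OF Qc]]
    show ?thesis by (rule ht_sym[OF Yc Qc])
  qed
  then have "null_maps R ?Q Y" unfolding null_maps_def by blast
  then show ?thesis by (rule null_maps_unshift[OF perfD(1)[OF pP(2)] Yc])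
qed

text \<open>The truncation triangle is known only up to isomorphism, as the cone of some map
  \<open>f\<close> between arbitrary complexes. Its source and target are replaced by strictly
  perfect \<open>A\<close> and \<open>F\<close>, and \<open>f\<close> by \<open>a\<close>, chosen so
  that \<open>y\<close> after \<open>a\<close> is homotopic to \<open>f\<close> after
  \<open>x\<close>. Comparing the two Hom sequences transfers orthogonality from \<open>C\<close> to
  the new cone.\<close>

lemma UU_orth:
  assumes F: "perf_cpx R F"
  shows "\<exists>A\<in>UU. \<exists>a C \<phi>. mcone R A F a C \<phi> \<and> (\<forall>P\<in>UU. orth R P C 0)"
proof -
  note Fc = perfD(1)[OF F]
  obtain A0 B u v w where A0: "A0 \<in> U" and B: "B \<in> shift_subcat (Perf R) (-1) V" and tr: "derived_triangle R A0 F B u v w"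
    using ts perf_perfect[OF F] Fc unfolding t_structure_def by auto
  obtain X' Y' f C i p where X': "X' \<in> cx" and Y': "Y' \<in> cx" and f: "f \<in> ch X' Y'"
    and mc: "mapping_cone R X' Y' f C i p" and iso: "isomorphic (derived_cat R) A0 X'" "isomorphic (derived_cat R) F Y'" "isomorphic (derived_cat R) B C"
    and Bc: "B \<in> cx" and A0c: "A0 \<in> cx"
    using tr unfolding derived_triangle_def isomorphic_def by blast
  obtain \<phi> where C: "mcone R X' Y' f C \<phi>" by (rule mapping_cone_mcone[OF X' Y' f mc])
  interpret C: mcone R X' Y' f C \<phi> by (rule C)
  obtain Y where Y: "Y \<in> V" "isomorphic (derived_cat R) B (shift_cpx (-1) Y)" using B unfolding shift_subcat_def by auto
  note Y1 = shift_complexes[OF V_complex[OF Y(1)], of "-1"]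
  have nullC: "null_maps R P C" if P: "P \<in> UU" for P
  proof -
    have pP: "perf_cpx R P" using P by (simp add: UU_def)
    show ?thesis using null_to_V[OF P Y(1)] linked_null_maps[OF Bc Y1 isomorphic_linked[OF Bc Y1 Y(2)] pP]
        linked_null_maps[OF Bc C.C isomorphic_linked[OF Bc C.C iso(3)] pP] by blast
  qed
  obtain A a0 where A: "perf_cpx R A" "isomorphic (derived_cat R) A0 A" "hqi A A0 a0" by (rule perfect_resolution[OF U_perfect[OF A0]])
  note Ac = perfD(1)[OF A(1)]
  have AU: "A \<in> UU" using U_closed[OF A0 perf_perfect[OF A(1)] A(2)] A(1) by (simp add: UU_def)
  obtain x where x: "hqi A X' x" by (rule linked_perf[OF A(1) A0c X' A(3) isomorphic_linked[OF A0c X' iso(1)]])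
  obtain y where y: "hqi F Y' y" by (rule linked_perf[OF F Fc Y' hqi_id[OF Fc] isomorphic_linked[OF Fc Y' iso(2)]])
  note xc = hqiD(1)[OF x] and yc = hqiD(1)[OF y]
  obtain a where a: "a \<in> ch A F" "ht A Y' (y \<circ>\<^sub>c a) (f \<circ>\<^sub>c x)" using hqiD(2)[OF y A(1) chain_maps_comp[OF xc f]] by blast
  obtain C1 \<phi>1 where C1: "mcone R A F a C1 \<phi>1" by (rule mcone_exists[OF inf Ac Fc a(1)])
  interpret C1: mcone R A F a C1 \<phi>1 by (rule C1)
  have "null_maps R P C1" if P: "P \<in> UU" for P
  proof -
    have pP: "perf_cpx R P" using P by (simp add: UU_def)
    note Pc = perfD(1)[OF pP]
    let ?Q = "shift_cpx (-1) P"
    have Q: "perf_cpx R ?Q" by (rule shift_perf_cpx[OF pP])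
    note Qc = perfD(1)[OF Q]
    have ya: "ht W Y' (y \<circ>\<^sub>c (a \<circ>\<^sub>c g)) (f \<circ>\<^sub>c (x \<circ>\<^sub>c g))" if "W \<in> cx" "g \<in> ch W A" for W g
      using ht_comp_right[OF that(1) Ac Y' a(2) that(2)] unfolding cmap_comp_assoc .
    show ?thesis
    \<comment> \<open>Injectivity and surjectivity for \<open>a\<close> come from
      \<open>lift_unique\<close> and \<open>lift_through\<close> for \<open>f\<close>, transported
      along \<open>x\<close> and \<open>y\<close>.\<close>
    proof (rule C1.null_into_cone[OF Pc Qc])
      show "?Q$n = P$(n - 1)" for n by simp
      show "cdiff ?Q n q = -[P$n] cdiff P (n - 1) q" for n q by simp
      show "ht ?Q A g (zmap A)" if g: "g \<in> ch ?Q A" and H: "ht ?Q F (a \<circ>\<^sub>c g) (zmap F)" for g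
      proof -
        note T = ht_trans[OF Y' Qc]
        have z: "ht ?Q Y' (y \<circ>\<^sub>c zmap F) (zmap Y')"
          by (rule ht_sym[OF Y' Qc ht_eqI[OF Y' Qc chain_maps_zero[OF Qc Y']]]) (simp add: cmap_comp_def zmap_def cmap_simps[OF Fc Y' yc])
        have 1: "ht ?Q Y' (f \<circ>\<^sub>c (x \<circ>\<^sub>c g)) (zmap Y')"
          by (rule T[OF ht_sym[OF Y' Qc ya[OF Qc g]] T[OF ht_comp_left[OF Qc Fc Y' H yc] z]])
        have "null_maps R (shift_cpx 1 ?Q) C"
          by (rule null_maps_source_cong[OF Pc shift_complexes[OF Qc] C.C nullC[OF P]])
            (use shift_shift[OF Pc, where j = "-1"] in \<open>simp_all add: shift_zero del: shift_cpx_simps\<close>)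
        from C.lift_unique[OF Qc this chain_maps_comp[OF g xc] 1]
        have 2: "ht ?Q X' (x \<circ>\<^sub>c g) (zmap X')" .
        have "ht ?Q X' (zmap X') (x \<circ>\<^sub>c zmap A)"
          by (rule ht_eqI[OF X' Qc chain_maps_zero[OF Qc X']]) (simp add: cmap_comp_def zmap_def cmap_simps[OF Ac X' xc])
        from hqiD(3)[OF x Q g chain_maps_zero[OF Qc Ac] ht_trans[OF X' Qc 2 this]] show ?thesis .
      qed
      show "\<exists>g\<in>ch P A. ht P F h (a \<circ>\<^sub>c g)" if h: "h \<in> ch P F" for h
      proof -
        note T = ht_trans[OF Y' Pc] and S = ht_sym[OF Y' Pc]
        obtain k where k: "k \<in> ch P X'" "ht P Y' (y \<circ>\<^sub>c h) (f \<circ>\<^sub>c k)"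
          using C.lift_through[OF Pc nullC[OF P] chain_maps_comp[OF h yc]] by blast
        obtain g where g: "g \<in> ch P A" "ht P X' (x \<circ>\<^sub>c g) k" using hqiD(2)[OF x pP k(1)] by blast
        have "ht P Y' (y \<circ>\<^sub>c h) (y \<circ>\<^sub>c (a \<circ>\<^sub>c g))"
          by (rule T[OF k(2) T[OF S[OF ht_comp_left[OF Pc X' Y' g(2) f]] S[OF ya[OF Pc g(1)]]]])
        from hqiD(3)[OF y pP h chain_maps_comp[OF g(1) a(1)] this] show ?thesis using g(1) by blast
      qed
    qed
  qed
  then have "orth R P C1 0" if "P \<in> UU" for P
    unfolding orth_def using UU_shift[OF that] by (metis zero_le_imp_eq_int)
  then show ?thesis using AU C1 by blast
qed

text \<open>\<open>X\<close> has an acyclic strictly perfect model \<open>P\<close>, so maps from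
  strictly perfect complexes into it are all homotopic. Two roofs out of \<open>X\<close> are
  dominated by zero maps from \<open>P\<close>, and two roofs into \<open>X\<close> by a resolution
  of their source.\<close>

lemma zero_objects:
  assumes ex: "\<And>P s. P \<in> UU ==> exact_at R {\<one>} P s" and X: "X \<in> U"
  shows "zero_object (Perf R) X"
proof -
  have pX: "perfect_cpx R X" by (rule U_perfect[OF X])
  obtain P x where P: "perf_cpx R P" "isomorphic (derived_cat R) X P" "hqi P X x" by (rule perfect_resolution[OF pX])
  note Pc = perfD(1)[OF P(1)]
  have Xc: "X \<in> cx" using pX by (simp add: perfect_cpx_def)
  have PU: "P \<in> UU" using U_closed[OF X perf_perfect[OF P(1)] P(2)] P(1) by (simp add: UU_def)
  have nullP: "null_maps R Q P" if "perf_cpx R Q" for Q by (rule null_maps_acyclic[OF that cring_axioms Pc ex[OF PU]])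
  have nullX: "null_maps R Q X" if "perf_cpx R Q" for Q using nullP[OF that] hqi_null_maps[OF Pc Xc P(3) that] by blast
  have nX: "ht Q X f g" if "perf_cpx R Q" "f \<in> ch Q X" "g \<in> ch Q X" for Q f g
    using nullX[OF that(1)] that ht_trans[OF Xc perfD(1)[OF that(1)]] ht_sym[OF Xc perfD(1)[OF that(1)]]
    unfolding null_maps_def by blast
  have hqiPX: "hqi P X g" if g: "g \<in> ch P X" for g
    by (rule hqi_cancel[OF Pc Xc Xc hqi_id[OF Xc] P(3) g]) (use nX[OF P(1) g hqiD(1)[OF P(3)]] in simp)
  have "\<exists>!\<Phi>. \<Phi> \<in> derived_hom R X Y" if Yc: "Y \<in> cx" for Y
  proof (rule unique_derived_hom[OF Xc Yc])
    fix Z s f Z' s' f' assume r: "(Z, s, f) \<in> roofs R X Y" "(Z', s', f') \<in> roofs R X Y"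
    note r1 = roofsD[OF r(1) Xc] and r2 = roofsD[OF r(2) Xc]
    have u: "zmap Z \<in> ch P Z" "zmap Z' \<in> ch P Z'" using chain_maps_zero[OF Pc] r1(1) r2(1) by blast+
    have su: "s \<circ>\<^sub>c zmap Z \<in> ch P X" "s' \<circ>\<^sub>c zmap Z' \<in> ch P X"
      using chain_maps_comp[OF u(1) hqiD(1)[OF r1(2)]] chain_maps_comp[OF u(2) hqiD(1)[OF r2(2)]] .
    have "ht P Y (f \<circ>\<^sub>c zmap Z) (f' \<circ>\<^sub>c zmap Z')"
      by (rule ht_eqI[OF Yc Pc chain_maps_comp[OF u(1) r1(3)]])
        (simp add: cmap_comp_def zmap_def cmap_simps[OF r1(1) Yc r1(3)] cmap_simps[OF r2(1) Yc r2(3)])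
    then show "((Z, s, f), (Z', s', f')) \<in> roof_rel R X Y"
      unfolding roof_rel_def using r Pc u hqi_quasi_iso[OF Pc Xc hqiPX[OF su(1)]] nX[OF P(1) su] by blast
  qed
  moreover have "\<exists>!\<Phi>. \<Phi> \<in> derived_hom R Y X" if pY: "perfect_cpx R Y" for Y
  proof -
    have Yc: "Y \<in> cx" using pY by (simp add: perfect_cpx_def)
    obtain Q y where Q: "perf_cpx R Q" "hqi Q Y y" by (rule perfect_resolution[OF pY])
    note Qc = perfD(1)[OF Q(1)]
    show ?thesis
    proof (rule unique_derived_hom[OF Yc Xc])
      fix Z s f Z' s' f' assume r: "(Z, s, f) \<in> roofs R Y X" "(Z', s', f') \<in> roofs R Y X"
      note r1 = roofsD[OF r(1) Yc] and r2 = roofsD[OF r(2) Yc]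
      obtain u where u: "u \<in> ch Q Z" "ht Q Y (s \<circ>\<^sub>c u) y" using hqiD(2)[OF r1(2) Q(1) hqiD(1)[OF Q(2)]] by blast
      obtain v where v: "v \<in> ch Q Z'" "ht Q Y (s' \<circ>\<^sub>c v) y" using hqiD(2)[OF r2(2) Q(1) hqiD(1)[OF Q(2)]] by blast
      have "hqi Q Y (s \<circ>\<^sub>c u)"
        by (rule hqi_cancel[OF Qc Yc Yc hqi_id[OF Yc] Q(2) chain_maps_comp[OF u(1) hqiD(1)[OF r1(2)]]]) (use u(2) in simp)
      then show "((Z, s, f), (Z', s', f')) \<in> roof_rel R Y X"
        unfolding roof_rel_def using r Qc u(1) v(1) hqi_quasi_iso[OF Qc Yc] ht_trans[OF Yc Qc u(2) ht_sym[OF Yc Qc v(2)]]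
          nX[OF Q(1) chain_maps_comp[OF u(1) r1(3)] chain_maps_comp[OF v(1) r2(3)]] by blast
    qed
  qed
  ultimately show ?thesis unfolding zero_object_def using Xc pX by simp
qed

text \<open>The truncation of a strictly perfect \<open>F\<close> has an acyclic cone, so
  \<open>F\<close> is isomorphic to its part \<open>A\<close> in the aisle.\<close>

lemma whole:
  assumes ex: "\<And>C k. perf_cpx R C ==> \<forall>P\<in>UU. orth R P C 0 ==> exact_at R {\<one>} C k"
  shows "U = Ob (Perf R)"
proof
  show "U \<subseteq> Ob (Perf R)" using U_perfect by (auto simp: perfect_cpx_def)
  show "Ob (Perf R) \<subseteq> U"
  proof
    fix X :: "('a, 'm) cpx" assume "X \<in> Ob (Perf R)"
    then have pX: "perfect_cpx R X" by simp
    obtain F x where F: "perf_cpx R F" "isomorphic (derived_cat R) X F" "hqi F X x" by (rule perfect_resolution[OF pX])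
    obtain A a C \<phi> where A: "A \<in> UU" "mcone R A F a C \<phi>" "\<forall>P\<in>UU. orth R P C 0" using UU_orth[OF F(1)] by blast
    interpret C: mcone R A F a C \<phi> by (rule A(2))
    have pA: "perf_cpx R A" "A \<in> U" using A(1) by (auto simp: UU_def)
    have "hqi A F a"
      by (rule acyclic_cone_hqi[OF A(2) null_maps_acyclic[OF _ cring_axioms C.C ex[OF C.perf_cone[OF pA(1) F(1)] A(3)]]])
    then have "F \<in> U" by (rule U_closed[OF pA(2) perf_perfect[OF F(1)] isomorphic_perf[OF pA(1) F(1)]])
    then show "X \<in> U" by (rule U_closed[OF _ pX isomorphic_sym[OF F(2)]])
  qed
qed

end

text \<open>The intersection of all primes works: if it contains \<open>a \<otimes> b\<close>, the
  closed sets of \<open>a\<close> and of \<open>b\<close> cover the spectrum, and irreducibility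
  makes one of them everything.\<close>

lemma (in cring) irreducible_minimal_prime:
  assumes irr: "irreducible_space (Spec R)"
  obtains \<eta> where "primeideal \<eta> R" "\<forall>q. primeideal q R \<longrightarrow> \<eta> \<subseteq> q"
proof
  have op: "openin (Spec R) W \<longleftrightarrow> zariski_open R W" for W
    unfolding Spec_def using topology_inverse'[OF istopology_zariski_open[OF cring_axioms]] by metis
  let ?P = "prime_spectrum R"
  have "zariski_open R ?P" unfolding zariski_open_def
  proof (intro exI[of _ "{\<one>}"] conjI)
    have "\<one> \<notin> P" if "primeideal P R" for P
    proof -
      interpret P: primeideal P R by fact
      show ?thesis using P.I_notcarr P.one_imp_carrier by blast
    qed
    then show "?P = {P \<in> ?P. \<not> {\<one>} \<subseteq> P}" unfolding prime_spectrum_def by auto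
  qed simp
  moreover have "W \<subseteq> ?P" if "zariski_open R W" for W using that unfolding zariski_open_def by blast
  ultimately have top: "topspace (Spec R) = ?P" unfolding topspace_def op by blast
  have ne: "?P \<noteq> {}" using irr unfolding irreducible_space_def top by blast
  let ?N = "\<Inter>?P"
  show "\<forall>q. primeideal q R \<longrightarrow> ?N \<subseteq> q" unfolding prime_spectrum_def by blast
  show "primeideal ?N R"
  proof (rule primeidealI)
    show "ideal ?N R" by (rule i_Intersect[OF _ ne]) (simp add: prime_spectrum_def primeideal.axioms(1))
    obtain P where P: "primeideal P R" using ne unfolding prime_spectrum_def by blast
    interpret P: primeideal P R by (rule P)
    show "carrier R \<noteq> ?N" using P P.I_notcarr additive_subgroup.a_subset[OF P.is_additive_subgroup] unfolding prime_spectrum_def by blast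
    fix a b assume ab: "a \<in> carrier R" "b \<in> carrier R" "a \<otimes> b \<in> ?N"
    let ?V = "\<lambda>c. {P \<in> ?P. c \<in> P}"
    have cl: "closedin (Spec R) (?V c)" if "c \<in> carrier R" for c
      unfolding closedin_def top op zariski_open_def using that by (auto intro!: exI[of _ "{c}"])
    have "?V a \<union> ?V b = ?P" using ab primeideal.I_prime[of _ R a b] unfolding prime_spectrum_def by blast
    then have "?V a = ?P \<or> ?V b = ?P" using irr cl[OF ab(1)] cl[OF ab(2)] unfolding irreducible_space_def top by blast
    then show "a \<in> ?N \<or> b \<in> ?N" by blast
  qed (rule cring_axioms)
qed

theorem theorem1p3:
  fixes R :: "('a, 'r) ring_scheme"
    and d :: nat
    and U V :: "('a, 'm) cpx set"
  assumes "cring R" and "noetherian_ring R"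
    and "krull_dim R = enat d"
    and "\<not> regular_ring R"
    and "irreducible_space (Spec R)"
    and "infinite (UNIV :: 'm set)" and "\<exists>\<iota> :: 'a \<Rightarrow> 'm. inj_on \<iota> (carrier R)"
    and "t_structure (Perf R) U V"
  shows "(\<forall>X\<in>U. zero_object (Perf R) X) \<or> U = Ob (Perf R)"
proof -
  interpret noeth_cring R by (intro noeth_cring.intro assms)
  interpret D: aisle R "TYPE('m)" U V
    by (intro aisle.intro derived.intro derived_axioms.intro aisle_axioms.intro noeth_cring_axioms assms)
  obtain \<eta> where \<eta>: "primeideal \<eta> R" "\<forall>q. primeideal q R \<longrightarrow> \<eta> \<subseteq> q" by (rule irreducible_minimal_prime[OF assms(5)])
  interpret T: truncation R D.UU \<eta>
  proof (intro truncation.intro truncation_axioms.intro noeth_cring_axioms assms(6,7) \<eta>(1))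
    show "P \<in> D.UU ==> perf_cpx R P" for P by (simp add: D.UU_def)
    show "perf_cpx R F ==> \<exists>A\<in>D.UU. \<exists>a C \<phi>. mcone R A F a C \<phi> \<and> (\<forall>P\<in>D.UU. orth R P C 0)" for F by (rule D.UU_orth)
    show "primeideal q R ==> \<eta> \<subseteq> q" for q using \<eta>(2) by blast
  qed
  let ?Q = "\<lambda>s. \<exists>P\<in>D.UU. \<not> exact_at R (carrier R - \<eta>) P s"
  \<comment> \<open>The degrees with cohomology of the aisle at \<open>\<eta>\<close>: none,
    unbounded above, or some but bounded above.\<close>
  consider "\<And>s. \<not> ?Q s" | "\<And>m. \<exists>s\<ge>m. ?Q s" | s m where "?Q s" "\<And>i. m < i ==> \<not> ?Q i"
    by (metis not_le order_less_imp_le)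
  then show ?thesis
  proof cases
    case 1
    then have "\<And>P s. P \<in> D.UU ==> exact_at R (carrier R - \<eta>) P s" by blast
    from D.zero_objects[OF T.all_exact[OF this]] show ?thesis by blast
  next
    case 2
    then have "\<And>m. \<exists>P\<in>D.UU. \<exists>s\<ge>m. \<not> exact_at R (carrier R - \<eta>) P s" by blast
    note T.orth_exact[OF this]
    then have "U = Ob (Perf R)" by (intro D.whole) blast
    then show ?thesis ..
  next
    case (3 s m)
    obtain e where e: "?Q e" "\<And>i. e < i ==> \<not> ?Q i" using int_greatest[of ?Q, OF 3] by metis
    obtain P0 where P0: "P0 \<in> D.UU" "\<not> exact_at R (carrier R - \<eta>) P0 e" using e(1) by blast
    have bd: "\<And>P k. P \<in> D.UU ==> e < k ==> exact_at R (carrier R - \<eta>) P k" using e(2) by blast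
    \<comment> \<open>In the bounded case all residue fields have finite minimal resolutions,
      against the singularity of \<open>R\<close>.\<close>
    have "regular_ring R"
    proof (rule regular_ringI[OF assms(3)])
      fix p assume p: "primeideal p R"
      show "\<exists>M r b \<phi> d N. min_res R p (M :: nat \<Rightarrow> ('a, 'm) module) r b \<phi> d \<and> r N = 0"
        by (rule T.finite_min_res[OF P0 bd p]) (assumption, assumption, blast)
    qed
    then show ?thesis using assms(4) by blast
  qed
qed

end
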